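(* Let $X_\bullet$ be a simplicial smooth manifold, let $\Lambda$ be a subgroup of $\mathbb{C}$, and let $\mathcal{F}=\{F^r\Omega^*_{dR}(X_\bullet)\}$ be a filtration of the de Rham complex $\Omega^*_{dR}(X_\bullet)$ of compatible forms. Then there exists a surjective homomorphism $$\Xi\colon \hat{H}^{2r-n-1}_r(X_\bullet;\mathbb{C}/\Lambda;\mathcal{F})\longrightarrow MH^{2r}_n(X_\bullet;\Lambda;\mathcal{F})$$ whose kernel is (isomorphic to) the group of forms in $F^r\Omega^{2r-n-1}_{dR}(X_\bullet)$ modulo the subgroup of those forms in $F^r\Omega^{2r-n-1}_{dR}(X_\bullet)$ that are closed and whose complex cohomology class is the image of a class in $H^{2r-n-1}(X_\bullet;\Lambda)$.
   Context: A simplicial smooth manifold $X_\bullet=\{X_n\}_{n\ge 0}$ is a simplicial object in the category of $\mathcal{C}^\infty$-manifolds, with face maps $\varepsilon_i\colon X_n\to X_{n-1}$; $\varepsilon^i\colon\Delta^{n-1}\to\Delta^n$ denotes the $i$-th face inclusion of standard simplices. Compatible forms: $\Omega^k_{dR}(X_\bullet)$ is the set of sequences $\omega=\{\omega^{(n)}\}_{n\ge0}$ of smooth complex $k$-forms $\omega^{(n)}\in\Omega^k_{dR}(\Delta^n\times X_n)$ with $(\varepsilon^i\times \mathrm{id})^*\omega^{(n)}=(\mathrm{id}\times\varepsilon_i)^*\omega^{(n-1)}$ on $\Delta^{n-1}\times X_n$ for all $0\le i\le n$, $n\ge 1$; the differential $d$ is the exterior differential. Compatible cochains: for an abelian group $R$,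 $C^k(X_\bullet;R)$ is the group of sequences $\{c^{(n)}\}_{n\ge0}$ of smooth singular $k$-cochains $c^{(n)}\in S^k(\Delta^n\times X_n;R)$ with $(\varepsilon^i\times \mathrm{id})^*c^{(n)}=(\mathrm{id}\times\varepsilon_i)^*c^{(n-1)}$ for all $0\le i\le n$, $n\geq 1$; it is a complex under the singular coboundary. Write $H^*(X_\bullet;R)$ for its cohomology (isomorphic to $H^*(\|X_\bullet\|;R)$, with $\|\cdot\|$ the fat realization). Integration of forms over simplices gives a quasi-isomorphism $\mathcal{I}'\colon\Omega^*_{dR}(X_\bullet)\to C^*(X_\bullet;\mathbb{C})$; the complex cohomology class of a closed form is the class of its image in $H^*(X_\bullet;\mathbb{C})$. A filtration $\mathcal{F}=\{F^r\Omega^*_{dR}(X_\bullet)\}_r$ is a decreasing filtration by subcomplexes. For a complex $C^*$, $\sigma_{\ge k}C^*$ is the subcomplex equal to $C^j$ in degrees $j\ge k$ and $0$ in degrees $j<k$. Cone convention: for $f\colon A^*\to B^*$, $\mathrm{cone}(f)^n=A^n\oplus B^{n-1}$ with $d(a,b)=(d_Aa,(-1)^{n+1}f(a)+d_Bb)$. Differential characters: $\hat{H}^{k-1}_r(X_\bullet;\mathbb{C}/\Lambda;\mathcal{F})=H^k(\mathrm{cone}(\sigma_{\ge k}F^r\Omega^*_{dR}(X_\bullet)\to C^*(X_\bullet;\mathbb{C}/\Lambda)))$, where the map is $\mathcal{I}'$ followed by reduction mod $\Lambda$. Multiplicative cohomology: $MH^{2r}_n(X_\bullet;\Lambda;\mathcal{F})=H^{2r-n}(\mathrm{cone}(C^*(X_\bullet;\Lambda)\oplus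 F^r\Omega^*_{dR}(X_\bullet)\to C^*(X_\bullet;\mathbb{C})))$, where the map is $(c,\omega)\mapsto c-\mathcal{I}'(\omega)$. *)

theory Defs
  imports "HOL-Analysis.Analysis" "HOL-Analysis.Finite_Function_Topology" "HOL-Homology.Homology"
begin

section \<open>Smooth maps between subsets of coordinate spaces\<close>

text \<open>
  Finitely supported real sequences (a normed space) serve as common ambient space for all
  \<open>\<real>\<^sup>m\<close>, so that dimensions may vary with natural numbers inside a statement.
\<close>

type_synonym coords = "nat \<Rightarrow>\<^sub>0 real"

definition coord_space :: "nat \<Rightarrow> coords set"
  where "coord_space m = {v. Poly_Mapping.keys v \<subseteq> {..<m}}"

primrec Ck_on :: "nat \<Rightarrow> 'e::real_normed_vector set \<Rightarrow> ('e \<Rightarrow> 'f::real_normed_vector) \<Rightarrow> bool" where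
  "Ck_on 0 U f \<longleftrightarrow> continuous_on U f"
| "Ck_on (Suc k) U f \<longleftrightarrow>
     (\<forall>x\<in>U. f differentiable (at x)) \<and> (\<forall>v. Ck_on k U (\<lambda>x. frechet_derivative f (at x) v))"

text \<open>
  Smoothness on an arbitrary set by local smooth extension, as usual for manifolds with corners.
  For \<open>S\<close> inside a finite-dimensional subspace, extending to an open set of that subspace or of the
  ambient space amounts to the same, by composing with a projection.
\<close>

definition smooth_on :: "'e::real_normed_vector set \<Rightarrow> ('e \<Rightarrow> 'f::real_normed_vector) \<Rightarrow> bool" where
  "smooth_on S f \<longleftrightarrow>
     (\<forall>x\<in>S. \<exists>U g. open U \<and> x \<in> U \<and> (\<forall>k. Ck_on k U g) \<and> (\<forall>y\<in>U \<inter> S. g y = f y))"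

section \<open>Charted spaces\<close>

text \<open>
  A chart carries, besides its domain and coordinate map, the space of tangent vectors \<open>ctan\<close>
  of its coordinate image: \<open>\<real>\<^sup>m\<close> for a manifold, and \<open>{v. \<Sum>v = 0} \<times> \<real>\<^sup>m\<close> for
  \<open>\<Delta>\<^sup>n \<times> X\<close>. The values of \<open>cmap\<close> outside \<open>cdom\<close> are irrelevant.
\<close>

record ('p, 'e) chart =
  cdom :: "'p set"
  cmap :: "'p \<Rightarrow> 'e"
  ctan :: "'e set"

record ('p, 'e) charted =
  ctop :: "'p topology"
  atlas :: "('p, 'e) chart set"

definition cimg :: "('p, 'e) chart \<Rightarrow> 'e set"
  where "cimg c = cmap c ` cdom c"

definition local_rep :: "('p \<Rightarrow> 'q) \<Rightarrow> ('p, 'e) chart \<Rightarrow> ('q, 'f) chart \<Rightarrow> 'e \<Rightarrow> 'f"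
  where "local_rep f c d = cmap d \<circ> f \<circ> inv_into (cdom c) (cmap c)"

definition local_dom :: "('p \<Rightarrow> 'q) \<Rightarrow> ('p, 'e) chart \<Rightarrow> ('q, 'f) chart \<Rightarrow> 'e set"
  where "local_dom f c d = cmap c ` (cdom c \<inter> f -` cdom d)"

text \<open>
  The differential in charts. The derivative within \<open>local_dom\<close> is determined
  on \<open>ctan c\<close> only, and it is only ever applied to such vectors.
\<close>

definition local_deriv ::
  "('p \<Rightarrow> 'q) \<Rightarrow> ('p, 'e::real_normed_vector) chart \<Rightarrow> ('q, 'f::real_normed_vector) chart \<Rightarrow> 'e \<Rightarrow> 'e \<Rightarrow> 'f"
  where "local_deriv f c d x = frechet_derivative (local_rep f c d) (at x within local_dom f c d)"

definition smooth_map ::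
  "('p, 'e::real_normed_vector) charted \<Rightarrow> ('q, 'f::real_normed_vector) charted \<Rightarrow> ('p \<Rightarrow> 'q) \<Rightarrow> bool"
  where "smooth_map M N f \<longleftrightarrow> continuous_map (ctop M) (ctop N) f \<and>
    (\<forall>c\<in>atlas M. \<forall>d\<in>atlas N. smooth_on (local_dom f c d) (local_rep f c d))"

definition smooth_manifold :: "('a, coords) charted \<Rightarrow> bool" where
  "smooth_manifold M \<longleftrightarrow>
     Hausdorff_space (ctop M) \<and> second_countable (ctop M) \<and>
     (\<Union>c\<in>atlas M. cdom c) = topspace (ctop M) \<and>
     (\<forall>c\<in>atlas M.
        openin (ctop M) (cdom c) \<and>
        (\<exists>m. ctan c = coord_space m \<and> openin (top_of_set (coord_space m)) (cimg c)) \<and>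
        homeomorphic_map (subtopology (ctop M) (cdom c)) (top_of_set (cimg c)) (cmap c)) \<and>
     (\<forall>c\<in>atlas M. \<forall>d\<in>atlas M. smooth_on (local_dom id c d) (local_rep id c d))"

section \<open>Standard simplices and their products with manifolds\<close>

definition std_simplex :: "nat \<Rightarrow> coords set"
  where "std_simplex n = {t. Poly_Mapping.lookup t \<in> standard_simplex n}"

definition simplex_tan :: "nat \<Rightarrow> coords set"
  where "simplex_tan n =
    {v. Poly_Mapping.keys v \<subseteq> {..n} \<and> (\<Sum>i\<le>n. Poly_Mapping.lookup v i) = 0}"

definition simplex_chart :: "nat \<Rightarrow> (coords, coords) chart"
  where "simplex_chart n = \<lparr>cdom = std_simplex n, cmap = id, ctan = simplex_tan n\<rparr>"

definition simplex_space :: "nat \<Rightarrow> (coords, coords) charted"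
  where "simplex_space n = \<lparr>ctop = top_of_set (std_simplex n), atlas = {simplex_chart n}\<rparr>"

definition simplex_times ::
  "nat \<Rightarrow> ('a, coords) charted \<Rightarrow> (coords \<times> 'a, coords \<times> coords) charted"
  where "simplex_times n M =
    \<lparr>ctop = prod_topology (top_of_set (std_simplex n)) (ctop M),
     atlas = (\<lambda>c. \<lparr>cdom = std_simplex n \<times> cdom c, cmap = map_prod id (cmap c),
                  ctan = simplex_tan n \<times> ctan c\<rparr>) ` atlas M\<rparr>"

definition coface :: "nat \<Rightarrow> coords \<Rightarrow> coords"
  where "coface i t = Abs_poly_mapping (simplical_face i (Poly_Mapping.lookup t))"

section \<open>Complex differential forms\<close>

text \<open>
  A form is the compatible family of its coordinate expressions: \<open>\<omega> c x vs\<close> is its value in the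
  chart \<open>c\<close> at the coordinate point \<open>x\<close> on the list \<open>vs\<close> of tangent vectors. It is set to \<open>0\<close>
  outside its proper domain, so that forms are equal iff they agree as functions.
  In negative degree only \<open>0\<close> remains.
\<close>

type_synonym ('p, 'e) form = "('p, 'e) chart \<Rightarrow> 'e \<Rightarrow> 'e list \<Rightarrow> complex"

definition alternating_on :: "'e::real_vector set \<Rightarrow> int \<Rightarrow> ('e list \<Rightarrow> complex) \<Rightarrow> bool" where
  "alternating_on T k \<alpha> \<longleftrightarrow>
     (\<forall>vs. int (length vs) = k \<and> set vs \<subseteq> T \<longrightarrow>
        (\<forall>i<length vs. \<forall>u\<in>T. \<forall>w\<in>T. \<forall>a b. \<alpha> (vs[i := a *\<^sub>R u + b *\<^sub>R w]) =
            a *\<^sub>R \<alpha> (vs[i := u]) + b *\<^sub>R \<alpha> (vs[i := w])) \<and>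
        (\<forall>i j. i < j \<and> j < length vs \<and> vs ! i = vs ! j \<longrightarrow> \<alpha> vs = 0))"

definition forms :: "int \<Rightarrow> ('p, 'e::real_normed_vector) charted \<Rightarrow> ('p, 'e) form set" where
  "forms k M = {\<omega>.
     (\<forall>c x vs. \<omega> c x vs \<noteq> 0 \<longrightarrow>
        c \<in> atlas M \<and> x \<in> cimg c \<and> int (length vs) = k \<and> set vs \<subseteq> ctan c) \<and>
     (\<forall>c\<in>atlas M. \<forall>x\<in>cimg c. alternating_on (ctan c) k (\<omega> c x)) \<and>
     (\<forall>c\<in>atlas M. \<forall>vs. set vs \<subseteq> ctan c \<longrightarrow> smooth_on (cimg c) (\<lambda>x. \<omega> c x vs)) \<and>
     (\<forall>c\<in>atlas M. \<forall>d\<in>atlas M. \<forall>x\<in>local_dom id c d. \<forall>vs. set vs \<subseteq> ctan c \<longrightarrow>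
        \<omega> c x vs = \<omega> d (local_rep id c d x) (map (local_deriv id c d x) vs))}"

text \<open>The choice of the chart around the image point is immaterial for forms.\<close>

definition pullback ::
  "('p, 'e::real_normed_vector) charted \<Rightarrow> ('q, 'f::real_normed_vector) charted \<Rightarrow> ('p \<Rightarrow> 'q) \<Rightarrow>
   ('q, 'f) form \<Rightarrow> ('p, 'e) form"
  where "pullback M N f \<omega> c x vs =
    (if c \<in> atlas M \<and> x \<in> cimg c \<and> set vs \<subseteq> ctan c
     then let d = (SOME d. d \<in> atlas N \<and> x \<in> local_dom f c d)
          in \<omega> d (local_rep f c d x) (map (local_deriv f c d x) vs)
     else 0)"

definition ext_deriv ::
  "('p, 'e::real_normed_vector) charted \<Rightarrow> ('p, 'e) form \<Rightarrow> ('p, 'e) form"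
  where "ext_deriv M \<omega> c x vs =
    (if c \<in> atlas M \<and> x \<in> cimg c \<and> set vs \<subseteq> ctan c
     then \<Sum>i<length vs. (-1) ^ i *
            frechet_derivative (\<lambda>y. \<omega> c y (take i vs @ drop (Suc i) vs))
              (at x within cimg c) (vs ! i)
     else 0)"

text \<open>
  Integration over \<open>\<Delta>\<^sup>k\<close> in the coordinates \<open>t\<^sub>1, \<dots>, t\<^sub>k\<close>, with orientation
  \<open>dt\<^sub>1 \<and> \<dots> \<and> dt\<^sub>k\<close>; the coordinate vector fields are \<open>e\<^sub>i - e\<^sub>0\<close>.
\<close>

definition bary :: "nat \<Rightarrow> (nat \<Rightarrow> real) \<Rightarrow> coords"
  where "bary k x = Poly_Mapping.single 0 (1 - (\<Sum>i=1..k. x i)) +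
    (\<Sum>i=1..k. Poly_Mapping.single i (x i))"

definition simplex_integral :: "nat \<Rightarrow> (coords, coords) form \<Rightarrow> complex"
  where "simplex_integral k \<eta> =
    (LINT x | PiM {1..k} (\<lambda>_. lborel).
      (if bary k x \<in> std_simplex k
       then \<eta> (simplex_chart k) (bary k x)
              (map (\<lambda>i. Poly_Mapping.single i 1 - Poly_Mapping.single 0 1) [1..<Suc k])
       else 0))"

section \<open>Smooth singular cochains\<close>

text \<open>
  A cochain with values in the abelian group \<open>R\<close> (written multiplicatively, as in HOL-Algebra)
  is identified with its values on the basis of smooth simplices. There are no simplices,
  hence only the trivial cochain, in negative degree.
\<close>

type_synonym 'p ssimplex = "coords \<Rightarrow> 'p"

definition smooth_simplices :: "int \<Rightarrow> ('p, 'e::real_normed_vector) charted \<Rightarrow> 'p ssimplex set"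
  where "smooth_simplices k M =
    (if k < 0 then {}
     else {\<sigma> \<in> extensional (std_simplex (nat k)). smooth_map (simplex_space (nat k)) M \<sigma>})"

definition cochain_group ::
  "int \<Rightarrow> ('p, 'e::real_normed_vector) charted \<Rightarrow> 'r monoid \<Rightarrow> ('p ssimplex \<Rightarrow> 'r) monoid"
  where "cochain_group k M R = product_group (smooth_simplices k M) (\<lambda>_. R)"

definition cochain_pullback ::
  "int \<Rightarrow> ('p, 'e::real_normed_vector) charted \<Rightarrow> ('p \<Rightarrow> 'q) \<Rightarrow>
   ('q ssimplex \<Rightarrow> 'r) \<Rightarrow> 'p ssimplex \<Rightarrow> 'r"
  where "cochain_pullback k M f c =
    (\<lambda>\<sigma>\<in>smooth_simplices k M. c (compose (std_simplex (nat k)) f \<sigma>))"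

definition coboundary ::
  "int \<Rightarrow> ('p, 'e::real_normed_vector) charted \<Rightarrow> 'r monoid \<Rightarrow>
   ('p ssimplex \<Rightarrow> 'r) \<Rightarrow> 'p ssimplex \<Rightarrow> 'r"
  where "coboundary k M R c =
    (\<lambda>\<sigma>\<in>smooth_simplices (k + 1) M.
       if k < 0 then \<one>\<^bsub>R\<^esub>
       else finprod R
         (\<lambda>i. let z = c (compose (std_simplex (nat k)) \<sigma> (coface i))
              in if even i then z else inv\<^bsub>R\<^esub> z)
         {..nat (k + 1)})"

definition complex_group :: "complex monoid"
  where "complex_group = \<lparr>carrier = UNIV, monoid.mult = (+), one = 0\<rparr>"

section \<open>Simplicial smooth manifolds\<close>

locale simplicial_manifold =
  fixes X :: "nat \<Rightarrow> ('a, coords) charted"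
    and face degen :: "nat \<Rightarrow> nat \<Rightarrow> 'a \<Rightarrow> 'a"
  assumes manifold: "smooth_manifold (X n)"
    and face_smooth: "i \<le> Suc n \<Longrightarrow> smooth_map (X (Suc n)) (X n) (face (Suc n) i)"
    and degen_smooth: "i \<le> n \<Longrightarrow> smooth_map (X n) (X (Suc n)) (degen n i)"
    and face_face: "\<lbrakk>i < j; j \<le> n + 2; x \<in> topspace (ctop (X (n + 2)))\<rbrakk> \<Longrightarrow>
      face (n + 1) i (face (n + 2) j x) = face (n + 1) (j - 1) (face (n + 2) i x)"
    and degen_degen: "\<lbrakk>i \<le> j; j \<le> n; x \<in> topspace (ctop (X n))\<rbrakk> \<Longrightarrow>
      degen (n + 1) i (degen n j x) = degen (n + 1) (j + 1) (degen n i x)"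
    and face_degen_less: "\<lbrakk>i < j; j \<le> n; x \<in> topspace (ctop (X n))\<rbrakk> \<Longrightarrow>
      face (n + 1) i (degen n j x) = degen (n - 1) (j - 1) (face n i x)"
    and face_degen_eq: "\<lbrakk>i = j \<or> i = j + 1; j \<le> n; x \<in> topspace (ctop (X n))\<rbrakk> \<Longrightarrow>
      face (n + 1) i (degen n j x) = x"
    and face_degen_greater: "\<lbrakk>j + 1 < i; i \<le> n + 1; x \<in> topspace (ctop (X n))\<rbrakk> \<Longrightarrow>
      face (n + 1) i (degen n j x) = degen (n - 1) j (face n (i - 1) x)"

section \<open>Cochain complexes\<close>

record 'g cplx =
  grp :: "int \<Rightarrow> 'g monoid"
  dif :: "int \<Rightarrow> 'g \<Rightarrow> 'g"

definition cocycles :: "'g cplx \<Rightarrow> int \<Rightarrow> 'g set"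
  where "cocycles A k = kernel (grp A k) (grp A (k + 1)) (dif A k)"

definition coboundaries :: "'g cplx \<Rightarrow> int \<Rightarrow> 'g set"
  where "coboundaries A k = dif A (k - 1) ` carrier (grp A (k - 1))"

definition cohomology :: "'g cplx \<Rightarrow> int \<Rightarrow> 'g set monoid"
  where "cohomology A k = (grp A k)\<lparr>carrier := cocycles A k\<rparr> Mod coboundaries A k"

definition coh_class :: "'g cplx \<Rightarrow> int \<Rightarrow> 'g \<Rightarrow> 'g set"
  where "coh_class A k z = coboundaries A k #>\<^bsub>grp A k\<^esub> z"

definition coh_map :: "('g \<Rightarrow> 'h) \<Rightarrow> 'h cplx \<Rightarrow> int \<Rightarrow> 'g set \<Rightarrow> 'h set"
  where "coh_map f B k \<xi> = the_elem ((\<lambda>z. coh_class B k (f z)) ` \<xi>)"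

definition cplx_sum :: "'g cplx \<Rightarrow> 'h cplx \<Rightarrow> ('g \<times> 'h) cplx"
  where "cplx_sum A B =
    \<lparr>grp = \<lambda>n. grp A n \<times>\<times> grp B n, dif = \<lambda>n. map_prod (dif A n) (dif B n)\<rparr>"

definition cplx_trunc :: "int \<Rightarrow> 'g cplx \<Rightarrow> 'g cplx"
  where "cplx_trunc k A =
    \<lparr>grp = \<lambda>j. if k \<le> j then grp A j else (grp A j)\<lparr>carrier := {\<one>\<^bsub>grp A j\<^esub>}\<rparr>, dif = dif A\<rparr>"

text \<open>\<open>d (a, b) = (d a, (-1)\<^sup>n\<^sup>+\<^sup>1 f a + d b)\<close> on \<open>A\<^sup>n \<oplus> B\<^sup>n\<^sup>-\<^sup>1\<close>.\<close>

definition cone :: "(int \<Rightarrow> 'g \<Rightarrow> 'h) \<Rightarrow> 'g cplx \<Rightarrow> 'h cplx \<Rightarrow> ('g \<times> 'h) cplx"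
  where "cone f A B =
    \<lparr>grp = \<lambda>n. grp A n \<times>\<times> grp B (n - 1),
     dif = \<lambda>n (a, b).
       (dif A n a,
        (if odd n then f n a else inv\<^bsub>grp B n\<^esub> (f n a)) \<otimes>\<^bsub>grp B n\<^esub> dif B (n - 1) b)\<rparr>"

section \<open>Compatible forms and cochains\<close>

type_synonym 'a form_seq = "nat \<Rightarrow> (coords \<times> 'a, coords \<times> coords) form"
type_synonym ('a, 'r) cochain_seq = "nat \<Rightarrow> (coords \<times> 'a) ssimplex \<Rightarrow> 'r"

definition compatible_forms ::
  "(nat \<Rightarrow> ('a, coords) charted) \<Rightarrow> (nat \<Rightarrow> nat \<Rightarrow> 'a \<Rightarrow> 'a) \<Rightarrow> int \<Rightarrow> 'a form_seq set"
  where "compatible_forms X face k = {\<omega>.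
    (\<forall>n. \<omega> n \<in> forms k (simplex_times n (X n))) \<and>
    (\<forall>n. \<forall>i\<le>Suc n.
       pullback (simplex_times n (X (Suc n))) (simplex_times (Suc n) (X (Suc n)))
         (map_prod (coface i) id) (\<omega> (Suc n)) =
       pullback (simplex_times n (X (Suc n))) (simplex_times n (X n))
         (map_prod id (face (Suc n) i)) (\<omega> n))}"

definition de_Rham ::
  "(nat \<Rightarrow> ('a, coords) charted) \<Rightarrow> (nat \<Rightarrow> nat \<Rightarrow> 'a \<Rightarrow> 'a) \<Rightarrow> 'a form_seq cplx"
  where "de_Rham X face =
    \<lparr>grp = \<lambda>k. \<lparr>carrier = compatible_forms X face k,
                monoid.mult = (\<lambda>\<omega> \<eta> n c x vs. \<omega> n c x vs + \<eta> n c x vs),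
                one = (\<lambda>n c x vs. 0)\<rparr>,
     dif = \<lambda>k \<omega> n. ext_deriv (simplex_times n (X n)) (\<omega> n)\<rparr>"

definition compatible_cochains ::
  "(nat \<Rightarrow> ('a, coords) charted) \<Rightarrow> (nat \<Rightarrow> nat \<Rightarrow> 'a \<Rightarrow> 'a) \<Rightarrow> 'r monoid \<Rightarrow> int \<Rightarrow>
   ('a, 'r) cochain_seq set"
  where "compatible_cochains X face R k = {c.
    (\<forall>n. c n \<in> carrier (cochain_group k (simplex_times n (X n)) R)) \<and>
    (\<forall>n. \<forall>i\<le>Suc n.
       cochain_pullback k (simplex_times n (X (Suc n))) (map_prod (coface i) id) (c (Suc n)) =
       cochain_pullback k (simplex_times n (X (Suc n))) (map_prod id (face (Suc n) i)) (c n))}"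

definition cochains ::
  "(nat \<Rightarrow> ('a, coords) charted) \<Rightarrow> (nat \<Rightarrow> nat \<Rightarrow> 'a \<Rightarrow> 'a) \<Rightarrow> 'r monoid \<Rightarrow>
   ('a, 'r) cochain_seq cplx"
  where "cochains X face R =
    \<lparr>grp = \<lambda>k. (product_group UNIV (\<lambda>n. cochain_group k (simplex_times n (X n)) R))
                 \<lparr>carrier := compatible_cochains X face R k\<rparr>,
     dif = \<lambda>k c n. coboundary k (simplex_times n (X n)) R (c n)\<rparr>"

definition integration ::
  "(nat \<Rightarrow> ('a, coords) charted) \<Rightarrow> int \<Rightarrow> 'a form_seq \<Rightarrow> ('a, complex) cochain_seq"
  where "integration X k \<omega> = (\<lambda>n. \<lambda>\<sigma>\<in>smooth_simplices k (simplex_times n (X n)).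
    simplex_integral (nat k)
      (pullback (simplex_space (nat k)) (simplex_times n (X n)) \<sigma> (\<omega> n)))"

definition reduce_mod ::
  "(nat \<Rightarrow> ('a, coords) charted) \<Rightarrow> complex set \<Rightarrow> int \<Rightarrow>
   ('a, complex) cochain_seq \<Rightarrow> ('a, complex set) cochain_seq"
  where "reduce_mod X \<Lambda> k c = (\<lambda>n. \<lambda>\<sigma>\<in>smooth_simplices k (simplex_times n (X n)).
    \<Lambda> #>\<^bsub>complex_group\<^esub> c n \<sigma>)"

section \<open>Filtrations, differential characters and multiplicative cohomology\<close>

definition filtration ::
  "(nat \<Rightarrow> ('a, coords) charted) \<Rightarrow> (nat \<Rightarrow> nat \<Rightarrow> 'a \<Rightarrow> 'a) \<Rightarrow>
   (int \<Rightarrow> int \<Rightarrow> 'a form_seq set) \<Rightarrow> bool"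
  where "filtration X face F \<longleftrightarrow> (\<forall>r k.
    F r k \<subseteq> compatible_forms X face k \<and>
    (\<lambda>n c x vs. 0) \<in> F r k \<and>
    (\<forall>\<omega>\<in>F r k. \<forall>\<eta>\<in>F r k. (\<lambda>n c x vs. \<omega> n c x vs + \<eta> n c x vs) \<in> F r k) \<and>
    (\<forall>a. \<forall>\<omega>\<in>F r k. (\<lambda>n c x vs. a * \<omega> n c x vs) \<in> F r k) \<and>
    dif (de_Rham X face) k ` F r k \<subseteq> F r (k + 1) \<and>
    F (r + 1) k \<subseteq> F r k)"

definition filtered_de_Rham ::
  "(nat \<Rightarrow> ('a, coords) charted) \<Rightarrow> (nat \<Rightarrow> nat \<Rightarrow> 'a \<Rightarrow> 'a) \<Rightarrow>
   (int \<Rightarrow> int \<Rightarrow> 'a form_seq set) \<Rightarrow> int \<Rightarrow> 'a form_seq cplx"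
  where "filtered_de_Rham X face F r =
    \<lparr>grp = \<lambda>k. (grp (de_Rham X face) k)\<lparr>carrier := F r k\<rparr>, dif = dif (de_Rham X face)\<rparr>"

text \<open>The group of differential characters of degree \<open>j\<close> is cohomology of a cone in degree \<open>j + 1\<close>.\<close>

definition diff_characters ::
  "(nat \<Rightarrow> ('a, coords) charted) \<Rightarrow> (nat \<Rightarrow> nat \<Rightarrow> 'a \<Rightarrow> 'a) \<Rightarrow> complex set \<Rightarrow>
   (int \<Rightarrow> int \<Rightarrow> 'a form_seq set) \<Rightarrow> int \<Rightarrow> int \<Rightarrow>
   ('a form_seq \<times> ('a, complex set) cochain_seq) set monoid"
  where "diff_characters X face \<Lambda> F r j =
    cohomology
      (cone (\<lambda>k \<omega>. reduce_mod X \<Lambda> k (integration X k \<omega>))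
         (cplx_trunc (j + 1) (filtered_de_Rham X face F r))
         (cochains X face (complex_group Mod \<Lambda>)))
      (j + 1)"

definition mult_cohomology ::
  "(nat \<Rightarrow> ('a, coords) charted) \<Rightarrow> (nat \<Rightarrow> nat \<Rightarrow> 'a \<Rightarrow> 'a) \<Rightarrow> complex set \<Rightarrow>
   (int \<Rightarrow> int \<Rightarrow> 'a form_seq set) \<Rightarrow> int \<Rightarrow> int \<Rightarrow>
   ((('a, complex) cochain_seq \<times> 'a form_seq) \<times> ('a, complex) cochain_seq) set monoid"
  where "mult_cohomology X face \<Lambda> F r n =
    cohomology
      (cone (\<lambda>k (c, \<omega>). let C = grp (cochains X face complex_group) k
                         in c \<otimes>\<^bsub>C\<^esub> inv\<^bsub>C\<^esub> (integration X k \<omega>))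
         (cplx_sum (cochains X face (complex_group\<lparr>carrier := \<Lambda>\<rparr>)) (filtered_de_Rham X face F r))
         (cochains X face complex_group))
      (2 * r - n)"

definition integral_closed_forms ::
  "(nat \<Rightarrow> ('a, coords) charted) \<Rightarrow> (nat \<Rightarrow> nat \<Rightarrow> 'a \<Rightarrow> 'a) \<Rightarrow> complex set \<Rightarrow>
   (int \<Rightarrow> int \<Rightarrow> 'a form_seq set) \<Rightarrow> int \<Rightarrow> int \<Rightarrow> 'a form_seq set"
  where "integral_closed_forms X face \<Lambda> F r k =
    {\<omega> \<in> cocycles (filtered_de_Rham X face F r) k.
       coh_class (cochains X face complex_group) k (integration X k \<omega>)
         \<in> coh_map (\<lambda>c. c) (cochains X face complex_group) k `
             carrier (cohomology (cochains X face (complex_group\<lparr>carrier := \<Lambda>\<rparr>)) k)}"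

end

theory Submission
  imports Defs
begin

text \<open>
  Let \<open>k = 2r - n\<close> and let \<open>W\<close> be the group of pairs \<open>(\<omega>, c)\<close> of a closed form
  \<open>\<omega> \<in> F\<^sup>r\<Omega>\<^sup>k\<close> and a compatible complex cochain \<open>c\<close> of degree \<open>k - 1\<close> such that
  \<open>l = (-1)\<^sup>k I \<omega> + d c\<close> takes values in \<open>\<Lambda>\<close>. Reducing \<open>c\<close> modulo \<open>\<Lambda>\<close> maps \<open>W\<close> onto
  the differential characters, and sending \<open>(\<omega>, c)\<close> to \<open>((l, \<omega>), c)\<close>, up to signs, maps \<open>W\<close>
  onto multiplicative cohomology. The kernel of the first map lies in the kernel of the second,
  which gives \<open>\<Xi>\<close>; the kernel of \<open>\<Xi>\<close> consists of the classes of the pairs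
  \<open>(d \<theta>, \<plusminus> I \<theta>)\<close> with \<open>\<theta> \<in> F\<^sup>r\<Omega>\<^sup>k\<^sup>-\<^sup>1\<close>, and such a class vanishes iff \<open>\<theta>\<close> is closed
  with \<open>\<Lambda>\<close>-integral cohomology class.

  Two facts enter besides this diagram chase: integration \<open>I\<close> is a chain map, by Stokes' theorem
  on the simplex, and every compatible cochain modulo \<open>\<Lambda>\<close> lifts to a compatible complex cochain,
  because compatibility prescribes a value only on the simplices lying in a face.
\<close>

section \<open>Smooth functions on subsets of normed spaces\<close>

text \<open>What separates the two cones is degree \<open>k - 1\<close>: the truncation removes all
  forms there, so coboundaries on the character side come from cochains alone, while multiplicative
  cohomology also divides by what forms of degree \<open>k - 1\<close> generate. This explains the
  kernel, a quotient of that group of forms. Lifting to complex cochains turns a condition modulo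
  \<open>\<Lambda>\<close> into a \<open>\<Lambda>\<close>-valued cochain, the component that a
  multiplicative cocycle has and a character lacks. The analytic obstacle is that simplices have
  corners and span only affine subspaces of an infinite-dimensional ambient space. Derivatives
  within such sets are determined in tangent directions only, so identities are stated for tangent
  vectors and proved by comparison with local smooth extensions. For Stokes, forms are evaluated on
  consecutive differences of vertices instead of edges at vertex 0: a coface maps such a difference
  to another one or to the sum of two neighbours, so the face terms match one by one. Lifts of
  cochains are chosen by recursion on the simplicial degree. A simplex lying in several faces has
  several prescribed values, and the simplicial identities make them agree.\<close>

lemma Ck_on_subset: "Ck_on k U f \<Longrightarrow> V \<subseteq> U \<Longrightarrow> Ck_on k V f"
  by (induction k arbitrary: f) (auto intro: continuous_on_subset)

text \<open>Since \<open>U\<close> is open, functions that agree on it have the same derivatives at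
  its points, and the induction goes through.\<close>

lemma Ck_on_cong:
  assumes "open U" "\<And>x. x \<in> U \<Longrightarrow> f x = g x" "Ck_on k U f"
  shows "Ck_on k U g"
  using assms(2,3)
proof (induction k arbitrary: f g)
  case 0
  then show ?case by (auto cong: continuous_on_cong)
next
  case (Suc k)
  have d: "(g has_derivative frechet_derivative f (at x)) (at x)" if "x \<in> U" for x
  proof -
    have "(f has_derivative frechet_derivative f (at x)) (at x)"
      using Suc.prems(2) that by (simp add: frechet_derivative_works)
    then show ?thesis
      using has_derivative_transform_within_open[OF _ \<open>open U\<close> that] Suc.prems(1) by blast
  qed
  then have e: "frechet_derivative f (at x) = frechet_derivative g (at x)" if "x \<in> U" for x
    using frechet_derivative_at that by blast
  show ?case
    using Suc.IH[of "\<lambda>x. frechet_derivative f (at x) v" "\<lambda>x. frechet_derivative g (at x) v" for v]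
      Suc.prems(2) d e by (auto simp: differentiable_def)
qed

text \<open>The clause for \<open>Suc k\<close> does not mention continuity of the function itself;
  in the base case it has to come from differentiability.\<close>

lemma Ck_on_Suc_imp: "Ck_on (Suc k) U f \<Longrightarrow> Ck_on k U f"
proof (induction k arbitrary: f)
  case 0
  then show ?case
    by (auto intro!: differentiable_imp_continuous_on differentiable_at_imp_differentiable_on)
next
  case (Suc k)
  then show ?case by (metis Ck_on.simps(2))
qed

text \<open>The induction step of the closure properties: some derivative is exhibited, and only its
  values in fixed directions have to be of class \<open>Ck_on k\<close>.\<close>

lemma Ck_on_SucI:
  assumes "open U" "\<And>x. x \<in> U \<Longrightarrow> (f has_derivative f' x) (at x)"
    and "\<And>v. Ck_on k U (\<lambda>x. f' x v)"
  shows "Ck_on (Suc k) U f"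
proof -
  have "frechet_derivative f (at x) = f' x" if "x \<in> U" for x
    using frechet_derivative_at assms(2) that by metis
  then show ?thesis
    using assms Ck_on_cong[OF assms(1), of "\<lambda>x. f' x v" "\<lambda>x. frechet_derivative f (at x) v" k for v]
    by (auto simp: differentiable_def)
qed

lemma Ck_on_SucD:
  assumes "Ck_on (Suc k) U f" "x \<in> U"
  shows "(f has_derivative frechet_derivative f (at x)) (at x)"
  using assms by (simp add: frechet_derivative_works)

lemma Ck_on_const: "open U \<Longrightarrow> Ck_on k U (\<lambda>x. c)"
proof (induction k arbitrary: c)
  case (Suc k)
  show ?case
    by (rule Ck_on_SucI[where f' = "\<lambda>x v. 0"]) (use Suc in auto)
qed simp

lemma Ck_on_bounded_linear:
  assumes "open U" "bounded_linear A" shows "Ck_on k U A"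
proof (cases k)
  case (Suc j)
  show ?thesis unfolding Suc
    by (rule Ck_on_SucI[where f' = "\<lambda>x. A"])
       (use assms Ck_on_const in \<open>auto intro: bounded_linear_imp_has_derivative\<close>)
qed (use assms in \<open>auto intro: linear_continuous_on\<close>)

lemma Ck_on_add:
  assumes "open U" "Ck_on k U f" "Ck_on k U g"
  shows "Ck_on k U (\<lambda>x. f x + g x)"
  using assms(2,3)
proof (induction k arbitrary: f g)
  case (Suc k)
  show ?case
    by (rule Ck_on_SucI[OF assms(1) has_derivative_add[OF Ck_on_SucD[OF Suc.prems(1)] Ck_on_SucD[OF Suc.prems(2)]]])
       (use Suc in auto)
qed (auto intro: continuous_intros)

lemma Ck_on_sum:
  assumes "open U" "\<And>i. i \<in> I \<Longrightarrow> Ck_on k U (f i)"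
  shows "Ck_on k U (\<lambda>x. \<Sum>i\<in>I. f i x)"
  using assms(2)
  by (induction I rule: infinite_finite_induct) (auto intro: Ck_on_const Ck_on_add assms(1))

lemma Ck_on_bounded_bilinear:
  assumes "open U" "bounded_bilinear p" "Ck_on k U f" "Ck_on k U g"
  shows "Ck_on k U (\<lambda>x. p (f x) (g x))"
  using assms(3,4)
proof (induction k arbitrary: f g)
  case 0
  then show ?case by (auto intro: bounded_bilinear.continuous_on[OF assms(2)])
next
  case (Suc k)
  show ?case
  proof (rule Ck_on_SucI[OF assms(1) bounded_bilinear.FDERIV[OF assms(2)
          Ck_on_SucD[OF Suc.prems(1)] Ck_on_SucD[OF Suc.prems(2)]]])
    \<comment> \<open>Each Leibniz term contains one undifferentiated factor, whose class drops from
      \<open>Suc k\<close> to \<open>k\<close>.\<close>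
    show "Ck_on k U (\<lambda>x. p (f x) (frechet_derivative g (at x) v) +
            p (frechet_derivative f (at x) v) (g x))" for v
      by (intro Ck_on_add assms(1) Suc.IH)
         (use Suc.prems Ck_on_Suc_imp[of k U] in auto)
  qed
qed

lemma Ck_on_compose_linear:
  assumes "open U" "bounded_linear A" "Ck_on k U f"
  shows "Ck_on k U (\<lambda>x. A (f x))"
  using assms(3)
proof (induction k arbitrary: f)
  case 0
  then show ?case
    using bounded_linear.continuous_on[OF assms(2)] by auto
next
  case (Suc k)
  show ?case
    by (rule Ck_on_SucI[OF assms(1) bounded_linear.has_derivative[OF assms(2) Ck_on_SucD[OF Suc.prems]]])
       (use Suc in auto)
qed

text \<open>
  The directional definition of \<open>Ck_on\<close> controls derivatives of \<open>g\<close> for one fixed direction at a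
  time, so the inner function has to take values in a finite-dimensional space.
\<close>

lemma Ck_on_compose:
  assumes "open U" "open V" "finite I" "\<And>i. i \<in> I \<Longrightarrow> Ck_on k U (h i)" "Ck_on k V g"
    and "\<And>x. x \<in> U \<Longrightarrow> a + (\<Sum>i\<in>I. h i x *\<^sub>R b i) \<in> V"
  shows "Ck_on k U (\<lambda>x. g (a + (\<Sum>i\<in>I. h i x *\<^sub>R b i)))"
  using assms(4,5)
proof (induction k arbitrary: g)
  case 0
  then show ?case
    using assms(6) by (auto intro!: continuous_on_compose2[of V g] continuous_intros)
next
  case (Suc k)
  let ?f = "\<lambda>x. a + (\<Sum>i\<in>I. h i x *\<^sub>R b i)"
  have hd: "((\<lambda>x. g (?f x)) has_derivative
      (\<lambda>v. \<Sum>i\<in>I. frechet_derivative (h i) (at x) v *\<^sub>R frechet_derivative g (at (?f x)) (b i))) (at x)"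
    if x: "x \<in> U" for x
  proof -
    have "(?f has_derivative (\<lambda>v. \<Sum>i\<in>I. frechet_derivative (h i) (at x) v *\<^sub>R b i)) (at x)"
      using Ck_on_SucD[OF Suc.prems(1) x] by (auto intro!: derivative_eq_intros)
    moreover have g: "(g has_derivative frechet_derivative g (at (?f x))) (at (?f x))"
      using Ck_on_SucD[OF Suc.prems(2) assms(6)[OF x]] .
    ultimately have "((\<lambda>x. g (?f x)) has_derivative
      (\<lambda>v. frechet_derivative g (at (?f x)) (\<Sum>i\<in>I. frechet_derivative (h i) (at x) v *\<^sub>R b i))) (at x)"
      using has_derivative_compose[of ?f _ x UNIV g] by auto
    then show ?thesis
      using has_derivative_linear[OF g] by (simp add: linear_sum linear_cmul)
  qed
  show ?case
  proof (rule Ck_on_SucI[OF assms(1) hd])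
    \<comment> \<open>The inner map is unchanged and \<open>g\<close> has become its derivative in
      the constant direction \<open>b i\<close>, so the induction hypothesis, which holds for
      arbitrary \<open>g\<close>, applies.\<close>
    show "Ck_on k U (\<lambda>x. \<Sum>i\<in>I. frechet_derivative (h i) (at x) v *\<^sub>R frechet_derivative g (at (?f x)) (b i))" for v
      by (intro Ck_on_sum Ck_on_bounded_bilinear[OF _ bounded_bilinear_scaleR] Suc.IH Ck_on_Suc_imp[of k U "h _"] assms(1))
         (use Suc.prems in auto)
  qed assumption
qed

section \<open>Smoothness on arbitrary sets and derivatives in tangent directions\<close>

lemma smooth_onE:
  assumes "smooth_on S f" "x \<in> S"
  obtains U g where "open U" "x \<in> U" "\<And>k. Ck_on k U g" "\<And>y. y \<in> U \<Longrightarrow> y \<in> S \<Longrightarrow> g y = f y"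
proof -
  obtain U g where *: "open U \<and> x \<in> U \<and> (\<forall>k. Ck_on k U g) \<and> (\<forall>y\<in>U \<inter> S. g y = f y)"
    using assms(1)[unfolded smooth_on_def, rule_format, OF assms(2)] by (elim exE)
  show ?thesis by (rule that[of U g]) (use * in auto)
qed

lemma smooth_onI:
  assumes "\<And>x. x \<in> S \<Longrightarrow> \<exists>U g. open U \<and> x \<in> U \<and> (\<forall>k. Ck_on k U g) \<and> (\<forall>y\<in>U \<inter> S. g y = f y)"
  shows "smooth_on S f"
  unfolding smooth_on_def by (intro ballI assms)

lemma smooth_on_subset: "smooth_on S f \<Longrightarrow> T \<subseteq> S \<Longrightarrow> smooth_on T f"
proof (rule smooth_onI)
  fix x assume "smooth_on S f" "T \<subseteq> S" "x \<in> T"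
  then obtain U g where "open U" "x \<in> U" "\<And>k. Ck_on k U g" "\<And>y. y \<in> U \<Longrightarrow> y \<in> S \<Longrightarrow> g y = f y"
    by (elim smooth_onE) auto
  with \<open>T \<subseteq> S\<close> show "\<exists>U g. open U \<and> x \<in> U \<and> (\<forall>k. Ck_on k U g) \<and> (\<forall>y\<in>U \<inter> T. g y = f y)"
    by (intro exI[of _ U] exI[of _ g]) auto
qed

lemma smooth_on_cong: "(\<And>x. x \<in> S \<Longrightarrow> f x = g x) \<Longrightarrow> smooth_on S f = smooth_on S g"
  unfolding smooth_on_def by auto

text \<open>Extensions are local anyway, so one over a relatively open piece serves after its domain
  is shrunk.\<close>

lemma smooth_on_local:
  assumes "\<And>x. x \<in> S \<Longrightarrow> \<exists>S'. openin (top_of_set S) S' \<and> x \<in> S' \<and> smooth_on S' f"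
  shows "smooth_on S f"
proof (rule smooth_onI)
  fix x assume "x \<in> S"
  then obtain S' W where S': "x \<in> S'" "smooth_on S' f" "open W" "S' = S \<inter> W"
    using assms by (metis openin_open)
  obtain U g where "open U" "x \<in> U" "\<And>k. Ck_on k U g" "\<And>y. y \<in> U \<Longrightarrow> y \<in> S' \<Longrightarrow> g y = f y"
    by (rule smooth_onE[OF S'(2,1)], rule that)
  then show "\<exists>U g. open U \<and> x \<in> U \<and> (\<forall>k. Ck_on k U g) \<and> (\<forall>y\<in>U \<inter> S. g y = f y)"
    using S' by (intro exI[of _ "U \<inter> W"] exI[of _ g]) (auto intro: Ck_on_subset)
qed

lemma smooth_on_const: "smooth_on S (\<lambda>x. c)"
  unfolding smooth_on_def by (intro ballI exI[of _ UNIV] exI[of _ "\<lambda>x. c"]) (simp add: Ck_on_const)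

lemma smooth_on_bounded_linear: "bounded_linear A \<Longrightarrow> smooth_on S A"
  unfolding smooth_on_def by (intro ballI exI[of _ UNIV] exI[of _ A]) (simp add: Ck_on_bounded_linear)

lemma smooth_on_id: "smooth_on S (\<lambda>x. x)"
  by (rule smooth_on_bounded_linear) (rule bounded_linear_ident)

lemma smooth_on_compose_linear:
  assumes "bounded_linear A" "smooth_on S f"
  shows "smooth_on S (\<lambda>x. A (f x))"
proof (rule smooth_onI)
  fix x assume "x \<in> S"
  obtain U g where
    *: "open U" "x \<in> U" "\<And>k. Ck_on k U g" "\<And>y. y \<in> U \<Longrightarrow> y \<in> S \<Longrightarrow> g y = f y"
    by (rule smooth_onE[OF assms(2) \<open>x \<in> S\<close>], rule that)
  then show "\<exists>U g. open U \<and> x \<in> U \<and> (\<forall>k. Ck_on k U g) \<and> (\<forall>y\<in>U \<inter> S. g y = A (f y))"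
    by (intro exI[of _ U] exI[of _ "\<lambda>x. A (g x)"]) (auto intro: Ck_on_compose_linear assms)
qed

lemma smooth_on_add:
  assumes "smooth_on S f" "smooth_on S g"
  shows "smooth_on S (\<lambda>x. f x + g x)"
proof (rule smooth_onI)
  fix x assume "x \<in> S"
  obtain U f' where
    f': "open U" "x \<in> U" "\<And>k. Ck_on k U f'" "\<And>y. y \<in> U \<Longrightarrow> y \<in> S \<Longrightarrow> f' y = f y"
    by (rule smooth_onE[OF assms(1) \<open>x \<in> S\<close>], rule that)
  obtain V g' where
    g': "open V" "x \<in> V" "\<And>k. Ck_on k V g'" "\<And>y. y \<in> V \<Longrightarrow> y \<in> S \<Longrightarrow> g' y = g y"
    by (rule smooth_onE[OF assms(2) \<open>x \<in> S\<close>], rule that)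
  note * = f' g'
  then show "\<exists>U h. open U \<and> x \<in> U \<and> (\<forall>k. Ck_on k U h) \<and> (\<forall>y\<in>U \<inter> S. h y = f y + g y)"
    by (intro exI[of _ "U \<inter> V"] exI[of _ "\<lambda>x. f' x + g' x"])
       (auto intro!: Ck_on_add intro: Ck_on_subset)
qed

lemma smooth_on_bounded_bilinear:
  assumes "bounded_bilinear p" "smooth_on S f" "smooth_on S g"
  shows "smooth_on S (\<lambda>x. p (f x) (g x))"
proof (rule smooth_onI)
  fix x assume "x \<in> S"
  obtain U f' where
    f': "open U" "x \<in> U" "\<And>k. Ck_on k U f'" "\<And>y. y \<in> U \<Longrightarrow> y \<in> S \<Longrightarrow> f' y = f y"
    by (rule smooth_onE[OF assms(2) \<open>x \<in> S\<close>], rule that)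
  obtain V g' where
    g': "open V" "x \<in> V" "\<And>k. Ck_on k V g'" "\<And>y. y \<in> V \<Longrightarrow> y \<in> S \<Longrightarrow> g' y = g y"
    by (rule smooth_onE[OF assms(3) \<open>x \<in> S\<close>], rule that)
  note * = f' g'
  then show "\<exists>U h. open U \<and> x \<in> U \<and> (\<forall>k. Ck_on k U h) \<and> (\<forall>y\<in>U \<inter> S. h y = p (f y) (g y))"
    by (intro exI[of _ "U \<inter> V"] exI[of _ "\<lambda>x. p (f' x) (g' x)"])
       (auto intro!: Ck_on_bounded_bilinear[OF _ assms(1)] intro: Ck_on_subset)
qed

lemma smooth_on_sum:
  assumes "\<And>i. i \<in> I \<Longrightarrow> smooth_on S (f i)"
  shows "smooth_on S (\<lambda>x. \<Sum>i\<in>I. f i x)"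
  using assms by (induction I rule: infinite_finite_induct) (auto intro: smooth_on_const smooth_on_add)

lemma smooth_on_imp_continuous_on:
  assumes "smooth_on S f" shows "continuous_on S f"
  unfolding continuous_on_eq_continuous_within
proof
  fix x assume x: "x \<in> S"
  obtain U g where
    *: "open U" "x \<in> U" "\<And>k. Ck_on k U g" "\<And>y. y \<in> U \<Longrightarrow> y \<in> S \<Longrightarrow> g y = f y"
    by (rule smooth_onE[OF assms \<open>x \<in> S\<close>], rule that)
  have "continuous (at x within S) g"
    using *(1,2) *(3)[of 0] by (simp add: continuous_on_eq_continuous_at continuous_at_imp_continuous_at_within)
  moreover have "\<forall>\<^sub>F y in at x within S. g y = f y"
    using *(1,2,4) by (auto simp: eventually_at_topological)
  ultimately show "continuous (at x within S) f"
    using *(2,4) x by (auto simp: continuous_within intro: Lim_transform_eventually)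
qed

text \<open>
  \<open>S\<close> may have boundary and corners and spans only an affine subspace with direction space \<open>T\<close>:
  one-sided directions at each point span \<open>T\<close>, so derivatives within \<open>S\<close> are unique on \<open>T\<close>.
\<close>

definition tangential :: "'e::real_normed_vector set \<Rightarrow> 'e set \<Rightarrow> bool" where
  "tangential S T \<longleftrightarrow> subspace T \<and>
     (\<exists>(I::nat set) b \<phi>. finite I \<and> (\<forall>i\<in>I. b i \<in> T \<and> bounded_linear (\<phi> i)) \<and>
        (\<forall>v\<in>T. v = (\<Sum>i\<in>I. \<phi> i v *\<^sub>R b i))) \<and>
     (\<forall>x\<in>S. \<forall>y\<in>S. y - x \<in> T) \<and>
     (\<forall>x\<in>S. T \<subseteq> span {w. \<exists>e>0. \<forall>t\<in>{0..e}. x + t *\<^sub>R w \<in> S})"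

lemma tangentialE:
  assumes "tangential S T"
  obtains I :: "nat set" and b \<phi> where "finite I" "\<And>i. i \<in> I \<Longrightarrow> b i \<in> T"
    "\<And>i. i \<in> I \<Longrightarrow> bounded_linear (\<phi> i)" "\<And>v. v \<in> T \<Longrightarrow> v = (\<Sum>i\<in>I. \<phi> i v *\<^sub>R b i)"
  using assms unfolding tangential_def by metis

lemma tangential_subspace: "tangential S T \<Longrightarrow> subspace T"
  by (simp add: tangential_def)

lemma tangential_diff: "tangential S T \<Longrightarrow> x \<in> S \<Longrightarrow> y \<in> S \<Longrightarrow> y - x \<in> T"
  by (simp add: tangential_def)

text \<open>Passing to a relatively open piece shortens the segments that stay inside but keeps
  their directions, so the span condition survives.\<close>

lemma tangential_openin:
  assumes "tangential S T" "openin (top_of_set S) S'"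
  shows "tangential S' T"
proof -
  have sub: "S' \<subseteq> S" using assms(2) openin_imp_subset by blast
  obtain W where W: "open W" "S' = S \<inter> W" using assms(2) by (metis openin_open)
  have "{w. \<exists>e>0. \<forall>t\<in>{0..e}. x + t *\<^sub>R w \<in> S} \<subseteq> {w. \<exists>e>0. \<forall>t\<in>{0..e}. x + t *\<^sub>R w \<in> S'}"
    if x: "x \<in> S'" for x
  proof clarify
    fix w and e :: real assume e: "e > 0" "\<forall>t\<in>{0..e}. x + t *\<^sub>R w \<in> S"
    have "open ((\<lambda>t::real. x + t *\<^sub>R w) -` W)"
      by (intro open_vimage W continuous_intros)
    moreover have "0 \<in> (\<lambda>t::real. x + t *\<^sub>R w) -` W" using x W by simp
    ultimately obtain d where "d > 0" "ball 0 d \<subseteq> (\<lambda>t::real. x + t *\<^sub>R w) -` W"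
      by (meson openE)
    then have d: "d > 0" "\<And>t. \<bar>t\<bar> < d \<Longrightarrow> x + t *\<^sub>R w \<in> W"
      by (auto simp: subset_iff)
    show "\<exists>e>0. \<forall>t\<in>{0..e}. x + t *\<^sub>R w \<in> S'"
      using d e W by (intro exI[of _ "min e (d/2)"]) auto
  qed
  then have "T \<subseteq> span {w. \<exists>e>0. \<forall>t\<in>{0..e}. x + t *\<^sub>R w \<in> S'}" if "x \<in> S'" for x
    using assms(1) sub that span_mono unfolding tangential_def by (meson order_trans subsetD)
  moreover have "\<forall>x\<in>S'. \<forall>y\<in>S'. y - x \<in> T"
    using assms(1) sub unfolding tangential_def by blast
  ultimately show ?thesis
    using assms(1) by (simp add: tangential_def)
qed

text \<open>Along a direction whose segment stays in \<open>S\<close>, both candidates equal the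
  one-sided derivative of a function of one real variable; linearity then carries the equality to
  the span, which contains \<open>T\<close>.\<close>

lemma tangential_derivative_unique:
  assumes "tangential S T" "x \<in> S" "v \<in> T"
    and f': "(f has_derivative f') (at x within S)" and g': "(f has_derivative g') (at x within S)"
  shows "f' v = g' v"
proof -
  let ?W = "{w. \<exists>e>0. \<forall>t\<in>{0..e}. x + t *\<^sub>R w \<in> S}"
  have "f' w = g' w" if w: "w \<in> ?W" for w
  proof -
    obtain e where e: "e > 0" "\<And>t. t \<in> {0..e} \<Longrightarrow> x + t *\<^sub>R w \<in> S" using w by auto
    let ?p = "\<lambda>t. x + t *\<^sub>R w"
    have p: "(?p has_derivative (\<lambda>t. t *\<^sub>R w)) (at 0 within {0..e})"
      by (auto intro!: derivative_eq_intros)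
    have "((\<lambda>t. f (?p t)) has_vector_derivative h' w) (at 0 within {0..e})"
      if "(f has_derivative h') (at x within S)" for h'
    proof -
      have "(f has_derivative h') (at (?p 0) within ?p ` {0..e})"
        using has_derivative_subset[OF that, of "?p ` {0..e}"] e(2) by (simp add: image_subset_iff)
      from has_derivative_in_compose[OF p this] have
        "((\<lambda>t. f (?p t)) has_derivative (\<lambda>t. h' (t *\<^sub>R w))) (at 0 within {0..e})" .
      then show ?thesis
        using has_derivative_linear[OF that] by (simp add: has_vector_derivative_def linear_cmul)
    qed
    \<comment> \<open>The interval is nondegenerate, so one-sided derivatives at its left end are
      unique.\<close>
    moreover have "at (0::real) within {0..e} \<noteq> bot"
      using e by (simp add: at_within_Icc_at_right)
    ultimately show ?thesis
      using vector_derivative_unique_within f' g' by blast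
  qed
  moreover have "v \<in> span ?W" using assms unfolding tangential_def by blast
  ultimately show ?thesis
    using linear_eq_on_span[OF has_derivative_linear[OF f'] has_derivative_linear[OF g']] by blast
qed

text \<open>The bridge between two notions: smoothness speaks of extensions to open sets, whereas
  forms are differentiated within the chart image.\<close>

lemma smooth_on_extension_deriv:
  assumes "x \<in> S" "open U" "x \<in> U" "\<And>k. Ck_on k U g" "\<And>y. y \<in> U \<Longrightarrow> y \<in> S \<Longrightarrow> g y = f y"
  shows "(f has_derivative frechet_derivative g (at x)) (at x within S)"
proof -
  have "(g has_derivative frechet_derivative g (at x)) (at x within S \<inter> U)"
    using Ck_on_SucD[OF assms(4) assms(3)] has_derivative_at_withinI by blast
  then have "(f has_derivative frechet_derivative g (at x)) (at x within S \<inter> U)"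
    by (rule has_derivative_transform[rotated 2]) (use assms in auto)
  then show ?thesis
    using at_within_nhd[of x U "S \<inter> U" S] assms by auto
qed

lemma smooth_on_has_derivative:
  assumes "smooth_on S f" "x \<in> S"
  shows "(f has_derivative frechet_derivative f (at x within S)) (at x within S)"
proof -
  obtain U g where "open U" "x \<in> U" "\<And>k. Ck_on k U g" "\<And>y. y \<in> U \<Longrightarrow> y \<in> S \<Longrightarrow> g y = f y"
    by (rule smooth_onE[OF assms], rule that)
  from smooth_on_extension_deriv[OF assms(2) this] show ?thesis
    by (auto simp: frechet_derivative_works[symmetric] intro: differentiableI)
qed

lemma frechet_derivative_tangential:
  assumes "tangential S T" "x \<in> S" "v \<in> T" "(f has_derivative f') (at x within S)"
  shows "frechet_derivative f (at x within S) v = f' v"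
  using tangential_derivative_unique[OF assms(1-3) _ assms(4)] assms(4)
  by (meson differentiableI frechet_derivative_works)

text \<open>The derivative of a local extension in direction \<open>v\<close> is itself a local
  extension of the derivative within \<open>S\<close>; tangency of \<open>v\<close> makes the latter
  well determined.\<close>

lemma smooth_on_frechet_derivative:
  assumes "tangential S T" "smooth_on S f" "v \<in> T"
  shows "smooth_on S (\<lambda>x. frechet_derivative f (at x within S) v)"
proof (rule smooth_onI)
  fix x assume x: "x \<in> S"
  obtain U g where
    *: "open U" "x \<in> U" "\<And>k. Ck_on k U g" "\<And>y. y \<in> U \<Longrightarrow> y \<in> S \<Longrightarrow> g y = f y"
    by (rule smooth_onE[OF assms(2) \<open>x \<in> S\<close>], rule that)
  have "frechet_derivative g (at y) v = frechet_derivative f (at y within S) v" if "y \<in> U \<inter> S" for y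
    using frechet_derivative_tangential[OF assms(1) _ assms(3)
        smooth_on_extension_deriv[OF _ *(1) _ *(3,4)]] that by auto
  moreover have "Ck_on k U (\<lambda>x. frechet_derivative g (at x) v)" for k
    using *(3)[of "Suc k"] by simp
  ultimately show "\<exists>U g. open U \<and> x \<in> U \<and> (\<forall>k. Ck_on k U g) \<and>
      (\<forall>y\<in>U \<inter> S. g y = frechet_derivative f (at y within S) v)"
    using * by blast
qed

lemma smooth_on_compose:
  assumes "smooth_on S f" "smooth_on S' g" "f ` S \<subseteq> S'" "tangential S' T"
  shows "smooth_on S (\<lambda>x. g (f x))"
proof (rule smooth_onI)
  fix x assume x: "x \<in> S"
  obtain U f' where
    f': "open U" "x \<in> U" "\<And>k. Ck_on k U f'" "\<And>y. y \<in> U \<Longrightarrow> y \<in> S \<Longrightarrow> f' y = f y"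
    by (rule smooth_onE[OF assms(1) x], rule that)
  have "f x \<in> S'" using x assms(3) by auto
  then obtain V g' where
    g': "open V" "f x \<in> V" "\<And>k. Ck_on k V g'" "\<And>y. y \<in> V \<Longrightarrow> y \<in> S' \<Longrightarrow> g' y = g y"
    by (elim smooth_onE[OF assms(2)], intro that)
  note * = f' g'
  obtain I :: "nat set" and b \<phi> where I: "finite I" "\<And>i. i \<in> I \<Longrightarrow> b i \<in> T"
    "\<And>i. i \<in> I \<Longrightarrow> bounded_linear (\<phi> i)" "\<And>v. v \<in> T \<Longrightarrow> v = (\<Sum>i\<in>I. \<phi> i v *\<^sub>R b i)"
    by (rule tangentialE[OF assms(4)], rule that)
  let ?h = "\<lambda>i y. \<phi> i (f' y - f x)"
  \<comment> \<open>The extension \<open>f'\<close> may leave the affine space spanned by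
    \<open>S'\<close>. Keeping only the coordinates of its increment gives a map of the shape that
    \<open>Ck_on_compose\<close> accepts and changes nothing on \<open>S\<close>.\<close>
  let ?P = "\<lambda>y. f x + (\<Sum>i\<in>I. ?h i y *\<^sub>R b i)"
  have h: "Ck_on k U (?h i)" if "i \<in> I" for i k
    using Ck_on_compose_linear[OF *(1) I(3)[OF that] Ck_on_add[OF *(1) *(3) Ck_on_const[OF *(1), where c = "- f x"]]]
    by simp
  have P: "?P y = f y" if "y \<in> U \<inter> S" for y
    using I(4)[OF tangential_diff[OF assms(4)], of "f x" "f y"] *(4) that x assms(3)
    by (simp add: image_subset_iff)
  have "continuous_on U ?P"
    using h[of _ 0] by (auto intro!: continuous_intros)
  then have o: "open (U \<inter> ?P -` V)"
    using *(1,5) by (simp add: continuous_on_open_vimage Int_commute)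
  have "Ck_on k (U \<inter> ?P -` V) (\<lambda>y. g' (?P y))" for k
    by (rule Ck_on_compose[OF o *(5) I(1) Ck_on_subset[OF h]]) (auto intro: *(7))
  moreover have "\<forall>y\<in>U \<inter> ?P -` V \<inter> S. g' (?P y) = g (f y)"
    using *(8) assms(3) P by (auto simp: image_subset_iff)
  ultimately show "\<exists>U h. open U \<and> x \<in> U \<and> (\<forall>k. Ck_on k U h) \<and> (\<forall>y\<in>U \<inter> S. h y = g (f y))"
    using o *(2) P[of x] x *(6) by (intro exI[of _ "U \<inter> ?P -` V"] exI[of _ "\<lambda>y. g' (?P y)"]) auto
qed

text \<open>Increments of \<open>f\<close> lie in \<open>T'\<close>, so projecting them by the
  coordinates of \<open>T'\<close> leaves \<open>f\<close> unchanged on \<open>S\<close>; uniqueness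
  of derivatives then makes \<open>f' v\<close> equal to its own projection.\<close>

lemma derivative_in_tangent_space:
  assumes "tangential S T" "tangential S' T'" "f ` S \<subseteq> S'" "x \<in> S" "v \<in> T"
    and f': "(f has_derivative f') (at x within S)"
  shows "f' v \<in> T'"
proof -
  obtain I :: "nat set" and b \<phi> where I: "finite I" "\<And>i. i \<in> I \<Longrightarrow> b i \<in> T'"
    "\<And>i. i \<in> I \<Longrightarrow> bounded_linear (\<phi> i)" "\<And>v. v \<in> T' \<Longrightarrow> v = (\<Sum>i\<in>I. \<phi> i v *\<^sub>R b i)"
    by (rule tangentialE[OF assms(2)], rule that)
  let ?P = "\<lambda>y. \<Sum>i\<in>I. \<phi> i y *\<^sub>R b i"
  have "((\<lambda>y. f x + ?P (f y - f x)) has_derivative (\<lambda>v. ?P (f' v))) (at x within S)"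
  proof -
    have "((\<lambda>y. \<phi> i (f y - f x)) has_derivative (\<lambda>v. \<phi> i (f' v))) (at x within S)" if "i \<in> I" for i
      using bounded_linear.has_derivative[OF I(3)[OF that] has_derivative_diff[OF f' has_derivative_const]]
      by simp
    then show ?thesis by (auto intro!: derivative_eq_intros)
  qed
  then have "(f has_derivative (\<lambda>v. ?P (f' v))) (at x within S)"
  proof (rule has_derivative_transform[rotated 2])
    fix y assume "y \<in> S"
    then have "f y - f x \<in> T'"
      using assms(3,4) by (intro tangential_diff[OF assms(2)]) auto
    then show "f y = f x + ?P (f y - f x)"
      using I(4) by (metis add.commute diff_add_cancel)
  qed (use assms in auto)
  then have "f' v = ?P (f' v)"
    using tangential_derivative_unique[OF assms(1,4,5) f'] by blast
  moreover have "?P (f' v) \<in> T'"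
    using tangential_subspace[OF assms(2)] I by (auto intro!: subspace_sum subspace_scale)
  ultimately show ?thesis by simp
qed

section \<open>Symmetry of second derivatives\<close>

lemma MVT_line:
  fixes f :: "real \<Rightarrow> real"
  assumes "s > 0" "\<And>t. 0 \<le> t \<Longrightarrow> t \<le> s \<Longrightarrow> (f has_real_derivative f' t) (at t)"
  obtains z where "0 < z" "z < s" "f s - f 0 = s * f' z"
  using MVT2[of 0 s f f'] assms by auto

lemma open_parallelogram:
  fixes x v w :: "'e::real_normed_vector"
  assumes "open U" "x \<in> U"
  obtains d where "d > 0" "\<And>s t::real. 0 \<le> s \<Longrightarrow> s \<le> d \<Longrightarrow> 0 \<le> t \<Longrightarrow> t \<le> d \<Longrightarrow> x + s *\<^sub>R v + t *\<^sub>R w \<in> U"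
proof -
  let ?p = "\<lambda>z::real \<times> real. x + fst z *\<^sub>R v + snd z *\<^sub>R w"
  have "open (?p -` U)" by (intro open_vimage assms continuous_intros)
  moreover have "(0, 0) \<in> ?p -` U" using assms by simp
  ultimately obtain A B where "open A" "open B" "(0, 0) \<in> A \<times> B" "A \<times> B \<subseteq> ?p -` U"
    by (rule open_prod_elim)
  then have AB: "open A" "0 \<in> A" "open B" "0 \<in> B" "A \<times> B \<subseteq> ?p -` U" by auto
  obtain a where a: "a > 0" "ball 0 a \<subseteq> A" by (rule openE[OF AB(1,2)])
  obtain b where b: "b > 0" "ball 0 b \<subseteq> B" by (rule openE[OF AB(3,4)])
  have "x + s *\<^sub>R v + t *\<^sub>R w \<in> U" if "0 \<le> s" "s \<le> min a b / 2" "0 \<le> t" "t \<le> min a b / 2" for s t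
  proof -
    have "s \<in> ball 0 a" "t \<in> ball 0 b" using that a(1) b(1) by (auto simp: min_def split: if_splits)
    then have "s \<in> A" "t \<in> B" using a(2) b(2) by auto
    then show ?thesis using AB(5) by auto
  qed
  then show ?thesis using that[of "min a b / 2"] a b by auto
qed

text \<open>The mean value theorem twice: in direction \<open>v\<close> for the difference of
  \<open>f\<close> across \<open>s *\<^sub>R w\<close>, then in direction \<open>w\<close> for the
  resulting derivative.\<close>

lemma second_difference_mean_value:
  fixes f :: "'e::real_normed_vector \<Rightarrow> real"
  assumes U: "\<And>a b. 0 \<le> a \<Longrightarrow> a \<le> s \<Longrightarrow> 0 \<le> b \<Longrightarrow> b \<le> s \<Longrightarrow> x + a *\<^sub>R v + b *\<^sub>R w \<in> U" and "s > 0"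
    and f: "Ck_on (Suc (Suc k)) U f"
  obtains a b where "0 < a" "a < s" "0 < b" "b < s"
    "f (x + s *\<^sub>R v + s *\<^sub>R w) - f (x + s *\<^sub>R v) - f (x + s *\<^sub>R w) + f x =
     s * (s * frechet_derivative (\<lambda>y. frechet_derivative f (at y) v) (at (x + a *\<^sub>R v + b *\<^sub>R w)) w)"
proof -
  have line: "((\<lambda>t. h (y + t *\<^sub>R u)) has_real_derivative frechet_derivative h (at (y + t *\<^sub>R u)) u) (at t)"
    if "Ck_on (Suc j) U h" "y + t *\<^sub>R u \<in> U" for j and h :: "'e \<Rightarrow> real" and y u t
  proof -
    have hd: "(h has_derivative frechet_derivative h (at (y + t *\<^sub>R u))) (at (y + t *\<^sub>R u))"
      using Ck_on_SucD that by blast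
    have "((\<lambda>t. y + t *\<^sub>R u) has_derivative (\<lambda>t. t *\<^sub>R u)) (at t)"
      by (auto intro!: derivative_eq_intros)
    from has_derivative_compose[OF this hd]
    have "((\<lambda>t. h (y + t *\<^sub>R u)) has_derivative (\<lambda>r. frechet_derivative h (at (y + t *\<^sub>R u)) (r *\<^sub>R u))) (at t)" .
    then show ?thesis
      using has_derivative_linear[OF hd]
      by (simp add: has_field_derivative_def linear_cmul) (simp add: mult_commute_abs)
  qed
  let ?g = "\<lambda>y. frechet_derivative f (at y) v"
  let ?p = "\<lambda>a. f ((x + s *\<^sub>R w) + a *\<^sub>R v) - f (x + a *\<^sub>R v)"
  obtain a where a: "0 < a" "a < s" "?p s - ?p 0 = s * (?g ((x + s *\<^sub>R w) + a *\<^sub>R v) - ?g (x + a *\<^sub>R v))"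
  proof (rule MVT_line[OF \<open>s > 0\<close>, of ?p "\<lambda>a. ?g ((x + s *\<^sub>R w) + a *\<^sub>R v) - ?g (x + a *\<^sub>R v)"])
    fix t assume t: "0 \<le> t" "t \<le> s"
    have "x + s *\<^sub>R w + t *\<^sub>R v \<in> U" "x + t *\<^sub>R v \<in> U"
      using U[OF t, of s] U[OF t, of 0] \<open>s > 0\<close> by (auto simp: algebra_simps)
    then show "(?p has_real_derivative ?g ((x + s *\<^sub>R w) + t *\<^sub>R v) - ?g (x + t *\<^sub>R v)) (at t)"
      by (intro DERIV_diff line[OF f])
  qed (use that in blast)
  obtain b where b: "0 < b" "b < s" "?g ((x + a *\<^sub>R v) + s *\<^sub>R w) - ?g ((x + a *\<^sub>R v) + 0 *\<^sub>R w) =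
      s * frechet_derivative ?g (at ((x + a *\<^sub>R v) + b *\<^sub>R w)) w"
  proof (rule MVT_line[OF \<open>s > 0\<close>, of "\<lambda>b. ?g ((x + a *\<^sub>R v) + b *\<^sub>R w)"
        "\<lambda>b. frechet_derivative ?g (at ((x + a *\<^sub>R v) + b *\<^sub>R w)) w"])
    fix t assume t: "0 \<le> t" "t \<le> s"
    show "((\<lambda>b. ?g ((x + a *\<^sub>R v) + b *\<^sub>R w)) has_real_derivative
        frechet_derivative ?g (at ((x + a *\<^sub>R v) + t *\<^sub>R w)) w) (at t)"
      by (rule line[of k]) (use f U[of a t] t a in auto)
  qed (use that in blast)
  show ?thesis
    using that[OF a(1,2) b(1,2)] a(3) b(3) by (simp add: algebra_simps)
qed

text \<open>The second difference over a parallelogram is symmetric in \<open>v\<close> and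
  \<open>w\<close>. Expanded in either order it gives a mixed derivative at a nearby point, and the
  two agree in the limit by continuity.\<close>

lemma frechet_derivative_symmetric_real:
  fixes f :: "'e::real_normed_vector \<Rightarrow> real"
  assumes "open U" "x \<in> U" "\<And>k. Ck_on k U f"
  shows "frechet_derivative (\<lambda>y. frechet_derivative f (at y) v) (at x) w =
         frechet_derivative (\<lambda>y. frechet_derivative f (at y) w) (at x) v"
proof -
  let ?D = "\<lambda>v w y. frechet_derivative (\<lambda>y. frechet_derivative f (at y) v) (at y) w"
  obtain d where d: "d > 0" "\<And>s t::real. 0 \<le> s \<Longrightarrow> s \<le> d \<Longrightarrow> 0 \<le> t \<Longrightarrow> t \<le> d \<Longrightarrow> x + s *\<^sub>R v + t *\<^sub>R w \<in> U"
    by (rule open_parallelogram[OF assms(1,2)], rule that)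
  define s where "s = (\<lambda>n. d / real (Suc n))"
  have s: "s n > 0" "s n \<le> d" for n
    using d(1) by (auto simp: s_def field_simps)
  have s0: "s \<longlonglongrightarrow> 0"
    unfolding s_def by (rule lim_const_over_n[THEN LIMSEQ_Suc])
  let ?\<Delta> = "\<lambda>n. f (x + s n *\<^sub>R v + s n *\<^sub>R w) - f (x + s n *\<^sub>R v) - f (x + s n *\<^sub>R w) + f x"
  have "\<forall>n. \<exists>a b. 0 < a \<and> a < s n \<and> 0 < b \<and> b < s n \<and> ?\<Delta> n = s n * (s n * ?D v w (x + a *\<^sub>R v + b *\<^sub>R w))"
  proof
    fix n
    have "x + a *\<^sub>R v + b *\<^sub>R w \<in> U" if "0 \<le> a" "a \<le> s n" "0 \<le> b" "b \<le> s n" for a b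
      using d(2)[of a b] that s[of n] by simp
    from second_difference_mean_value[OF this s(1) assms(3)] obtain a b where
      ab: "0 < a" "a < s n" "0 < b" "b < s n" "?\<Delta> n = s n * (s n * ?D v w (x + a *\<^sub>R v + b *\<^sub>R w))"
      by blast
    then show "\<exists>a b. 0 < a \<and> a < s n \<and> 0 < b \<and> b < s n \<and> ?\<Delta> n = s n * (s n * ?D v w (x + a *\<^sub>R v + b *\<^sub>R w))"
      by (intro exI[of _ a] exI[of _ b] conjI)
  qed
  then obtain a b where ab: "\<And>n. 0 < a n" "\<And>n. a n < s n" "\<And>n. 0 < b n" "\<And>n. b n < s n"
      "\<And>n. ?\<Delta> n = s n * (s n * ?D v w (x + a n *\<^sub>R v + b n *\<^sub>R w))"
    by metis
  have "\<forall>n. \<exists>a b. 0 < a \<and> a < s n \<and> 0 < b \<and> b < s n \<and> ?\<Delta> n = s n * (s n * ?D w v (x + a *\<^sub>R w + b *\<^sub>R v))"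
  proof
    fix n
    have "x + a *\<^sub>R w + b *\<^sub>R v \<in> U" if "0 \<le> a" "a \<le> s n" "0 \<le> b" "b \<le> s n" for a b
      using d(2)[of b a] that s[of n] by (simp add: algebra_simps)
    from second_difference_mean_value[OF this s(1) assms(3)] obtain a b where
      ab': "0 < a" "a < s n" "0 < b" "b < s n" "f (x + s n *\<^sub>R w + s n *\<^sub>R v) - f (x + s n *\<^sub>R w) - f (x + s n *\<^sub>R v) + f x
        = s n * (s n * ?D w v (x + a *\<^sub>R w + b *\<^sub>R v))"
      by blast
    have "?\<Delta> n = f (x + s n *\<^sub>R w + s n *\<^sub>R v) - f (x + s n *\<^sub>R w) - f (x + s n *\<^sub>R v) + f x"
      by (simp add: algebra_simps)
    with ab'(5) have "?\<Delta> n = s n * (s n * ?D w v (x + a *\<^sub>R w + b *\<^sub>R v))" by simp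
    with ab'(1-4) show "\<exists>a b. 0 < a \<and> a < s n \<and> 0 < b \<and> b < s n \<and> ?\<Delta> n = s n * (s n * ?D w v (x + a *\<^sub>R w + b *\<^sub>R v))"
      by (intro exI[of _ a] exI[of _ b] conjI)
  qed
  then obtain a' b' where ab': "\<And>n. 0 < a' n" "\<And>n. a' n < s n" "\<And>n. 0 < b' n" "\<And>n. b' n < s n"
      "\<And>n. ?\<Delta> n = s n * (s n * ?D w v (x + a' n *\<^sub>R w + b' n *\<^sub>R v))"
    by metis
  have eq: "?D v w (x + a n *\<^sub>R v + b n *\<^sub>R w) = ?D w v (x + a' n *\<^sub>R w + b' n *\<^sub>R v)" for n
  proof -
    have "s n * (s n * ?D v w (x + a n *\<^sub>R v + b n *\<^sub>R w)) = s n * (s n * ?D w v (x + a' n *\<^sub>R w + b' n *\<^sub>R v))"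
      using ab(5)[of n] ab'(5)[of n] by linarith
    then show ?thesis
      using s(1)[of n] by simp
  qed
  have lim0: "h \<longlonglongrightarrow> 0" if "\<And>n. 0 < h n" "\<And>n. h n < s n" for h
    by (rule tendsto_sandwich[OF _ _ tendsto_const s0]) (auto intro!: always_eventually less_imp_le that)
  have c: "isCont (?D v w) x" for v w
    using assms(3)[of "Suc (Suc 0)"] assms(1,2) by (simp add: continuous_on_eq_continuous_at)
  have lim: "(\<lambda>n. ?D v w (x + h n *\<^sub>R v' + k n *\<^sub>R w')) \<longlonglongrightarrow> ?D v w x"
    if "h \<longlonglongrightarrow> 0" "k \<longlonglongrightarrow> 0" for h k v w v' w'
  proof -
    have "(\<lambda>n. x + h n *\<^sub>R v' + k n *\<^sub>R w') \<longlonglongrightarrow> x + 0 *\<^sub>R v' + 0 *\<^sub>R w'"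
      by (intro tendsto_intros that)
    then show ?thesis
      using isCont_tendsto_compose[OF c] by simp
  qed
  have "(\<lambda>n. ?D v w (x + a n *\<^sub>R v + b n *\<^sub>R w)) \<longlonglongrightarrow> ?D v w x"
    by (intro lim lim0 ab)
  moreover have "(\<lambda>n. ?D v w (x + a n *\<^sub>R v + b n *\<^sub>R w)) \<longlonglongrightarrow> ?D w v x"
    unfolding eq by (intro lim lim0 ab')
  ultimately show ?thesis by (rule LIMSEQ_unique)
qed

lemma frechet_derivative_within_linear:
  assumes "tangential S T" "smooth_on S f" "bounded_linear A" "x \<in> S" "v \<in> T"
  shows "frechet_derivative (\<lambda>y. A (f y)) (at x within S) v = A (frechet_derivative f (at x within S) v)"
  by (rule frechet_derivative_tangential[OF assms(1,4,5)])
     (rule bounded_linear.has_derivative[OF assms(3) smooth_on_has_derivative[OF assms(2,4)]])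

lemma frechet_derivative_within_cong:
  assumes "\<And>y. y \<in> S \<Longrightarrow> f y = g y" "x \<in> S"
  shows "frechet_derivative f (at x within S) = frechet_derivative g (at x within S)"
proof -
  have "(f has_derivative D) (at x within S) \<longleftrightarrow> (g has_derivative D) (at x within S)" for D
    using has_derivative_transform[OF assms(2), of f g] has_derivative_transform[OF assms(2), of g f] assms(1)
    by auto
  then show ?thesis by (simp add: frechet_derivative_def)
qed

lemma frechet_derivative_within_symmetric_real:
  fixes f :: "'e::real_normed_vector \<Rightarrow> real"
  assumes "tangential S T" "smooth_on S f" "x \<in> S" "v \<in> T" "w \<in> T"
  shows "frechet_derivative (\<lambda>y. frechet_derivative f (at y within S) v) (at x within S) w =
         frechet_derivative (\<lambda>y. frechet_derivative f (at y within S) w) (at x within S) v"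
proof -
  obtain U g where
    *: "open U" "x \<in> U" "\<And>k. Ck_on k U g" "\<And>y. y \<in> U \<Longrightarrow> y \<in> S \<Longrightarrow> g y = f y"
    by (rule smooth_onE[OF assms(2,3)], rule that)
  have "frechet_derivative (\<lambda>y. frechet_derivative f (at y within S) v) (at x within S) w =
      frechet_derivative (\<lambda>y. frechet_derivative g (at y) v) (at x) w" if "v \<in> T" "w \<in> T" for v w
  proof (rule frechet_derivative_tangential[OF assms(1,3) that(2)], rule smooth_on_extension_deriv[OF assms(3) *(1,2)])
    show "Ck_on k U (\<lambda>y. frechet_derivative g (at y) v)" for k
      using *(3)[of "Suc k"] by simp
    show "frechet_derivative g (at y) v = frechet_derivative f (at y within S) v" if "y \<in> U" "y \<in> S" for y
      using frechet_derivative_tangential[OF assms(1) _ \<open>v \<in> T\<close> smooth_on_extension_deriv[OF _ *(1) _ *(3,4)]]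
        that by auto
  qed
  then show ?thesis
    using frechet_derivative_symmetric_real[OF *(1-3)] assms by simp
qed

text \<open>The mean value argument is confined to real-valued functions, so vector-valued maps are
  tested with bounded real functionals.\<close>

lemma frechet_derivative_within_symmetric_linear:
  fixes A :: "'f::real_normed_vector \<Rightarrow> real"
  assumes "tangential S T" "smooth_on S f" "x \<in> S" "v \<in> T" "w \<in> T" "bounded_linear A"
  shows "A (frechet_derivative (\<lambda>y. frechet_derivative f (at y within S) v) (at x within S) w) =
         A (frechet_derivative (\<lambda>y. frechet_derivative f (at y within S) w) (at x within S) v)"
proof -
  have "A (frechet_derivative (\<lambda>y. frechet_derivative f (at y within S) v) (at x within S) w) =
    frechet_derivative (\<lambda>y. frechet_derivative (\<lambda>y. A (f y)) (at y within S) v) (at x within S) w"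
    if "v \<in> T" "w \<in> T" for v w
  proof -
    have "A (frechet_derivative (\<lambda>y. frechet_derivative f (at y within S) v) (at x within S) w)
      = frechet_derivative (\<lambda>y. A (frechet_derivative f (at y within S) v)) (at x within S) w"
      using frechet_derivative_within_linear[OF assms(1) smooth_on_frechet_derivative[OF assms(1,2) that(1)]
          assms(6,3) that(2)] by simp
    also have "\<dots> = frechet_derivative (\<lambda>y. frechet_derivative (\<lambda>y. A (f y)) (at y within S) v) (at x within S) w"
      by (rule fun_cong[OF frechet_derivative_within_cong[OF _ assms(3)]])
         (use frechet_derivative_within_linear[OF assms(1,2,6)] that in simp)
    finally show ?thesis .
  qed
  then show ?thesis
    using frechet_derivative_within_symmetric_real[OF assms(1) smooth_on_compose_linear[OF assms(6,2)] assms(3)] assms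
    by simp
qed

lemma frechet_derivative_within_symmetric:
  fixes f :: "'e::real_normed_vector \<Rightarrow> complex"
  assumes "tangential S T" "smooth_on S f" "x \<in> S" "v \<in> T" "w \<in> T"
  shows "frechet_derivative (\<lambda>y. frechet_derivative f (at y within S) v) (at x within S) w =
         frechet_derivative (\<lambda>y. frechet_derivative f (at y within S) w) (at x within S) v"
  using frechet_derivative_within_symmetric_linear[OF assms bounded_linear_Re]
    frechet_derivative_within_symmetric_linear[OF assms bounded_linear_Im]
  by (rule complex_eqI)

text \<open>Lets a derivative, which takes values in a tangent space, be differentiated once more as
  a map into a set with that same tangent space.\<close>

lemma tangential_self:
  assumes "tangential S T" shows "tangential T T"
proof -
  have "T \<subseteq> span {w. \<exists>e>0. \<forall>t\<in>{0..e}. x + t *\<^sub>R w \<in> T}" if "x \<in> T" for x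
  proof
    fix w assume "w \<in> T"
    then have "\<exists>e>0::real. \<forall>t\<in>{0..e}. x + t *\<^sub>R w \<in> T"
      using that tangential_subspace[OF assms]
      by (intro exI[of _ 1]) (auto intro: subspace_add subspace_scale)
    then show "w \<in> span {w. \<exists>e>0. \<forall>t\<in>{0..e}. x + t *\<^sub>R w \<in> T}"
      by (intro span_base) simp
  qed
  then show ?thesis
    using assms subspace_diff[OF tangential_subspace[OF assms]] unfolding tangential_def by blast
qed

lemma frechet_derivative_within_in_tangent_space:
  assumes "tangential S T" "tangential S' T'" "smooth_on S f" "f ` S \<subseteq> S'" "x \<in> S" "v \<in> T"
  shows "frechet_derivative f (at x within S) v \<in> T'"
  by (rule derivative_in_tangent_space[OF assms(1,2,4,5,6) smooth_on_has_derivative[OF assms(3,5)]])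

lemma second_derivative_in_tangent_space:
  assumes "tangential S T" "tangential S' T'" "smooth_on S f" "f ` S \<subseteq> S'" "x \<in> S" "v \<in> T" "w \<in> T"
  shows "frechet_derivative (\<lambda>y. frechet_derivative f (at y within S) v) (at x within S) w \<in> T'"
  using frechet_derivative_within_in_tangent_space[OF assms(1) tangential_self[OF assms(2)]
      smooth_on_frechet_derivative[OF assms(1,3,6)] _ assms(5,7)]
    frechet_derivative_within_in_tangent_space[OF assms(1-4)] assms(6)
  by blast

text \<open>The coordinate functionals separate points of \<open>T'\<close> only, so both second
  derivatives are first placed in \<open>T'\<close>.\<close>

lemma frechet_derivative_within_symmetric_tangent:
  assumes "tangential S T" "tangential S' T'" "smooth_on S f" "f ` S \<subseteq> S'" "x \<in> S" "v \<in> T" "w \<in> T"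
  shows "frechet_derivative (\<lambda>y. frechet_derivative f (at y within S) v) (at x within S) w =
         frechet_derivative (\<lambda>y. frechet_derivative f (at y within S) w) (at x within S) v"
    (is "?l = ?r")
proof -
  obtain I :: "nat set" and b \<phi> where I: "finite I" "\<And>i. i \<in> I \<Longrightarrow> b i \<in> T'"
    "\<And>i. i \<in> I \<Longrightarrow> bounded_linear (\<phi> i)" "\<And>v. v \<in> T' \<Longrightarrow> v = (\<Sum>i\<in>I. \<phi> i v *\<^sub>R b i)"
    by (rule tangentialE[OF assms(2)], rule that)
  have "?l = (\<Sum>i\<in>I. \<phi> i ?l *\<^sub>R b i)"
    by (rule I(4)) (rule second_derivative_in_tangent_space[OF assms])
  also have "\<dots> = (\<Sum>i\<in>I. \<phi> i ?r *\<^sub>R b i)"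
    using frechet_derivative_within_symmetric_linear[OF assms(1,3,5-7) I(3)] by simp
  also have "\<dots> = ?r"
    by (rule I(4)[symmetric]) (rule second_derivative_in_tangent_space[OF assms(1-5,7,6)])
  finally show ?thesis .
qed

section \<open>Alternating functions\<close>

text \<open>The pairing behind every vanishing double sum here: \<open>(a, b - 1)\<close> is matched
  with \<open>(b, a)\<close> for \<open>a < b\<close>. It serves the exterior derivative, the
  singular coboundary and the second-derivative terms of pulled back forms alike.\<close>

lemma sum_skip_cancel:
  fixes R :: "nat \<Rightarrow> nat \<Rightarrow> 'a::ab_group_add"
  assumes "\<And>a b. a < b \<Longrightarrow> b \<le> n \<Longrightarrow> R a (b - 1) + R b a = 0"
  shows "(\<Sum>i\<le>n. \<Sum>j<n. R i j) = 0"
proof -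
  let ?L = "{(i, j). i \<le> n \<and> j < i}" and ?U = "{(i, j). i \<le> j \<and> j < n}"
  have fin: "finite ?L" "finite ?U"
    by (rule finite_subset[of _ "{..n} \<times> {..n}"]; auto)+
  have "(\<Sum>i\<le>n. \<Sum>j<n. R i j) = (\<Sum>(i, j)\<in>?L \<union> ?U. R i j)"
  proof -
    have "{..n} \<times> {..<n} = ?L \<union> ?U" by auto
    then show ?thesis unfolding sum.cartesian_product by (rule arg_cong)
  qed
  also have "\<dots> = (\<Sum>(i, j)\<in>?L. R i j) + (\<Sum>(i, j)\<in>?U. R i j)"
    by (rule sum.union_disjoint[OF fin]) auto
  also have "(\<Sum>(i, j)\<in>?U. R i j) = (\<Sum>(i, j)\<in>?L. R j (i - 1))"
    by (rule sum.reindex_bij_witness[of _ "\<lambda>(i, j). (j, i - 1)" "\<lambda>(i, j). (Suc j, i)"]) auto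
  also have "(\<Sum>(i, j)\<in>?L. R i j) + (\<Sum>(i, j)\<in>?L. R j (i - 1)) = (\<Sum>(i, j)\<in>?L. R j (i - 1) + R i j)"
    by (simp add: sum.distrib[symmetric] case_prod_unfold add.commute)
  also have "\<dots> = 0"
    by (rule sum.neutral) (use assms in auto)
  finally show ?thesis .
qed

lemma alternating_on_linear:
  assumes "alternating_on T k \<alpha>" "subspace T" "int (length us + length ws) + 1 = k" "set us \<subseteq> T" "set ws \<subseteq> T" "u \<in> T" "w \<in> T"
  shows "\<alpha> (us @ (a *\<^sub>R u + b *\<^sub>R w) # ws) = a *\<^sub>R \<alpha> (us @ u # ws) + b *\<^sub>R \<alpha> (us @ w # ws)"
proof -
  let ?vs = "us @ 0 # ws"
  have *: "int (length ?vs) = k \<and> set ?vs \<subseteq> T"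
    using assms subspace_0[of T] by auto
  have "\<alpha> (?vs[length us := a *\<^sub>R u + b *\<^sub>R w]) = a *\<^sub>R \<alpha> (?vs[length us := u]) + b *\<^sub>R \<alpha> (?vs[length us := w])"
    using assms(1)[unfolded alternating_on_def, rule_format, OF *, THEN conjunct1, rule_format, of "length us" u w a b] assms by simp
  then show ?thesis by simp
qed

lemma alternating_on_repeat:
  assumes "alternating_on T k \<alpha>" "int (length us + length ws + length vs) + 2 = k"
    "set us \<subseteq> T" "set ws \<subseteq> T" "set vs \<subseteq> T" "u \<in> T"
  shows "\<alpha> (us @ u # vs @ u # ws) = 0"
proof -
  let ?vs = "us @ u # vs @ u # ws"
  have *: "int (length ?vs) = k \<and> set ?vs \<subseteq> T"
    using assms by auto
  show ?thesis
    using assms(1)[unfolded alternating_on_def, rule_format, OF *, THEN conjunct2, rule_format, of "length us" "length us + Suc (length vs)"]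
    by (auto simp: nth_append)
qed

lemma alternating_on_add:
  assumes "alternating_on T k \<alpha>" "subspace T" "int (length us + length ws) + 1 = k" "set us \<subseteq> T" "set ws \<subseteq> T" "u \<in> T" "w \<in> T"
  shows "\<alpha> (us @ (u + w) # ws) = \<alpha> (us @ u # ws) + \<alpha> (us @ w # ws)"
  using alternating_on_linear[OF assms, of 1 1] by simp

lemma alternating_on_scale:
  assumes "alternating_on T k \<alpha>" "subspace T" "int (length us + length ws) + 1 = k" "set us \<subseteq> T" "set ws \<subseteq> T" "u \<in> T"
  shows "\<alpha> (us @ (a *\<^sub>R u) # ws) = a *\<^sub>R \<alpha> (us @ u # ws)"
  using alternating_on_linear[OF assms(1-5) assms(6) assms(6), of a 0] by simp

lemma alternating_on_sum:
  assumes "alternating_on T k \<alpha>" "subspace T" "int (length us + length ws) + 1 = k" "set us \<subseteq> T" "set ws \<subseteq> T"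
    "\<And>i. i \<in> I \<Longrightarrow> b i \<in> T"
  shows "\<alpha> (us @ (\<Sum>i\<in>I. c i *\<^sub>R b i) # ws) = (\<Sum>i\<in>I. c i *\<^sub>R \<alpha> (us @ b i # ws))"
  using assms(6)
proof (induction I rule: infinite_finite_induct)
  case (insert j J)
  then have "(\<Sum>i\<in>J. c i *\<^sub>R b i) \<in> T"
    by (intro subspace_sum subspace_scale assms(2)) auto
  then show ?case
    using insert alternating_on_linear[OF assms(1-5), of "b j" "\<Sum>i\<in>J. c i *\<^sub>R b i" "c j" 1] by simp
qed (use alternating_on_scale[OF assms(1-5), of 0 0] subspace_0[OF assms(2)] in auto)

lemma alternating_on_swap:
  assumes "alternating_on T k \<alpha>" "subspace T" "int (length us + length ws) + 2 = k" "set us \<subseteq> T" "set ws \<subseteq> T"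
    "u \<in> T" "w \<in> T"
  shows "\<alpha> (us @ u # w # ws) = - \<alpha> (us @ w # u # ws)"
proof -
  have 0: "\<alpha> (us @ v # v # ws) = 0" if "v \<in> T" for v
    using alternating_on_repeat[OF assms(1), of us ws "[]" v] that assms by simp
  have uw: "u + w \<in> T" using assms by (intro subspace_add)
  have 1: "\<alpha> (us @ (u + w) # v # ws) = \<alpha> (us @ u # v # ws) + \<alpha> (us @ w # v # ws)" if "v \<in> T" for v
    using alternating_on_add[OF assms(1,2), of us "v # ws" u w] that assms by simp
  have 2: "\<alpha> (us @ v # (u + w) # ws) = \<alpha> (us @ v # u # ws) + \<alpha> (us @ v # w # ws)" if "v \<in> T" for v
    using alternating_on_add[OF assms(1,2), of "us @ [v]" ws u w] that assms by simp
  have "0 = \<alpha> (us @ (u + w) # (u + w) # ws)" using 0[OF uw] by simp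
  also have "\<dots> = \<alpha> (us @ u # w # ws) + \<alpha> (us @ w # u # ws)"
    using 1[OF uw] 2[OF assms(6)] 2[OF assms(7)] 0 assms(6,7) by simp
  finally show ?thesis by (simp add: add_eq_0_iff)
qed

lemma alternating_on_move:
  assumes "alternating_on T k \<alpha>" "subspace T" "int (length us + length bs + length cs) + 1 = k"
    "set us \<subseteq> T" "set bs \<subseteq> T" "set cs \<subseteq> T" "s \<in> T"
  shows "\<alpha> (us @ s # bs @ cs) = (-1) ^ length bs * \<alpha> (us @ bs @ s # cs)"
  using assms(3-6)
proof (induction bs arbitrary: us)
  case (Cons b bs)
  have "\<alpha> (us @ s # b # bs @ cs) = - \<alpha> (us @ b # s # bs @ cs)"
    by (rule alternating_on_swap[OF assms(1,2)]) (use Cons.prems assms(7) in auto)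
  also have "\<alpha> (us @ b # s # bs @ cs) = (-1) ^ length bs * \<alpha> (us @ b # bs @ s # cs)"
    using Cons.IH[of "us @ [b]"] Cons.prems by simp
  finally show ?case by simp
qed simp

section \<open>Deleting list entries and cancellation of symmetric terms\<close>

definition del_nth :: "nat \<Rightarrow> 'a list \<Rightarrow> 'a list"
  where "del_nth i vs = take i vs @ drop (Suc i) vs"

lemma length_del_nth: "i < length vs \<Longrightarrow> length (del_nth i vs) = length vs - 1"
  by (simp add: del_nth_def)

lemma set_del_nth: "set (del_nth i vs) \<subseteq> set vs"
  using set_take_subset set_drop_subset by (fastforce simp: del_nth_def)

lemma map_del_nth: "map f (del_nth i vs) = del_nth i (map f vs)"
  by (simp add: del_nth_def take_map drop_map)

lemma nth_del_nth: "i < length vs \<Longrightarrow> j < length vs - 1 \<Longrightarrow> del_nth i vs ! j = vs ! (if j < i then j else Suc j)"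
  by (auto simp: del_nth_def nth_append)

lemma list_split2:
  assumes "a < b" "b < length ws"
  obtains A B C where "ws = A @ ws ! a # B @ ws ! b # C" "length A = a" "length B = b - a - 1"
proof
  have "take (b - a - 1) (drop (Suc a) ws) @ ws ! b # drop (Suc b) ws = drop (Suc a) ws"
    using id_take_nth_drop[of "b - a - 1" "drop (Suc a) ws"] assms by simp
  then show "ws = take a ws @ ws ! a # take (b - a - 1) (drop (Suc a) ws) @ ws ! b # drop (Suc b) ws"
    using assms by (simp add: id_take_nth_drop)
qed (use assms in auto)

text \<open>\<open>s i j\<close> plays the second derivative of a map in directions \<open>i\<close>
  and \<open>j\<close>, which arises when direction \<open>i\<close> differentiates the transported
  vector number \<open>j\<close>. The terms for \<open>(i, j)\<close> and \<open>(j, i)\<close>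
  contain the same vector at two different places and cancel.\<close>

lemma alternating_on_symmetric_cancel:
  assumes "alternating_on T (int k) \<alpha>" "subspace T" "length ws = Suc k" "set ws \<subseteq> T"
    and s: "\<And>i j. i \<le> k \<Longrightarrow> j \<le> k \<Longrightarrow> s i j \<in> T" "\<And>i j. i \<le> k \<Longrightarrow> j \<le> k \<Longrightarrow> s i j = s j i"
  shows "(\<Sum>i\<le>k. \<Sum>j<k. (-1) ^ i * \<alpha> ((del_nth i ws)[j := s i (if j < i then j else Suc j)])) = 0"
proof (rule sum_skip_cancel)
  fix a b assume ab: "a < b" "b \<le> k"
  then have "b < length ws" using assms by simp
  obtain A B C where ws: "ws = A @ ws ! a # B @ ws ! b # C" "length A = a" "length B = b - a - 1"
    by (rule list_split2[OF ab(1) \<open>b < length ws\<close>])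
  let ?u = "ws ! a" and ?w = "ws ! b"
  have b: "b = Suc (length A + length B)" using ws ab by simp
  have w': "ws = (A @ ?u # B) @ ?w # C" using ws(1) by simp
  have 1: "del_nth a ws = A @ B @ ?w # C"
    by (subst ws(1)) (use ws(2) in \<open>simp add: del_nth_def\<close>)
  have 2: "del_nth b ws = A @ ?u # B @ C"
    by (subst w') (use b in \<open>simp add: del_nth_def\<close>)
  have 3: "(A @ B @ ?w # C)[b - 1 := s a b] = A @ B @ s a b # C"
    using list_update_length[of "A @ B" ?w C "s a b"] b by simp
  have 4: "(A @ ?u # B @ C)[a := s b a] = A @ s a b # B @ C"
    using list_update_length[of A ?u "B @ C" "s b a"] ws(2) s(2) ab by simp
  have len: "int (length A + length B + length C) + 1 = int k"
    using assms(3) by (subst (asm) ws(1)) simp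
  have sub: "set A \<subseteq> T" "set B \<subseteq> T" "set C \<subseteq> T"
    using assms(4) by (subst (asm) ws(1), auto)+
  have mv: "\<alpha> (A @ s a b # B @ C) = (-1) ^ length B * \<alpha> (A @ B @ s a b # C)"
    by (rule alternating_on_move[OF assms(1,2) len sub]) (use s ab in auto)
  \<comment> \<open>Since \<open>b\<close> equals \<open>a + length B + 1\<close>, the sign of
    moving past \<open>B\<close> makes the two terms exactly opposite.\<close>
  have "(-1) ^ a + (-1) ^ b * (-1) ^ length B = (0::complex)"
    by (simp add: b ws(2) power_add[symmetric] mult_2[symmetric])
       (simp add: ws(2)[symmetric] power_add flip: power_mult_distrib)
  then have "((-1) ^ a + (-1) ^ b * (-1) ^ length B) * \<alpha> (A @ B @ s a b # C) = 0" by simp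
  then show "(- 1) ^ a * \<alpha> ((del_nth a ws)[b - 1 := s a (if b - 1 < a then b - 1 else Suc (b - 1))]) +
           (- 1) ^ b * \<alpha> ((del_nth b ws)[a := s b (if a < b then a else Suc a)]) = 0"
    using ab 1 2 3 4 mv by (simp add: algebra_simps)
qed

section \<open>Differentiating forms along maps\<close>

lemma smooth_on_frechet_linear:
  assumes "smooth_on S f" "x \<in> S"
  shows "bounded_linear (frechet_derivative f (at x within S))"
  using smooth_on_has_derivative[OF assms] by (rule has_derivative_bounded_linear)

lemma has_derivative_compose_smooth:
  assumes "smooth_on S f" "smooth_on S' g" "f ` S \<subseteq> S'" "x \<in> S"
  shows "((\<lambda>x. g (f x)) has_derivative
    (\<lambda>v. frechet_derivative g (at (f x) within S') (frechet_derivative f (at x within S) v))) (at x within S)"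
proof -
  have "(g has_derivative frechet_derivative g (at (f x) within S')) (at (f x) within f ` S)"
    using has_derivative_subset[OF smooth_on_has_derivative[OF assms(2)] assms(3)] assms(3,4) by blast
  from has_derivative_in_compose[OF smooth_on_has_derivative[OF assms(1,4)] this] show ?thesis .
qed

text \<open>Smoothness of a form is known for constant vectors only. One field after another is
  expanded in a finite spanning family of \<open>T'\<close>, which moves it from \<open>gs\<close>
  to the constant vectors \<open>us\<close> at the price of smooth coefficients.\<close>

lemma smooth_on_form_along:
  fixes \<omega> :: "'f::real_normed_vector \<Rightarrow> 'f list \<Rightarrow> complex"
  assumes "tangential S' T'" "smooth_on S f" "f ` S \<subseteq> S'"
    and alt: "\<And>y. y \<in> S' \<Longrightarrow> alternating_on T' (int k) (\<omega> y)"
    and sm: "\<And>vs. set vs \<subseteq> T' \<Longrightarrow> smooth_on S' (\<lambda>y. \<omega> y vs)"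
    and "set us \<subseteq> T'" "length us + length gs = k"
    and gs: "\<And>g. g \<in> set gs \<Longrightarrow> smooth_on S g \<and> g ` S \<subseteq> T'"
  shows "smooth_on S (\<lambda>x. \<omega> (f x) (us @ map (\<lambda>g. g x) gs))"
  using assms(6-)
proof (induction gs arbitrary: us)
  case Nil
  then show ?case using smooth_on_compose[OF assms(2) sm[of us] assms(3,1)] by simp
next
  case (Cons g gs)
  obtain I :: "nat set" and b \<phi> where I: "finite I" "\<And>i. i \<in> I \<Longrightarrow> b i \<in> T'"
    "\<And>i. i \<in> I \<Longrightarrow> bounded_linear (\<phi> i)" "\<And>v. v \<in> T' \<Longrightarrow> v = (\<Sum>i\<in>I. \<phi> i v *\<^sub>R b i)"
    by (rule tangentialE[OF assms(1)], rule that)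
  have eq: "\<omega> (f x) (us @ map (\<lambda>g. g x) (g # gs)) =
      (\<Sum>i\<in>I. \<phi> i (g x) *\<^sub>R \<omega> (f x) ((us @ [b i]) @ map (\<lambda>g. g x) gs))" if "x \<in> S" for x
  proof -
    have g: "g x \<in> T'" using Cons.prems that by auto
    have "\<omega> (f x) (us @ (\<Sum>i\<in>I. \<phi> i (g x) *\<^sub>R b i) # map (\<lambda>g. g x) gs) =
      (\<Sum>i\<in>I. \<phi> i (g x) *\<^sub>R \<omega> (f x) (us @ b i # map (\<lambda>g. g x) gs))"
    proof (rule alternating_on_sum[OF alt tangential_subspace[OF assms(1)]])
      show "set (map (\<lambda>g. g x) gs) \<subseteq> T'" using Cons.prems that by auto
      show "int (length us + length (map (\<lambda>g. g x) gs)) + 1 = int k" using Cons.prems by simp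
      show "f x \<in> S'" using that assms(3) by auto
      show "set us \<subseteq> T'" using Cons.prems by simp
    qed (rule I(2))
    then show ?thesis using I(4)[OF g] by simp
  qed
  have "smooth_on S (\<lambda>x. \<Sum>i\<in>I. \<phi> i (g x) *\<^sub>R \<omega> (f x) ((us @ [b i]) @ map (\<lambda>g. g x) gs))"
    by (intro smooth_on_sum smooth_on_bounded_bilinear[OF bounded_bilinear_scaleR] Cons.IH smooth_on_compose_linear[OF I(3)])
       (use Cons.prems I(2) in auto)
  then show ?case by (subst smooth_on_cong[OF eq])
qed

text \<open>The product rule for a form evaluated on vector fields along \<open>f\<close>: one term
  moves the base point, and one term for each field differentiates that field. The induction again
  trades fields for constant vectors.\<close>

lemma derivative_form_along:
  fixes \<omega> :: "'f::real_normed_vector \<Rightarrow> 'f list \<Rightarrow> complex"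
  assumes "tangential S' T'" "smooth_on S f" "f ` S \<subseteq> S'"
    and alt: "\<And>y. y \<in> S' \<Longrightarrow> alternating_on T' (int k) (\<omega> y)"
    and sm: "\<And>vs. set vs \<subseteq> T' \<Longrightarrow> smooth_on S' (\<lambda>y. \<omega> y vs)"
    and S: "tangential S T" "x \<in> S" "v \<in> T"
    and "set us \<subseteq> T'" "length us + length gs = k"
    and gs: "\<And>g. g \<in> set gs \<Longrightarrow> smooth_on S g \<and> g ` S \<subseteq> T'"
  shows "frechet_derivative (\<lambda>x. \<omega> (f x) (us @ map (\<lambda>g. g x) gs)) (at x within S) v =
    frechet_derivative (\<lambda>y. \<omega> y (us @ map (\<lambda>g. g x) gs)) (at (f x) within S') (frechet_derivative f (at x within S) v) +
    (\<Sum>j<length gs. \<omega> (f x) (us @ (map (\<lambda>g. g x) gs)[j := frechet_derivative (gs ! j) (at x within S) v]))"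
  using assms(9-)
proof (induction gs arbitrary: us)
  case Nil
  then show ?case
    using frechet_derivative_tangential[OF S has_derivative_compose_smooth[OF assms(2) sm[of us] assms(3) S(2)]]
    by simp
next
  case (Cons g gs)
  obtain I :: "nat set" and b \<phi> where I: "finite I" "\<And>i. i \<in> I \<Longrightarrow> b i \<in> T'"
    "\<And>i. i \<in> I \<Longrightarrow> bounded_linear (\<phi> i)" "\<And>v. v \<in> T' \<Longrightarrow> v = (\<Sum>i\<in>I. \<phi> i v *\<^sub>R b i)"
    by (rule tangentialE[OF assms(1)], rule that)
  let ?D = "\<lambda>h. frechet_derivative h (at x within S) v"
  let ?w = "?D f"
  let ?E = "\<lambda>vs. frechet_derivative (\<lambda>y. \<omega> y vs) (at (f x) within S') ?w"
  let ?r = "\<lambda>x. map (\<lambda>g. g x) gs"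
  have sT': "subspace T'" using tangential_subspace[OF assms(1)] .
  have expand: "\<omega> y (us @ u # ws) = (\<Sum>i\<in>I. \<phi> i u *\<^sub>R \<omega> y ((us @ [b i]) @ ws))"
    if "y \<in> S'" "u \<in> T'" "set ws \<subseteq> T'" "length ws = length gs" for y u ws
  proof -
    have "\<omega> y (us @ (\<Sum>i\<in>I. \<phi> i u *\<^sub>R b i) # ws) = (\<Sum>i\<in>I. \<phi> i u *\<^sub>R \<omega> y (us @ b i # ws))"
      by (rule alternating_on_sum[OF alt sT']) (use Cons.prems that I(2) in auto)
    then show ?thesis using I(4)[OF that(2)] by simp
  qed
  have r: "set (?r x) \<subseteq> T'" if "x \<in> S" for x using Cons.prems that by auto
  have g: "g x \<in> T'" if "x \<in> S" for x using Cons.prems that by auto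
  have gsm: "smooth_on S g" using Cons.prems by auto
  have fx: "f x \<in> S'" using S(2) assms(3) by auto
  have w: "?w \<in> T'" by (rule frechet_derivative_within_in_tangent_space[OF S(1) assms(1,2,3) S(2,3)])
  have Dg: "?D g \<in> T'"
    by (rule frechet_derivative_within_in_tangent_space[OF S(1) tangential_self[OF assms(1)] gsm _ S(2,3)])
       (use g in auto)
  let ?h = "\<lambda>i x. \<omega> (f x) ((us @ [b i]) @ ?r x)"
  have h: "smooth_on S (?h i)" if "i \<in> I" for i
    by (rule smooth_on_form_along[OF assms(1-5)]) (use Cons.prems I(2)[OF that] in auto)
  \<comment> \<open>The derivative in the base point is linear in the constant vector
    \<open>u\<close> too; this is what reassembles the expansion of \<open>g x\<close>
    below.\<close>
  have E: "?E (us @ u # ws) = (\<Sum>i\<in>I. \<phi> i u *\<^sub>R ?E ((us @ [b i]) @ ws))"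
    if "u \<in> T'" "set ws \<subseteq> T'" "length ws = length gs" for u ws
  proof -
    have "((\<lambda>y. \<Sum>i\<in>I. \<phi> i u *\<^sub>R \<omega> y ((us @ [b i]) @ ws)) has_derivative
       (\<lambda>w. \<Sum>i\<in>I. \<phi> i u *\<^sub>R frechet_derivative (\<lambda>y. \<omega> y ((us @ [b i]) @ ws)) (at (f x) within S') w)) (at (f x) within S')"
      by (intro has_derivative_sum has_derivative_scaleR_right smooth_on_has_derivative sm fx)
         (use I(2) that Cons.prems in auto)
    then have "((\<lambda>y. \<omega> y (us @ u # ws)) has_derivative
       (\<lambda>w. \<Sum>i\<in>I. \<phi> i u *\<^sub>R frechet_derivative (\<lambda>y. \<omega> y ((us @ [b i]) @ ws)) (at (f x) within S') w)) (at (f x) within S')"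
      by (rule has_derivative_transform[OF fx, rotated]) (rule expand[OF _ that])
    then show ?thesis by (rule frechet_derivative_tangential[OF assms(1) fx w])
  qed
  have "?D (\<lambda>x. \<omega> (f x) (us @ map (\<lambda>g. g x) (g # gs))) = ?D (\<lambda>x. \<Sum>i\<in>I. \<phi> i (g x) *\<^sub>R ?h i x)"
    by (rule fun_cong[OF frechet_derivative_within_cong[OF _ S(2)]])
       (use expand[OF _ g r] assms(3) in auto)
  also have "\<dots> = (\<Sum>i\<in>I. \<phi> i (g x) *\<^sub>R ?D (?h i) + \<phi> i (?D g) *\<^sub>R ?h i x)"
  proof (rule frechet_derivative_tangential[OF S])
    show "((\<lambda>x. \<Sum>i\<in>I. \<phi> i (g x) *\<^sub>R ?h i x) has_derivative
      (\<lambda>v. \<Sum>i\<in>I. \<phi> i (g x) *\<^sub>R frechet_derivative (?h i) (at x within S) v +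
         \<phi> i (frechet_derivative g (at x within S) v) *\<^sub>R ?h i x)) (at x within S)"
      by (intro has_derivative_sum has_derivative_scaleR smooth_on_has_derivative h S(2)
          bounded_linear.has_derivative[OF I(3)] gsm)
  qed
  also have "\<dots> = (\<Sum>i\<in>I. \<phi> i (g x) *\<^sub>R ?E ((us @ [b i]) @ ?r x)) +
      (\<Sum>i\<in>I. \<phi> i (g x) *\<^sub>R (\<Sum>j<length gs. \<omega> (f x) ((us @ [b i]) @ (?r x)[j := ?D (gs ! j)]))) +
      (\<Sum>i\<in>I. \<phi> i (?D g) *\<^sub>R ?h i x)"
  proof -
    have "?D (?h i) = ?E ((us @ [b i]) @ ?r x) +
       (\<Sum>j<length gs. \<omega> (f x) ((us @ [b i]) @ (?r x)[j := ?D (gs ! j)]))" if "i \<in> I" for i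
      by (rule Cons.IH) (use Cons.prems I(2)[OF that] in auto)
    then show ?thesis by (simp add: sum.distrib scaleR_add_right)
  qed
  also have "(\<Sum>i\<in>I. \<phi> i (g x) *\<^sub>R ?E ((us @ [b i]) @ ?r x)) = ?E (us @ g x # ?r x)"
    using E[OF g[OF S(2)] r[OF S(2)]] by simp
  also have "(\<Sum>i\<in>I. \<phi> i (?D g) *\<^sub>R ?h i x) = \<omega> (f x) (us @ ?D g # ?r x)"
    using expand[OF fx Dg r[OF S(2)]] by simp
  also have "(\<Sum>i\<in>I. \<phi> i (g x) *\<^sub>R (\<Sum>j<length gs. \<omega> (f x) ((us @ [b i]) @ (?r x)[j := ?D (gs ! j)]))) =
     (\<Sum>j<length gs. \<omega> (f x) (us @ g x # (?r x)[j := ?D (gs ! j)]))"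
  proof -
    have "\<omega> (f x) (us @ g x # (?r x)[j := ?D (gs ! j)]) =
      (\<Sum>i\<in>I. \<phi> i (g x) *\<^sub>R \<omega> (f x) ((us @ [b i]) @ (?r x)[j := ?D (gs ! j)]))" if "j < length gs" for j
    proof (rule expand[OF fx g[OF S(2)]])
      have "gs ! j \<in> set gs" using that by simp
      then have "?D (gs ! j) \<in> T'"
        by (intro frechet_derivative_within_in_tangent_space[OF S(1) tangential_self[OF assms(1)] _ _ S(2,3)])
           (use Cons.prems in auto)
      then show "set ((?r x)[j := ?D (gs ! j)]) \<subseteq> T'"
        using r[OF S(2)] set_update_subset_insert[of "?r x" j] by fastforce
    qed simp
    then show ?thesis
      by (simp add: scaleR_sum_right sum.swap[of _ I])
  qed
  finally show ?case
    by (simp add: lessThan_Suc_eq_insert_0 sum.reindex image_comp comp_def algebra_simps del: lessThan_Suc)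
qed

text \<open>In the product rule the derivatives of the transported vectors are second derivatives of
  \<open>f\<close>; being symmetric, they cancel in the alternating sum. What remains is the
  exterior derivative at \<open>f x\<close>, so \<open>d\<close> commutes with pullback in
  coordinates.\<close>

lemma derivative_form_along_map:
  fixes \<omega> :: "'f::real_normed_vector \<Rightarrow> 'f list \<Rightarrow> complex"
  assumes "tangential S' T'" "smooth_on S f" "f ` S \<subseteq> S'"
    and alt: "\<And>y. y \<in> S' \<Longrightarrow> alternating_on T' (int k) (\<omega> y)"
    and sm: "\<And>vs. set vs \<subseteq> T' \<Longrightarrow> smooth_on S' (\<lambda>y. \<omega> y vs)"
    and S: "tangential S T" "x \<in> S" and vs: "length vs = Suc k" "set vs \<subseteq> T"
  defines "Df \<equiv> \<lambda>x. frechet_derivative f (at x within S)"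
  shows "(\<Sum>i\<le>k. (-1) ^ i * frechet_derivative (\<lambda>x. \<omega> (f x) (map (Df x) (del_nth i vs))) (at x within S) (vs ! i)) =
    (\<Sum>i\<le>k. (-1) ^ i * frechet_derivative (\<lambda>y. \<omega> y (del_nth i (map (Df x) vs))) (at (f x) within S') (Df x (vs ! i)))"
proof -
  define s where "s i j = frechet_derivative (\<lambda>x. Df x (vs ! j)) (at x within S) (vs ! i)" for i j
  have vT: "vs ! i \<in> T" if "i \<le> k" for i using vs that nth_mem[of i vs] by auto
  have sT: "s i j \<in> T'" if "i \<le> k" "j \<le> k" for i j
    unfolding s_def Df_def
    by (rule second_derivative_in_tangent_space[OF S(1) assms(1-3) S(2)]) (use vT that in auto)
  have sym: "s i j = s j i" if "i \<le> k" "j \<le> k" for i j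
    unfolding s_def Df_def
    by (rule frechet_derivative_within_symmetric_tangent[OF S(1) assms(1-3) S(2)]) (use vT that in auto)
  have DT: "Df y v \<in> T'" if "y \<in> S" "v \<in> T" for y v
    unfolding Df_def by (rule frechet_derivative_within_in_tangent_space[OF S(1) assms(1,2,3) that])
  have main: "frechet_derivative (\<lambda>x. \<omega> (f x) (map (Df x) (del_nth i vs))) (at x within S) (vs ! i) =
      frechet_derivative (\<lambda>y. \<omega> y (del_nth i (map (Df x) vs))) (at (f x) within S') (Df x (vs ! i)) +
      (\<Sum>j<k. \<omega> (f x) ((del_nth i (map (Df x) vs))[j := s i (if j < i then j else Suc j)]))"
    if i: "i \<le> k" for i
  proof -
    let ?gs = "map (\<lambda>v x. Df x v) (del_nth i vs)"
    have len: "length (del_nth i vs) = k" using vs i by (simp add: length_del_nth)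
    have eq: "map (\<lambda>g. g x) ?gs = map (Df x) (del_nth i vs)" for x by simp
    \<comment> \<open>Entry \<open>j\<close> of the shortened list is entry \<open>j\<close> or
      \<open>Suc j\<close> of \<open>vs\<close>, which explains the shifted second index of
      \<open>s\<close>.\<close>
    have nth: "frechet_derivative (?gs ! j) (at x within S) (vs ! i) = s i (if j < i then j else Suc j)" if "j < k" for j
      using that len vs i by (simp add: nth_del_nth s_def)
    have gs: "smooth_on S g \<and> g ` S \<subseteq> T'" if g: "g \<in> set ?gs" for g
    proof -
      obtain v where v: "v \<in> set (del_nth i vs)" "g = (\<lambda>x. Df x v)"
        using g by auto
      then have "v \<in> T" using set_del_nth vs by fastforce
      then show ?thesis
        using DT smooth_on_frechet_derivative[OF S(1) assms(2)] by (auto simp: v Df_def)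
    qed
    have lg: "length ?gs = k" using len by simp
    have "frechet_derivative (\<lambda>x. \<omega> (f x) ([] @ map (\<lambda>g. g x) ?gs)) (at x within S) (vs ! i) =
      frechet_derivative (\<lambda>y. \<omega> y ([] @ map (\<lambda>g. g x) ?gs)) (at (f x) within S') (frechet_derivative f (at x within S) (vs ! i)) +
      (\<Sum>j<length ?gs. \<omega> (f x) ([] @ (map (\<lambda>g. g x) ?gs)[j := frechet_derivative (?gs ! j) (at x within S) (vs ! i)]))"
      by (rule derivative_form_along[OF assms(1-5) S vT[OF i]]) (use len gs in auto)
    also have "(\<Sum>j<length ?gs. \<omega> (f x) ([] @ (map (\<lambda>g. g x) ?gs)[j := frechet_derivative (?gs ! j) (at x within S) (vs ! i)])) =
      (\<Sum>j<k. \<omega> (f x) ((map (\<lambda>g. g x) ?gs)[j := s i (if j < i then j else Suc j)]))"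
      unfolding lg append_Nil by (intro sum.cong refl) (simp only: nth lessThan_iff)
    finally show ?thesis
      unfolding eq append_Nil unfolding map_del_nth Df_def .
  qed
  have "(\<Sum>i\<le>k. \<Sum>j<k. (-1) ^ i * \<omega> (f x) ((del_nth i (map (Df x) vs))[j := s i (if j < i then j else Suc j)])) = 0"
  proof (rule alternating_on_symmetric_cancel[OF alt tangential_subspace[OF assms(1)]])
    show "f x \<in> S'" using S assms by auto
    show "set (map (Df x) vs) \<subseteq> T'" using DT[OF S(2)] vs by auto
  qed (use vs sT sym in auto)
  then show ?thesis
    by (simp add: main distrib_left sum.distrib sum_distrib_left)
qed

text \<open>Deleting entries \<open>a\<close> and \<open>b\<close> in either order leaves the same
  list with opposite signs, while the two mixed derivatives agree.\<close>

lemma second_exterior_derivative_zero: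
  fixes \<omega> :: "'e::real_normed_vector \<Rightarrow> 'e list \<Rightarrow> complex"
  assumes S: "tangential S T" "x \<in> S" and vs: "length vs = Suc (Suc k)" "set vs \<subseteq> T"
    and sm: "\<And>vs. set vs \<subseteq> T \<Longrightarrow> smooth_on S (\<lambda>y. \<omega> y vs)"
  shows "(\<Sum>i\<le>Suc k. (-1) ^ i * frechet_derivative (\<lambda>x. \<Sum>j\<le>k. (-1) ^ j *
      frechet_derivative (\<lambda>x. \<omega> x (del_nth j (del_nth i vs))) (at x within S) (del_nth i vs ! j)) (at x within S) (vs ! i)) = 0"
proof -
  have vT: "vs ! i \<in> T" if "i \<le> Suc k" for i using vs that nth_mem[of i vs] by auto
  let ?sk = "\<lambda>i j. if j < i then j else Suc j"
  let ?H = "\<lambda>L u v. frechet_derivative (\<lambda>x. frechet_derivative (\<lambda>x. \<omega> x L) (at x within S) u) (at x within S) v"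
  have dT: "set (del_nth j (del_nth i vs)) \<subseteq> T" for i j
    using set_del_nth vs(2) by (metis dual_order.trans)
  have skT: "vs ! ?sk i j \<in> T" if "i \<le> Suc k" "j \<le> k" for i j
    using vT that by simp
  have "(\<Sum>i\<le>Suc k. (-1) ^ i * frechet_derivative (\<lambda>x. \<Sum>j\<le>k. (-1) ^ j *
      frechet_derivative (\<lambda>x. \<omega> x (del_nth j (del_nth i vs))) (at x within S) (del_nth i vs ! j)) (at x within S) (vs ! i)) =
    (\<Sum>i\<le>Suc k. \<Sum>j<Suc k. (-1) ^ i * ((-1) ^ j * ?H (del_nth j (del_nth i vs)) (vs ! ?sk i j) (vs ! i)))"
  proof (rule sum.cong[OF refl])
    fix i assume "i \<in> {..Suc k}"
    then have i: "i \<le> Suc k" by simp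
    have nth: "del_nth i vs ! j = vs ! ?sk i j" if "j \<le> k" for j
      using nth_del_nth[of i vs j] vs i that by simp
    have "((\<lambda>x. \<Sum>j\<le>k. (-1) ^ j * frechet_derivative (\<lambda>x. \<omega> x (del_nth j (del_nth i vs))) (at x within S) (vs ! ?sk i j))
      has_derivative (\<lambda>v. \<Sum>j\<le>k. (-1) ^ j * ?H (del_nth j (del_nth i vs)) (vs ! ?sk i j) v)) (at x within S)"
      by (intro has_derivative_sum has_derivative_mult_right smooth_on_has_derivative S(2)
          smooth_on_frechet_derivative[OF S(1) sm[OF dT]] skT[OF i]) simp
    from frechet_derivative_tangential[OF S vT[OF i] this]
    show "(-1) ^ i * frechet_derivative (\<lambda>x. \<Sum>j\<le>k. (-1) ^ j *
      frechet_derivative (\<lambda>x. \<omega> x (del_nth j (del_nth i vs))) (at x within S) (del_nth i vs ! j)) (at x within S) (vs ! i) =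
      (\<Sum>j<Suc k. (-1) ^ i * ((-1) ^ j * ?H (del_nth j (del_nth i vs)) (vs ! ?sk i j) (vs ! i)))"
      by (simp add: nth sum_distrib_left lessThan_Suc_atMost)
  qed
  also have "\<dots> = 0"
  proof (rule sum_skip_cancel)
    fix a b assume ab: "a < b" "b \<le> Suc k"
    then have "b < length vs" using vs by simp
    obtain A B C where ws: "vs = A @ vs ! a # B @ vs ! b # C" "length A = a" "length B = b - a - 1"
      by (rule list_split2[OF ab(1) \<open>b < length vs\<close>])
    have b: "b = Suc (length A + length B)" using ws ab by simp
    have w': "vs = (A @ vs ! a # B) @ vs ! b # C" using ws(1) by simp
    have 1: "del_nth a vs = A @ B @ vs ! b # C"
      by (subst ws(1)) (use ws(2) in \<open>simp add: del_nth_def\<close>)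
    have 2: "del_nth b vs = A @ vs ! a # B @ C"
      by (subst w') (use b in \<open>simp add: del_nth_def\<close>)
    have 3: "del_nth (b - 1) (A @ B @ vs ! b # C) = A @ B @ C"
      using b by (simp add: del_nth_def)
    have 4: "del_nth a (A @ vs ! a # B @ C) = A @ B @ C"
      using ws(2) by (simp add: del_nth_def)
    have "set (A @ B @ C) \<subseteq> T" using vs(2) by (subst (asm) ws(1)) auto
    then have H: "?H (A @ B @ C) (vs ! b) (vs ! a) = ?H (A @ B @ C) (vs ! a) (vs ! b)"
      using frechet_derivative_within_symmetric[OF S(1) sm S(2)] vT ab by simp
    obtain b' where b': "b = Suc b'" using ab by (cases b) auto
    show "(- 1) ^ a * ((- 1) ^ (b - 1) * ?H (del_nth (b - 1) (del_nth a vs)) (vs ! ?sk a (b - 1)) (vs ! a)) +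
      (- 1) ^ b * ((- 1) ^ a * ?H (del_nth a (del_nth b vs)) (vs ! ?sk b a) (vs ! b)) = 0"
      using ab 1 2 3 4 H b' by simp
  qed
  finally show ?thesis .
qed

section \<open>Charted spaces and pullback of forms\<close>

text \<open>The axioms shared by manifolds, simplices and their products, so that forms on all three are treated at once.\<close>

definition regular_charted :: "('p, 'e::real_normed_vector) charted \<Rightarrow> bool" where
  "regular_charted M \<longleftrightarrow>
     (\<Union>c\<in>atlas M. cdom c) = topspace (ctop M) \<and>
     (\<forall>c\<in>atlas M. openin (ctop M) (cdom c) \<and> tangential (cimg c) (ctan c) \<and>
        homeomorphic_map (subtopology (ctop M) (cdom c)) (top_of_set (cimg c)) (cmap c)) \<and>
     (\<forall>c\<in>atlas M. \<forall>d\<in>atlas M. smooth_on (local_dom id c d) (local_rep id c d))"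

abbreviation cinv :: "('p, 'e) chart \<Rightarrow> 'e \<Rightarrow> 'p" where
  "cinv c \<equiv> inv_into (cdom c) (cmap c)"

lemma regular_charted_chart:
  assumes "regular_charted M" "c \<in> atlas M"
  shows regular_chart_open: "openin (ctop M) (cdom c)"
    and regular_chart_tangential: "tangential (cimg c) (ctan c)"
    and regular_chart_homeo: "homeomorphic_map (subtopology (ctop M) (cdom c)) (top_of_set (cimg c)) (cmap c)"
    and regular_chart_subset: "cdom c \<subseteq> topspace (ctop M)"
    and regular_chart_inj: "inj_on (cmap c) (cdom c)"
proof -
  show 1: "openin (ctop M) (cdom c)" "tangential (cimg c) (ctan c)"
    "homeomorphic_map (subtopology (ctop M) (cdom c)) (top_of_set (cimg c)) (cmap c)"
    using assms unfolding regular_charted_def by blast+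
  show 2: "cdom c \<subseteq> topspace (ctop M)" using openin_subset[OF 1(1)] .
  show "inj_on (cmap c) (cdom c)"
    using homeomorphic_imp_injective_map[OF 1(3)] 2 by (simp add: Int_absorb1)
qed

lemma regular_charted_cover:
  assumes "regular_charted M" "p \<in> topspace (ctop M)"
  obtains c where "c \<in> atlas M" "p \<in> cdom c"
  using assms unfolding regular_charted_def by blast

lemma cinv_in: "x \<in> cimg c \<Longrightarrow> cinv c x \<in> cdom c"
  by (simp add: cimg_def inv_into_into)

lemma cmap_cinv: "x \<in> cimg c \<Longrightarrow> cmap c (cinv c x) = x"
  by (simp add: cimg_def f_inv_into_f)

lemma local_dom_iff:
  assumes "inj_on (cmap c) (cdom c)"
  shows "x \<in> local_dom f c d \<longleftrightarrow> x \<in> cimg c \<and> f (cinv c x) \<in> cdom d"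
proof
  assume "x \<in> local_dom f c d"
  then show "x \<in> cimg c \<and> f (cinv c x) \<in> cdom d"
    using assms by (auto simp: local_dom_def cimg_def)
next
  assume x: "x \<in> cimg c \<and> f (cinv c x) \<in> cdom d"
  then have "x = cmap c (cinv c x)" "cinv c x \<in> cdom c \<inter> f -` cdom d"
    using cmap_cinv cinv_in by (metis, auto)
  then show "x \<in> local_dom f c d" unfolding local_dom_def by (rule image_eqI)
qed

lemma local_dom_subset: "local_dom f c d \<subseteq> cimg c"
  by (auto simp: local_dom_def cimg_def)

lemma local_rep_eq: "local_rep f c d x = cmap d (f (cinv c x))"
  by (simp add: local_rep_def)

lemma local_rep_in: "inj_on (cmap c) (cdom c) \<Longrightarrow> x \<in> local_dom f c d \<Longrightarrow> local_rep f c d x \<in> cimg d"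
  by (auto simp: local_dom_iff local_rep_eq cimg_def)

text \<open>Chart maps are homeomorphisms onto their images, so they carry the open preimage of a
  chart domain to a relatively open set.\<close>

lemma openin_local_dom:
  assumes M: "regular_charted M" and N: "regular_charted N" and f: "continuous_map (ctop M) (ctop N) f"
    and c: "c \<in> atlas M" and d: "d \<in> atlas N"
  shows "openin (top_of_set (cimg c)) (local_dom f c d)"
proof -
  have "openin (ctop M) {p \<in> topspace (ctop M). f p \<in> cdom d}"
    by (rule openin_continuous_map_preimage[OF f regular_chart_open[OF N d]])
  then have "openin (subtopology (ctop M) (cdom c)) ({p \<in> topspace (ctop M). f p \<in> cdom d} \<inter> cdom c)"
    by (auto simp: openin_subtopology)
  moreover have "{p \<in> topspace (ctop M). f p \<in> cdom d} \<inter> cdom c = cdom c \<inter> f -` cdom d"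
    using regular_chart_subset[OF M c] by auto
  ultimately show ?thesis
    using homeomorphic_imp_open_map[OF regular_chart_homeo[OF M c]]
    by (simp add: open_map_def local_dom_def)
qed

lemma openin_top_of_set_Int:
  assumes "openin (top_of_set B) C" "A \<subseteq> B"
  shows "openin (top_of_set A) (A \<inter> C)"
  using assms by (auto simp: openin_open)

lemma tangential_local_dom:
  assumes "regular_charted M" "regular_charted N" "continuous_map (ctop M) (ctop N) f"
    "c \<in> atlas M" "d \<in> atlas N"
  shows "tangential (local_dom f c d) (ctan c)"
  by (rule tangential_openin[OF regular_chart_tangential[OF assms(1,4)] openin_local_dom[OF assms]])

lemma smooth_map_continuous: "smooth_map M N f \<Longrightarrow> continuous_map (ctop M) (ctop N) f"
  by (simp add: smooth_map_def)

lemma smooth_map_local: "smooth_map M N f \<Longrightarrow> c \<in> atlas M \<Longrightarrow> d \<in> atlas N \<Longrightarrow>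
    smooth_on (local_dom f c d) (local_rep f c d)"
  by (simp add: smooth_map_def)

lemma smooth_map_id: "regular_charted M \<Longrightarrow> smooth_map M M id"
  by (simp add: smooth_map_def regular_charted_def)

section \<open>Composition of smooth maps in charts\<close>

lemma local_rep_compose:
  assumes "inj_on (cmap c) (cdom c)" "inj_on (cmap d) (cdom d)" "x \<in> local_dom f c d"
  shows "local_rep f c d x \<in> local_dom g d e \<longleftrightarrow> x \<in> local_dom (g \<circ> f) c e"
    and "local_rep (g \<circ> f) c e x = local_rep g d e (local_rep f c d x)"
proof -
  have x: "f (cinv c x) \<in> cdom d" "x \<in> cimg c" using assms by (auto simp: local_dom_iff)
  then have "cinv d (local_rep f c d x) = f (cinv c x)"
    using assms(2) by (simp add: local_rep_eq)
  then show "local_rep f c d x \<in> local_dom g d e \<longleftrightarrow> x \<in> local_dom (g \<circ> f) c e"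
     "local_rep (g \<circ> f) c e x = local_rep g d e (local_rep f c d x)"
    using assms x local_rep_in[OF assms(1,3)] by (auto simp: local_dom_iff local_rep_eq)
qed

lemma smooth_map_compose:
  assumes M: "regular_charted M" and N: "regular_charted N" and P: "regular_charted P"
    and f: "smooth_map M N f" and g: "smooth_map N P g"
  shows "smooth_map M P (g \<circ> f)"
  unfolding smooth_map_def
proof (intro conjI ballI)
  show gf: "continuous_map (ctop M) (ctop P) (g \<circ> f)"
    by (rule continuous_map_compose[OF smooth_map_continuous[OF f] smooth_map_continuous[OF g]])
  fix c e assume c: "c \<in> atlas M" and e: "e \<in> atlas P"
  show "smooth_on (local_dom (g \<circ> f) c e) (local_rep (g \<circ> f) c e)"
  proof (rule smooth_on_local)
    fix x assume x: "x \<in> local_dom (g \<circ> f) c e"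
    have ci: "inj_on (cmap c) (cdom c)" by (rule regular_chart_inj[OF M c])
    have "cinv c x \<in> topspace (ctop M)"
      using cinv_in[of x c] x regular_chart_subset[OF M c] by (auto simp: local_dom_iff[OF ci])
    then have "f (cinv c x) \<in> topspace (ctop N)"
      using smooth_map_continuous[OF f] by (auto simp: continuous_map_def Pi_iff)
    then obtain d where d: "d \<in> atlas N" "f (cinv c x) \<in> cdom d"
      by (rule regular_charted_cover[OF N])
    have di: "inj_on (cmap d) (cdom d)" by (rule regular_chart_inj[OF N d(1)])
    \<comment> \<open>The domain of a chart of \<open>M\<close> need not be mapped into a single
      chart of \<open>N\<close>; the relatively open piece \<open>?S\<close> around \<open>x\<close>
      is mapped into \<open>d\<close>.\<close>
    let ?S = "local_dom (g \<circ> f) c e \<inter> local_dom f c d"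
    have o: "openin (top_of_set (local_dom (g \<circ> f) c e)) ?S"
      by (rule openin_top_of_set_Int[OF openin_local_dom[OF M N smooth_map_continuous[OF f] c d(1)] local_dom_subset])
    have "smooth_on ?S (\<lambda>y. local_rep g d e (local_rep f c d y))"
    proof (rule smooth_on_compose[where f = "local_rep f c d" and g = "local_rep g d e"])
      show "smooth_on ?S (local_rep f c d)"
        using smooth_map_local[OF f c d(1)] smooth_on_subset by blast
      show "smooth_on (local_dom g d e) (local_rep g d e)"
        by (rule smooth_map_local[OF g d(1) e])
      show "local_rep f c d ` ?S \<subseteq> local_dom g d e"
        using local_rep_compose(1)[OF ci di] by auto
      show "tangential (local_dom g d e) (ctan d)"
        by (rule tangential_local_dom[OF N P smooth_map_continuous[OF g] d(1) e])
    qed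
    then have "smooth_on ?S (local_rep (g \<circ> f) c e)"
      by (rule smooth_on_cong[THEN iffD1, rotated]) (rule local_rep_compose(2)[OF ci di, symmetric], simp)
    moreover have "x \<in> ?S" using x d(2) by (simp add: local_dom_iff[OF ci])
    ultimately show "\<exists>S'. openin (top_of_set (local_dom (g \<circ> f) c e)) S' \<and> x \<in> S' \<and>
        smooth_on S' (local_rep (g \<circ> f) c e)"
      using o by blast
  qed
qed

lemma local_deriv_in:
  assumes M: "regular_charted M" and N: "regular_charted N" and f: "smooth_map M N f"
    and c: "c \<in> atlas M" and d: "d \<in> atlas N" and x: "x \<in> local_dom f c d" "v \<in> ctan c"
  shows "local_deriv f c d x v \<in> ctan d"
  unfolding local_deriv_def
  by (rule frechet_derivative_within_in_tangent_space[OF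
        tangential_local_dom[OF M N smooth_map_continuous[OF f] c d] regular_chart_tangential[OF N d]
        smooth_map_local[OF f c d] _ x])
     (use local_rep_in[OF regular_chart_inj[OF M c]] in blast)

text \<open>The derivatives are taken within different domains. On the intersection of the two
  domains in the chart \<open>c\<close>, both sides are derivatives of the composite, and in tangent
  directions there is only one.\<close>

lemma local_deriv_compose:
  assumes M: "regular_charted M" and N: "regular_charted N" and P: "regular_charted P"
    and f: "smooth_map M N f" and g: "smooth_map N P g"
    and c: "c \<in> atlas M" and d: "d \<in> atlas N" and e: "e \<in> atlas P"
    and x: "x \<in> local_dom f c d" "x \<in> local_dom (g \<circ> f) c e" "v \<in> ctan c"
  shows "local_deriv (g \<circ> f) c e x v = local_deriv g d e (local_rep f c d x) (local_deriv f c d x v)"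
proof -
  have ci: "inj_on (cmap c) (cdom c)" by (rule regular_chart_inj[OF M c])
  have di: "inj_on (cmap d) (cdom d)" by (rule regular_chart_inj[OF N d])
  have gf: "smooth_map M P (g \<circ> f)" by (rule smooth_map_compose[OF M N P f g])
  let ?A = "local_dom f c d" and ?C = "local_dom (g \<circ> f) c e"
  let ?S = "?A \<inter> ?C"
  have "openin (top_of_set ?A) ?S"
    by (rule openin_top_of_set_Int[OF openin_local_dom[OF M P smooth_map_continuous[OF gf] c e] local_dom_subset])
  then have tS: "tangential ?S (ctan c)"
    by (rule tangential_openin[OF tangential_local_dom[OF M N smooth_map_continuous[OF f] c d]])
  have xS: "x \<in> ?S" using x by simp
  have "(local_rep (g \<circ> f) c e has_derivative local_deriv (g \<circ> f) c e x) (at x within ?S)"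
    unfolding local_deriv_def
    by (rule has_derivative_subset[OF smooth_on_has_derivative[OF smooth_map_local[OF gf c e] x(2)]]) simp
  moreover have "(local_rep (g \<circ> f) c e has_derivative
     (\<lambda>v. local_deriv g d e (local_rep f c d x) (local_deriv f c d x v))) (at x within ?S)"
  proof (rule has_derivative_transform[OF xS])
    have "(local_rep f c d has_derivative local_deriv f c d x) (at x within ?S)"
      unfolding local_deriv_def
      by (rule has_derivative_subset[OF smooth_on_has_derivative[OF smooth_map_local[OF f c d] x(1)]]) simp
    moreover have "(local_rep g d e has_derivative local_deriv g d e (local_rep f c d x))
        (at (local_rep f c d x) within local_rep f c d ` ?S)"
      unfolding local_deriv_def
      by (rule has_derivative_subset[OF smooth_on_has_derivative[OF smooth_map_local[OF g d e]]])
         (use local_rep_compose(1)[OF ci di] x in auto)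
    ultimately show "((\<lambda>x. local_rep g d e (local_rep f c d x)) has_derivative
       (\<lambda>v. local_deriv g d e (local_rep f c d x) (local_deriv f c d x v))) (at x within ?S)"
      by (rule has_derivative_in_compose)
  qed (rule local_rep_compose(2)[OF ci di], simp)
  ultimately show ?thesis
    by (rule tangential_derivative_unique[OF tS xS x(3)])
qed

section \<open>Pullback and exterior derivative of forms\<close>

lemma formsD:
  assumes "\<omega> \<in> forms k M"
  shows forms_nonzero: "\<omega> c x vs \<noteq> 0 \<Longrightarrow> c \<in> atlas M \<and> x \<in> cimg c \<and> int (length vs) = k \<and> set vs \<subseteq> ctan c"
    and forms_alternating: "c \<in> atlas M \<Longrightarrow> x \<in> cimg c \<Longrightarrow> alternating_on (ctan c) k (\<omega> c x)"
    and forms_smooth: "c \<in> atlas M \<Longrightarrow> set vs \<subseteq> ctan c \<Longrightarrow> smooth_on (cimg c) (\<lambda>x. \<omega> c x vs)"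
    and forms_transition: "c \<in> atlas M \<Longrightarrow> d \<in> atlas M \<Longrightarrow> x \<in> local_dom id c d \<Longrightarrow> set vs \<subseteq> ctan c \<Longrightarrow>
        \<omega> c x vs = \<omega> d (local_rep id c d x) (map (local_deriv id c d x) vs)"
  using assms unfolding forms_def by blast+

text \<open>Turns the chart picked by \<open>SOME\<close> in \<open>pullback\<close> into a free
  choice: the transition rule of forms and the chain rule carry one chart around the image point to
  any other.\<close>

lemma pullback_eq:
  assumes M: "regular_charted M" and N: "regular_charted N" and f: "smooth_map M N f"
    and \<omega>: "\<omega> \<in> forms k N" and c: "c \<in> atlas M" and d: "d \<in> atlas N"
    and x: "x \<in> local_dom f c d" and vs: "set vs \<subseteq> ctan c"
  shows "pullback M N f \<omega> c x vs = \<omega> d (local_rep f c d x) (map (local_deriv f c d x) vs)"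
proof -
  have ci: "inj_on (cmap c) (cdom c)" by (rule regular_chart_inj[OF M c])
  define d0 where "d0 = (SOME d. d \<in> atlas N \<and> x \<in> local_dom f c d)"
  have "d0 \<in> atlas N \<and> x \<in> local_dom f c d0"
    unfolding d0_def by (rule someI[of _ d]) (use d x in auto)
  then have d0: "d0 \<in> atlas N" "x \<in> local_dom f c d0" by auto
  have d0i: "inj_on (cmap d0) (cdom d0)" by (rule regular_chart_inj[OF N d0(1)])
  have y: "local_rep f c d0 x \<in> local_dom id d0 d"
    using local_rep_compose(1)[OF ci d0i d0(2), of id d] x by simp
  have "pullback M N f \<omega> c x vs = \<omega> d0 (local_rep f c d0 x) (map (local_deriv f c d0 x) vs)"
    using c vs subsetD[OF local_dom_subset x] by (simp add: pullback_def d0_def Let_def)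
  also have "\<dots> = \<omega> d (local_rep id d0 d (local_rep f c d0 x))
      (map (local_deriv id d0 d (local_rep f c d0 x)) (map (local_deriv f c d0 x) vs))"
    by (rule forms_transition[OF \<omega> d0(1) d y])
       (use local_deriv_in[OF M N f c d0] vs in auto)
  also have "local_rep id d0 d (local_rep f c d0 x) = local_rep f c d x"
    using local_rep_compose(2)[OF ci d0i d0(2), of id d] by simp
  also have "map (local_deriv id d0 d (local_rep f c d0 x)) (map (local_deriv f c d0 x) vs) =
      map (local_deriv f c d x) vs"
    using local_deriv_compose[OF M N N f smooth_map_id[OF N] c d0(1) d d0(2)] x vs by auto
  finally show ?thesis .
qed

lemma local_dom_exists:
  assumes "regular_charted M" "regular_charted N" "smooth_map M N f" "c \<in> atlas M" "x \<in> cimg c"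
  obtains d where "d \<in> atlas N" "x \<in> local_dom f c d"
proof -
  have "f (cinv c x) \<in> topspace (ctop N)"
    using smooth_map_continuous[OF assms(3)] regular_chart_subset[OF assms(1,4)] cinv_in[OF assms(5)]
    by (auto simp: continuous_map_def Pi_iff)
  then obtain d where "d \<in> atlas N" "f (cinv c x) \<in> cdom d"
    by (rule regular_charted_cover[OF assms(2)])
  then show thesis
    using that assms(5) local_dom_iff[OF regular_chart_inj[OF assms(1,4)]] by blast
qed

text \<open>Needed for restricting the pullback along a simplex to a face of that simplex, and for
  simplices pushed forward along the structure maps of the prisms.\<close>

lemma pullback_pullback:
  assumes M: "regular_charted M" and N: "regular_charted N" and P: "regular_charted P"
    and f: "smooth_map M N f" and g: "smooth_map N P g" and \<omega>: "\<omega> \<in> forms k P"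
  shows "pullback M N f (pullback N P g \<omega>) = pullback M P (g \<circ> f) \<omega>"
proof (intro ext)
  fix c x vs
  show "pullback M N f (pullback N P g \<omega>) c x vs = pullback M P (g \<circ> f) \<omega> c x vs"
  proof (cases "c \<in> atlas M \<and> x \<in> cimg c \<and> set vs \<subseteq> ctan c")
    case True
    then have c: "c \<in> atlas M" "x \<in> cimg c" "set vs \<subseteq> ctan c" by auto
    define d where "d = (SOME d. d \<in> atlas N \<and> x \<in> local_dom f c d)"
    have "\<exists>d. d \<in> atlas N \<and> x \<in> local_dom f c d"
      using local_dom_exists[OF M N f c(1,2)] by blast
    then have "d \<in> atlas N \<and> x \<in> local_dom f c d"
      unfolding d_def by (rule someI_ex)
    then have d: "d \<in> atlas N" "x \<in> local_dom f c d" by auto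
    have ci: "inj_on (cmap c) (cdom c)" by (rule regular_chart_inj[OF M c(1)])
    have di: "inj_on (cmap d) (cdom d)" by (rule regular_chart_inj[OF N d(1)])
    obtain e where e: "e \<in> atlas P" "local_rep f c d x \<in> local_dom g d e"
      using local_dom_exists[OF N P g d(1) local_rep_in[OF ci d(2)]] by blast
    have xe: "x \<in> local_dom (g \<circ> f) c e"
      using local_rep_compose(1)[OF ci di d(2), of g e] e(2) by simp
    have "pullback M N f (pullback N P g \<omega>) c x vs =
        pullback N P g \<omega> d (local_rep f c d x) (map (local_deriv f c d x) vs)"
      using True by (simp add: pullback_def[of M] d_def Let_def)
    also have "\<dots> = \<omega> e (local_rep g d e (local_rep f c d x))
        (map (local_deriv g d e (local_rep f c d x)) (map (local_deriv f c d x) vs))"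
      by (rule pullback_eq[OF N P g \<omega> d(1) e]) (use local_deriv_in[OF M N f c(1) d] c(3) in auto)
    also have "\<dots> = \<omega> e (local_rep (g \<circ> f) c e x) (map (local_deriv (g \<circ> f) c e x) vs)"
    proof -
      have "map (local_deriv g d e (local_rep f c d x)) (map (local_deriv f c d x) vs) =
          map (local_deriv (g \<circ> f) c e x) vs"
        using local_deriv_compose[OF M N P f g c(1) d(1) e(1) d(2) xe] c(3) by auto
      then show ?thesis by (simp only: local_rep_compose(2)[OF ci di d(2)])
    qed
    also have "\<dots> = pullback M P (g \<circ> f) \<omega> c x vs"
      by (rule pullback_eq[symmetric, OF M P smooth_map_compose[OF M N P f g] \<omega> c(1) e(1) xe c(3)])
    finally show ?thesis .
  qed (auto simp: pullback_def)
qed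

lemma local_dom_cong: "(\<And>p. p \<in> cdom c \<Longrightarrow> f p = g p) \<Longrightarrow> local_dom f c d = local_dom g c d"
  by (auto simp: local_dom_def)

lemma local_rep_cong:
  assumes "\<And>p. p \<in> cdom c \<Longrightarrow> f p = g p"
  shows "x \<in> cimg c \<Longrightarrow> local_rep f c d x = local_rep g c d x"
    and "x \<in> local_dom f c d \<Longrightarrow> local_deriv f c d x = local_deriv g c d x"
proof -
  have l: "local_dom f c d = local_dom g c d" by (rule local_dom_cong) (rule assms)
  show 2: "local_rep f c d x = local_rep g c d x" if "x \<in> cimg c" for x
    using assms cinv_in[OF that] by (simp add: local_rep_eq)
  show "local_deriv f c d x = local_deriv g c d x" if "x \<in> local_dom f c d"
    unfolding local_deriv_def l[symmetric]
    by (rule frechet_derivative_within_cong[OF 2 that]) (rule subsetD[OF local_dom_subset])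
qed

text \<open>Composites of singular simplices are normalised to \<open>undefined\<close> off the
  standard simplex, so they equal ordinary composites on \<open>topspace\<close> only.\<close>

lemma pullback_cong:
  assumes "regular_charted M" "\<And>p. p \<in> topspace (ctop M) \<Longrightarrow> f p = g p"
    and "smooth_map M N f" "regular_charted N"
  shows "pullback M N f \<omega> = pullback M N g \<omega>"
proof (intro ext)
  fix c x vs
  show "pullback M N f \<omega> c x vs = pullback M N g \<omega> c x vs"
  proof (cases "c \<in> atlas M \<and> x \<in> cimg c \<and> set vs \<subseteq> ctan c")
    case True
    have eq: "f p = g p" if "p \<in> cdom c" for p
      using assms(2) that regular_chart_subset[OF assms(1)] True by blast
    define d where "d = (SOME d. d \<in> atlas N \<and> x \<in> local_dom f c d)"
    have "\<exists>d. d \<in> atlas N \<and> x \<in> local_dom f c d"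
      using local_dom_exists[OF assms(1,4,3)] True by blast
    then have "d \<in> atlas N \<and> x \<in> local_dom f c d"
      unfolding d_def by (rule someI_ex)
    then have d: "x \<in> local_dom f c d" by simp
    have l: "local_dom f c e = local_dom g c e" for e
      by (rule local_dom_cong) (rule eq)
    have "pullback M N f \<omega> c x vs = \<omega> d (local_rep f c d x) (map (local_deriv f c d x) vs)"
      using True by (simp add: pullback_def d_def Let_def)
    also have "local_rep f c d x = local_rep g c d x"
      by (rule local_rep_cong(1)) (use eq True in auto)
    also have "local_deriv f c d x = local_deriv g c d x"
      by (rule local_rep_cong(2)) (use eq d in auto)
    also have "\<omega> d (local_rep g c d x) (map (local_deriv g c d x) vs) = pullback M N g \<omega> c x vs"
      using True by (simp add: pullback_def d_def Let_def l)
    finally show ?thesis .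
  qed (auto simp: pullback_def)
qed

lemma smooth_map_cong:
  assumes "regular_charted M" "smooth_map M N f" "\<And>p. p \<in> topspace (ctop M) \<Longrightarrow> f p = g p"
  shows "smooth_map M N g"
  unfolding smooth_map_def
proof (intro conjI ballI)
  show "continuous_map (ctop M) (ctop N) g"
    using continuous_map_eq[OF smooth_map_continuous[OF assms(2)]] assms(3) by blast
  fix c d assume c: "c \<in> atlas M" and d: "d \<in> atlas N"
  have eq: "f p = g p" if "p \<in> cdom c" for p
    using assms(3) that regular_chart_subset[OF assms(1) c] by blast
  have l: "local_dom f c d = local_dom g c d" by (rule local_dom_cong) (rule eq)
  have "smooth_on (local_dom g c d) (local_rep f c d)"
    using smooth_map_local[OF assms(2) c d] by (simp only: l)
  then show "smooth_on (local_dom g c d) (local_rep g c d)"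
    by (rule smooth_on_cong[THEN iffD1, rotated]) (rule local_rep_cong(1)[OF eq subsetD[OF local_dom_subset]])
qed

lemma frechet_derivative_openin:
  assumes "tangential S T" "openin (top_of_set S) S'" "x \<in> S'" "v \<in> T" "smooth_on S f"
  shows "frechet_derivative f (at x within S') v = frechet_derivative f (at x within S) v"
proof -
  have "S' \<subseteq> S" using assms(2) openin_imp_subset by blast
  then show ?thesis
    by (intro frechet_derivative_tangential[OF tangential_openin[OF assms(1,2)] assms(3,4)]
        has_derivative_subset[OF smooth_on_has_derivative[OF assms(5)]]) (use assms(3) in auto)
qed

lemma pullback_smooth:
  assumes M: "regular_charted M" and N: "regular_charted N" and f: "smooth_map M N f"
    and \<omega>: "\<omega> \<in> forms (int k) N" and c: "c \<in> atlas M" and vs: "set vs \<subseteq> ctan c"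
  shows "smooth_on (cimg c) (\<lambda>x. pullback M N f \<omega> c x vs)"
proof (rule smooth_on_local)
  fix x assume x: "x \<in> cimg c"
  obtain d where d: "d \<in> atlas N" "x \<in> local_dom f c d"
    by (rule local_dom_exists[OF M N f c x])
  let ?S = "local_dom f c d"
  have ci: "inj_on (cmap c) (cdom c)" by (rule regular_chart_inj[OF M c])
  have tS: "tangential ?S (ctan c)" by (rule tangential_local_dom[OF M N smooth_map_continuous[OF f] c d(1)])
  have eq: "\<omega> d (local_rep f c d x) (map (local_deriv f c d x) vs) = pullback M N f \<omega> c x vs" if "x \<in> ?S" for x
    using pullback_eq[OF M N f \<omega> c d(1) that vs] by simp
  have "smooth_on ?S (\<lambda>x. pullback M N f \<omega> c x vs)"
  proof (cases "length vs = k")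
    case True
    have "smooth_on ?S (\<lambda>x. \<omega> d (local_rep f c d x) ([] @ map (\<lambda>g. g x) (map (\<lambda>v x. local_deriv f c d x v) vs)))"
    proof (rule smooth_on_form_along[where S' = "cimg d" and T' = "ctan d" and k = k])
      show "tangential (cimg d) (ctan d)" by (rule regular_chart_tangential[OF N d(1)])
      show "smooth_on ?S (local_rep f c d)" by (rule smooth_map_local[OF f c d(1)])
      show "local_rep f c d ` ?S \<subseteq> cimg d" using local_rep_in[OF ci] by blast
      show "smooth_on ?S g \<and> g ` ?S \<subseteq> ctan d" if g: "g \<in> set (map (\<lambda>v x. local_deriv f c d x v) vs)" for g
      proof -
        obtain v where v: "v \<in> set vs" "g = (\<lambda>x. local_deriv f c d x v)" using g by auto
        then have "v \<in> ctan c" using vs by auto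
        then show ?thesis
          using local_deriv_in[OF M N f c d(1)] smooth_on_frechet_derivative[OF tS smooth_map_local[OF f c d(1)]]
          by (auto simp: v(2) local_deriv_def)
      qed
    qed (use True \<omega> forms_alternating forms_smooth d(1) in auto)
    moreover have "map (\<lambda>g. g x) (map (\<lambda>v x. local_deriv f c d x v) vs) = map (local_deriv f c d x) vs" for x
      by simp
    ultimately have "smooth_on ?S (\<lambda>x. \<omega> d (local_rep f c d x) (map (local_deriv f c d x) vs))"
      by (simp only: append_Nil)
    then show ?thesis by (rule smooth_on_cong[THEN iffD1, rotated]) (rule eq)
  next
    case False
    \<comment> \<open>On lists of the wrong length a form is zero;
      \<open>smooth_on_form_along\<close> covers the right length.\<close>
    then have "pullback M N f \<omega> c x vs = 0" if "x \<in> ?S" for x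
      using eq[OF that] forms_nonzero[OF \<omega>] by (metis length_map of_nat_eq_iff)
    then show ?thesis using smooth_on_cong[of ?S "\<lambda>x. pullback M N f \<omega> c x vs" "\<lambda>x. 0"] smooth_on_const
      by blast
  qed
  then show "\<exists>S'. openin (top_of_set (cimg c)) S' \<and> x \<in> S' \<and> smooth_on S' (\<lambda>x. pullback M N f \<omega> c x vs)"
    using openin_local_dom[OF M N smooth_map_continuous[OF f] c d(1)] d(2) by blast
qed

lemma alternating_on_cong:
  assumes "subspace T" "\<And>vs. set vs \<subseteq> T \<Longrightarrow> \<alpha> vs = \<beta> vs"
  shows "alternating_on T k \<alpha> = alternating_on T k \<beta>"
proof -
  have "set (vs[i := u]) \<subseteq> T" if "set vs \<subseteq> T" "u \<in> T" for vs i u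
    using that set_update_subset_insert[of vs i u] by auto
  moreover have "a *\<^sub>R u + b *\<^sub>R w \<in> T" if "u \<in> T" "w \<in> T" for a b u w
    using that assms(1) by (simp add: subspace_add subspace_scale)
  ultimately show ?thesis
    unfolding alternating_on_def using assms(2) by (auto cong: conj_cong)
qed

lemma alternating_on_linear_map:
  assumes "alternating_on T' k \<alpha>" "linear L" "\<And>v. v \<in> T \<Longrightarrow> L v \<in> T'"
  shows "alternating_on T k (\<lambda>vs. \<alpha> (map L vs))"
  unfolding alternating_on_def
proof (intro allI impI, elim conjE)
  fix vs assume vs: "int (length vs) = k" "set vs \<subseteq> T"
  then have "int (length (map L vs)) = k \<and> set (map L vs) \<subseteq> T'" using assms(3) by auto
  note * = assms(1)[unfolded alternating_on_def, rule_format, OF this]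
  show "(\<forall>i<length vs. \<forall>u\<in>T. \<forall>w\<in>T. \<forall>a b. \<alpha> (map L (vs[i := a *\<^sub>R u + b *\<^sub>R w])) =
            a *\<^sub>R \<alpha> (map L (vs[i := u])) + b *\<^sub>R \<alpha> (map L (vs[i := w]))) \<and>
        (\<forall>i j. i < j \<and> j < length vs \<and> vs ! i = vs ! j \<longrightarrow> \<alpha> (map L vs) = 0)"
  proof (intro conjI allI impI)
    fix i j assume "i < j \<and> j < length vs \<and> vs ! i = vs ! j"
    then show "\<alpha> (map L vs) = 0"
      using *[THEN conjunct2, rule_format, of i j] by simp
  qed (use *[THEN conjunct1] assms(3) in \<open>simp add: map_update linear_add[OF assms(2)] linear_cmul[OF assms(2)]\<close>)
qed

lemma local_deriv_linear:
  assumes "regular_charted M" "smooth_map M N f" "c \<in> atlas M" "d \<in> atlas N" "x \<in> local_dom f c d"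
  shows "linear (local_deriv f c d x)"
  unfolding local_deriv_def
  using smooth_on_frechet_linear[OF smooth_map_local[OF assms(2-4)] assms(5)] bounded_linear.linear by blast

lemma pullback_alternating:
  assumes M: "regular_charted M" and N: "regular_charted N" and f: "smooth_map M N f"
    and \<omega>: "\<omega> \<in> forms k N" and c: "c \<in> atlas M" "x \<in> cimg c"
  shows "alternating_on (ctan c) k (pullback M N f \<omega> c x)"
proof -
  obtain d where d: "d \<in> atlas N" "x \<in> local_dom f c d"
    by (rule local_dom_exists[OF M N f c])
  have eq: "pullback M N f \<omega> c x vs = \<omega> d (local_rep f c d x) (map (local_deriv f c d x) vs)" if "set vs \<subseteq> ctan c" for vs
    using pullback_eq[OF M N f \<omega> c(1) d that] .
  have "alternating_on (ctan c) k (\<lambda>vs. \<omega> d (local_rep f c d x) (map (local_deriv f c d x) vs))"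
    by (rule alternating_on_linear_map[OF forms_alternating[OF \<omega> d(1)] local_deriv_linear[OF M f c(1) d]])
       (use local_rep_in[OF regular_chart_inj[OF M c(1)] d(2)] local_deriv_in[OF M N f c(1) d] in auto)
  moreover have "subspace (ctan c)" using tangential_subspace[OF regular_chart_tangential[OF M c(1)]] .
  ultimately show ?thesis
    using alternating_on_cong[of "ctan c" "pullback M N f \<omega> c x"
        "\<lambda>vs. \<omega> d (local_rep f c d x) (map (local_deriv f c d x) vs)" k] eq by blast
qed

lemma ext_deriv_eq:
  assumes "c \<in> atlas M" "x \<in> cimg c" "set vs \<subseteq> ctan c"
  shows "ext_deriv M \<omega> c x vs =
    (\<Sum>i<length vs. (-1) ^ i * frechet_derivative (\<lambda>y. \<omega> c y (del_nth i vs)) (at x within cimg c) (vs ! i))"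
  using assms by (simp add: ext_deriv_def del_nth_def)

lemma ext_deriv_degree:
  assumes M: "regular_charted M" and "\<And>c x vs. int (length vs) \<noteq> k \<Longrightarrow> \<omega> c x vs = 0" "int (length vs) \<noteq> k + 1"
  shows "ext_deriv M \<omega> c x vs = 0"
proof (cases "c \<in> atlas M \<and> x \<in> cimg c \<and> set vs \<subseteq> ctan c")
  case True
  then have c: "c \<in> atlas M" "x \<in> cimg c" "set vs \<subseteq> ctan c" by auto
  have "frechet_derivative (\<lambda>y. \<omega> c y (del_nth i vs)) (at x within cimg c) (vs ! i) = 0" if "i < length vs" for i
  proof -
    have "int (length (del_nth i vs)) \<noteq> k" using that assms(3) by (simp add: length_del_nth of_nat_diff)
    then have "\<omega> c y (del_nth i vs) = 0" for y using assms(2) by blast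
    moreover have "vs ! i \<in> ctan c" using c(3) that nth_mem by blast
    ultimately show ?thesis
      using frechet_derivative_tangential[OF regular_chart_tangential[OF M c(1)] c(2) _ has_derivative_const]
      by simp
  qed
  then show ?thesis by (simp add: ext_deriv_eq[OF c])
qed (auto simp: ext_deriv_def)

lemma ext_deriv_zero:
  assumes "regular_charted M"
  shows "ext_deriv M (\<lambda>c x vs. 0) = (\<lambda>c x vs. 0)"
proof (intro ext)
  fix c x vs show "ext_deriv M (\<lambda>c x vs. 0) c x vs = 0"
    using ext_deriv_degree[OF assms, of "int (length vs)"] by simp
qed

lemma ext_deriv_ext_deriv:
  assumes M: "regular_charted M" and \<omega>: "\<omega> \<in> forms k M"
  shows "ext_deriv M (ext_deriv M \<omega>) = (\<lambda>c x vs. 0)"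
proof (intro ext)
  fix c x vs
  have deg0: "\<omega> c x vs = 0" if "int (length vs) \<noteq> k" for c x vs
    using forms_nonzero[OF \<omega>] that by blast
  have deg: "ext_deriv M \<omega> c x vs = 0" if "int (length vs) \<noteq> k + 1" for c x vs
    using ext_deriv_degree[OF M deg0 that] .
  show "ext_deriv M (ext_deriv M \<omega>) c x vs = 0"
  proof (cases "c \<in> atlas M \<and> x \<in> cimg c \<and> set vs \<subseteq> ctan c \<and> int (length vs) = k + 1 + 1")
    case False
    have "ext_deriv M (ext_deriv M \<omega>) c x vs = 0" if "int (length vs) \<noteq> k + 1 + 1"
      by (rule ext_deriv_degree[OF M _ that]) (rule deg)
    moreover have "ext_deriv M (ext_deriv M \<omega>) c x vs = 0" if "\<not> (c \<in> atlas M \<and> x \<in> cimg c \<and> set vs \<subseteq> ctan c)"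
      using that unfolding ext_deriv_def[of M "ext_deriv M \<omega>"] by (rule if_not_P)
    ultimately show ?thesis using False by blast
  next
    case True
    then have c: "c \<in> atlas M" "x \<in> cimg c" "set vs \<subseteq> ctan c" by auto
    show ?thesis
    proof (cases "k < 0")
      \<comment> \<open>A form of negative degree is zero; the computation below needs
        \<open>k\<close> to be a natural number.\<close>
      case True
      then have "\<omega> = (\<lambda>c x vs. 0)" by (intro ext deg0) linarith
      then show ?thesis by (simp add: ext_deriv_zero[OF M])
    next
      case False
      then obtain m where m: "k = int m" using nonneg_int_cases[of k] by auto
      have len: "length vs = Suc (Suc m)" using True m by simp
      have t: "tangential (cimg c) (ctan c)" by (rule regular_chart_tangential[OF M c(1)])
      have dT: "set (del_nth i vs) \<subseteq> ctan c" for i using set_del_nth c(3) by (metis dual_order.trans)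
      have vT: "vs ! i \<in> ctan c" if "i \<le> Suc m" for i using c(3) len that nth_mem[of i vs] by auto
      have eq: "ext_deriv M \<omega> c y (del_nth i vs) = (\<Sum>j\<le>m. (-1) ^ j *
        frechet_derivative (\<lambda>y. \<omega> c y (del_nth j (del_nth i vs))) (at y within cimg c) (del_nth i vs ! j))"
        if "i \<le> Suc m" "y \<in> cimg c" for i y
        using ext_deriv_eq[OF c(1) that(2) dT] that len by (simp add: length_del_nth lessThan_Suc_atMost)
      have "ext_deriv M (ext_deriv M \<omega>) c x vs = (\<Sum>i\<le>Suc m. (-1) ^ i * frechet_derivative (\<lambda>x. \<Sum>j\<le>m. (-1) ^ j *
          frechet_derivative (\<lambda>x. \<omega> c x (del_nth j (del_nth i vs))) (at x within cimg c) (del_nth i vs ! j)) (at x within cimg c) (vs ! i))"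
        unfolding ext_deriv_eq[OF c] len lessThan_Suc_atMost
      proof (rule sum.cong[OF refl])
        fix i assume "i \<in> {..Suc m}"
        then have i: "i \<le> Suc m" by simp
        show "(-1) ^ i * frechet_derivative (\<lambda>y. ext_deriv M \<omega> c y (del_nth i vs)) (at x within cimg c) (vs ! i) =
         (-1) ^ i * frechet_derivative (\<lambda>x. \<Sum>j\<le>m. (-1) ^ j *
          frechet_derivative (\<lambda>x. \<omega> c x (del_nth j (del_nth i vs))) (at x within cimg c) (del_nth i vs ! j)) (at x within cimg c) (vs ! i)"
          using fun_cong[OF frechet_derivative_within_cong[OF eq[OF i] c(2)]] by simp
      qed
      also have "\<dots> = 0"
        by (rule second_exterior_derivative_zero[OF t c(2) len c(3)]) (rule forms_smooth[OF \<omega> c(1)])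
      finally show ?thesis .
    qed
  qed
qed

text \<open>A computation in one pair of charts, possible because derivatives may be restricted to a
  relatively open piece. That \<open>ext_deriv N \<omega>\<close> is again a form is assumed, since
  its pullback must not depend on the chart chosen; later the filtration supplies this.\<close>

lemma ext_deriv_pullback:
  assumes M: "regular_charted M" and N: "regular_charted N" and f: "smooth_map M N f"
    and \<omega>: "\<omega> \<in> forms (int k) N" and d\<omega>: "ext_deriv N \<omega> \<in> forms (int (Suc k)) N"
    and c: "c \<in> atlas M" "x \<in> cimg c" "set vs \<subseteq> ctan c" "length vs = Suc k"
  shows "ext_deriv M (pullback M N f \<omega>) c x vs = pullback M N f (ext_deriv N \<omega>) c x vs"
proof -
  obtain d where d: "d \<in> atlas N" "x \<in> local_dom f c d"
    by (rule local_dom_exists[OF M N f c(1,2)])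
  let ?S = "local_dom f c d"
  have ci: "inj_on (cmap c) (cdom c)" by (rule regular_chart_inj[OF M c(1)])
  have tc: "tangential (cimg c) (ctan c)" by (rule regular_chart_tangential[OF M c(1)])
  have td: "tangential (cimg d) (ctan d)" by (rule regular_chart_tangential[OF N d(1)])
  have o: "openin (top_of_set (cimg c)) ?S" by (rule openin_local_dom[OF M N smooth_map_continuous[OF f] c(1) d(1)])
  have tS: "tangential ?S (ctan c)" by (rule tangential_openin[OF tc o])
  have dT: "set (del_nth i vs) \<subseteq> ctan c" for i using set_del_nth c(3) by (metis dual_order.trans)
  have vT: "vs ! i \<in> ctan c" if "i \<le> k" for i using c(3,4) that nth_mem[of i vs] by auto
  have "ext_deriv M (pullback M N f \<omega>) c x vs = (\<Sum>i\<le>k. (-1) ^ i *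
      frechet_derivative (\<lambda>y. \<omega> d (local_rep f c d y) (map (local_deriv f c d y) (del_nth i vs))) (at x within ?S) (vs ! i))"
    unfolding ext_deriv_eq[OF c(1-3)] c(4) lessThan_Suc_atMost
  proof (rule sum.cong[OF refl])
    fix i assume "i \<in> {..k}"
    then have i: "i \<le> k" by simp
    have "frechet_derivative (\<lambda>y. pullback M N f \<omega> c y (del_nth i vs)) (at x within cimg c) (vs ! i) =
      frechet_derivative (\<lambda>y. pullback M N f \<omega> c y (del_nth i vs)) (at x within ?S) (vs ! i)"
      using frechet_derivative_openin[OF tc o d(2) vT[OF i] pullback_smooth[OF M N f \<omega> c(1) dT]] by simp
    also have "\<dots> = frechet_derivative (\<lambda>y. \<omega> d (local_rep f c d y) (map (local_deriv f c d y) (del_nth i vs))) (at x within ?S) (vs ! i)"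
      by (rule fun_cong[OF frechet_derivative_within_cong[OF _ d(2)]])
         (rule pullback_eq[OF M N f \<omega> c(1) d(1) _ dT])
    finally show "(-1) ^ i * frechet_derivative (\<lambda>y. pullback M N f \<omega> c y (del_nth i vs)) (at x within cimg c) (vs ! i) =
       (-1) ^ i * frechet_derivative (\<lambda>y. \<omega> d (local_rep f c d y) (map (local_deriv f c d y) (del_nth i vs))) (at x within ?S) (vs ! i)"
      by simp
  qed
  also have "\<dots> = (\<Sum>i\<le>k. (-1) ^ i * frechet_derivative (\<lambda>y. \<omega> d y (del_nth i (map (local_deriv f c d x) vs)))
      (at (local_rep f c d x) within cimg d) (local_deriv f c d x (vs ! i)))"
    unfolding local_deriv_def
    by (rule derivative_form_along_map[OF td smooth_map_local[OF f c(1) d(1)] _ forms_alternating[OF \<omega> d(1)]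
          forms_smooth[OF \<omega> d(1)] tS d(2) c(4,3)])
       (use local_rep_in[OF ci] in blast)
  also have "\<dots> = ext_deriv N \<omega> d (local_rep f c d x) (map (local_deriv f c d x) vs)"
  proof -
    have "set (map (local_deriv f c d x) vs) \<subseteq> ctan d"
      using local_deriv_in[OF M N f c(1) d] c(3) by auto
    from ext_deriv_eq[OF d(1) local_rep_in[OF ci d(2)] this, of \<omega>] show ?thesis
      using c(4) by (auto simp: lessThan_Suc_atMost intro!: sum.cong)
  qed
  also have "\<dots> = pullback M N f (ext_deriv N \<omega>) c x vs"
    by (rule pullback_eq[OF M N f d\<omega> c(1) d c(3), symmetric])
  finally show ?thesis .
qed

section \<open>Simplices and their products with manifolds\<close>

abbreviation (input) lk :: "coords \<Rightarrow> nat \<Rightarrow> real" where "lk \<equiv> Poly_Mapping.lookup"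

lemma lookup_scaleR: "lk (a *\<^sub>R x) i = a * lk x i"
proof -
  have "finite {i. a *\<^sub>R lk x i \<noteq> 0}"
    by (rule finite_subset[OF _ finite_keys[of x]]) (auto simp: in_keys_iff)
  then show ?thesis by (simp add: scaleR_poly_mapping_def lookup_Abs_poly_mapping)
qed

text \<open>Finitely supported sequences carry the sum norm, so coordinate functionals,
  \<open>coface i\<close> and \<open>drop_coord i\<close> are bounded with constant 1.\<close>

lemma norm_coords: "finite A \<Longrightarrow> Poly_Mapping.keys x \<subseteq> A \<Longrightarrow> norm x = (\<Sum>i\<in>A. \<bar>lk x i\<bar>)"
  unfolding norm_poly_mapping_def dist_poly_mapping_def
  by (rule sum.mono_neutral_cong_left) (auto simp: in_keys_iff dist_real_def)

lemma lookup_le_norm: "\<bar>lk x i\<bar> \<le> norm x"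
proof (cases "i \<in> Poly_Mapping.keys x")
  case True
  have "\<bar>lk x i\<bar> \<le> (\<Sum>i\<in>Poly_Mapping.keys x. \<bar>lk x i\<bar>)"
    by (rule member_le_sum) (use True in auto)
  then show ?thesis using norm_coords[of "Poly_Mapping.keys x" x] by simp
qed (simp add: in_keys_iff)

lemma bounded_linear_lookup: "bounded_linear (\<lambda>x. lk x i)"
  by (rule bounded_linear_intro[where K = 1]) (simp_all add: lookup_add lookup_scaleR lookup_le_norm)

lemma coords_eqI: "(\<And>i. lk x i = lk y i) \<Longrightarrow> x = y"
  by (rule poly_mapping_eqI)

lemma lookup_sum_coords: "lk (\<Sum>i\<in>I. f i) k = (\<Sum>i\<in>I. lk (f i) k)"
  by (induction I rule: infinite_finite_induct) (simp_all add: lookup_add)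

text \<open>The increasing map that omits \<open>i\<close>, that is, the effect of the
  \<open>i\<close>-th coface on the numbering of vertices.\<close>

definition skip :: "nat \<Rightarrow> nat \<Rightarrow> nat"
  where "skip i k = (if k < i then k else Suc k)"

lemma inj_skip: "inj (skip i)"
  by (auto simp: inj_def skip_def split: if_splits)

lemma skip_neq: "skip i k \<noteq> i"
  by (simp add: skip_def)

lemma skip_image: "i \<le> Suc n \<Longrightarrow> skip i ` {..n} = {..Suc n} - {i}"
proof (intro equalityI subsetI)
  fix k assume "i \<le> Suc n" "k \<in> {..Suc n} - {i}"
  then show "k \<in> skip i ` {..n}"
    by (cases "k < i") (auto simp: skip_def image_iff intro!: bexI[of _ "if k < i then k else k - 1"])
qed (auto simp: skip_def split: if_splits)

lemma finite_simplical_face: "finite {k. simplical_face i (lk t) k \<noteq> 0}"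
proof (rule finite_subset)
  show "{k. simplical_face i (lk t) k \<noteq> 0} \<subseteq> skip i ` Poly_Mapping.keys t"
  proof
    fix k assume "k \<in> {k. simplical_face i (lk t) k \<noteq> 0}"
    then show "k \<in> skip i ` Poly_Mapping.keys t"
      by (intro image_eqI[of _ _ "if k < i then k else k - 1"])
         (auto simp: simplical_face_def skip_def in_keys_iff split: if_splits)
  qed
qed simp

lemma lookup_coface: "lk (coface i t) k = simplical_face i (lk t) k"
  unfolding coface_def by (simp add: lookup_Abs_poly_mapping[OF finite_simplical_face])

lemma lookup_coface_skip: "lk (coface i t) (skip i k) = lk t k"
  by (simp add: lookup_coface simplical_face_def skip_def)

lemma lookup_coface_same: "lk (coface i t) i = 0"
  by (simp add: lookup_coface simplical_face_def)

lemma keys_coface: "Poly_Mapping.keys (coface i t) \<subseteq> skip i ` Poly_Mapping.keys t"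
proof
  fix k assume "k \<in> Poly_Mapping.keys (coface i t)"
  then show "k \<in> skip i ` Poly_Mapping.keys t"
    by (intro image_eqI[of _ _ "if k < i then k else k - 1"])
       (auto simp: simplical_face_def skip_def in_keys_iff lookup_coface split: if_splits)
qed

lemma bounded_linear_coface: "bounded_linear (coface i)"
proof (rule bounded_linear_intro[where K = 1])
  show "norm (coface i t) \<le> norm t * 1" for t
    using norm_coords[OF finite_keys subset_refl, of t]
    by (subst norm_coords[OF finite_imageI[OF finite_keys] keys_coface])
       (simp add: sum.reindex inj_on_subset[OF inj_skip] lookup_coface_skip)
qed (auto intro!: coords_eqI simp: lookup_coface simplical_face_def lookup_add lookup_scaleR)

text \<open>A left inverse of \<open>coface i\<close>, defined and linear on the whole space so that
  its smoothness needs no separate argument on the face.\<close>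

definition drop_coord :: "nat \<Rightarrow> coords \<Rightarrow> coords"
  where "drop_coord i t = Abs_poly_mapping (\<lambda>k. lk t (skip i k))"

lemma lookup_drop_coord: "lk (drop_coord i t) k = lk t (skip i k)"
proof -
  have "finite (skip i -` Poly_Mapping.keys t)" by (rule finite_vimageI[OF finite_keys inj_skip])
  then have "finite {k. lk t (skip i k) \<noteq> 0}" by (simp add: vimage_def in_keys_iff)
  then show ?thesis unfolding drop_coord_def by (simp add: lookup_Abs_poly_mapping)
qed

lemma bounded_linear_drop_coord: "bounded_linear (drop_coord i)"
proof (rule bounded_linear_intro[where K = 1])
  fix t
  have sub: "skip i ` Poly_Mapping.keys (drop_coord i t) \<subseteq> Poly_Mapping.keys t"
    by (auto simp: in_keys_iff lookup_drop_coord)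
  have "norm (drop_coord i t) = (\<Sum>k\<in>Poly_Mapping.keys (drop_coord i t). \<bar>lk t (skip i k)\<bar>)"
    by (subst norm_coords[OF finite_keys subset_refl]) (simp add: lookup_drop_coord)
  also have "\<dots> = (\<Sum>k\<in>skip i ` Poly_Mapping.keys (drop_coord i t). \<bar>lk t k\<bar>)"
    by (simp add: sum.reindex inj_on_subset[OF inj_skip])
  also have "\<dots> \<le> (\<Sum>k\<in>Poly_Mapping.keys t. \<bar>lk t k\<bar>)"
    by (rule sum_mono2[OF finite_keys sub]) simp
  also have "\<dots> = norm t" by (simp add: norm_coords[OF finite_keys subset_refl])
  finally show "norm (drop_coord i t) \<le> norm t * 1" by simp
qed (auto intro!: coords_eqI simp: lookup_drop_coord lookup_add lookup_scaleR)

lemma coface_drop_coord: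
  assumes "lk t i = 0" shows "coface i (drop_coord i t) = t"
proof (rule coords_eqI)
  fix k show "lk (coface i (drop_coord i t)) k = lk t k"
    using assms by (auto simp: lookup_coface simplical_face_def lookup_drop_coord skip_def)
qed

lemma drop_coord_coface: "drop_coord i (coface i t) = t"
  by (rule coords_eqI) (simp add: lookup_drop_coord lookup_coface_skip)

lemma coface_coface: "i < j \<Longrightarrow> coface j (coface i t) = coface i (coface (j - 1) t)"
  by (rule coords_eqI) (auto simp: lookup_coface simplical_face_def)

section \<open>The standard simplex and its tangent space\<close>

lemma std_simplexD:
  assumes "t \<in> std_simplex n"
  shows "0 \<le> lk t i" "lk t i \<le> 1" "n < i \<Longrightarrow> lk t i = 0" "(\<Sum>i\<le>n. lk t i) = 1"
  using assms by (auto simp: std_simplex_def standard_simplex_def)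

lemma std_simplexI:
  assumes "\<And>i. 0 \<le> lk t i" "\<And>i. n < i \<Longrightarrow> lk t i = 0" "(\<Sum>i\<le>n. lk t i) = 1"
  shows "t \<in> std_simplex n"
proof -
  have "lk t i \<le> 1" for i
  proof (cases "i \<le> n")
    case True
    have "lk t i \<le> (\<Sum>i\<le>n. lk t i)" by (rule member_le_sum) (use True assms in auto)
    then show ?thesis using assms by simp
  qed (use assms in auto)
  then show ?thesis using assms by (simp add: std_simplex_def standard_simplex_def)
qed

lemma coface_in_simplex: "i \<le> Suc n \<Longrightarrow> t \<in> std_simplex n \<Longrightarrow> coface i t \<in> std_simplex (Suc n)"
  using simplical_face_in_standard_simplex[of "Suc n" i "lk t"]
  by (simp add: std_simplex_def lookup_coface fun_eq_iff)
     (metis (no_types, lifting) lookup_coface ext)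

lemma drop_coord_in_simplex:
  assumes "i \<le> Suc n" "t \<in> std_simplex (Suc n)" "lk t i = 0"
  shows "drop_coord i t \<in> std_simplex n"
proof (rule std_simplexI)
  have "(\<Sum>k\<le>n. lk (drop_coord i t) k) = (\<Sum>k\<in>skip i ` {..n}. lk t k)"
    by (simp add: sum.reindex inj_on_subset[OF inj_skip] lookup_drop_coord)
  also have "\<dots> = (\<Sum>k\<le>Suc n. lk t k)"
    unfolding skip_image[OF assms(1)] using assms(1,3) by (subst sum.remove[of _ i]) auto
  finally show "(\<Sum>k\<le>n. lk (drop_coord i t) k) = 1" using std_simplexD(4)[OF assms(2)] by simp
qed (use assms(1) std_simplexD[OF assms(2)] in \<open>auto simp: lookup_drop_coord skip_def\<close>)

lemma vertex_in_simplex: "j \<le> n \<Longrightarrow> Poly_Mapping.single j 1 \<in> std_simplex n"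
  by (rule std_simplexI) (auto simp: lookup_single when_def)

lemma simplex_tanI: "(\<And>i. n < i \<Longrightarrow> lk v i = 0) \<Longrightarrow> (\<Sum>i\<le>n. lk v i) = 0 \<Longrightarrow> v \<in> simplex_tan n"
  unfolding simplex_tan_def by (auto simp: in_keys_iff) (metis not_le)

lemma simplex_tanD:
  assumes "v \<in> simplex_tan n"
  shows "n < i \<Longrightarrow> lk v i = 0" "(\<Sum>i\<le>n. lk v i) = 0"
  using assms by (auto simp: simplex_tan_def in_keys_iff)

lemma subspace_simplex_tan: "subspace (simplex_tan n)"
  unfolding subspace_def
proof (intro conjI ballI allI)
  fix x y a assume x: "x \<in> simplex_tan n"
  show "a *\<^sub>R x \<in> simplex_tan n"
    using simplex_tanD[OF x] by (intro simplex_tanI) (simp_all add: lookup_scaleR flip: sum_distrib_left)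
  assume y: "y \<in> simplex_tan n"
  show "x + y \<in> simplex_tan n"
    using simplex_tanD[OF x] simplex_tanD[OF y] by (intro simplex_tanI) (simp_all add: lookup_add sum.distrib)
qed (auto intro: simplex_tanI)

lemma simplex_diff_tan: "x \<in> std_simplex n \<Longrightarrow> y \<in> std_simplex n \<Longrightarrow> y - x \<in> simplex_tan n"
  by (rule simplex_tanI) (auto simp: lookup_minus std_simplexD sum_subtractf)

abbreviation edge :: "nat \<Rightarrow> coords" where
  "edge i \<equiv> Poly_Mapping.single i 1 - Poly_Mapping.single 0 1"

lemma edge_tan: "i \<le> n \<Longrightarrow> edge i \<in> simplex_tan n"
  using simplex_diff_tan[OF vertex_in_simplex vertex_in_simplex, of 0 n i] by simp

lemma simplex_tan_expand:
  assumes "v \<in> simplex_tan n"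
  shows "v = (\<Sum>i\<in>{1..n}. lk v i *\<^sub>R edge i)"
proof (rule coords_eqI)
  fix k
  have "lk (\<Sum>i\<in>{1..n}. lk v i *\<^sub>R edge i) k = (\<Sum>i\<in>{1..n}. (if i = k then lk v i else 0) - (if k = 0 then lk v i else 0))"
    unfolding lookup_sum_coords
    by (rule sum.cong) (auto simp: lookup_scaleR lookup_minus lookup_single lookup_one when_def)
  also have "\<dots> = (\<Sum>i\<in>{1..n}. if i = k then lk v i else 0) - (\<Sum>i\<in>{1..n}. if k = 0 then lk v i else 0)"
    by (rule sum_subtractf)
  also have "\<dots> = lk v k"
  proof (cases "k = 0")
    case True
    have "{..n} = insert 0 {1..n}" by auto
    then have "(\<Sum>i\<le>n. lk v i) = lk v 0 + (\<Sum>i\<in>{1..n}. lk v i)"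
      by simp
    then show ?thesis using True simplex_tanD(2)[OF assms] by simp
  next
    case False
    then show ?thesis using simplex_tanD(1)[OF assms, of k] by (cases "k \<le> n") auto
  qed
  finally show "lk v k = lk (\<Sum>i\<in>{1..n}. lk v i *\<^sub>R edge i) k" by (rule sym)
qed

lemma std_simplex_convex:
  assumes "x \<in> std_simplex n" "y \<in> std_simplex n" "0 \<le> t" "t \<le> 1"
  shows "x + t *\<^sub>R (y - x) \<in> std_simplex n"
proof (rule std_simplexI)
  have eq: "lk (x + t *\<^sub>R (y - x)) i = (1 - t) * lk x i + t * lk y i" for i
    by (simp add: lookup_add lookup_scaleR lookup_minus algebra_simps)
  show "0 \<le> lk (x + t *\<^sub>R (y - x)) i" for i
    unfolding eq using assms std_simplexD(1) by simp
  show "n < i \<Longrightarrow> lk (x + t *\<^sub>R (y - x)) i = 0" for i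
    unfolding eq using assms std_simplexD(3) by simp
  show "(\<Sum>i\<le>n. lk (x + t *\<^sub>R (y - x)) i) = 1"
    unfolding eq sum.distrib sum_distrib_left[symmetric] using assms std_simplexD(4) by simp
qed

text \<open>Segments from any point towards a vertex stay in the simplex by convexity, and
  differences of these directions are the edges, which span the tangent space. Boundary points
  therefore need no special treatment.\<close>

lemma tangential_std_simplex: "tangential (std_simplex n) (simplex_tan n)"
  unfolding tangential_def
proof (intro conjI ballI)
  show "subspace (simplex_tan n)" by (rule subspace_simplex_tan)
  show "\<exists>(I::nat set) b \<phi>. finite I \<and> (\<forall>i\<in>I. b i \<in> simplex_tan n \<and> bounded_linear (\<phi> i)) \<and>
     (\<forall>v\<in>simplex_tan n. v = (\<Sum>i\<in>I. \<phi> i v *\<^sub>R b i))"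
  proof (intro exI conjI ballI)
    show "finite {1..n}" by simp
    fix i assume "i \<in> {1..n}"
    then show "edge i \<in> simplex_tan n" "bounded_linear (\<lambda>v. lk v i)"
      using edge_tan bounded_linear_lookup by auto
  next
    fix v assume "v \<in> simplex_tan n"
    then show "v = (\<Sum>i\<in>{1..n}. lk v i *\<^sub>R edge i)" by (rule simplex_tan_expand)
  qed
next
  fix x y assume "x \<in> std_simplex n" "y \<in> std_simplex n"
  then show "y - x \<in> simplex_tan n" by (rule simplex_diff_tan)
next
  fix x assume x: "x \<in> std_simplex n"
  let ?W = "{w. \<exists>e>0. \<forall>t\<in>{0..e}. x + t *\<^sub>R w \<in> std_simplex n}"
  have v: "Poly_Mapping.single j 1 - x \<in> span ?W" if "j \<le> n" for j
  proof (rule span_base, rule CollectI, intro exI conjI ballI)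
    show "(1::real) > 0" by simp
    fix t :: real assume "t \<in> {0..1}"
    then show "x + t *\<^sub>R (Poly_Mapping.single j 1 - x) \<in> std_simplex n"
      using std_simplex_convex[OF x vertex_in_simplex[OF that]] by simp
  qed
  have e: "edge i \<in> span ?W" if "i \<le> n" for i
    using span_diff[OF v[OF that] v[of 0]] by simp
  show "simplex_tan n \<subseteq> span ?W"
  proof
    fix v assume "v \<in> simplex_tan n"
    then have "v = (\<Sum>i\<in>{1..n}. lk v i *\<^sub>R edge i)" by (rule simplex_tan_expand)
    also have "\<dots> \<in> span ?W" by (intro span_sum span_scale e) auto
    finally show "v \<in> span ?W" .
  qed
qed

lemma coord_spaceD: "v \<in> coord_space m \<Longrightarrow> m \<le> i \<Longrightarrow> lk v i = 0"
  by (auto simp: coord_space_def in_keys_iff)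

lemma coord_spaceI: "(\<And>i. m \<le> i \<Longrightarrow> lk v i = 0) \<Longrightarrow> v \<in> coord_space m"
  unfolding coord_space_def by (auto simp: in_keys_iff) (metis not_le)

lemma subspace_coord_space: "subspace (coord_space m)"
  unfolding subspace_def by (auto intro!: coord_spaceI simp: lookup_add lookup_scaleR coord_spaceD)

lemma tangential_coord_space: "tangential (coord_space m) (coord_space m)"
  unfolding tangential_def
proof (intro conjI ballI)
  show "subspace (coord_space m)" by (rule subspace_coord_space)
  show "\<exists>(I::nat set) b \<phi>. finite I \<and> (\<forall>i\<in>I. b i \<in> coord_space m \<and> bounded_linear (\<phi> i)) \<and>
     (\<forall>v\<in>coord_space m. v = (\<Sum>i\<in>I. \<phi> i v *\<^sub>R b i))"
  proof (intro exI conjI ballI)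
    show "finite {..<m}" by simp
    fix i assume "i \<in> {..<m}"
    then show "Poly_Mapping.single i 1 \<in> coord_space m" "bounded_linear (\<lambda>v. lk v i)"
      using bounded_linear_lookup by (auto intro!: coord_spaceI simp: lookup_single)
  next
    fix v assume v: "v \<in> coord_space m"
    show "v = (\<Sum>i\<in>{..<m}. lk v i *\<^sub>R Poly_Mapping.single i 1)"
    proof (rule coords_eqI)
      fix k
      have "lk (\<Sum>i\<in>{..<m}. lk v i *\<^sub>R Poly_Mapping.single i 1) k = (\<Sum>i\<in>{..<m}. if i = k then lk v i else 0)"
        unfolding lookup_sum_coords by (rule sum.cong) (auto simp: lookup_scaleR lookup_single when_def)
      also have "\<dots> = lk v k" using coord_spaceD[OF v, of k] by (cases "k < m") auto
      finally show "lk v k = lk (\<Sum>i\<in>{..<m}. lk v i *\<^sub>R Poly_Mapping.single i 1) k" by (rule sym)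
    qed
  qed
next
  fix x y assume "x \<in> coord_space m" "y \<in> coord_space m"
  then show "y - x \<in> coord_space m" using subspace_diff[OF subspace_coord_space] by blast
next
  fix x assume x: "x \<in> coord_space m"
  show "coord_space m \<subseteq> span {w. \<exists>e>0. \<forall>t\<in>{0..e}. x + t *\<^sub>R w \<in> coord_space m}"
  proof
    fix w assume w: "w \<in> coord_space m"
    show "w \<in> span {w. \<exists>e>0. \<forall>t\<in>{0..e}. x + t *\<^sub>R w \<in> coord_space m}"
    proof (rule span_base, rule CollectI, intro exI conjI ballI)
      show "(1::real) > 0" by simp
      show "x + t *\<^sub>R w \<in> coord_space m" for t
        using x w subspace_coord_space by (simp add: subspace_add subspace_scale)
    qed
  qed
qed

lemma tangential_Times:
  assumes A: "tangential A T" and B: "tangential B V"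
  shows "tangential (A \<times> B) (T \<times> V)"
  unfolding tangential_def
proof (intro conjI ballI)
  have sT: "subspace T" "subspace V" using A B tangential_subspace by auto
  show "subspace (T \<times> V)" by (rule subspace_Times[OF sT])
  obtain I :: "nat set" and b \<phi> where I: "finite I" "\<And>i. i \<in> I \<Longrightarrow> b i \<in> T"
    "\<And>i. i \<in> I \<Longrightarrow> bounded_linear (\<phi> i)" "\<And>v. v \<in> T \<Longrightarrow> v = (\<Sum>i\<in>I. \<phi> i v *\<^sub>R b i)"
    by (rule tangentialE[OF A], rule that)
  obtain J :: "nat set" and c \<psi> where J: "finite J" "\<And>i. i \<in> J \<Longrightarrow> c i \<in> V"
    "\<And>i. i \<in> J \<Longrightarrow> bounded_linear (\<psi> i)" "\<And>v. v \<in> V \<Longrightarrow> v = (\<Sum>i\<in>J. \<psi> i v *\<^sub>R c i)"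
    by (rule tangentialE[OF B], rule that)
  \<comment> \<open>Index sets consist of natural numbers, so the disjoint union of the two families
    is coded by even and odd numbers.\<close>
  let ?K = "(\<lambda>i. 2 * i) ` I \<union> (\<lambda>i. 2 * i + 1) ` J"
  let ?b = "\<lambda>k. if even k then (b (k div 2), 0) else (0, c (k div 2))"
  let ?\<phi> = "\<lambda>k v. if even k then \<phi> (k div 2) (fst v) else \<psi> (k div 2) (snd v)"
  show "\<exists>(I::nat set) b \<phi>. finite I \<and> (\<forall>i\<in>I. b i \<in> T \<times> V \<and> bounded_linear (\<phi> i)) \<and>
     (\<forall>v\<in>T \<times> V. v = (\<Sum>i\<in>I. \<phi> i v *\<^sub>R b i))"
  proof (rule exI[of _ ?K], rule exI[of _ ?b], rule exI[of _ ?\<phi>], intro conjI ballI)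
    show "finite ?K" using I J by simp
    fix k assume "k \<in> ?K"
    then show "?b k \<in> T \<times> V" "bounded_linear (?\<phi> k)"
      using I(2) J(2) subspace_0[OF sT(1)] subspace_0[OF sT(2)]
      by (auto intro!: bounded_linear_compose[OF I(3) bounded_linear_fst] bounded_linear_compose[OF J(3) bounded_linear_snd])
  next
    fix v assume v: "v \<in> T \<times> V"
    have "(\<Sum>k\<in>?K. ?\<phi> k v *\<^sub>R ?b k) =
      (\<Sum>k\<in>(\<lambda>i. 2 * i) ` I. ?\<phi> k v *\<^sub>R ?b k) + (\<Sum>k\<in>(\<lambda>i. 2 * i + 1) ` J. ?\<phi> k v *\<^sub>R ?b k)"
      by (rule sum.union_disjoint) (use I J in \<open>auto, presburger\<close>)
    also have "(\<Sum>k\<in>(\<lambda>i. 2 * i) ` I. ?\<phi> k v *\<^sub>R ?b k) = (\<Sum>i\<in>I. \<phi> i (fst v) *\<^sub>R (b i, 0))"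
      by (subst sum.reindex) (auto simp: inj_on_def)
    also have "\<dots> = (fst v, 0)"
      using I(4)[of "fst v"] v by (simp add: scaleR_prod_def sum_prod mem_Times_iff)
    also have "(\<Sum>k\<in>(\<lambda>i. 2 * i + 1) ` J. ?\<phi> k v *\<^sub>R ?b k) = (\<Sum>i\<in>J. \<psi> i (snd v) *\<^sub>R (0, c i))"
      by (subst sum.reindex) (auto simp: inj_on_def)
    also have "\<dots> = (0, snd v)"
      using J(4)[of "snd v"] v by (simp add: scaleR_prod_def sum_prod mem_Times_iff)
    finally show "v = (\<Sum>k\<in>?K. ?\<phi> k v *\<^sub>R ?b k)" by simp
  qed
next
  fix x y assume "x \<in> A \<times> B" "y \<in> A \<times> B"
  then show "y - x \<in> T \<times> V"
    using tangential_diff[OF A] tangential_diff[OF B] by (auto simp: minus_prod_def mem_Times_iff)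
next
  fix x assume x: "x \<in> A \<times> B"
  let ?WA = "{w. \<exists>e>0. \<forall>t\<in>{0..e}. fst x + t *\<^sub>R w \<in> A}"
  let ?WB = "{w. \<exists>e>0. \<forall>t\<in>{0..e}. snd x + t *\<^sub>R w \<in> B}"
  let ?W = "{w. \<exists>e>0. \<forall>t\<in>{0..e}. x + t *\<^sub>R w \<in> A \<times> B}"
  have im: "(\<lambda>w. (w, 0)) ` ?WA \<subseteq> ?W" "(\<lambda>w. (0, w)) ` ?WB \<subseteq> ?W"
    using x by (auto simp: plus_prod_def mem_Times_iff)
  have "(\<lambda>w. (w, 0)) ` span ?WA = span ((\<lambda>w. (w, 0)) ` ?WA)"
    by (rule linear_span_image[symmetric]) (simp add: linear_iff)
  also have "\<dots> \<subseteq> span ?W" by (rule span_mono[OF im(1)])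
  finally have WA: "(\<lambda>w. (w, 0)) ` span ?WA \<subseteq> span ?W" .
  have "(\<lambda>w. (0, w)) ` span ?WB = span ((\<lambda>w. (0, w)) ` ?WB)"
    by (rule linear_span_image[symmetric]) (simp add: linear_iff)
  also have "\<dots> \<subseteq> span ?W" by (rule span_mono[OF im(2)])
  finally have WB: "(\<lambda>w. (0, w)) ` span ?WB \<subseteq> span ?W" .
  show "T \<times> V \<subseteq> span ?W"
  proof
    fix v assume v: "v \<in> T \<times> V"
    have "fst v \<in> span ?WA" "snd v \<in> span ?WB"
      using A B x v unfolding tangential_def by (auto simp: mem_Times_iff subset_iff)
    then have "(fst v, 0) \<in> span ?W" "(0, snd v) \<in> span ?W" using WA WB by auto
    then have "(fst v, 0) + (0, snd v) \<in> span ?W" by (rule span_add)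
    then show "v \<in> span ?W" by simp
  qed
qed

section \<open>Charts of simplices and of their products with manifolds\<close>

lemma cimg_simplex_chart: "cimg (simplex_chart n) = std_simplex n"
  by (simp add: cimg_def simplex_chart_def)

lemma regular_charted_simplex_space: "regular_charted (simplex_space n)"
  unfolding regular_charted_def
proof (intro conjI ballI)
  show "(\<Union>c\<in>atlas (simplex_space n). cdom c) = topspace (ctop (simplex_space n))"
    by (simp add: simplex_space_def simplex_chart_def)
  fix c assume "c \<in> atlas (simplex_space n)"
  then have c: "c = simplex_chart n" by (simp add: simplex_space_def)
  show "openin (ctop (simplex_space n)) (cdom c)"
    by (simp add: c simplex_space_def simplex_chart_def)
  show "tangential (cimg c) (ctan c)"
    unfolding c cimg_simplex_chart by (simp add: simplex_chart_def tangential_std_simplex)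
  show "homeomorphic_map (subtopology (ctop (simplex_space n)) (cdom c)) (top_of_set (cimg c)) (cmap c)"
    unfolding c cimg_simplex_chart by (simp add: simplex_space_def simplex_chart_def subtopology_subtopology)
  fix d assume "d \<in> atlas (simplex_space n)"
  then have d: "d = simplex_chart n" by (simp add: simplex_space_def)
  have inv: "inv_into (std_simplex n) id x = x" if "x \<in> std_simplex n" for x :: coords
    using inv_into_f_f[of id "std_simplex n" x] that by simp
  have 1: "local_dom id c d = std_simplex n"
    by (simp add: c d local_dom_def simplex_chart_def)
  have 2: "local_rep id c d x = x" if "x \<in> std_simplex n" for x
    using inv[OF that] by (simp add: c d local_rep_def simplex_chart_def)
  show "smooth_on (local_dom id c d) (local_rep id c d)"
    unfolding 1 by (rule smooth_on_cong[THEN iffD2, OF 2 smooth_on_id])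
qed

abbreviation times_chart :: "nat \<Rightarrow> ('a, coords) chart \<Rightarrow> (coords \<times> 'a, coords \<times> coords) chart" where
  "times_chart n c \<equiv> \<lparr>cdom = std_simplex n \<times> cdom c, cmap = map_prod id (cmap c), ctan = simplex_tan n \<times> ctan c\<rparr>"

lemma cimg_times_chart: "cimg (times_chart n c) = std_simplex n \<times> cimg c"
  by (force simp: cimg_def)

lemma smooth_manifold_chart:
  assumes "smooth_manifold M" "c \<in> atlas M"
  shows manifold_chart_open: "openin (ctop M) (cdom c)"
    and manifold_chart_tangential: "tangential (cimg c) (ctan c)"
    and manifold_chart_homeo: "homeomorphic_map (subtopology (ctop M) (cdom c)) (top_of_set (cimg c)) (cmap c)"
  using assms tangential_openin[OF tangential_coord_space]
  unfolding smooth_manifold_def by metis+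

lemma regular_charted_manifold: "smooth_manifold M \<Longrightarrow> regular_charted M"
  unfolding regular_charted_def
  using manifold_chart_open manifold_chart_tangential manifold_chart_homeo
  unfolding smooth_manifold_def by metis

lemma smooth_on_Pair:
  assumes "smooth_on S f" "smooth_on S g"
  shows "smooth_on S (\<lambda>x. (f x, g x))"
proof -
  have "smooth_on S (\<lambda>x. (f x, 0) + (0, g x))"
    using smooth_on_add[OF smooth_on_compose_linear[OF bounded_linear_Pair[OF bounded_linear_ident bounded_linear_zero] assms(1)]
        smooth_on_compose_linear[OF bounded_linear_Pair[OF bounded_linear_zero bounded_linear_ident] assms(2)]] .
  then show ?thesis by simp
qed

lemma local_rep_times_chart:
  assumes "inj_on (cmap c) (cdom c)" "g ` std_simplex n \<subseteq> std_simplex n'"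
  shows "local_dom (map_prod g f) (times_chart n c) (times_chart n' d) = std_simplex n \<times> local_dom f c d"
    and "x \<in> std_simplex n \<times> cimg c \<Longrightarrow> local_rep (map_prod g f) (times_chart n c) (times_chart n' d) x = map_prod g (local_rep f c d) x"
proof -
  have inj: "inj_on (map_prod id (cmap c)) (std_simplex n \<times> cdom c)"
    using assms(1) by (auto simp: inj_on_def)
  have inv: "cinv (times_chart n c) x = (fst x, cinv c (snd x))" if "x \<in> std_simplex n \<times> cimg c" for x
  proof -
    have "(fst x, cinv c (snd x)) \<in> std_simplex n \<times> cdom c"
      using that cinv_in[of "snd x" c] by auto
    from inv_into_f_f[OF inj this] show ?thesis
      using that cmap_cinv[of "snd x" c] by auto
  qed
  show "local_dom (map_prod g f) (times_chart n c) (times_chart n' d) = std_simplex n \<times> local_dom f c d"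
    using inv assms inj by (auto simp: local_dom_iff cimg_times_chart)
  show "local_rep (map_prod g f) (times_chart n c) (times_chart n' d) x = map_prod g (local_rep f c d) x"
    if "x \<in> std_simplex n \<times> cimg c"
    using inv[OF that] by (simp add: local_rep_eq map_prod_def case_prod_unfold)
qed

lemma smooth_on_times_chart:
  assumes M: "smooth_manifold M" and N: "smooth_manifold N" and f: "smooth_map M N f"
    and g: "bounded_linear g" "g ` std_simplex n \<subseteq> std_simplex n'" and c: "c \<in> atlas M" "d \<in> atlas N"
  shows "smooth_on (local_dom (map_prod g f) (times_chart n c) (times_chart n' d))
     (local_rep (map_prod g f) (times_chart n c) (times_chart n' d))"
proof -
  have rM: "regular_charted M" and rN: "regular_charted N" using M N regular_charted_manifold by auto
  have ci: "inj_on (cmap c) (cdom c)" by (rule regular_chart_inj[OF rM c(1)])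
  have 1: "smooth_on (std_simplex n \<times> local_dom f c d) (\<lambda>x. local_rep f c d (snd x))"
    by (rule smooth_on_compose[OF smooth_on_bounded_linear[OF bounded_linear_snd] smooth_map_local[OF f c] _
          tangential_local_dom[OF rM rN smooth_map_continuous[OF f] c]]) auto
  have 2: "smooth_on (std_simplex n \<times> local_dom f c d) (\<lambda>x. g (fst x))"
    by (rule smooth_on_compose_linear[OF g(1) smooth_on_bounded_linear[OF bounded_linear_fst]])
  have "smooth_on (std_simplex n \<times> local_dom f c d) (\<lambda>x. (g (fst x), local_rep f c d (snd x)))"
    by (rule smooth_on_Pair[OF 2 1])
  then show ?thesis
    unfolding local_rep_times_chart(1)[OF ci g(2)]
  proof (rule smooth_on_cong[THEN iffD1, rotated])
    fix x assume "x \<in> std_simplex n \<times> local_dom f c d"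
    then have "x \<in> std_simplex n \<times> cimg c" using local_dom_subset by fastforce
    then show "(g (fst x), local_rep f c d (snd x)) = local_rep (map_prod g f) (times_chart n c) (times_chart n' d) x"
      unfolding local_rep_times_chart(2)[OF ci g(2) \<open>x \<in> std_simplex n \<times> cimg c\<close>]
      by (simp add: map_prod_def case_prod_unfold)
  qed
qed

lemma simplex_times_atlas: "atlas (simplex_times n M) = times_chart n ` atlas M"
  by (simp add: simplex_times_def)

lemma simplex_times_ctop: "ctop (simplex_times n M) = prod_topology (top_of_set (std_simplex n)) (ctop M)"
  by (simp add: simplex_times_def)

lemma regular_charted_simplex_times:
  assumes M: "smooth_manifold M"
  shows "regular_charted (simplex_times n M)"
  unfolding regular_charted_def simplex_times_ctop
proof (intro conjI ballI)
  show "(\<Union>c\<in>atlas (simplex_times n M). cdom c) = topspace (prod_topology (top_of_set (std_simplex n)) (ctop M))"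
    using M by (auto simp: simplex_times_atlas smooth_manifold_def)
  fix c' assume "c' \<in> atlas (simplex_times n M)"
  then obtain c where c: "c' = times_chart n c" "c \<in> atlas M" by (auto simp: simplex_times_atlas)
  show "openin (prod_topology (top_of_set (std_simplex n)) (ctop M)) (cdom c')"
    using manifold_chart_open[OF M c(2)] by (simp add: c openin_prod_Times_iff)
  show "tangential (cimg c') (ctan c')"
    unfolding c cimg_times_chart using tangential_Times[OF tangential_std_simplex manifold_chart_tangential[OF M c(2)]] by simp
  obtain g where g: "homeomorphic_maps (subtopology (ctop M) (cdom c)) (top_of_set (cimg c)) (cmap c) g"
    using manifold_chart_homeo[OF M c(2)] homeomorphic_map_maps by blast
  have "homeomorphic_maps (top_of_set (std_simplex n)) (top_of_set (std_simplex n)) id id"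
    by (simp add: homeomorphic_maps_id)
  with g have "homeomorphic_maps (prod_topology (top_of_set (std_simplex n)) (subtopology (ctop M) (cdom c)))
     (prod_topology (top_of_set (std_simplex n)) (top_of_set (cimg c))) (\<lambda>(x, y). (id x, cmap c y)) (\<lambda>(x, y). (id x, g y))"
    by (subst homeomorphic_maps_prod) blast
  moreover have "(\<lambda>(x, y). (id x, cmap c y)) = cmap c'" by (auto simp: c)
  ultimately have "homeomorphic_map (prod_topology (top_of_set (std_simplex n)) (subtopology (ctop M) (cdom c)))
     (prod_topology (top_of_set (std_simplex n)) (top_of_set (cimg c))) (cmap c')"
    using homeomorphic_map_maps by metis
  moreover have "prod_topology (top_of_set (std_simplex n)) (subtopology (ctop M) (cdom c)) =
     subtopology (prod_topology (top_of_set (std_simplex n)) (ctop M)) (cdom c')"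
    by (simp add: c subtopology_Times subtopology_subtopology)
  moreover have "prod_topology (top_of_set (std_simplex n)) (top_of_set (cimg c)) = top_of_set (cimg c')"
    unfolding c cimg_times_chart by simp
  ultimately show "homeomorphic_map (subtopology (prod_topology (top_of_set (std_simplex n)) (ctop M)) (cdom c'))
      (top_of_set (cimg c')) (cmap c')" by simp
  fix d' assume "d' \<in> atlas (simplex_times n M)"
  then obtain d where d: "d' = times_chart n d" "d \<in> atlas M" by (auto simp: simplex_times_atlas)
  have "smooth_map M M id" by (rule smooth_map_id[OF regular_charted_manifold[OF M]])
  then have "smooth_on (local_dom (map_prod id id) (times_chart n c) (times_chart n d))
     (local_rep (map_prod id id) (times_chart n c) (times_chart n d))"
    by (intro smooth_on_times_chart[OF M M]) (use c d in \<open>auto simp: id_def bounded_linear_ident\<close>)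
  then show "smooth_on (local_dom id c' d') (local_rep id c' d')"
    by (simp add: c d prod.map_id0)
qed

lemma smooth_map_prod:
  assumes M: "smooth_manifold M" and N: "smooth_manifold N" and f: "smooth_map M N f"
    and g: "bounded_linear g" "g ` std_simplex n \<subseteq> std_simplex n'"
  shows "smooth_map (simplex_times n M) (simplex_times n' N) (map_prod g f)"
  unfolding smooth_map_def
proof (intro conjI ballI)
  have "continuous_map (top_of_set (std_simplex n)) (top_of_set (std_simplex n')) g"
    using g by (auto simp: continuous_map_in_subtopology linear_continuous_on)
  then have "continuous_map (ctop (simplex_times n M)) (ctop (simplex_times n' N)) (\<lambda>(x, y). (g x, f y))"
    unfolding simplex_times_ctop using smooth_map_continuous[OF f] by (subst continuous_map_prod_top) simp
  then show "continuous_map (ctop (simplex_times n M)) (ctop (simplex_times n' N)) (map_prod g f)"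
    by (simp add: map_prod_def)
qed (auto simp: simplex_times_atlas intro: smooth_on_times_chart[OF assms])

text \<open>The simplex has a single chart with the identity as coordinate map, so a linear map is
  its own local representative and its own derivative.\<close>

lemma smooth_map_simplex_linear:
  assumes g: "bounded_linear g" "g ` std_simplex n \<subseteq> std_simplex n'"
  shows "smooth_map (simplex_space n) (simplex_space n') g"
    and "x \<in> std_simplex n \<Longrightarrow> local_dom g (simplex_chart n) (simplex_chart n') = std_simplex n"
    and "x \<in> std_simplex n \<Longrightarrow> local_rep g (simplex_chart n) (simplex_chart n') x = g x"
    and "x \<in> std_simplex n \<Longrightarrow> v \<in> simplex_tan n \<Longrightarrow> local_deriv g (simplex_chart n) (simplex_chart n') x v = g v"
proof -
  have inv: "inv_into (std_simplex n) id x = x" if "x \<in> std_simplex n" for x :: coords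
    using inv_into_f_f[of id "std_simplex n" x] that by simp
  have 1: "local_dom g (simplex_chart n) (simplex_chart n') = std_simplex n"
    using g by (auto simp: local_dom_def simplex_chart_def)
  have 2: "local_rep g (simplex_chart n) (simplex_chart n') x = g x" if "x \<in> std_simplex n" for x
    using inv[OF that] by (simp add: local_rep_def simplex_chart_def)
  show "local_dom g (simplex_chart n) (simplex_chart n') = std_simplex n" by (rule 1)
  show "local_rep g (simplex_chart n) (simplex_chart n') x = g x" if "x \<in> std_simplex n" by (rule 2[OF that])
  show "smooth_map (simplex_space n) (simplex_space n') g"
    unfolding smooth_map_def
  proof (intro conjI ballI)
    show "continuous_map (ctop (simplex_space n)) (ctop (simplex_space n')) g"
      using g by (auto simp: simplex_space_def continuous_map_in_subtopology linear_continuous_on)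
    fix c d assume "c \<in> atlas (simplex_space n)" "d \<in> atlas (simplex_space n')"
    then have cd: "c = simplex_chart n" "d = simplex_chart n'" by (auto simp: simplex_space_def)
    have "smooth_on (std_simplex n) (local_rep g (simplex_chart n) (simplex_chart n'))"
      by (rule smooth_on_cong[THEN iffD2, OF 2 smooth_on_bounded_linear[OF g(1)]])
    then show "smooth_on (local_dom g c d) (local_rep g c d)"
      by (simp only: cd 1)
  qed
  show "local_deriv g (simplex_chart n) (simplex_chart n') x v = g v" if "x \<in> std_simplex n" "v \<in> simplex_tan n"
    unfolding local_deriv_def 1
  proof (rule frechet_derivative_tangential[OF tangential_std_simplex that])
    have "(g has_derivative g) (at x within std_simplex n)"
      by (rule bounded_linear_imp_has_derivative[OF g(1)])
    then show "(local_rep g (simplex_chart n) (simplex_chart n') has_derivative g) (at x within std_simplex n)"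
      by (rule has_derivative_transform[OF that(1) 2, rotated])
  qed
qed

text \<open>\<open>drop_coord i\<close> maps only the \<open>i\<close>-th face, not the whole
  simplex, into the simplex of lower dimension, so this is not a composite of smooth maps. The claim
  holds in charts because the map is linear on the simplex factor and leaves the manifold factor
  alone.\<close>

lemma smooth_map_drop_coord:
  assumes M: "smooth_manifold M" and \<tau>: "smooth_map (simplex_space k) (simplex_times (Suc n) M) \<tau>"
    and i: "i \<le> Suc n" and 0: "\<And>t. t \<in> std_simplex k \<Longrightarrow> lk (fst (\<tau> t)) i = 0"
  shows "smooth_map (simplex_space k) (simplex_times n M) (map_prod (drop_coord i) id \<circ> \<tau>)"
  unfolding smooth_map_def
proof (intro conjI ballI)
  have \<tau>c: "continuous_map (top_of_set (std_simplex k)) (top_of_set (std_simplex (Suc n))) (fst \<circ> \<tau>)"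
    "continuous_map (top_of_set (std_simplex k)) (ctop M) (snd \<circ> \<tau>)"
    using smooth_map_continuous[OF \<tau>]
    by (auto simp: simplex_space_def simplex_times_ctop continuous_map_pairwise)
  have in_simplex: "drop_coord i (fst (\<tau> t)) \<in> std_simplex n" if "t \<in> std_simplex k" for t
    using \<tau>c(1) that 0[OF that] i by (intro drop_coord_in_simplex) (auto simp: continuous_map_def Pi_iff)
  have "continuous_on (std_simplex k) (\<lambda>t. drop_coord i (fst (\<tau> t)))"
    using \<tau>c(1) by (intro bounded_linear.continuous_on[OF bounded_linear_drop_coord])
      (simp add: continuous_map_in_subtopology comp_def)
  then have "continuous_map (top_of_set (std_simplex k)) (top_of_set (std_simplex n)) (\<lambda>t. drop_coord i (fst (\<tau> t)))"
    using in_simplex by (auto simp: continuous_map_in_subtopology)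
  then show "continuous_map (ctop (simplex_space k)) (ctop (simplex_times n M)) (map_prod (drop_coord i) id \<circ> \<tau>)"
    using \<tau>c(2) by (simp add: simplex_space_def simplex_times_ctop continuous_map_pairwise comp_def)
  fix c d' assume "c \<in> atlas (simplex_space k)" "d' \<in> atlas (simplex_times n M)"
  then obtain d where c: "c = simplex_chart k" and d: "d' = times_chart n d" "d \<in> atlas M"
    by (auto simp: simplex_space_def simplex_times_atlas)
  let ?d = "times_chart (Suc n) d"
  have "fst (\<tau> t) \<in> std_simplex (Suc n)" if "t \<in> std_simplex k" for t
    using \<tau>c(1) that by (auto simp: continuous_map_def Pi_iff)
  then have "map_prod (drop_coord i) id (\<tau> t) \<in> std_simplex n \<times> cdom d \<longleftrightarrow> \<tau> t \<in> std_simplex (Suc n) \<times> cdom d"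
    if "t \<in> std_simplex k" for t
    using in_simplex[OF that] that by (cases "\<tau> t") fastforce
  note mem = this
  have "std_simplex k \<inter> (map_prod (drop_coord i) id \<circ> \<tau>) -` (std_simplex n \<times> cdom d) =
      std_simplex k \<inter> \<tau> -` (std_simplex (Suc n) \<times> cdom d)"
    by (rule Set.set_eqI) (simp only: Int_iff vimage_eq comp_apply mem cong: conj_cong)
  \<comment> \<open>Both charts see the same part of the domain, since only the manifold component
    decides.\<close>
  then have 1: "local_dom (map_prod (drop_coord i) id \<circ> \<tau>) c d' = local_dom \<tau> c ?d"
    unfolding local_dom_def c d simplex_chart_def chart.simps by (rule arg_cong)
  have 2: "local_rep (map_prod (drop_coord i) id \<circ> \<tau>) c d' = (\<lambda>x. map_prod (drop_coord i) id (local_rep \<tau> c ?d x))"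
    by (simp add: local_rep_def d fun_eq_iff map_prod_def case_prod_unfold)
  have "bounded_linear (map_prod (drop_coord i) (id :: coords \<Rightarrow> coords))"
    using bounded_linear_Pair[OF bounded_linear_compose[OF bounded_linear_drop_coord bounded_linear_fst] bounded_linear_snd]
    by (simp add: map_prod_def case_prod_unfold)
  moreover have "smooth_on (local_dom \<tau> c ?d) (local_rep \<tau> c ?d)"
    by (rule smooth_map_local[OF \<tau>]) (use c d in \<open>auto simp: simplex_space_def simplex_times_atlas\<close>)
  ultimately show "smooth_on (local_dom (map_prod (drop_coord i) id \<circ> \<tau>) c d') (local_rep (map_prod (drop_coord i) id \<circ> \<tau>) c d')"
    unfolding 1 2 by (rule smooth_on_compose_linear)
qed

section \<open>Integration over simplices and Stokes' theorem\<close>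

interpretation lborel_prod: product_sigma_finite "\<lambda>_::nat. lborel :: real measure"
  by unfold_locales

section \<open>Integrals of functions over the standard simplex\<close>

lemma lookup_bary: "lk (bary k x) j = (if j = 0 then 1 - (\<Sum>i\<in>{1..k}. x i) else if j \<le> k then x j else 0)"
proof -
  have "(\<Sum>i=1..k. lk (Poly_Mapping.single i (x i)) j) = (\<Sum>i\<in>{1..k}. if i = j then x i else 0)"
    by (rule sum.cong) (auto simp: lookup_single when_def)
  then show ?thesis
    by (auto simp: bary_def lookup_add lookup_sum_coords lookup_single when_def)
qed

lemma bary_in_simplex: "bary k x \<in> std_simplex k \<longleftrightarrow> (\<forall>i\<in>{1..k}. 0 \<le> x i) \<and> (\<Sum>i\<in>{1..k}. x i) \<le> 1"
proof
  assume "bary k x \<in> std_simplex k"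
  note * = std_simplexD(1)[OF this]
  have "0 \<le> x i" if "i \<in> {1..k}" for i using *[of i] that by (simp add: lookup_bary)
  moreover have "(\<Sum>i\<in>{1..k}. x i) \<le> 1" using *[of 0] by (simp add: lookup_bary)
  ultimately show "(\<forall>i\<in>{1..k}. 0 \<le> x i) \<and> (\<Sum>i\<in>{1..k}. x i) \<le> 1" by blast
next
  assume x: "(\<forall>i\<in>{1..k}. 0 \<le> x i) \<and> (\<Sum>i\<in>{1..k}. x i) \<le> 1"
  have "{..k} = insert 0 {1..k}" by auto
  then have "(\<Sum>i\<le>k. lk (bary k x) i) = 1"
    by (simp add: lookup_bary)
  then show "bary k x \<in> std_simplex k"
    by (intro std_simplexI) (use x in \<open>auto simp: lookup_bary\<close>)
qed

lemma bary_cong: "(\<And>i. i \<in> {1..k} \<Longrightarrow> x i = y i) \<Longrightarrow> bary k x = bary k y"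
  by (rule coords_eqI) (auto simp: lookup_bary intro!: sum.cong)

lemma bary_affine: "bary k x = Poly_Mapping.single 0 1 + (\<Sum>i\<in>{1..k}. x i *\<^sub>R edge i)"
proof (rule coords_eqI)
  fix j
  have "lk (\<Sum>i\<in>{1..k}. x i *\<^sub>R edge i) j = (\<Sum>i\<in>{1..k}. (if i = j then x i else 0) - (if j = 0 then x i else 0))"
    unfolding lookup_sum_coords
    by (rule sum.cong) (auto simp: lookup_scaleR lookup_minus lookup_single lookup_one when_def)
  also have "\<dots> = (\<Sum>i\<in>{1..k}. if i = j then x i else 0) - (\<Sum>i\<in>{1..k}. if j = 0 then x i else 0)"
    by (rule sum_subtractf)
  finally show "lk (bary k x) j = lk (Poly_Mapping.single 0 1 + (\<Sum>i\<in>{1..k}. x i *\<^sub>R edge i)) j"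
    by (auto simp: lookup_bary lookup_add lookup_single lookup_one when_def)
qed

lemma continuous_on_bary: "continuous_on UNIV (bary k)"
  unfolding bary_affine by (intro continuous_intros continuous_on_product_coordinates)

lemma closed_std_simplex: "closed (std_simplex n)"
proof -
  have "std_simplex n = {t. (\<forall>i. 0 \<le> lk t i) \<and> (\<forall>i. n < i \<longrightarrow> lk t i = 0) \<and> (\<Sum>i\<le>n. lk t i) = 1}"
    using std_simplexD std_simplexI by blast
  moreover have "closed {t. (\<forall>i. 0 \<le> lk t i) \<and> (\<forall>i. n < i \<longrightarrow> lk t i = 0) \<and> (\<Sum>i\<le>n. lk t i) = 1}"
    by (intro closed_Collect_conj closed_Collect_all closed_Collect_imp closed_Collect_le closed_Collect_eq
        open_Collect_const continuous_intros linear_continuous_on bounded_linear_lookup)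
  ultimately show ?thesis by simp
qed

text \<open>In an infinite-dimensional space closed and bounded is not enough; the simplex is
  compact as a closed subset of the convex hull of its finitely many vertices.\<close>

lemma compact_std_simplex: "compact (std_simplex n)"
proof -
  let ?V = "(\<lambda>i. Poly_Mapping.single i (1::real)) ` {..n}"
  have "std_simplex n \<subseteq> convex hull ?V"
  proof
    fix t assume t: "t \<in> std_simplex n"
    have "t = (\<Sum>i\<in>{..n}. lk t i *\<^sub>R Poly_Mapping.single i 1)"
    proof (rule coords_eqI)
      fix k
      have "lk (\<Sum>i\<in>{..n}. lk t i *\<^sub>R Poly_Mapping.single i 1) k = (\<Sum>i\<in>{..n}. if i = k then lk t i else 0)"
        unfolding lookup_sum_coords by (rule sum.cong) (auto simp: lookup_scaleR lookup_single when_def)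
      also have "\<dots> = lk t k" using std_simplexD(3)[OF t, of k] by (cases "k \<le> n") auto
      finally show "lk t k = lk (\<Sum>i\<in>{..n}. lk t i *\<^sub>R Poly_Mapping.single i 1) k" by (rule sym)
    qed
    also have "\<dots> \<in> convex hull ?V"
      by (rule convex_sum) (use std_simplexD[OF t] in \<open>auto intro: hull_inc\<close>)
    finally show "t \<in> convex hull ?V" .
  qed
  moreover have "compact (convex hull ?V)" by (rule finite_imp_compact_convex_hull) simp
  ultimately show ?thesis
    using compact_Int_closed[OF _ closed_std_simplex, of "convex hull ?V" n] by (simp add: Int_absorb1)
qed

definition simplex_int :: "nat \<Rightarrow> (coords \<Rightarrow> complex) \<Rightarrow> complex" where
  "simplex_int k f = (LINT x | PiM {1..k} (\<lambda>_. lborel). (if bary k x \<in> std_simplex k then f (bary k x) else 0))"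

lemma simplex_int_cong: "(\<And>x. x \<in> std_simplex k \<Longrightarrow> f x = g x) \<Longrightarrow> simplex_int k f = simplex_int k g"
  unfolding simplex_int_def by (rule Bochner_Integration.integral_cong) auto

text \<open>Points of the product measure are \<open>undefined\<close> outside
  \<open>{1..k}\<close>, while \<open>bary k\<close> is continuous on all of
  \<open>nat \<Rightarrow> real\<close>. Padding with zeros, which does not affect
  \<open>bary k\<close>, connects the two.\<close>

lemma measurable_extend_zero:
  "(\<lambda>x i. if i \<in> {1..k} then x i else 0) \<in> measurable (PiM {1..k} (\<lambda>_::nat. lborel :: real measure)) borel"
proof -
  have "(\<lambda>x i. if i \<in> {1..k} then x i else 0) \<in>
    measurable (PiM {1..k} (\<lambda>_::nat. lborel :: real measure)) (PiM UNIV (\<lambda>_. borel))"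
  proof (rule measurable_PiM_single')
    fix i :: nat
    show "(\<lambda>x. if i \<in> {1..k} then x i else 0) \<in> borel_measurable (PiM {1..k} (\<lambda>_::nat. lborel :: real measure))"
    proof (cases "i \<in> {1..k}")
      case True
      then show ?thesis
        using measurable_component_singleton[OF True, of "\<lambda>_. lborel :: real measure"] by simp
    next
      case False
      then show ?thesis by (simp only: if_False) simp
    qed
  qed simp
  then show ?thesis
    using measurable_cong_sets[OF refl sets_PiM_equal_borel] by blast
qed

lemma simplex_int_measurable:
  assumes "continuous_on (std_simplex k) f"
  shows "(\<lambda>x. if bary k x \<in> std_simplex k then f (bary k x) else 0 :: complex) \<in> borel_measurable (PiM {1..k} (\<lambda>_. lborel))"
proof -
  let ?D = "bary k -` std_simplex k"
  have "isCont (bary k) x" for x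
    using continuous_on_bary[of k] by (simp add: continuous_on_eq_continuous_at)
  then have "closed ?D" by (rule continuous_closed_vimage[OF closed_std_simplex])
  then have "?D \<in> sets borel" by simp
  moreover have "continuous_on ?D (\<lambda>x. f (bary k x))"
    by (rule continuous_on_compose2[OF assms continuous_on_subset[OF continuous_on_bary]]) auto
  ultimately have "(\<lambda>x. indicator ?D x *\<^sub>R f (bary k x)) \<in> borel_measurable borel"
    by (rule borel_measurable_continuous_on_indicator)
  from measurable_compose[OF measurable_extend_zero this]
  have "(\<lambda>x. indicator ?D (\<lambda>i. if i \<in> {1..k} then x i else 0) *\<^sub>R f (bary k (\<lambda>i. if i \<in> {1..k} then x i else 0)))
     \<in> borel_measurable (PiM {1..k} (\<lambda>_. lborel))" .
  moreover have "indicator ?D (\<lambda>i. if i \<in> {1..k} then x i else 0) *\<^sub>R f (bary k (\<lambda>i. if i \<in> {1..k} then x i else 0)) =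
      (if bary k x \<in> std_simplex k then f (bary k x) else 0)" for x
  proof -
    have "bary k (\<lambda>i. if i \<in> {1..k} then x i else 0) = bary k x" by (rule bary_cong) simp
    then show ?thesis by (simp add: indicator_def)
  qed
  ultimately show ?thesis by (simp only:)
qed

lemma simplex_int_integrable:
  assumes "continuous_on (std_simplex k) f"
  shows "integrable (PiM {1..k} (\<lambda>_. lborel)) (\<lambda>x. if bary k x \<in> std_simplex k then f (bary k x) else 0 :: complex)"
proof -
  have "bounded (f ` std_simplex k)"
    by (rule compact_imp_bounded[OF compact_continuous_image[OF assms compact_std_simplex]])
  then obtain B where B: "\<And>x. x \<in> std_simplex k \<Longrightarrow> norm (f x) \<le> B" unfolding bounded_iff by auto
  let ?A = "PiE {1..k} (\<lambda>_. {0..1::real})"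
  show ?thesis
  \<comment> \<open>A bounded measurable function that vanishes outside the unit cube, a set of
    finite measure.\<close>
  proof (rule integrableI_bounded_set[where A = ?A and B = "max B 0"])
    show "?A \<in> sets (PiM {1..k} (\<lambda>_. lborel))" by (rule sets_PiM_I_finite) auto
    have "emeasure (PiM {1..k} (\<lambda>_. lborel)) ?A = (\<Prod>i\<in>{1..k}. emeasure lborel {0..1::real})"
      by (rule lborel_prod.emeasure_PiM) auto
    then show "emeasure (PiM {1..k} (\<lambda>_. lborel)) ?A < \<infinity>" by simp
    show "(\<lambda>x. if bary k x \<in> std_simplex k then f (bary k x) else 0) \<in> borel_measurable (PiM {1..k} (\<lambda>_. lborel))"
      by (rule simplex_int_measurable[OF assms])
    show "AE x in PiM {1..k} (\<lambda>_. lborel). x \<in> ?A \<longrightarrow> norm (if bary k x \<in> std_simplex k then f (bary k x) else 0) \<le> max B 0"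
      using B by (auto simp: le_max_iff_disj)
    have "x \<in> ?A" if x: "x \<in> space (PiM {1..k} (\<lambda>_. lborel))" and in_simplex: "bary k x \<in> std_simplex k" for x
    proof -
      have "0 \<le> x i \<and> x i \<le> 1" if "i \<in> {1..k}" for i
        using std_simplexD(1,2)[OF in_simplex, of i] that by (auto simp: lookup_bary split: if_splits)
      then show ?thesis using x by (auto simp: space_PiM PiE_iff)
    qed
    then show "AE x in PiM {1..k} (\<lambda>_. lborel). x \<notin> ?A \<longrightarrow> (if bary k x \<in> std_simplex k then f (bary k x) else 0) = 0"
      by (intro AE_I2) auto
  qed
qed

lemma simplex_int_add:
  assumes "continuous_on (std_simplex k) f" "continuous_on (std_simplex k) g"
  shows "simplex_int k (\<lambda>x. f x + g x) = simplex_int k f + simplex_int k g"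
  unfolding simplex_int_def
  by (subst Bochner_Integration.integral_add[OF simplex_int_integrable[OF assms(1)] simplex_int_integrable[OF assms(2)], symmetric])
     (rule Bochner_Integration.integral_cong; simp)

lemma simplex_int_mult: "simplex_int k (\<lambda>x. a * f x) = a * simplex_int k f"
proof -
  have "simplex_int k (\<lambda>x. a * f x) = (LINT x | PiM {1..k} (\<lambda>_. lborel). a * (if bary k x \<in> std_simplex k then f (bary k x) else 0))"
    unfolding simplex_int_def by (rule Bochner_Integration.integral_cong) auto
  then show ?thesis by (simp add: simplex_int_def)
qed

lemma simplex_int_diff:
  assumes "continuous_on (std_simplex k) f" "continuous_on (std_simplex k) g"
  shows "simplex_int k (\<lambda>x. f x - g x) = simplex_int k f - simplex_int k g"
  using simplex_int_add[OF assms(1) continuous_on_mult_left[OF assms(2), of "-1"]] simplex_int_mult[of k "-1" g]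
  by simp

lemma simplex_int_zero: "simplex_int k (\<lambda>x. 0) = 0"
  by (simp add: simplex_int_def)

lemma simplex_int_sum:
  assumes "\<And>i. i \<in> I \<Longrightarrow> continuous_on (std_simplex k) (f i)"
  shows "simplex_int k (\<lambda>x. \<Sum>i\<in>I. f i x) = (\<Sum>i\<in>I. simplex_int k (f i))"
  using assms
  by (induction I rule: infinite_finite_induct)
     (auto simp: simplex_int_zero simplex_int_add continuous_on_sum)

section \<open>Symmetry of the simplex and integration along edges\<close>

definition swap_vertex :: "nat \<Rightarrow> coords \<Rightarrow> coords"
  where "swap_vertex j t = t - (lk t j - lk t 0) *\<^sub>R edge j"

lemma lookup_swap_vertex: "lk (swap_vertex j t) l = (if l = j then lk t 0 else if l = 0 then lk t j else lk t l)"
  by (auto simp: swap_vertex_def lookup_minus lookup_scaleR lookup_single lookup_one when_def)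

lemma bounded_linear_swap_vertex: "bounded_linear (swap_vertex j)"
  unfolding swap_vertex_def
  by (intro bounded_linear_sub bounded_linear_ident bounded_linear_compose[OF bounded_linear_scaleR_left] bounded_linear_lookup)

lemma swap_vertex_0: "swap_vertex 0 t = t"
  by (rule coords_eqI) (simp add: lookup_swap_vertex)

lemma swap_vertex_in_simplex:
  assumes "j \<le> k" "t \<in> std_simplex k"
  shows "swap_vertex j t \<in> std_simplex k"
proof (rule std_simplexI)
  show "(\<Sum>i\<le>k. lk (swap_vertex j t) i) = 1"
  proof (cases "j = 0")
    case False
    have "{..k} = insert 0 (insert j ({..k} - {0, j}))" using assms by auto
    then have s: "(\<Sum>i\<le>k. h i) = h 0 + (h j + (\<Sum>i\<in>{..k} - {0, j}. h i))" for h :: "nat \<Rightarrow> real"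
      using False by (metis Diff_iff finite_Diff finite_atMost finite_insert insertCI insertE sum.insert)
    have "(\<Sum>i\<in>{..k} - {0, j}. lk (swap_vertex j t) i) = (\<Sum>i\<in>{..k} - {0, j}. lk t i)"
      by (rule sum.cong) (auto simp: lookup_swap_vertex)
    then show ?thesis
      using std_simplexD(4)[OF assms(2)] s[of "lk t"] s[of "lk (swap_vertex j t)"] False by (simp add: lookup_swap_vertex)
  qed (use std_simplexD(4)[OF assms(2)] in \<open>simp add: swap_vertex_0\<close>)
qed (use assms std_simplexD in \<open>auto simp: lookup_swap_vertex\<close>)

lemma swap_vertex_swap_vertex: "swap_vertex j (swap_vertex j t) = t"
  by (rule coords_eqI) (simp add: lookup_swap_vertex)

text \<open>Coordinate 0 is not an integration variable but 1 minus the sum of all of them. With the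
  other variables fixed, exchanging it with coordinate \<open>j\<close> reflects the single variable
  \<open>j\<close>, and Lebesgue measure on the line is invariant under reflections.\<close>

lemma simplex_int_swap_vertex:
  assumes "continuous_on (std_simplex k) f" "j \<le> k"
  shows "simplex_int k (\<lambda>x. f (swap_vertex j x)) = simplex_int k f"
proof (cases "j = 0")
  case False
  define J where "J = {1..k} - {j}"
  have J: "finite J" "j \<notin> J" "insert j J = {1..k}" using assms False by (auto simp: J_def)
  let ?G = "\<lambda>f x. if bary k x \<in> std_simplex k then f (bary k x) else 0 :: complex"
  have c: "continuous_on (std_simplex k) (\<lambda>x. f (swap_vertex j x))"
    by (rule continuous_on_compose2[OF assms(1) linear_continuous_on[OF bounded_linear_swap_vertex]])
       (use swap_vertex_in_simplex[OF assms(2)] in auto)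
  have int: "simplex_int k h = (\<integral>x. (\<integral>y. ?G h (x(j := y)) \<partial>lborel) \<partial>PiM J (\<lambda>_. lborel))"
    if "continuous_on (std_simplex k) h" for h
    unfolding simplex_int_def
    using lborel_prod.product_integral_insert[OF J(1,2), of "?G h"] simplex_int_integrable[OF that] J(3) by simp
  have b: "bary k (x(j := (1 - (\<Sum>i\<in>J. x i)) - r)) = swap_vertex j (bary k (x(j := r)))" for x r
  proof (rule coords_eqI)
    fix l
    have s: "(\<Sum>i\<in>{1..k}. (x(j := r)) i) = r + (\<Sum>i\<in>J. x i)" for r
    proof -
      have "(\<Sum>i\<in>J. (x(j := r)) i) = (\<Sum>i\<in>J. x i)" by (rule sum.cong) (use J(2) in auto)
      then show ?thesis unfolding J(3)[symmetric] using J(1,2) by (simp add: sum.insert)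
    qed
    show "lk (bary k (x(j := (1 - (\<Sum>i\<in>J. x i)) - r))) l = lk (swap_vertex j (bary k (x(j := r)))) l"
      using False assms(2) unfolding lookup_swap_vertex lookup_bary s by auto
  qed
  have "(\<integral>y. ?G (\<lambda>x. f (swap_vertex j x)) (x(j := y)) \<partial>lborel) = (\<integral>y. ?G f (x(j := y)) \<partial>lborel)" for x
  proof -
    \<comment> \<open>The reflection has slope -1, so the substitution contributes the factor
      1.\<close>
    have "(\<integral>y. ?G f (x(j := y)) \<partial>lborel) = (\<integral>y. ?G f (x(j := (1 - (\<Sum>i\<in>J. x i)) + (-1) * y)) \<partial>lborel)"
      by (subst lborel_integral_real_affine[of "-1" _ "1 - (\<Sum>i\<in>J. x i)"]) auto
    also have "\<dots> = (\<integral>y. ?G (\<lambda>x. f (swap_vertex j x)) (x(j := y)) \<partial>lborel)"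
    proof (rule Bochner_Integration.integral_cong[OF refl])
      fix y
      have m: "swap_vertex j z \<in> std_simplex k \<longleftrightarrow> z \<in> std_simplex k" for z
        using swap_vertex_in_simplex[OF assms(2)] swap_vertex_swap_vertex by metis
      show "?G f (x(j := (1 - (\<Sum>i\<in>J. x i)) + (-1) * y)) = ?G (\<lambda>x. f (swap_vertex j x)) (x(j := y))"
        using b[of x y] m by simp
    qed
    finally show ?thesis by simp
  qed
  then show ?thesis by (simp add: int[OF c] int[OF assms(1)])
qed (simp add: swap_vertex_0)

text \<open>Deleting variable \<open>i\<close> from \<open>{1..Suc k}\<close> leaves the image of
  \<open>{1..k}\<close> under \<open>skip i\<close>; renaming the variables brings back the product
  measure that defines integrals over the lower simplex.\<close>

lemma PiM_lborel_reindex: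
  fixes h :: "nat \<Rightarrow> nat"
  assumes "finite K" "inj_on h K"
  defines "\<phi> \<equiv> \<lambda>u. \<lambda>j\<in>h ` K. u (inv_into K h j)"
  shows "distr (PiM K (\<lambda>_. lborel)) (PiM (h ` K) (\<lambda>_. lborel)) \<phi> = PiM (h ` K) (\<lambda>_. lborel :: real measure)"
    and "\<phi> \<in> measurable (PiM K (\<lambda>_. lborel)) (PiM (h ` K) (\<lambda>_. lborel :: real measure))"
proof -
  show m: "\<phi> \<in> measurable (PiM K (\<lambda>_. lborel)) (PiM (h ` K) (\<lambda>_. lborel :: real measure))"
    unfolding \<phi>_def
  proof (rule measurable_restrict)
    fix j assume "j \<in> h ` K"
    then have "inv_into K h j \<in> K" by (rule inv_into_into)
    then show "(\<lambda>u. u (inv_into K h j)) \<in> measurable (PiM K (\<lambda>_. lborel)) (lborel :: real measure)"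
      by (rule measurable_component_singleton)
  qed
  show "distr (PiM K (\<lambda>_. lborel)) (PiM (h ` K) (\<lambda>_. lborel)) \<phi> = PiM (h ` K) (\<lambda>_. lborel :: real measure)"
  proof (rule lborel_prod.PiM_eqI)
    fix A :: "nat \<Rightarrow> real set" assume A: "\<And>i. i \<in> h ` K \<Longrightarrow> A i \<in> sets lborel"
    have "\<phi> -` PiE (h ` K) A \<inter> space (PiM K (\<lambda>_. lborel)) = PiE K (\<lambda>i. A (h i))"
      using assms(2) by (auto simp: \<phi>_def space_PiM PiE_iff)
    then have "emeasure (distr (PiM K (\<lambda>_. lborel)) (PiM (h ` K) (\<lambda>_. lborel)) \<phi>) (PiE (h ` K) A) =
      emeasure (PiM K (\<lambda>_. lborel)) (PiE K (\<lambda>i. A (h i)))"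
      using A assms(1) by (subst emeasure_distr[OF m]) (auto intro!: sets_PiM_I_finite)
    also have "\<dots> = (\<Prod>i\<in>K. emeasure lborel (A (h i)))"
      by (rule lborel_prod.emeasure_PiM) (use A assms(1) in auto)
    also have "\<dots> = (\<Prod>i\<in>h ` K. emeasure lborel (A i))"
      by (simp add: prod.reindex[OF assms(2)])
    finally show "emeasure (distr (PiM K (\<lambda>_. lborel)) (PiM (h ` K) (\<lambda>_. lborel)) \<phi>) (PiE (h ` K) A) =
      (\<Prod>i\<in>h ` K. emeasure lborel (A i))" .
  qed (use assms in auto)
qed

text \<open>Slices the simplex by lines parallel to \<open>edge i\<close>. Starting from a point of
  the \<open>i\<close>-th face, moving along \<open>edge i\<close> transfers weight from vertex 0 to
  vertex \<open>i\<close>, which is possible as long as weight at vertex 0 remains.\<close>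

lemma coface_plus_edge_in_simplex:
  assumes i: "i \<in> {1..Suc k}"
  shows "coface i (bary k u) + r *\<^sub>R edge i \<in> std_simplex (Suc k) \<longleftrightarrow>
    bary k u \<in> std_simplex k \<and> 0 \<le> r \<and> r \<le> lk (bary k u) 0"
proof -
  let ?y = "bary k u" and ?z = "coface i (bary k u) + r *\<^sub>R edge i"
  have z: "lk ?z l = (if l = 0 then lk ?y 0 - r else if l = i then r else lk (coface i ?y) l)" for l
    using i by (auto simp: lookup_add lookup_scaleR lookup_minus lookup_single lookup_one when_def lookup_coface simplical_face_def)
  have sk: "skip i l = 0 \<longleftrightarrow> l = 0" for l using i by (auto simp: skip_def)
  show ?thesis
  proof
    assume in_simplex: "?z \<in> std_simplex (Suc k)"
    have r: "0 \<le> r" "r \<le> lk ?y 0"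
      using std_simplexD(1)[OF in_simplex, of i] std_simplexD(1)[OF in_simplex, of 0] z i by auto
    have "0 \<le> lk ?y l" for l
    proof (cases "l = 0")
      case False
      then show ?thesis
        using std_simplexD(1)[OF in_simplex, of "skip i l"] z[of "skip i l"] sk[of l] skip_neq[of i l]
        by (simp add: lookup_coface_skip)
    qed (use r in simp)
    then have "?y \<in> std_simplex k"
      unfolding bary_in_simplex by (metis atLeastAtMost_iff diff_ge_0_iff_ge lookup_bary not_one_le_zero)
    then show "?y \<in> std_simplex k \<and> 0 \<le> r \<and> r \<le> lk ?y 0" using r by simp
  next
    assume y: "?y \<in> std_simplex k \<and> 0 \<le> r \<and> r \<le> lk ?y 0"
    then have cy: "coface i ?y \<in> std_simplex (Suc k)" using i by (intro coface_in_simplex) auto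
    show "?z \<in> std_simplex (Suc k)"
    proof (rule std_simplexI)
      have "edge i \<in> simplex_tan (Suc k)" using i by (intro edge_tan) auto
      then have "(\<Sum>l\<le>Suc k. lk (r *\<^sub>R edge i) l) = 0"
        using simplex_tanD(2)[OF subspace_scale[OF subspace_simplex_tan]] by blast
      then show "(\<Sum>l\<le>Suc k. lk ?z l) = 1"
        using std_simplexD(4)[OF cy] unfolding lookup_add sum.distrib by simp
    qed (use y z std_simplexD[OF cy] i in auto)
  qed
qed

text \<open>Fubini along these lines and the fundamental theorem on each slice. A slice starts in
  the \<open>i\<close>-th face and ends where coordinate 0 vanishes; that endpoint is the starting
  point with vertices 0 and \<open>i\<close> exchanged.\<close>

lemma simplex_int_derivative_edge:
  assumes f: "smooth_on (std_simplex (Suc k)) f" and i: "i \<in> {1..Suc k}"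
  shows "simplex_int (Suc k) (\<lambda>x. frechet_derivative f (at x within std_simplex (Suc k)) (edge i)) =
    simplex_int k (\<lambda>y. f (swap_vertex i (coface i y))) - simplex_int k (\<lambda>y. f (coface i y))"
proof -
  let ?S = "std_simplex (Suc k)"
  let ?g = "\<lambda>x. frechet_derivative f (at x within ?S) (edge i)"
  let ?G = "\<lambda>x. if bary (Suc k) x \<in> ?S then ?g (bary (Suc k) x) else 0"
  define J where "J = skip i ` {1..k}"
  have inj: "inj_on (skip i) {1..k}" by (rule inj_on_subset[OF inj_skip]) simp
  have "{..k} = insert 0 {1..k}" by auto
  then have "{..Suc k} - {i} = insert 0 J"
    using skip_image[of i k] i by (simp add: J_def) (simp add: skip_def)
  moreover have "0 \<notin> J" by (auto simp: J_def skip_def split: if_splits)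
  ultimately have "J = {..Suc k} - {i} - {0}" by auto
  also have "\<dots> = {1..Suc k} - {i}" by auto
  finally have Jeq: "J = {1..Suc k} - {i}" .
  have J: "finite J" "i \<notin> J" "insert i J = {1..Suc k}" using i unfolding Jeq by auto
  have edge: "edge i \<in> simplex_tan (Suc k)" using i by (intro edge_tan) auto
  have gc: "continuous_on ?S ?g"
    by (rule smooth_on_imp_continuous_on[OF smooth_on_frechet_derivative[OF tangential_std_simplex f edge]])
  let ?\<phi> = "\<lambda>u. \<lambda>j\<in>J. u (inv_into {1..k} (skip i) j)"
  \<comment> \<open>The renaming of variables below requires the inner integral to be measurable in
    the remaining ones.\<close>
  have meas: "(\<lambda>x. \<integral>r. ?G (x(i := r)) \<partial>lborel) \<in> borel_measurable (PiM J (\<lambda>_. lborel))"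
  proof (rule lborel.borel_measurable_lebesgue_integral)
    have "(\<lambda>(x, r). x(i := r)) \<in> measurable (PiM J (\<lambda>_. lborel) \<Otimes>\<^sub>M lborel) (PiM {1..Suc k} (\<lambda>_. lborel :: real measure))"
      using measurable_add_dim[of i J "\<lambda>_. lborel :: real measure"] J(3) by simp
    from measurable_compose[OF this simplex_int_measurable[OF gc]]
    show "(\<lambda>(x, r). ?G (x(i := r))) \<in> borel_measurable (PiM J (\<lambda>_. lborel) \<Otimes>\<^sub>M lborel)"
      by (rule back_subst[where P = "\<lambda>h. h \<in> _"]) (rule ext, simp split: prod.split)
  qed
  have "simplex_int (Suc k) ?g = (\<integral>x. (\<integral>r. ?G (x(i := r)) \<partial>lborel) \<partial>PiM J (\<lambda>_. lborel))"
    unfolding simplex_int_def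
    using lborel_prod.product_integral_insert[OF J(1,2), of ?G] simplex_int_integrable[OF gc] J(3) by simp
  also have "\<dots> = (\<integral>u. (\<integral>r. ?G ((?\<phi> u)(i := r)) \<partial>lborel) \<partial>PiM {1..k} (\<lambda>_. lborel))"
    using PiM_lborel_reindex[OF _ inj] integral_distr[OF PiM_lborel_reindex(2)[OF _ inj], folded J_def, OF _ meas]
    by (simp add: J_def)
  also have "\<dots> = (\<integral>u. (if bary k u \<in> std_simplex k then f (swap_vertex i (coface i (bary k u))) - f (coface i (bary k u)) else 0)
      \<partial>PiM {1..k} (\<lambda>_. lborel))"
  proof (rule Bochner_Integration.integral_cong[OF refl])
    fix u
    let ?y = "bary k u" and ?p = "\<lambda>r. coface i (bary k u) + r *\<^sub>R edge i"
    \<comment> \<open>The inserted variable \<open>r\<close> is coordinate \<open>i\<close>, so it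
      moves the point along \<open>edge i\<close> away from the \<open>i\<close>-th face.\<close>
    have p: "bary (Suc k) ((?\<phi> u)(i := r)) = ?p r" for r
    proof (rule coords_eqI)
      fix l
      have "(\<Sum>j\<in>J. ?\<phi> u j) = (\<Sum>j\<in>{1..k}. u j)"
        unfolding J_def by (subst sum.reindex[OF inj]) (auto simp: inv_into_f_f[OF inj, simplified] intro!: sum.cong)
      then have s: "(\<Sum>j\<in>{1..Suc k}. ((?\<phi> u)(i := r)) j) = r + (\<Sum>j\<in>{1..k}. u j)"
      proof -
        have "(\<Sum>j\<in>J. ((?\<phi> u)(i := r)) j) = (\<Sum>j\<in>J. ?\<phi> u j)" by (rule sum.cong) (use J(2) in auto)
        then show ?thesis unfolding J(3)[symmetric] using J(1,2) \<open>(\<Sum>j\<in>J. ?\<phi> u j) = (\<Sum>j\<in>{1..k}. u j)\<close>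
          by (simp add: sum.insert)
      qed
      consider "l = 0" | "l = i" | "l \<in> J" | "l > Suc k"
        unfolding Jeq by fastforce
      then show "lk (bary (Suc k) ((?\<phi> u)(i := r))) l = lk (?p r) l"
      proof cases
        case 1
        then show ?thesis using i unfolding lookup_bary s
          by (simp add: lookup_add lookup_scaleR lookup_minus lookup_single lookup_one lookup_coface simplical_face_def lookup_bary)
      next
        case 2
        then show ?thesis using i unfolding lookup_bary s
          by (simp add: lookup_add lookup_scaleR lookup_minus lookup_single lookup_one lookup_coface_same)
      next
        case l: 3
        then obtain j where 3: "j \<in> {1..k}" "l = skip i j" unfolding J_def by (elim imageE)
        note \<open>l \<in> J\<close>
        then have l: "l \<noteq> 0" "l \<noteq> i" "l \<le> Suc k" using J by auto
        have "?\<phi> u l = u j" using 3 inj \<open>l \<in> J\<close> by simp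
        moreover have "lk (?p r) l = u j"
          using 3 l by (simp add: lookup_add lookup_scaleR lookup_minus lookup_single lookup_one lookup_coface_skip lookup_bary)
        ultimately show ?thesis using l unfolding lookup_bary by simp
      next
        case 4
        then show ?thesis using i
          by (simp add: lookup_bary lookup_add lookup_scaleR lookup_minus lookup_single lookup_one lookup_coface simplical_face_def)
      qed
    qed
    note in_simplex = coface_plus_edge_in_simplex[OF i, of u]
    show "(\<integral>r. ?G ((?\<phi> u)(i := r)) \<partial>lborel) =
      (if ?y \<in> std_simplex k then f (swap_vertex i (coface i ?y)) - f (coface i ?y) else 0)"
    proof (cases "?y \<in> std_simplex k")
      case False
      then show ?thesis unfolding p in_simplex by simp
    next
      case True
      let ?c = "lk ?y 0"
      have c: "0 \<le> ?c" by (rule std_simplexD(1)[OF True])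
      have "(\<integral>r. ?G ((?\<phi> u)(i := r)) \<partial>lborel) = (\<integral>r. indicator {0..?c} r *\<^sub>R ?g (?p r) \<partial>lborel)"
        unfolding p in_simplex using True by (intro Bochner_Integration.integral_cong) (auto simp: indicator_def)
      also have "\<dots> = f (?p ?c) - f (?p 0)"
      proof (rule integral_FTC_Icc[OF c])
        have ps: "?p r \<in> ?S" if "r \<in> {0..?c}" for r using in_simplex True that by simp
        have pd: "(?p has_derivative (\<lambda>r. r *\<^sub>R edge i)) (at r within {0..?c})" for r
          by (auto intro!: derivative_eq_intros)
        show "((\<lambda>r. f (?p r)) has_vector_derivative ?g (?p r)) (at r within {0..?c})" if "0 \<le> r" "r \<le> ?c" for r
        proof -
          have fd: "(f has_derivative frechet_derivative f (at (?p r) within ?S)) (at (?p r) within ?p ` {0..?c})"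
            by (rule has_derivative_subset[OF smooth_on_has_derivative[OF f]]) (use ps that in auto)
          from has_derivative_in_compose[OF pd this]
          show ?thesis
            using has_derivative_linear[OF fd] by (simp add: has_vector_derivative_def linear_cmul)
        qed
        show "continuous_on {0..?c} (\<lambda>r. ?g (?p r))"
          by (rule continuous_on_compose2[OF gc]) (use ps in \<open>auto intro!: continuous_intros\<close>)
      qed
      also have "?p 0 = coface i ?y" by simp
      also have "?p ?c = swap_vertex i (coface i ?y)"
        using i by (simp add: swap_vertex_def lookup_coface_same) (simp add: lookup_coface simplical_face_def)
      finally show ?thesis by (simp only: True if_True)
    qed
  qed
  also have "\<dots> = simplex_int k (\<lambda>y. f (swap_vertex i (coface i y)) - f (coface i y))"
    by (simp add: simplex_int_def)
  also have "\<dots> = simplex_int k (\<lambda>y. f (swap_vertex i (coface i y))) - simplex_int k (\<lambda>y. f (coface i y))"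
  proof (rule simplex_int_diff)
    have fc: "continuous_on ?S f" by (rule smooth_on_imp_continuous_on[OF f])
    have sub: "coface i ` std_simplex k \<subseteq> ?S" "(\<lambda>y. swap_vertex i (coface i y)) ` std_simplex k \<subseteq> ?S"
      using coface_in_simplex swap_vertex_in_simplex i by auto
    show "continuous_on (std_simplex k) (\<lambda>y. f (swap_vertex i (coface i y)))"
      by (rule continuous_on_compose2[OF fc linear_continuous_on[OF bounded_linear_compose[OF bounded_linear_swap_vertex bounded_linear_coface]] sub(2)])
    show "continuous_on (std_simplex k) (\<lambda>y. f (coface i y))"
      by (rule continuous_on_compose2[OF fc linear_continuous_on[OF bounded_linear_coface] sub(1)])
  qed
  finally show ?thesis .
qed

abbreviation step :: "nat \<Rightarrow> coords" where
  "step i \<equiv> Poly_Mapping.single i 1 - Poly_Mapping.single (i - 1) 1"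

text \<open>Exchanging vertices 0 and \<open>i - 1\<close> turns \<open>edge i\<close> into
  \<open>step i\<close>, preserves integrals over the simplex, and acts on the two faces again by an
  exchange of vertices. So the edge case applies; for \<open>i = 1\<close> the exchange is the
  identity.\<close>

lemma simplex_int_derivative_step:
  assumes f: "smooth_on (std_simplex (Suc k)) f" and i: "i \<in> {1..Suc k}"
  shows "simplex_int (Suc k) (\<lambda>x. frechet_derivative f (at x within std_simplex (Suc k)) (step i)) =
    simplex_int k (\<lambda>y. f (coface (i - 1) y)) - simplex_int k (\<lambda>y. f (coface i y))"
proof -
  let ?S = "std_simplex (Suc k)"
  define s where "s = swap_vertex (i - 1)"
  have s: "bounded_linear s" unfolding s_def by (rule bounded_linear_swap_vertex)
  have ss: "s x \<in> ?S" if "x \<in> ?S" for x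
    unfolding s_def using i that by (intro swap_vertex_in_simplex) auto
  have stepT: "step i \<in> simplex_tan (Suc k)"
    using simplex_diff_tan[OF vertex_in_simplex vertex_in_simplex, of "i - 1" "Suc k" i] i by auto
  have edgeT: "edge i \<in> simplex_tan (Suc k)" using i by (intro edge_tan) auto
  have se: "s (edge i) = step i"
    unfolding s_def using i
    by (intro coords_eqI) (auto simp: lookup_swap_vertex lookup_minus lookup_single lookup_one when_def)
  have fc: "continuous_on ?S f" by (rule smooth_on_imp_continuous_on[OF f])
  have fs: "smooth_on ?S (\<lambda>x. f (s x))"
    by (rule smooth_on_compose[OF smooth_on_bounded_linear[OF s] f _ tangential_std_simplex]) (use ss in auto)
  have inv: "simplex_int k (\<lambda>y. f (coface j (s y))) = simplex_int k (\<lambda>y. f (coface j y))" if "j \<le> Suc k" for j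
    unfolding s_def
  proof (rule simplex_int_swap_vertex)
    show "continuous_on (std_simplex k) (\<lambda>y. f (coface j y))"
      by (rule continuous_on_compose2[OF fc linear_continuous_on[OF bounded_linear_coface]])
         (use coface_in_simplex[OF that] in auto)
  qed (use i in auto)
  have "simplex_int (Suc k) (\<lambda>x. frechet_derivative f (at x within ?S) (step i)) =
    simplex_int (Suc k) (\<lambda>x. frechet_derivative f (at (s x) within ?S) (step i))"
    unfolding s_def
    by (rule simplex_int_swap_vertex[symmetric])
       (use i smooth_on_imp_continuous_on[OF smooth_on_frechet_derivative[OF tangential_std_simplex f stepT]] in auto)
  also have "\<dots> = simplex_int (Suc k) (\<lambda>x. frechet_derivative (\<lambda>x. f (s x)) (at x within ?S) (edge i))"
  proof (rule simplex_int_cong)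
    fix x assume x: "x \<in> ?S"
    have "(f has_derivative frechet_derivative f (at (s x) within ?S)) (at (s x) within s ` ?S)"
      by (rule has_derivative_subset[OF smooth_on_has_derivative[OF f ss[OF x]]]) (use ss in auto)
    from frechet_derivative_tangential[OF tangential_std_simplex x edgeT
        has_derivative_in_compose[OF bounded_linear_imp_has_derivative[OF s] this]]
    show "frechet_derivative f (at (s x) within ?S) (step i) = frechet_derivative (\<lambda>x. f (s x)) (at x within ?S) (edge i)"
      by (simp only: se)
  qed
  also have "\<dots> = simplex_int k (\<lambda>y. f (s (swap_vertex i (coface i y)))) - simplex_int k (\<lambda>y. f (s (coface i y)))"
    by (rule simplex_int_derivative_edge[OF fs i])
  also have "(\<lambda>y. f (s (swap_vertex i (coface i y)))) = (\<lambda>y. f (coface (i - 1) (s y)))"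
    unfolding s_def using i
    by (intro ext arg_cong[where f = f] coords_eqI) (auto simp: lookup_swap_vertex lookup_coface simplical_face_def)
  also have "(\<lambda>y. f (s (coface i y))) = (\<lambda>y. f (coface i (s y)))"
    unfolding s_def using i
    by (intro ext arg_cong[where f = f] coords_eqI) (auto simp: lookup_swap_vertex lookup_coface simplical_face_def)
  finally have "simplex_int (Suc k) (\<lambda>x. frechet_derivative f (at x within ?S) (step i)) =
    simplex_int k (\<lambda>y. f (coface (i - 1) (s y))) - simplex_int k (\<lambda>y. f (coface i (s y)))" .
  moreover have "i \<le> Suc k" "i - 1 \<le> Suc k" using i by auto
  ultimately show ?thesis by (simp only: inv)
qed

section \<open>Stokes' theorem on the standard simplex\<close>

lemma step_tan: "i \<in> {1..n} \<Longrightarrow> step i \<in> simplex_tan n"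
  using simplex_diff_tan[OF vertex_in_simplex vertex_in_simplex, of "i - 1" n i] by auto

text \<open>The two bases of tangent vectors are related by a unimodular triangular matrix.\<close>

lemma alternating_on_edges_steps:
  assumes \<alpha>: "alternating_on T (int m) \<alpha>" "subspace T" and T: "\<And>i. i \<in> {1..m} \<Longrightarrow> edge i \<in> T" "\<And>i. i \<in> {1..m} \<Longrightarrow> step i \<in> T"
  shows "\<alpha> (map edge [1..<Suc m]) = \<alpha> (map step [1..<Suc m])"
proof -
  \<comment> \<open>From the left, one \<open>step\<close> after another becomes an
    \<open>edge\<close>. The difference is a term that contains \<open>edge j\<close> twice or, for
    \<open>j = 0\<close>, the zero vector.\<close>
  have "\<alpha> (map edge [1..<Suc j] @ map step [Suc j..<Suc m]) = \<alpha> (map step [1..<Suc m])" if "j \<le> m" for j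
    using that
  proof (induction j)
    case 0
    then show ?case by simp
  next
    case (Suc j)
    let ?us = "map edge [1..<Suc j]" and ?ws = "map step [Suc (Suc j)..<Suc m]"
    have us: "set ?us \<subseteq> T" using T(1) Suc.prems by auto
    have ws: "set ?ws \<subseteq> T" using T(2) by auto
    have len: "int (length ?us + length ?ws) + 1 = int m" using Suc.prems by simp
    have e: "edge (Suc j) = edge j + step (Suc j)" by simp
    have ej: "edge j \<in> T" using T(1)[of j] Suc.prems subspace_0[OF \<alpha>(2)] by (cases "j = 0") auto
    have "map edge [1..<Suc (Suc j)] @ map step [Suc (Suc j)..<Suc m] = ?us @ edge (Suc j) # ?ws" by simp
    also have "\<alpha> \<dots> = \<alpha> (?us @ edge j # ?ws) + \<alpha> (?us @ step (Suc j) # ?ws)"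
      unfolding e by (rule alternating_on_add[OF \<alpha> len us ws ej]) (use T(2)[of "Suc j"] Suc.prems in simp)
    also have "\<alpha> (?us @ edge j # ?ws) = 0"
    proof (cases j)
      case 0
      then show ?thesis
        using alternating_on_scale[OF \<alpha> len us ws ej, of 0] by simp
    next
      case (Suc j')
      have "\<alpha> (map edge [1..<j] @ edge j # [] @ edge j # ?ws) = 0"
        by (rule alternating_on_repeat[OF \<alpha>(1)]) (use len us ws ej Suc in auto)
      moreover have "?us = map edge [1..<j] @ [edge j]" using Suc by simp
      ultimately show ?thesis by simp
    qed
    also have "?us @ step (Suc j) # ?ws = map edge [1..<Suc j] @ map step [Suc j..<Suc m]"
      using Suc.prems by (simp add: upt_conv_Cons del: upt_Suc)
    finally show ?case using Suc by simp
  qed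
  from this[of m] show ?thesis by simp
qed

lemma coface_single: "coface j (Poly_Mapping.single a 1) = Poly_Mapping.single (skip j a) 1"
  by (rule coords_eqI) (auto simp: lookup_coface simplical_face_def lookup_single when_def skip_def)

lemma coface_step:
  assumes "1 \<le> l"
  shows "coface j (step l) = (if l < j then step l else if l = j then step j + step (Suc j) else step (Suc l))"
proof -
  have "coface j (step l) = Poly_Mapping.single (skip j l) 1 - Poly_Mapping.single (skip j (l - 1)) 1"
    using bounded_linear.linear[OF bounded_linear_coface] by (simp add: linear_diff coface_single)
  then show ?thesis using assms by (auto simp: skip_def)
qed

lemma coface_step_Suc:
  "coface j (Poly_Mapping.single (Suc i) 1 - Poly_Mapping.single i 1) =
    (if Suc i < j then step (Suc i) else if Suc i = j then step j + step (Suc j) else step (Suc (Suc i)))"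
  using coface_step[of "Suc i" j] by simp

lemma coface_tan: "v \<in> simplex_tan n \<Longrightarrow> j \<le> Suc n \<Longrightarrow> coface j v \<in> simplex_tan (Suc n)"
proof -
  assume v: "v \<in> simplex_tan n" and j: "j \<le> Suc n"
  have "coface j v = (\<Sum>i\<in>{1..n}. lk v i *\<^sub>R coface j (edge i))"
    using arg_cong[OF simplex_tan_expand[OF v], of "coface j"] bounded_linear.linear[OF bounded_linear_coface]
    by (simp add: linear_sum linear_cmul)
  also have "\<dots> \<in> simplex_tan (Suc n)"
  proof (intro subspace_sum subspace_scale subspace_simplex_tan)
    fix i assume "i \<in> {1..n}"
    have "coface j (edge i) = Poly_Mapping.single (skip j i) 1 - Poly_Mapping.single (skip j 0) 1"
      using bounded_linear.linear[OF bounded_linear_coface] by (simp add: linear_diff coface_single del: single_one)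
    also have "\<dots> \<in> simplex_tan (Suc n)"
      by (intro simplex_diff_tan vertex_in_simplex) (use \<open>i \<in> {1..n}\<close> in \<open>auto simp: skip_def\<close>)
    finally show "coface j (edge i) \<in> simplex_tan (Suc n)" .
  qed
  finally show ?thesis .
qed

text \<open>Omitting vertex \<open>j\<close> merges the steps into and out of it to their sum and
  renumbers the later ones; for \<open>j = 0\<close> and \<open>j = Suc k\<close> there is nothing
  to merge. By additivity the value is the sum over the two ways of deleting one of the merged
  steps. Position \<open>i\<close> of \<open>V\<close> holds \<open>step (Suc i)\<close>, hence the
  indices \<open>j\<close> and \<open>j - 1\<close>.\<close>

lemma coface_steps:
  fixes \<alpha> :: "coords list \<Rightarrow> complex"
  assumes \<alpha>: "alternating_on (simplex_tan (Suc k)) (int k) \<alpha>" and j: "j \<le> Suc k"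
  defines "V \<equiv> map step [1..<Suc (Suc k)]"
  shows "\<alpha> (map (coface j) (map step [1..<Suc k])) =
    (if j \<le> k then \<alpha> (del_nth j V) else 0) + (if 1 \<le> j then \<alpha> (del_nth (j - 1) V) else 0)"
proof -
  have V: "length V = Suc k" by (simp add: V_def)
  have nthV: "V ! i = step (Suc i)" if "i \<le> k" for i
    using that by (simp add: V_def del: upt_Suc)
  have L: "map (coface j) (map step [1..<Suc k]) ! i = coface j (step (Suc i))" if "i < k" for i
    using that by (simp del: upt_Suc)
  consider "j = 0" | "j = Suc k" | "1 \<le> j" "j \<le> k" using j by linarith
  then show ?thesis
  proof cases
    case 1
    have "map (coface j) (map step [1..<Suc k]) = del_nth 0 V"
      by (rule nth_equalityI) (use 1 V in \<open>auto simp: L nth_del_nth nthV length_del_nth coface_step_Suc simp del: upt_Suc map_map\<close>)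
    then show ?thesis using 1 by simp
  next
    case 2
    have "map (coface j) (map step [1..<Suc k]) = del_nth k V"
      by (rule nth_equalityI) (use 2 V in \<open>auto simp: L nth_del_nth nthV length_del_nth coface_step_Suc simp del: upt_Suc map_map\<close>)
    then show ?thesis using 2 by simp
  next
    case 3
    let ?A = "take (j - 1) V" and ?C = "drop (Suc j) V"
    have T: "set V \<subseteq> simplex_tan (Suc k)" using step_tan[of _ "Suc k"] by (auto simp: V_def simp del: upt_Suc)
    have len: "int (length ?A + length ?C) + 1 = int k" using 3 V by simp
    have eq: "map (coface j) (map step [1..<Suc k]) = ?A @ (step j + step (Suc j)) # ?C"
    proof (rule nth_equalityI)
      fix i assume "i < length (map (coface j) (map step [1..<Suc k]))"
      then have i: "i < k" by (simp del: upt_Suc)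
      consider "i < j - 1" | "i = j - 1" | "j - 1 < i" by linarith
      then show "map (coface j) (map step [1..<Suc k]) ! i = (?A @ (step j + step (Suc j)) # ?C) ! i"
      proof cases
        case 1
        then have "Suc i < j" by simp
        then show ?thesis using 1 3 V i nthV[of i] by (simp add: L nth_append coface_step_Suc del: upt_Suc map_map)
      next
        case 2
        then have "Suc i = j" using 3 by simp
        then show ?thesis using 3 V i by (simp add: L nth_append coface_step_Suc del: upt_Suc map_map) (auto simp: L coface_step_Suc simp del: upt_Suc map_map)
      next
        case c: 3
        then have "j \<le> i" by simp
        then obtain m where m: "i = j + m" using le_Suc_ex by blast
        have "\<not> j + m < j - Suc 0" by simp
        then show ?thesis using 3 V i m nthV[of "Suc i"] by (simp add: L nth_append coface_step_Suc del: upt_Suc map_map)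
      qed
    qed (use 3 V in simp)
    have "\<alpha> (?A @ (step j + step (Suc j)) # ?C) = \<alpha> (?A @ step j # ?C) + \<alpha> (?A @ step (Suc j) # ?C)"
      by (rule alternating_on_add[OF \<alpha> subspace_simplex_tan len])
         (use T 3 step_tan[of j "Suc k"] step_tan[of "Suc j" "Suc k"] in \<open>auto dest: in_set_takeD in_set_dropD\<close>)
    moreover have "?A @ step j # ?C = del_nth j V"
      using 3 V nthV[of "j - 1"] take_Suc_conv_app_nth[of "j - 1" V] by (simp add: del_nth_def)
    moreover have "?A @ step (Suc j) # ?C = del_nth (j - 1) V"
      using 3 V nthV[of j] Cons_nth_drop_Suc[of j V] by (simp add: del_nth_def)
    ultimately show ?thesis using 3 eq by simp
  qed
qed

lemma alternating_on_coface:
  "alternating_on (simplex_tan (Suc n)) k \<alpha> \<Longrightarrow> j \<le> Suc n \<Longrightarrow> alternating_on (simplex_tan n) k (\<lambda>vs. \<alpha> (map (coface j) vs))"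
  by (rule alternating_on_linear_map) (auto intro: coface_tan bounded_linear.linear[OF bounded_linear_coface])

text \<open>Evaluated on steps, \<open>\<theta>\<close> is an alternating sum of directional
  derivatives, each of which integrates to a difference of the neighbouring faces \<open>i\<close>
  and \<open>Suc i\<close>. Sorted by faces, these are the two deletions that
  \<open>coface_steps\<close> produces. Edges enter only at both ends, because
  \<open>simplex_integral\<close> is defined with them.\<close>

lemma stokes_simplex:
  fixes k :: nat and \<eta> \<theta> :: "coords \<Rightarrow> coords list \<Rightarrow> complex"
  defines "S \<equiv> std_simplex (Suc k)" and "T \<equiv> simplex_tan (Suc k)"
  assumes sm: "\<And>vs. set vs \<subseteq> T \<Longrightarrow> smooth_on S (\<lambda>x. \<eta> x vs)"
    and alt: "\<And>x. x \<in> S \<Longrightarrow> alternating_on T (int k) (\<eta> x)"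
    and alt': "\<And>x. x \<in> S \<Longrightarrow> alternating_on T (int (Suc k)) (\<theta> x)"
    and d: "\<And>x vs. x \<in> S \<Longrightarrow> length vs = Suc k \<Longrightarrow> set vs \<subseteq> T \<Longrightarrow>
      \<theta> x vs = (\<Sum>i\<le>k. (-1) ^ i * frechet_derivative (\<lambda>y. \<eta> y (del_nth i vs)) (at x within S) (vs ! i))"
  shows "simplex_int (Suc k) (\<lambda>x. \<theta> x (map edge [1..<Suc (Suc k)])) =
    (\<Sum>j\<le>Suc k. (-1) ^ j * simplex_int k (\<lambda>y. \<eta> (coface j y) (map (coface j) (map edge [1..<Suc k]))))"
proof -
  define V where "V = map step [1..<Suc (Suc k)]"
  have sT: "subspace T" unfolding T_def by (rule subspace_simplex_tan)
  have V: "length V = Suc k" by (simp add: V_def)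
  have nthV: "V ! i = step (Suc i)" if "i \<le> k" for i
    using that by (simp add: V_def del: upt_Suc)
  have TV: "set V \<subseteq> T" using step_tan[of _ "Suc k"] by (auto simp: V_def T_def simp del: upt_Suc)
  have Tdel: "set (del_nth i V) \<subseteq> T" for i using TV set_del_nth by (metis dual_order.trans)
  let ?f = "\<lambda>i x. \<eta> x (del_nth i V)"
  have f: "smooth_on S (?f i)" for i by (rule sm[OF Tdel])
  have fc: "continuous_on (std_simplex k) (\<lambda>y. ?f i (coface j y))" if "j \<le> Suc k" for i j
    by (rule continuous_on_compose2[OF smooth_on_imp_continuous_on[OF f] linear_continuous_on[OF bounded_linear_coface]])
       (use coface_in_simplex[OF that] in \<open>auto simp: S_def\<close>)
  let ?I = "\<lambda>i j. simplex_int k (\<lambda>y. ?f i (coface j y))"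
  have "simplex_int (Suc k) (\<lambda>x. \<theta> x (map edge [1..<Suc (Suc k)])) =
    simplex_int (Suc k) (\<lambda>x. \<Sum>i\<le>k. (-1) ^ i * frechet_derivative (?f i) (at x within S) (step (Suc i)))"
  proof (rule simplex_int_cong)
    fix x assume x: "x \<in> std_simplex (Suc k)"
    have "\<theta> x (map edge [1..<Suc (Suc k)]) = \<theta> x V"
      unfolding V_def
      by (rule alternating_on_edges_steps[OF alt' sT])
         (use x step_tan[of _ "Suc k"] edge_tan[of _ "Suc k"] in \<open>auto simp: S_def T_def\<close>)
    also have "\<dots> = (\<Sum>i\<le>k. (-1) ^ i * frechet_derivative (?f i) (at x within S) (step (Suc i)))"
      using d[OF _ V TV] x nthV by (simp add: S_def)
    finally show "\<theta> x (map edge [1..<Suc (Suc k)]) = (\<Sum>i\<le>k. (-1) ^ i * frechet_derivative (?f i) (at x within S) (step (Suc i)))" .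
  qed
  also have "\<dots> = (\<Sum>i\<le>k. (-1) ^ i * simplex_int (Suc k) (\<lambda>x. frechet_derivative (?f i) (at x within S) (step (Suc i))))"
  proof -
    have "continuous_on S (\<lambda>x. frechet_derivative (?f i) (at x within S) (step (Suc i)))" if "i \<le> k" for i
      by (rule smooth_on_imp_continuous_on, rule smooth_on_frechet_derivative[of S T])
         (use f step_tan[of "Suc i" "Suc k"] tangential_std_simplex that in \<open>auto simp: S_def T_def\<close>)
    then show ?thesis
      unfolding S_def[symmetric] simplex_int_mult[symmetric]
      by (intro simplex_int_sum) (auto simp: S_def intro!: continuous_on_mult_left)
  qed
  also have "\<dots> = (\<Sum>i\<le>k. (-1) ^ i * (?I i i - ?I i (Suc i)))"
  proof (rule sum.cong[OF refl])
    fix i assume "i \<in> {..k}"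
    then show "(-1) ^ i * simplex_int (Suc k) (\<lambda>x. frechet_derivative (?f i) (at x within S) (step (Suc i))) =
      (-1) ^ i * (?I i i - ?I i (Suc i))"
      using simplex_int_derivative_step[OF f[unfolded S_def], of "Suc i" i] by (simp add: S_def)
  qed
  also have "\<dots> = (\<Sum>i\<le>k. (-1) ^ i * ?I i i) + (\<Sum>i\<le>k. (-1) ^ Suc i * ?I i (Suc i))"
    by (simp add: sum.distrib[symmetric] algebra_simps)
  \<comment> \<open>Sorted by faces: face \<open>j\<close> receives the term \<open>i = j\<close>
    with its own sign, and the term \<open>i = j - 1\<close>, where the minus of the difference
    again gives \<open>(-1) ^ j\<close>.\<close>
  also have "\<dots> = (\<Sum>j\<le>Suc k. (-1) ^ j * ((if j \<le> k then ?I j j else 0) + (if 1 \<le> j then ?I (j - 1) j else 0)))"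
  proof -
    have "(\<Sum>j\<le>Suc k. (-1) ^ j * (if j \<le> k then ?I j j else 0)) = (\<Sum>i\<le>k. (-1) ^ i * ?I i i)"
      by simp
    moreover have "(\<Sum>j\<le>Suc k. (-1) ^ j * (if 1 \<le> j then ?I (j - 1) j else 0)) = (\<Sum>i\<le>k. (-1) ^ Suc i * ?I i (Suc i))"
      by (subst sum.atMost_Suc_shift) simp
    ultimately show ?thesis by (simp only: distrib_left sum.distrib)
  qed
  also have "\<dots> = (\<Sum>j\<le>Suc k. (-1) ^ j * simplex_int k (\<lambda>y. \<eta> (coface j y) (map (coface j) (map edge [1..<Suc k]))))"
  proof (intro sum.cong refl arg_cong2[where f = "(*)"])
    fix j assume "j \<in> {..Suc k}"
    then have j: "j \<le> Suc k" by simp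
    have "simplex_int k (\<lambda>y. \<eta> (coface j y) (map (coface j) (map edge [1..<Suc k]))) =
      simplex_int k (\<lambda>y. (if j \<le> k then ?f j (coface j y) else 0) + (if 1 \<le> j then ?f (j - 1) (coface j y) else 0))"
    proof (rule simplex_int_cong)
      fix y assume y: "y \<in> std_simplex k"
      then have cy: "coface j y \<in> S" unfolding S_def using coface_in_simplex[OF j] by blast
      have "\<eta> (coface j y) (map (coface j) (map edge [1..<Suc k])) = \<eta> (coface j y) (map (coface j) (map step [1..<Suc k]))"
        by (rule alternating_on_edges_steps[OF alternating_on_coface[OF alt[OF cy, unfolded T_def] j] subspace_simplex_tan])
           (use edge_tan step_tan[of _ k] in auto)
      also have "\<dots> = (if j \<le> k then ?f j (coface j y) else 0) + (if 1 \<le> j then ?f (j - 1) (coface j y) else 0)"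
        unfolding V_def by (rule coface_steps[OF alt[OF cy, unfolded T_def] j])
      finally show "\<eta> (coface j y) (map (coface j) (map edge [1..<Suc k])) =
        (if j \<le> k then ?f j (coface j y) else 0) + (if 1 \<le> j then ?f (j - 1) (coface j y) else 0)" .
    qed
    also have "\<dots> = (if j \<le> k then ?I j j else 0) + (if 1 \<le> j then ?I (j - 1) j else 0)"
      using fc[OF j] by (cases "j \<le> k"; cases "1 \<le> j") (simp_all add: simplex_int_add simplex_int_zero)
    finally show "(if j \<le> k then ?I j j else 0) + (if 1 \<le> j then ?I (j - 1) j else 0) =
      simplex_int k (\<lambda>y. \<eta> (coface j y) (map (coface j) (map edge [1..<Suc k])))" by simp
  qed
  finally show ?thesis .
qed

section \<open>Compatible cochains\<close>

lemma comm_group_complex: "comm_group complex_group"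
  by (rule comm_groupI) (auto simp: complex_group_def intro: exI[of _ "- _"] add.left_inverse)

lemma complex_group_simps [simp]:
  "carrier complex_group = UNIV" "x \<otimes>\<^bsub>complex_group\<^esub> y = x + y" "\<one>\<^bsub>complex_group\<^esub> = 0"
  by (simp_all add: complex_group_def)

lemma inv_complex_group [simp]: "inv\<^bsub>complex_group\<^esub> x = - x"
proof -
  interpret comm_group complex_group by (rule comm_group_complex)
  show ?thesis by (rule inv_equality) auto
qed

lemma finprod_complex: "finite A \<Longrightarrow> finprod complex_group f A = sum f A"
proof (induction A rule: finite_induct)
  interpret comm_group complex_group by (rule comm_group_complex)
  {
    case empty
    then show ?case by simp
  next
    case (insert x F)
    then show ?case by (subst finprod_insert) auto
  }
qed

lemma finprod_hom:
  assumes "comm_group G" "comm_group H" "h \<in> hom G H" "finite A" "f \<in> A \<rightarrow> carrier G"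
  shows "h (finprod G f A) = finprod H (\<lambda>i. h (f i)) A"
  using assms(4,5)
proof (induction A rule: finite_induct)
  interpret G: comm_group G by (rule assms)
  interpret H: comm_group H by (rule assms)
  {
    case empty
    then show ?case using hom_one[OF assms(3) G.is_group H.is_group] by simp
  next
    case (insert x F)
    have "h (finprod G f (insert x F)) = h (f x \<otimes>\<^bsub>G\<^esub> finprod G f F)"
      using insert by (subst G.finprod_insert) auto
    also have "\<dots> = h (f x) \<otimes>\<^bsub>H\<^esub> h (finprod G f F)"
      using insert.prems by (intro hom_mult[OF assms(3)] G.finprod_closed) auto
    also have "\<dots> = finprod H (\<lambda>i. h (f i)) (insert x F)"
      using insert hom_in_carrier[OF assms(3)] by (subst H.finprod_insert) auto
    finally show ?case .
  }
qed

lemma topspace_simplex_space: "topspace (ctop (simplex_space n)) = std_simplex n"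
  by (simp add: simplex_space_def)

lemma smooth_simplices_iff:
  "\<sigma> \<in> smooth_simplices k M \<longleftrightarrow>
    0 \<le> k \<and> \<sigma> \<in> extensional (std_simplex (nat k)) \<and> smooth_map (simplex_space (nat k)) M \<sigma>"
  by (auto simp: smooth_simplices_def)

lemma smooth_simplices_compose:
  assumes "regular_charted M" "regular_charted N" "smooth_map M N f" "\<sigma> \<in> smooth_simplices k M"
  shows "compose (std_simplex (nat k)) f \<sigma> \<in> smooth_simplices k N"
proof -
  have "smooth_map (simplex_space (nat k)) N (f \<circ> \<sigma>)"
    by (rule smooth_map_compose[OF regular_charted_simplex_space assms(1,2) _ assms(3)])
       (use assms(4) in \<open>simp add: smooth_simplices_iff\<close>)
  then have "smooth_map (simplex_space (nat k)) N (compose (std_simplex (nat k)) f \<sigma>)"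
    by (rule smooth_map_cong[OF regular_charted_simplex_space]) (simp add: topspace_simplex_space compose_def)
  then show ?thesis using assms(4) by (simp add: smooth_simplices_iff)
qed

lemma smooth_map_coface: "i \<le> Suc n \<Longrightarrow> smooth_map (simplex_space n) (simplex_space (Suc n)) (coface i)"
  by (rule smooth_map_simplex_linear(1)[OF bounded_linear_coface]) (auto intro: coface_in_simplex)

lemma smooth_simplices_coface:
  assumes "regular_charted M" "\<sigma> \<in> smooth_simplices (k + 1) M" "0 \<le> k" "i \<le> nat (k + 1)"
  shows "compose (std_simplex (nat k)) \<sigma> (coface i) \<in> smooth_simplices k M"
proof -
  have k: "nat (k + 1) = Suc (nat k)" using assms(3) by simp
  have "smooth_map (simplex_space (nat k)) M (\<sigma> \<circ> coface i)"
    by (rule smooth_map_compose[OF regular_charted_simplex_space regular_charted_simplex_space assms(1) smooth_map_coface])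
       (use assms(2,4) k in \<open>auto simp: smooth_simplices_iff\<close>)
  then have "smooth_map (simplex_space (nat k)) M (compose (std_simplex (nat k)) \<sigma> (coface i))"
    by (rule smooth_map_cong[OF regular_charted_simplex_space]) (simp add: topspace_simplex_space compose_def)
  then show ?thesis using assms(3) by (simp add: smooth_simplices_iff)
qed

text \<open>Stated for an arbitrary homomorphism of coefficients because it serves both the
  inclusion of \<open>\<Lambda>\<close> and the reduction modulo \<open>\<Lambda>\<close>.\<close>

lemma coboundary_natural:
  assumes "comm_group R" "comm_group R'" "h \<in> hom R R'" "regular_charted M"
    and c: "c \<in> smooth_simplices k M \<rightarrow>\<^sub>E carrier R"
  shows "coboundary k M R' (\<lambda>\<sigma>\<in>smooth_simplices k M. h (c \<sigma>)) = (\<lambda>\<sigma>\<in>smooth_simplices (k + 1) M. h (coboundary k M R c \<sigma>))"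
proof -
  interpret R: comm_group R by (rule assms)
  interpret R': comm_group R' by (rule assms)
  have "(if k < 0 then \<one>\<^bsub>R'\<^esub> else finprod R' (\<lambda>i. let z = (\<lambda>\<sigma>\<in>smooth_simplices k M. h (c \<sigma>)) (compose (std_simplex (nat k)) \<sigma> (coface i))
      in if even i then z else inv\<^bsub>R'\<^esub> z) {..nat (k + 1)}) =
     h (if k < 0 then \<one>\<^bsub>R\<^esub> else finprod R (\<lambda>i. let z = c (compose (std_simplex (nat k)) \<sigma> (coface i))
      in if even i then z else inv\<^bsub>R\<^esub> z) {..nat (k + 1)})" (is "?l = h ?r") if \<sigma>: "\<sigma> \<in> smooth_simplices (k + 1) M" for \<sigma>
  proof (cases "k < 0")
    case True
    then show ?thesis using hom_one[OF assms(3) R.is_group R'.is_group] by simp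
  next
    case False
    let ?s = "\<lambda>i. compose (std_simplex (nat k)) \<sigma> (coface i)"
    have s: "?s i \<in> smooth_simplices k M" if "i \<le> nat (k + 1)" for i
      using smooth_simplices_coface[OF assms(4) \<sigma> _ that] False by simp
    have cs: "c (?s i) \<in> carrier R" if "i \<le> nat (k + 1)" for i using c s[OF that] by blast
    have hinv: "h (inv\<^bsub>R\<^esub> x) = inv\<^bsub>R'\<^esub> h x" if "x \<in> carrier R" for x
      using group_hom.hom_inv[of R R' h x] that assms(3) R.is_group R'.is_group
      by (simp add: group_hom_def group_hom_axioms_def)
    have "h ?r = finprod R' (\<lambda>i. h (let z = c (?s i) in if even i then z else inv\<^bsub>R\<^esub> z)) {..nat (k + 1)}"
      using False cs by (simp add: Let_def) (subst finprod_hom[OF assms(1-3)], auto)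
    also have "\<dots> = ?l"
    proof -
      have "finprod R' (\<lambda>i. h (let z = c (?s i) in if even i then z else inv\<^bsub>R\<^esub> z)) {..nat (k + 1)} =
        finprod R' (\<lambda>i. let z = (\<lambda>\<sigma>\<in>smooth_simplices k M. h (c \<sigma>)) (?s i) in if even i then z else inv\<^bsub>R'\<^esub> z) {..nat (k + 1)}"
        by (rule R'.finprod_cong') (use s cs hinv hom_in_carrier[OF assms(3)] in \<open>auto simp: Let_def\<close>)
      then show ?thesis using False by simp
    qed
    finally show ?thesis by simp
  qed
  then show ?thesis unfolding coboundary_def by (intro ext) (simp add: restrict_def)
qed

lemma coboundary_complex:
  assumes "\<sigma> \<in> smooth_simplices (k + 1) M" "0 \<le> k"
  shows "coboundary k M complex_group c \<sigma> = (\<Sum>i\<le>nat (k + 1). (-1) ^ i * c (compose (std_simplex (nat k)) \<sigma> (coface i)))"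
  using assms by (simp add: coboundary_def finprod_complex Let_def) (intro sum.cong, auto)

lemma coboundary_complex_neg:
  assumes "\<sigma> \<in> smooth_simplices (k + 1) M" "k < 0"
  shows "coboundary k M complex_group c \<sigma> = 0"
  using assms by (simp add: coboundary_def)

lemma coboundary_undefined: "\<sigma> \<notin> smooth_simplices (k + 1) M \<Longrightarrow> coboundary k M R c \<sigma> = undefined"
  by (simp add: coboundary_def)

lemma coboundary_coboundary:
  assumes M: "regular_charted M" and \<sigma>: "\<sigma> \<in> smooth_simplices (k + 1 + 1) M"
  shows "coboundary (k + 1) M complex_group (coboundary k M complex_group c) \<sigma> = 0"
proof (cases "0 \<le> k + 1")
  case False
  then show ?thesis by (intro coboundary_complex_neg \<sigma>) simp
next
  case k1: True
  let ?A = "std_simplex (nat (k + 1))"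
  have s: "compose ?A \<sigma> (coface i) \<in> smooth_simplices (k + 1) M" if "i \<le> nat (k + 1 + 1)" for i
    by (rule smooth_simplices_coface[OF M \<sigma> k1 that])
  show ?thesis
  proof (cases "0 \<le> k")
    \<comment> \<open>Here \<open>k = -1\<close>: there are simplices of degree 0, but by convention
      the coboundary from negative degree is zero on them.\<close>
    case False
    then show ?thesis
      using s by (simp add: coboundary_complex[OF \<sigma> k1] coboundary_complex_neg)
  next
    case k: True
    define m where "m = nat k"
    have m: "nat k = m" "nat (k + 1) = Suc m" "nat (k + 1 + 1) = Suc (Suc m)" using k by (auto simp: m_def)
    let ?s = "\<lambda>i j. compose (std_simplex m) (compose (std_simplex (Suc m)) \<sigma> (coface i)) (coface j)"
    have "coboundary (k + 1) M complex_group (coboundary k M complex_group c) \<sigma> =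
      (\<Sum>i\<le>Suc (Suc m). \<Sum>j<Suc (Suc m). (-1) ^ i * ((-1) ^ j * c (?s i j)))"
    proof -
      have "coboundary k M complex_group c (compose (std_simplex (Suc m)) \<sigma> (coface i)) = (\<Sum>j\<le>Suc m. (-1) ^ j * c (?s i j))"
        if "i \<le> Suc (Suc m)" for i
        using coboundary_complex[OF s[of i] k, of c] that unfolding m by blast
      then show ?thesis
        unfolding coboundary_complex[OF \<sigma> k1] m sum_distrib_left[symmetric] lessThan_Suc_atMost
        by (intro sum.cong refl) (simp only: atMost_iff)
    qed
    also have "\<dots> = 0"
    proof (rule sum_skip_cancel)
      fix a b assume ab: "a < b" "b \<le> Suc (Suc m)"
      have "?s a (b - 1) = ?s b a"
      proof
        fix t
        have "coface (b - 1) t \<in> std_simplex (Suc m)" "coface a t \<in> std_simplex (Suc m)" if "t \<in> std_simplex m"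
          using that ab by (auto intro: coface_in_simplex)
        then show "?s a (b - 1) t = ?s b a t"
          using coface_coface[OF ab(1)] by (simp add: compose_def)
      qed
      moreover obtain b' where "b = Suc b'" using ab by (cases b) auto
      ultimately show "(- 1) ^ a * ((- 1) ^ (b - 1) * c (?s a (b - 1))) + (- 1) ^ b * ((- 1) ^ a * c (?s b a)) = 0"
        by simp
    qed
    finally show ?thesis .
  qed
qed

section \<open>The complex of compatible cochains\<close>

context simplicial_manifold
begin

abbreviation prism :: "nat \<Rightarrow> (coords \<times> 'a, coords \<times> coords) charted" where
  "prism n \<equiv> simplex_times n (X n)"

abbreviation prism_face :: "nat \<Rightarrow> (coords \<times> 'a, coords \<times> coords) charted" where
  "prism_face n \<equiv> simplex_times n (X (Suc n))"

abbreviation up :: "int \<Rightarrow> nat \<Rightarrow> (coords \<times> 'a) ssimplex \<Rightarrow> (coords \<times> 'a) ssimplex" where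
  "up k i \<tau> \<equiv> compose (std_simplex (nat k)) (map_prod (coface i) id) \<tau>"

abbreviation down :: "int \<Rightarrow> nat \<Rightarrow> nat \<Rightarrow> (coords \<times> 'a) ssimplex \<Rightarrow> (coords \<times> 'a) ssimplex" where
  "down k n i \<tau> \<equiv> compose (std_simplex (nat k)) (map_prod id (face (Suc n) i)) \<tau>"

lemma regular_prism: "regular_charted (simplex_times m (X n))"
  by (rule regular_charted_simplex_times[OF manifold])

lemma smooth_map_up: "i \<le> Suc n \<Longrightarrow> smooth_map (prism_face n) (prism (Suc n)) (map_prod (coface i) id)"
  by (rule smooth_map_prod[OF manifold manifold smooth_map_id[OF regular_charted_manifold[OF manifold]] bounded_linear_coface])
     (auto intro: coface_in_simplex)

lemma smooth_map_down: "i \<le> Suc n \<Longrightarrow> smooth_map (prism_face n) (prism n) (map_prod id (face (Suc n) i))"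
  by (rule smooth_map_prod[OF manifold manifold face_smooth]) (auto simp: id_def bounded_linear_ident)

lemma up_in: "i \<le> Suc n \<Longrightarrow> \<tau> \<in> smooth_simplices k (prism_face n) \<Longrightarrow> up k i \<tau> \<in> smooth_simplices k (prism (Suc n))"
  by (rule smooth_simplices_compose[OF regular_prism regular_prism smooth_map_up])

lemma down_in: "i \<le> Suc n \<Longrightarrow> \<tau> \<in> smooth_simplices k (prism_face n) \<Longrightarrow> down k n i \<tau> \<in> smooth_simplices k (prism n)"
  by (rule smooth_simplices_compose[OF regular_prism regular_prism smooth_map_down])

lemma compatible_cochains_iff:
  "c \<in> compatible_cochains X face R k \<longleftrightarrow>
    (\<forall>n. c n \<in> smooth_simplices k (prism n) \<rightarrow>\<^sub>E carrier R) \<and>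
    (\<forall>n i \<tau>. i \<le> Suc n \<longrightarrow> \<tau> \<in> smooth_simplices k (prism_face n) \<longrightarrow> c (Suc n) (up k i \<tau>) = c n (down k n i \<tau>))"
proof -
  have r: "restrict f A = restrict g A \<longleftrightarrow> (\<forall>x\<in>A. f x = g x)" for f g :: "(coords \<times> 'a) ssimplex \<Rightarrow> 'b" and A
    by (auto simp: restrict_def fun_eq_iff)
  show ?thesis
    unfolding compatible_cochains_def cochain_pullback_def cochain_group_def r carrier_product_group by blast
qed

lemma compatible_cochainsD:
  assumes "c \<in> compatible_cochains X face R k"
  shows "\<sigma> \<in> smooth_simplices k (prism n) \<Longrightarrow> c n \<sigma> \<in> carrier R"
    and "\<sigma> \<notin> smooth_simplices k (prism n) \<Longrightarrow> c n \<sigma> = undefined"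
    and "c n \<in> smooth_simplices k (prism n) \<rightarrow>\<^sub>E carrier R"
    and "i \<le> Suc n \<Longrightarrow> \<tau> \<in> smooth_simplices k (prism_face n) \<Longrightarrow> c (Suc n) (up k i \<tau>) = c n (down k n i \<tau>)"
  using assms unfolding compatible_cochains_iff by (blast, blast intro: PiE_arb, blast, blast)

lemma compatible_cochainsI:
  assumes "\<And>n \<sigma>. \<sigma> \<in> smooth_simplices k (prism n) \<Longrightarrow> c n \<sigma> \<in> carrier R"
    and "\<And>n \<sigma>. \<sigma> \<notin> smooth_simplices k (prism n) \<Longrightarrow> c n \<sigma> = undefined"
    and "\<And>n i \<tau>. i \<le> Suc n \<Longrightarrow> \<tau> \<in> smooth_simplices k (prism_face n) \<Longrightarrow> c (Suc n) (up k i \<tau>) = c n (down k n i \<tau>)"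
  shows "c \<in> compatible_cochains X face R k"
  unfolding compatible_cochains_iff using assms by (auto intro!: PiE_I)

lemma compatible_cochains_eqI:
  assumes "c \<in> compatible_cochains X face R k" "d \<in> compatible_cochains X face R' k"
    and "\<And>n \<sigma>. \<sigma> \<in> smooth_simplices k (prism n) \<Longrightarrow> c n \<sigma> = d n \<sigma>"
  shows "c = d"
proof (intro ext)
  fix n \<sigma> show "c n \<sigma> = d n \<sigma>"
    using assms(3) compatible_cochainsD(2)[OF assms(1)] compatible_cochainsD(2)[OF assms(2)]
    by (cases "\<sigma> \<in> smooth_simplices k (prism n)") auto
qed

lemma carrier_cochains: "carrier (grp (cochains X face R) k) = compatible_cochains X face R k"
  by (simp add: cochains_def)

lemma mult_cochains: "\<sigma> \<in> smooth_simplices k (prism n) \<Longrightarrow>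
    (c \<otimes>\<^bsub>grp (cochains X face R) k\<^esub> d) n \<sigma> = c n \<sigma> \<otimes>\<^bsub>R\<^esub> d n \<sigma>"
  by (simp add: cochains_def cochain_group_def)

lemma mult_cochains_undefined: "\<sigma> \<notin> smooth_simplices k (prism n) \<Longrightarrow>
    (c \<otimes>\<^bsub>grp (cochains X face R) k\<^esub> d) n \<sigma> = undefined"
  by (simp add: cochains_def cochain_group_def)

lemma one_cochains: "\<one>\<^bsub>grp (cochains X face R) k\<^esub> n \<sigma> =
    (if \<sigma> \<in> smooth_simplices k (prism n) then \<one>\<^bsub>R\<^esub> else undefined)"
  by (simp add: cochains_def cochain_group_def)

lemma dif_cochains: "dif (cochains X face R) k c n = coboundary k (prism n) R (c n)"
  by (simp add: cochains_def)

lemma one_compatible: "comm_group R \<Longrightarrow> \<one>\<^bsub>grp (cochains X face R) k\<^esub> \<in> compatible_cochains X face R k"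
proof -
  assume "comm_group R"
  then interpret comm_group R .
  show ?thesis by (rule compatible_cochainsI) (auto simp: one_cochains up_in down_in)
qed

lemma mult_compatible:
  assumes "comm_group R" "c \<in> compatible_cochains X face R k" "d \<in> compatible_cochains X face R k"
  shows "c \<otimes>\<^bsub>grp (cochains X face R) k\<^esub> d \<in> compatible_cochains X face R k"
proof -
  interpret comm_group R by (rule assms)
  show ?thesis
    by (rule compatible_cochainsI)
       (use compatible_cochainsD[OF assms(2)] compatible_cochainsD[OF assms(3)] in
         \<open>auto simp: mult_cochains mult_cochains_undefined up_in down_in\<close>)
qed

lemma comm_group_cochains:
  assumes "comm_group R"
  shows "comm_group (grp (cochains X face R) k)"
proof -
  interpret R: comm_group R by (rule assms)
  let ?G = "grp (cochains X face R) k"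
  note D = compatible_cochainsD
  show ?thesis
  proof (rule comm_groupI; unfold carrier_cochains)
    fix x y z
    assume x: "x \<in> compatible_cochains X face R k" and y: "y \<in> compatible_cochains X face R k"
      and z: "z \<in> compatible_cochains X face R k"
    show "x \<otimes>\<^bsub>?G\<^esub> y \<otimes>\<^bsub>?G\<^esub> z = x \<otimes>\<^bsub>?G\<^esub> (y \<otimes>\<^bsub>?G\<^esub> z)"
      by (rule compatible_cochains_eqI[where k = k])
         (use x y z D(1)[OF x] D(1)[OF y] D(1)[OF z] in \<open>auto intro: mult_compatible[OF assms] simp: mult_cochains R.m_assoc\<close>)
  next
    fix x y
    assume x: "x \<in> compatible_cochains X face R k" and y: "y \<in> compatible_cochains X face R k"
    show "x \<otimes>\<^bsub>?G\<^esub> y = y \<otimes>\<^bsub>?G\<^esub> x"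
      by (rule compatible_cochains_eqI[where k = k])
         (use x y D(1)[OF x] D(1)[OF y] in \<open>auto intro: mult_compatible[OF assms] simp: mult_cochains R.m_comm\<close>)
  next
    fix x assume x: "x \<in> compatible_cochains X face R k"
    show "\<one>\<^bsub>?G\<^esub> \<otimes>\<^bsub>?G\<^esub> x = x"
      by (rule compatible_cochains_eqI[where k = k])
         (use x D(1)[OF x] in \<open>auto intro: mult_compatible[OF assms] one_compatible[OF assms] simp: mult_cochains one_cochains\<close>)
    let ?y = "\<lambda>n. \<lambda>\<sigma>\<in>smooth_simplices k (prism n). inv\<^bsub>R\<^esub> x n \<sigma>"
    have y: "?y \<in> compatible_cochains X face R k"
      by (rule compatible_cochainsI) (use D[OF x] in \<open>auto simp: up_in down_in\<close>)
    have "?y \<otimes>\<^bsub>?G\<^esub> x = \<one>\<^bsub>?G\<^esub>"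
      by (rule compatible_cochains_eqI[where k = k])
         (use x y D(1)[OF x] in \<open>auto intro: mult_compatible[OF assms] one_compatible[OF assms] simp: mult_cochains one_cochains\<close>)
    with y show "\<exists>y\<in>compatible_cochains X face R k. y \<otimes>\<^bsub>?G\<^esub> x = \<one>\<^bsub>?G\<^esub>" by blast
  qed (use mult_compatible[OF assms] one_compatible[OF assms] in auto)
qed

lemma up_coface:
  assumes "0 \<le> k" "j \<le> Suc (nat k)"
  shows "compose (std_simplex (nat k)) (up (k + 1) i \<tau>) (coface j) = up k i (compose (std_simplex (nat k)) \<tau> (coface j))"
  using assms coface_in_simplex[of j "nat k"] by (auto simp: compose_def restrict_def fun_eq_iff nat_add_distrib)

lemma down_coface:
  assumes "0 \<le> k" "j \<le> Suc (nat k)"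
  shows "compose (std_simplex (nat k)) (down (k + 1) n i \<tau>) (coface j) = down k n i (compose (std_simplex (nat k)) \<tau> (coface j))"
  using assms coface_in_simplex[of j "nat k"] by (auto simp: compose_def restrict_def fun_eq_iff nat_add_distrib)

text \<open>Taking a face of a simplex is precomposition, while \<open>up\<close> and
  \<open>down\<close> are postcompositions; they commute, so compatibility holds for each term of
  the sum.\<close>

lemma coboundary_compatible:
  assumes c: "c \<in> compatible_cochains X face complex_group k"
  shows "dif (cochains X face complex_group) k c \<in> compatible_cochains X face complex_group (k + 1)"
proof (rule compatible_cochainsI)
  fix n i \<tau> assume i: "i \<le> Suc n" and \<tau>: "\<tau> \<in> smooth_simplices (k + 1) (prism_face n)"
  show "dif (cochains X face complex_group) k c (Suc n) (up (k + 1) i \<tau>) =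
    dif (cochains X face complex_group) k c n (down (k + 1) n i \<tau>)"
  proof (cases "0 \<le> k")
    case True
    have "dif (cochains X face complex_group) k c (Suc n) (up (k + 1) i \<tau>) =
      (\<Sum>j\<le>nat (k + 1). (-1) ^ j * c (Suc n) (compose (std_simplex (nat k)) (up (k + 1) i \<tau>) (coface j)))"
      unfolding dif_cochains by (rule coboundary_complex[OF up_in[OF i \<tau>] True])
    also have "\<dots> = (\<Sum>j\<le>nat (k + 1). (-1) ^ j * c n (compose (std_simplex (nat k)) (down (k + 1) n i \<tau>) (coface j)))"
    proof (intro sum.cong refl arg_cong2[where f = "(*)"])
      fix j assume "j \<in> {..nat (k + 1)}"
      then have j: "j \<le> nat (k + 1)" "j \<le> Suc (nat k)" using True by auto
      show "c (Suc n) (compose (std_simplex (nat k)) (up (k + 1) i \<tau>) (coface j)) =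
        c n (compose (std_simplex (nat k)) (down (k + 1) n i \<tau>) (coface j))"
        unfolding up_coface[OF True j(2)] down_coface[OF True j(2)]
        by (rule compatible_cochainsD(4)[OF c i smooth_simplices_coface[OF regular_prism \<tau> True j(1)]])
    qed
    also have "\<dots> = dif (cochains X face complex_group) k c n (down (k + 1) n i \<tau>)"
      unfolding dif_cochains by (rule coboundary_complex[OF down_in[OF i \<tau>] True, symmetric])
    finally show ?thesis .
  next
    case False
    then have "k < 0" by simp
    then show ?thesis
      by (simp only: dif_cochains coboundary_complex_neg[OF up_in[OF i \<tau>]] coboundary_complex_neg[OF down_in[OF i \<tau>]])
  qed
qed (auto simp: dif_cochains coboundary_undefined)

lemma dif_cochains_hom: "dif (cochains X face complex_group) k \<in> hom (grp (cochains X face complex_group) k) (grp (cochains X face complex_group) (k + 1))"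
proof (rule homI; unfold carrier_cochains)
  fix c d assume c: "c \<in> compatible_cochains X face complex_group k" and d: "d \<in> compatible_cochains X face complex_group k"
  let ?d = "dif (cochains X face complex_group) k"
  show "?d (c \<otimes>\<^bsub>grp (cochains X face complex_group) k\<^esub> d) = ?d c \<otimes>\<^bsub>grp (cochains X face complex_group) (k + 1)\<^esub> ?d d"
  proof (rule compatible_cochains_eqI[where k = "k + 1" and R = complex_group and R' = complex_group])
    fix n \<sigma> assume \<sigma>: "\<sigma> \<in> smooth_simplices (k + 1) (prism n)"
    show "?d (c \<otimes>\<^bsub>grp (cochains X face complex_group) k\<^esub> d) n \<sigma> = (?d c \<otimes>\<^bsub>grp (cochains X face complex_group) (k + 1)\<^esub> ?d d) n \<sigma>"
    proof (cases "0 \<le> k")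
      case True
      then show ?thesis
        using smooth_simplices_coface[OF regular_prism \<sigma> True]
        by (simp add: mult_cochains[OF \<sigma>] dif_cochains coboundary_complex[OF \<sigma> True] mult_cochains sum.distrib[symmetric] distrib_left)
    next
      case False
      then show ?thesis by (simp add: mult_cochains[OF \<sigma>] dif_cochains coboundary_complex_neg[OF \<sigma>])
    qed
  qed (use c d mult_compatible[OF comm_group_complex] coboundary_compatible in auto)
qed (rule coboundary_compatible)

lemma dif_dif_cochains:
  assumes "c \<in> compatible_cochains X face complex_group k"
  shows "dif (cochains X face complex_group) (k + 1) (dif (cochains X face complex_group) k c) =
    \<one>\<^bsub>grp (cochains X face complex_group) (k + 1 + 1)\<^esub>"
proof (rule compatible_cochains_eqI[where k = "k + 1 + 1" and R = complex_group and R' = complex_group])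
  fix n \<sigma> assume "\<sigma> \<in> smooth_simplices (k + 1 + 1) (prism n)"
  then show "dif (cochains X face complex_group) (k + 1) (dif (cochains X face complex_group) k c) n \<sigma> =
    \<one>\<^bsub>grp (cochains X face complex_group) (k + 1 + 1)\<^esub> n \<sigma>"
    by (simp only: dif_cochains coboundary_coboundary[OF regular_prism] one_cochains if_True complex_group_simps)
qed (intro coboundary_compatible assms one_compatible[OF comm_group_complex])+

end

lemma coboundary_closed:
  assumes "comm_group R" "regular_charted M" "c \<in> smooth_simplices k M \<rightarrow>\<^sub>E carrier R" "\<sigma> \<in> smooth_simplices (k + 1) M"
  shows "coboundary k M R c \<sigma> \<in> carrier R"
proof -
  interpret R: comm_group R by (rule assms)
  show ?thesis
  proof (cases "k < 0")
    case True
    then show ?thesis using assms(4) by (simp add: coboundary_def)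
  next
    case False
    have "c (compose (std_simplex (nat k)) \<sigma> (coface i)) \<in> carrier R" if "i \<le> nat (k + 1)" for i
      using smooth_simplices_coface[OF assms(2,4) _ that] False assms(3) by auto
    then show ?thesis
      using False assms(4) by (simp add: coboundary_def Let_def)
  qed
qed

lemma restrict_coboundary: "(\<lambda>\<sigma>\<in>smooth_simplices (k + 1) M. coboundary k M R c \<sigma>) = coboundary k M R c"
  by (rule ext) (simp add: coboundary_def)

section \<open>Change of coefficients and lifting of cochains modulo \<Lambda>\<close>

context simplicial_manifold
begin

text \<open>
  A simplex of \<open>\<Delta>\<^sup>n\<^sup>+\<^sup>1 \<times> X\<^sub>n\<^sub>+\<^sub>1\<close> lying in the \<open>i\<close>-th face has a prescribed value, namely that of
  its reduction to \<open>\<Delta>\<^sup>n \<times> X\<^sub>n\<close>; on the remaining simplices a cochain can be chosen freely.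
\<close>

abbreviation in_face :: "int \<Rightarrow> nat \<Rightarrow> (coords \<times> 'a) ssimplex \<Rightarrow> bool" where
  "in_face k i \<sigma> \<equiv> \<forall>t\<in>std_simplex (nat k). lk (fst (\<sigma> t)) i = 0"

abbreviation red :: "int \<Rightarrow> nat \<Rightarrow> nat \<Rightarrow> (coords \<times> 'a) ssimplex \<Rightarrow> (coords \<times> 'a) ssimplex" where
  "red k n i \<sigma> \<equiv> compose (std_simplex (nat k)) (map_prod (drop_coord i) (face (Suc n) i)) \<sigma>"

abbreviation drop_simplex :: "int \<Rightarrow> nat \<Rightarrow> (coords \<times> 'a) ssimplex \<Rightarrow> (coords \<times> 'a) ssimplex" where
  "drop_simplex k i \<sigma> \<equiv> compose (std_simplex (nat k)) (map_prod (drop_coord i) id) \<sigma>"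

text \<open>\<open>SOME\<close> picks representatives freely off the faces. Among several faces the
  least index is taken to make the recursion definite; \<open>lift_red_unique\<close> shows that any
  other face would give the same value.\<close>

primrec lift_cochain :: "complex set \<Rightarrow> int \<Rightarrow> ('a, complex set) cochain_seq \<Rightarrow> ('a, complex) cochain_seq" where
  "lift_cochain \<Lambda> k q 0 = (\<lambda>\<sigma>\<in>smooth_simplices k (prism 0). SOME z. \<Lambda> #>\<^bsub>complex_group\<^esub> z = q 0 \<sigma>)"
| "lift_cochain \<Lambda> k q (Suc n) = (\<lambda>\<sigma>\<in>smooth_simplices k (prism (Suc n)).
     if \<exists>i\<le>Suc n. in_face k i \<sigma> then lift_cochain \<Lambda> k q n (red k n (LEAST i. in_face k i \<sigma>) \<sigma>)
     else SOME z. \<Lambda> #>\<^bsub>complex_group\<^esub> z = q (Suc n) \<sigma>)"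

context
  fixes \<Lambda> :: "complex set"
  assumes \<Lambda>: "subgroup \<Lambda> complex_group"
begin

abbreviation (input) C_cochains where "C_cochains \<equiv> cochains X face complex_group"
abbreviation (input) L_cochains where "L_cochains \<equiv> cochains X face (complex_group\<lparr>carrier := \<Lambda>\<rparr>)"
abbreviation (input) Q_cochains where "Q_cochains \<equiv> cochains X face (complex_group Mod \<Lambda>)"

lemma comm_group_Lambda: "comm_group (complex_group\<lparr>carrier := \<Lambda>\<rparr>)"
proof -
  interpret C: comm_group complex_group by (rule comm_group_complex)
  show ?thesis
    using subgroup.subgroup_is_group[OF \<Lambda> C.is_group] by (rule group.group_comm_groupI) simp
qed

lemma comm_group_Mod: "comm_group (complex_group Mod \<Lambda>)"
  by (rule comm_group.abelian_FactGroup[OF comm_group_complex \<Lambda>])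

lemma coset_hom: "(\<lambda>z. \<Lambda> #>\<^bsub>complex_group\<^esub> z) \<in> hom complex_group (complex_group Mod \<Lambda>)"
  by (rule normal.r_coset_hom_Mod[OF comm_group.subgroup_imp_normal[OF comm_group_complex \<Lambda>]])

lemma coset_eq_iff: "\<Lambda> #>\<^bsub>complex_group\<^esub> z = \<Lambda> \<longleftrightarrow> z \<in> \<Lambda>"
proof -
  interpret C: comm_group complex_group by (rule comm_group_complex)
  show ?thesis
    using C.coset_join1[OF _ _ \<Lambda>, of z] C.coset_join2[OF _ \<Lambda>, of z] subgroup.subset[OF \<Lambda>] by auto
qed

lemma Lambda_cochains_iff:
  "c \<in> compatible_cochains X face (complex_group\<lparr>carrier := \<Lambda>\<rparr>) k \<longleftrightarrow>
    c \<in> compatible_cochains X face complex_group k \<and> (\<forall>n. \<forall>\<sigma>\<in>smooth_simplices k (prism n). c n \<sigma> \<in> \<Lambda>)"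
  unfolding compatible_cochains_iff by (auto simp: PiE_iff)

lemma grp_Lambda_cochains: "grp L_cochains k = (grp C_cochains k)\<lparr>carrier := carrier (grp L_cochains k)\<rparr>"
  by (simp add: cochains_def cochain_group_def product_group_def)

text \<open>The coboundary is formed with products and inverses of the coefficient group; naturality
  under the inclusion of \<open>\<Lambda>\<close> shows that both groups give the same
  result.\<close>

lemma dif_Lambda_cochains:
  assumes "c \<in> compatible_cochains X face (complex_group\<lparr>carrier := \<Lambda>\<rparr>) k"
  shows "dif L_cochains k c = dif C_cochains k c"
proof
  fix n
  have cn: "c n \<in> smooth_simplices k (prism n) \<rightarrow>\<^sub>E carrier (complex_group\<lparr>carrier := \<Lambda>\<rparr>)"
    by (rule compatible_cochainsD(3)[OF assms])
  have "id \<in> hom (complex_group\<lparr>carrier := \<Lambda>\<rparr>) complex_group" by (rule homI) auto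
  from coboundary_natural[OF comm_group_Lambda comm_group_complex this regular_prism cn]
  have "coboundary k (prism n) complex_group (\<lambda>\<sigma>\<in>smooth_simplices k (prism n). c n \<sigma>) =
    (\<lambda>\<sigma>\<in>smooth_simplices (k + 1) (prism n). coboundary k (prism n) (complex_group\<lparr>carrier := \<Lambda>\<rparr>) (c n) \<sigma>)"
    by simp
  moreover have "(\<lambda>\<sigma>\<in>smooth_simplices k (prism n). c n \<sigma>) = c n"
    using cn by (rule PiE_restrict)
  ultimately show "dif L_cochains k c n = dif C_cochains k c n"
    by (simp only: dif_cochains restrict_coboundary)
qed

lemma reduce_mod_apply:
  "reduce_mod X \<Lambda> k c n \<sigma> = (if \<sigma> \<in> smooth_simplices k (prism n) then \<Lambda> #>\<^bsub>complex_group\<^esub> c n \<sigma> else undefined)"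
  by (simp add: reduce_mod_def)

lemma reduce_mod_compatible:
  assumes "c \<in> compatible_cochains X face complex_group k"
  shows "reduce_mod X \<Lambda> k c \<in> compatible_cochains X face (complex_group Mod \<Lambda>) k"
  by (rule compatible_cochainsI)
     (use compatible_cochainsD[OF assms] hom_in_carrier[OF coset_hom] in \<open>auto simp: reduce_mod_apply up_in down_in\<close>)

lemma reduce_mod_hom: "reduce_mod X \<Lambda> k \<in> hom (grp C_cochains k) (grp Q_cochains k)"
proof (rule homI; unfold carrier_cochains)
  fix c d assume c: "c \<in> compatible_cochains X face complex_group k" and d: "d \<in> compatible_cochains X face complex_group k"
  show "reduce_mod X \<Lambda> k (c \<otimes>\<^bsub>grp C_cochains k\<^esub> d) = reduce_mod X \<Lambda> k c \<otimes>\<^bsub>grp Q_cochains k\<^esub> reduce_mod X \<Lambda> k d"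
  proof (rule compatible_cochains_eqI[where k = k])
    show "reduce_mod X \<Lambda> k (c \<otimes>\<^bsub>grp C_cochains k\<^esub> d) \<in> compatible_cochains X face (complex_group Mod \<Lambda>) k"
      by (intro reduce_mod_compatible mult_compatible comm_group_complex c d)
    show "reduce_mod X \<Lambda> k c \<otimes>\<^bsub>grp Q_cochains k\<^esub> reduce_mod X \<Lambda> k d \<in> compatible_cochains X face (complex_group Mod \<Lambda>) k"
      by (intro reduce_mod_compatible mult_compatible comm_group_Mod c d)
    fix n \<sigma> assume \<sigma>: "\<sigma> \<in> smooth_simplices k (prism n)"
    then show "reduce_mod X \<Lambda> k (c \<otimes>\<^bsub>grp C_cochains k\<^esub> d) n \<sigma> = (reduce_mod X \<Lambda> k c \<otimes>\<^bsub>grp Q_cochains k\<^esub> reduce_mod X \<Lambda> k d) n \<sigma>"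
      using hom_mult[OF coset_hom, of "c n \<sigma>" "d n \<sigma>"] by (simp add: mult_cochains reduce_mod_apply)
  qed
qed (rule reduce_mod_compatible)

lemma reduce_mod_kernel:
  assumes "c \<in> compatible_cochains X face complex_group k"
  shows "reduce_mod X \<Lambda> k c = \<one>\<^bsub>grp Q_cochains k\<^esub> \<longleftrightarrow> c \<in> compatible_cochains X face (complex_group\<lparr>carrier := \<Lambda>\<rparr>) k"
  using assms unfolding Lambda_cochains_iff fun_eq_iff
  by (auto simp: reduce_mod_apply one_cochains coset_eq_iff split: if_splits)

lemma reduce_mod_dif:
  assumes "c \<in> compatible_cochains X face complex_group k"
  shows "dif Q_cochains k (reduce_mod X \<Lambda> k c) = reduce_mod X \<Lambda> (k + 1) (dif C_cochains k c)"
  unfolding dif_cochains[abs_def] fun_eq_iff[of "reduce_mod X \<Lambda> (k + 1) _"]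
  using coboundary_natural[OF comm_group_complex comm_group_Mod coset_hom regular_prism compatible_cochainsD(3)[OF assms]]
  by (intro ext) (simp add: reduce_mod_def dif_cochains)

end

lemma drop_simplex_in:
  assumes "\<sigma> \<in> smooth_simplices k (simplex_times (Suc n) (X m))" "i \<le> Suc n" "in_face k i \<sigma>"
  shows "drop_simplex k i \<sigma> \<in> smooth_simplices k (simplex_times n (X m))"
proof -
  have "smooth_map (simplex_space (nat k)) (simplex_times n (X m)) (map_prod (drop_coord i) id \<circ> \<sigma>)"
    by (rule smooth_map_drop_coord[OF manifold _ assms(2)]) (use assms in \<open>auto simp: smooth_simplices_iff\<close>)
  then have "smooth_map (simplex_space (nat k)) (simplex_times n (X m)) (drop_simplex k i \<sigma>)"
    by (rule smooth_map_cong[OF regular_charted_simplex_space]) (simp add: topspace_simplex_space compose_def)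
  then show ?thesis using assms(1) by (simp add: smooth_simplices_iff)
qed

lemma up_drop_simplex:
  assumes "\<sigma> \<in> smooth_simplices k M" "in_face k i \<sigma>"
  shows "up k i (drop_simplex k i \<sigma>) = \<sigma>"
proof
  fix t
  show "up k i (drop_simplex k i \<sigma>) t = \<sigma> t"
    using assms by (cases "t \<in> std_simplex (nat k)"; cases "\<sigma> t")
      (auto simp: compose_def coface_drop_coord smooth_simplices_iff extensional_def)
qed

lemma down_drop_simplex: "down k n i (drop_simplex k i \<sigma>) = red k n i \<sigma>"
  by (auto simp: compose_def fun_eq_iff map_prod_def case_prod_unfold)

lemma smooth_simplex_mem:
  assumes "\<sigma> \<in> smooth_simplices k (simplex_times n M)" "t \<in> std_simplex (nat k)"
  shows "fst (\<sigma> t) \<in> std_simplex n" "snd (\<sigma> t) \<in> topspace (ctop M)"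
proof -
  have "continuous_map (top_of_set (std_simplex (nat k))) (prod_topology (top_of_set (std_simplex n)) (ctop M)) \<sigma>"
    using assms(1) smooth_map_continuous by (fastforce simp: smooth_simplices_iff simplex_space_def simplex_times_ctop)
  then show "fst (\<sigma> t) \<in> std_simplex n" "snd (\<sigma> t) \<in> topspace (ctop M)"
    using assms(2) by (auto simp: continuous_map_def Pi_iff mem_Times_iff)
qed

lemma std_simplex_nonempty: "\<exists>t. t \<in> std_simplex n"
  using vertex_in_simplex[of 0 n] by blast

context
  fixes \<Lambda> :: "complex set" and q :: "('a, complex set) cochain_seq" and k :: int
  assumes \<Lambda>: "subgroup \<Lambda> complex_group"
    and q: "q \<in> compatible_cochains X face (complex_group Mod \<Lambda>) k"
begin

abbreviation (input) "lift \<equiv> lift_cochain \<Lambda> k q"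

lemma red_in:
  assumes "\<sigma> \<in> smooth_simplices k (prism (Suc n))" "i \<le> Suc n" "in_face k i \<sigma>"
  shows "red k n i \<sigma> \<in> smooth_simplices k (prism n)"
  using down_in[OF assms(2) drop_simplex_in[OF assms]] by (simp only: down_drop_simplex)

lemma coset_ex: "\<sigma> \<in> smooth_simplices k (prism n) \<Longrightarrow> \<Lambda> #>\<^bsub>complex_group\<^esub> (SOME z. \<Lambda> #>\<^bsub>complex_group\<^esub> z = q n \<sigma>) = q n \<sigma>"
proof -
  assume "\<sigma> \<in> smooth_simplices k (prism n)"
  then have "q n \<sigma> \<in> carrier (complex_group Mod \<Lambda>)" by (rule compatible_cochainsD(1)[OF q])
  then have "\<exists>z. \<Lambda> #>\<^bsub>complex_group\<^esub> z = q n \<sigma>" by (auto simp: carrier_FactGroup)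
  then show ?thesis by (rule someI_ex)
qed

lemma in_face_Least:
  assumes "\<exists>i\<le>Suc n. in_face k i \<sigma>"
  shows "(LEAST i. in_face k i \<sigma>) \<le> Suc n" "in_face k (LEAST i. in_face k i \<sigma>) \<sigma>"
proof -
  obtain i where i: "i \<le> Suc n" "in_face k i \<sigma>" using assms by blast
  show "in_face k (LEAST i. in_face k i \<sigma>) \<sigma>" by (rule LeastI[of _ i]) (rule i(2))
  show "(LEAST i. in_face k i \<sigma>) \<le> Suc n" using Least_le[of "\<lambda>i. in_face k i \<sigma>" i] i by simp
qed

text \<open>A simplex in a face inherits its value from one degree lower, and it is the
  compatibility of \<open>q\<close> that puts this value into the right coset.\<close>

lemma lift_coset: "\<sigma> \<in> smooth_simplices k (prism n) \<Longrightarrow> \<Lambda> #>\<^bsub>complex_group\<^esub> lift n \<sigma> = q n \<sigma>"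
proof (induction n arbitrary: \<sigma>)
  case 0
  then show ?case using coset_ex by simp
next
  case (Suc n)
  show ?case
  proof (cases "\<exists>i\<le>Suc n. in_face k i \<sigma>")
    case False
    then have "lift (Suc n) \<sigma> = (SOME z. \<Lambda> #>\<^bsub>complex_group\<^esub> z = q (Suc n) \<sigma>)"
      using Suc.prems by (simp only: lift_cochain.simps restrict_apply if_True if_False)
    then show ?thesis by (simp only: coset_ex[OF Suc.prems])
  next
    case True
    let ?i = "LEAST i. in_face k i \<sigma>"
    note i = in_face_Least[OF True]
    have "lift (Suc n) \<sigma> = lift n (red k n ?i \<sigma>)" using True Suc.prems by simp
    then have "\<Lambda> #>\<^bsub>complex_group\<^esub> lift (Suc n) \<sigma> = q n (red k n ?i \<sigma>)"
      using Suc.IH[OF red_in[OF Suc.prems i]] by simp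
    also have "\<dots> = q (Suc n) (up k ?i (drop_simplex k ?i \<sigma>))"
      using compatible_cochainsD(4)[OF q i(1) drop_simplex_in[OF Suc.prems i]] by (simp only: down_drop_simplex)
    finally show ?thesis using up_drop_simplex[OF Suc.prems i(2)] by simp
  qed
qed

lemma in_face_red_less:
  assumes "i < j" "in_face k i \<sigma>" shows "in_face k i (red k n j \<sigma>)"
  using assms by (auto simp: compose_def lookup_drop_coord skip_def map_prod_def case_prod_unfold)

lemma in_face_red_greater:
  assumes "i < j" "in_face k j \<sigma>" shows "in_face k (j - 1) (red k n i \<sigma>)"
  using assms by (auto simp: compose_def lookup_drop_coord skip_def map_prod_def case_prod_unfold)

text \<open>The simplicial identity \<open>face_face\<close> on the manifold factor goes together
  with the dual identity for deleting two coordinates.\<close>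

lemma red_red:
  assumes "\<sigma> \<in> smooth_simplices k (prism (Suc (Suc m)))" "i < j" "j \<le> Suc (Suc m)"
  shows "red k m (j - 1) (red k (Suc m) i \<sigma>) = red k m i (red k (Suc m) j \<sigma>)"
proof
  fix t
  show "red k m (j - 1) (red k (Suc m) i \<sigma>) t = red k m i (red k (Suc m) j \<sigma>) t"
  proof (cases "t \<in> std_simplex (nat k)")
    case True
    have "face (Suc m) i (face (Suc (Suc m)) j (snd (\<sigma> t))) = face (Suc m) (j - 1) (face (Suc (Suc m)) i (snd (\<sigma> t)))"
      using face_face[of i j m "snd (\<sigma> t)"] assms smooth_simplex_mem(2)[OF assms(1) True] by simp
    moreover have "drop_coord (j - 1) (drop_coord i s) = drop_coord i (drop_coord j s)" for s
      using assms(2) by (intro coords_eqI) (auto simp: lookup_drop_coord skip_def)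
    ultimately show ?thesis using True by (simp add: compose_def map_prod_def case_prod_unfold)
  qed (simp add: compose_def)
qed

text \<open>Both values are pushed down once more, to the intersection of faces \<open>i\<close> and
  \<open>j\<close>, where \<open>red_red\<close> identifies them. The premise \<open>IH\<close> is
  compatibility one degree lower, which the induction in \<open>lift_compatible_step\<close>
  provides.\<close>

lemma lift_red_unique:
  assumes IH: "\<And>m i \<tau>. n = Suc m \<Longrightarrow> i \<le> Suc m \<Longrightarrow> \<tau> \<in> smooth_simplices k (prism_face m) \<Longrightarrow>
      lift (Suc m) (up k i \<tau>) = lift m (down k m i \<tau>)"
    and \<sigma>: "\<sigma> \<in> smooth_simplices k (prism (Suc n))" and ij: "i < j" "j \<le> Suc n" "in_face k i \<sigma>" "in_face k j \<sigma>"
  shows "lift n (red k n i \<sigma>) = lift n (red k n j \<sigma>)"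
proof (cases n)
  \<comment> \<open>The two faces of the 1-simplex are disjoint: a common point would have
    coordinate sum 0 instead of 1.\<close>
  case 0
  obtain t where t: "t \<in> std_simplex (nat k)" using std_simplex_nonempty by blast
  have "i = 0" "j = 1" using ij 0 by auto
  then have "(\<Sum>l\<le>Suc 0. lk (fst (\<sigma> t)) l) = 0" using ij t by simp
  then show ?thesis using std_simplexD(4)[OF smooth_simplex_mem(1)[OF \<sigma> t]] 0 by simp
next
  case (Suc m)
  have eq: "lift (Suc m) \<rho> = lift m (red k m l \<rho>)"
    if "\<rho> \<in> smooth_simplices k (prism (Suc m))" "l \<le> Suc m" "in_face k l \<rho>" for \<rho> l
    using IH[OF Suc that(2) drop_simplex_in[OF that]] up_drop_simplex[OF that(1,3)] by (simp only: down_drop_simplex)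
  have "lift n (red k n i \<sigma>) = lift m (red k m (j - 1) (red k n i \<sigma>))"
    unfolding Suc
    by (rule eq[OF red_in[OF \<sigma>[unfolded Suc]] _ in_face_red_greater[OF ij(1,4)]]) (use ij Suc in auto)
  also have "\<dots> = lift m (red k m i (red k n j \<sigma>))"
    using red_red[OF \<sigma>[unfolded Suc] ij(1)] ij Suc by simp
  also have "\<dots> = lift n (red k n j \<sigma>)"
    unfolding Suc
    by (rule eq[symmetric, OF red_in[OF \<sigma>[unfolded Suc]] _ in_face_red_less[OF ij(1,3)]]) (use ij Suc in auto)
  finally show ?thesis .
qed

text \<open>A simplex pushed into face \<open>i\<close> may also lie in a face of smaller index, and
  the recursion follows the least one; \<open>lift_red_unique\<close> compares the two.\<close>

lemma lift_compatible_step: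
  "i \<le> Suc n \<Longrightarrow> \<tau> \<in> smooth_simplices k (prism_face n) \<Longrightarrow> lift (Suc n) (up k i \<tau>) = lift n (down k n i \<tau>)"
proof (induction n arbitrary: i \<tau> rule: less_induct)
  case (less n)
  let ?\<sigma> = "up k i \<tau>"
  have \<sigma>: "?\<sigma> \<in> smooth_simplices k (prism (Suc n))" by (rule up_in[OF less.prems])
  have i: "in_face k i ?\<sigma>"
    by (auto simp: compose_def map_prod_def case_prod_unfold lookup_coface_same)
  have r: "red k n i ?\<sigma> = down k n i \<tau>"
    by (auto simp: compose_def fun_eq_iff map_prod_def case_prod_unfold drop_coord_coface)
  let ?l = "LEAST i. in_face k i ?\<sigma>"
  have ex: "\<exists>i\<le>Suc n. in_face k i ?\<sigma>" using i less.prems(1) by blast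
  note l = in_face_Least[OF ex]
  have "lift (Suc n) ?\<sigma> = lift n (red k n ?l ?\<sigma>)" using ex \<sigma> by simp
  also have "\<dots> = lift n (red k n i ?\<sigma>)"
  proof -
    have le: "?l \<le> i" by (rule Least_le) (rule i)
    show ?thesis
    proof (cases "?l = i")
      case False
      show ?thesis
      proof (rule lift_red_unique[OF _ \<sigma> _ less.prems(1) l(2) i])
        show "?l < i" using le False by simp
        show "lift (Suc m) (up k i' \<tau>') = lift m (down k m i' \<tau>')"
          if "n = Suc m" "i' \<le> Suc m" "\<tau>' \<in> smooth_simplices k (prism_face m)" for m i' \<tau>'
          by (rule less.IH[OF _ that(2,3)]) (simp add: that(1))
      qed
    qed simp
  qed
  finally show ?case unfolding r .
qed

lemma reduce_mod_surj: "\<exists>c\<in>compatible_cochains X face complex_group k. reduce_mod X \<Lambda> k c = q"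
proof (rule bexI[of _ lift])
  have und: "lift n \<sigma> = undefined" if "\<sigma> \<notin> smooth_simplices k (prism n)" for n \<sigma>
    using that by (cases n) auto
  show c: "lift \<in> compatible_cochains X face complex_group k"
    by (rule compatible_cochainsI) (use und lift_compatible_step in auto)
  show "reduce_mod X \<Lambda> k lift = q"
    by (rule compatible_cochains_eqI[OF reduce_mod_compatible[OF \<Lambda> c] q])
       (simp add: reduce_mod_apply[OF \<Lambda>] lift_coset)
qed

end

end

section \<open>The integration map\<close>

lemma simplex_integral_eq:
  "simplex_integral k \<eta> = simplex_int k (\<lambda>x. \<eta> (simplex_chart k) x (map edge [1..<Suc k]))"
  by (simp only: simplex_integral_def simplex_int_def)

lemma simplex_chart_atlas: "simplex_chart n \<in> atlas (simplex_space n)"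
  by (simp add: simplex_space_def)

lemma ctan_simplex_chart: "ctan (simplex_chart n) = simplex_tan n"
  by (simp add: simplex_chart_def)

lemma edges_tan: "set (map edge [1..<Suc k]) \<subseteq> simplex_tan k"
  using edge_tan by auto

lemma pullback_coface:
  assumes "j \<le> Suc m" "y \<in> std_simplex m" "set vs \<subseteq> simplex_tan m"
  shows "pullback (simplex_space m) (simplex_space (Suc m)) (coface j) \<xi> (simplex_chart m) y vs =
    \<xi> (simplex_chart (Suc m)) (coface j y) (map (coface j) vs)"
proof -
  have sub: "coface j ` std_simplex m \<subseteq> std_simplex (Suc m)" using coface_in_simplex[OF assms(1)] by blast
  note L = smooth_map_simplex_linear[OF bounded_linear_coface sub]
  have some: "(SOME d. d \<in> atlas (simplex_space (Suc m)) \<and> y \<in> local_dom (coface j) (simplex_chart m) d) = simplex_chart (Suc m)"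
    using assms(2) L(2)[OF assms(2)] by (intro some_equality) (auto simp: simplex_space_def)
  have deriv: "map (local_deriv (coface j) (simplex_chart m) (simplex_chart (Suc m)) y) vs = map (coface j) vs"
    using L(4)[OF assms(2)] assms(3) by auto
  show ?thesis
    by (simp only: pullback_def simplex_chart_atlas cimg_simplex_chart ctan_simplex_chart assms(2,3) simp_thms if_True
        Let_def some deriv L(3)[OF assms(2)])
qed

text \<open>Stokes on the standard simplex, applied to the pullback of \<open>\<omega>\<close>: its
  differential is the pullback of the differential, and its restriction to face \<open>j\<close> is
  the pullback along that face of \<open>\<sigma>\<close>.\<close>

lemma stokes_pullback:
  assumes N: "regular_charted N" and \<sigma>: "smooth_map (simplex_space (Suc m)) N \<sigma>"
    and \<omega>: "\<omega> \<in> forms (int m) N" and d\<omega>: "ext_deriv N \<omega> \<in> forms (int (Suc m)) N"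
  shows "simplex_integral (Suc m) (pullback (simplex_space (Suc m)) N \<sigma> (ext_deriv N \<omega>)) =
    (\<Sum>j\<le>Suc m. (-1) ^ j * simplex_integral m (pullback (simplex_space m) N (compose (std_simplex m) \<sigma> (coface j)) \<omega>))"
proof -
  let ?S = "simplex_space (Suc m)" and ?c = "simplex_chart (Suc m)"
  let ?\<eta> = "pullback ?S N \<sigma> \<omega>" and ?\<theta> = "pullback ?S N \<sigma> (ext_deriv N \<omega>)"
  note S = regular_charted_simplex_space[of "Suc m"]
  note ch = simplex_chart_atlas[of "Suc m"]
  have "simplex_int (Suc m) (\<lambda>x. ?\<theta> ?c x (map edge [1..<Suc (Suc m)])) =
    (\<Sum>j\<le>Suc m. (-1) ^ j * simplex_int m (\<lambda>y. ?\<eta> ?c (coface j y) (map (coface j) (map edge [1..<Suc m]))))"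
  proof (rule stokes_simplex)
    show "smooth_on (std_simplex (Suc m)) (\<lambda>x. ?\<eta> ?c x vs)" if "set vs \<subseteq> simplex_tan (Suc m)" for vs
      using pullback_smooth[OF S N \<sigma> \<omega> ch] that by (simp add: cimg_simplex_chart ctan_simplex_chart)
    show "alternating_on (simplex_tan (Suc m)) (int m) (?\<eta> ?c x)" if "x \<in> std_simplex (Suc m)" for x
      using pullback_alternating[OF S N \<sigma> \<omega> ch] that by (simp add: cimg_simplex_chart ctan_simplex_chart)
    show "alternating_on (simplex_tan (Suc m)) (int (Suc m)) (?\<theta> ?c x)" if "x \<in> std_simplex (Suc m)" for x
      using pullback_alternating[OF S N \<sigma> d\<omega> ch] that by (simp add: cimg_simplex_chart ctan_simplex_chart)
    show "?\<theta> ?c x vs = (\<Sum>i\<le>m. (-1) ^ i * frechet_derivative (\<lambda>y. ?\<eta> ?c y (del_nth i vs)) (at x within std_simplex (Suc m)) (vs ! i))"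
      if "x \<in> std_simplex (Suc m)" "length vs = Suc m" "set vs \<subseteq> simplex_tan (Suc m)" for x vs
      using ext_deriv_pullback[OF S N \<sigma> \<omega> d\<omega> ch, of x vs] ext_deriv_eq[OF ch, of x vs ?\<eta>] that
      by (simp add: cimg_simplex_chart ctan_simplex_chart lessThan_Suc_atMost)
  qed
  moreover have "simplex_int m (\<lambda>y. ?\<eta> ?c (coface j y) (map (coface j) (map edge [1..<Suc m]))) =
    simplex_integral m (pullback (simplex_space m) N (compose (std_simplex m) \<sigma> (coface j)) \<omega>)" if j: "j \<le> Suc m" for j
  proof -
    note R = regular_charted_simplex_space[of m]
    have sc: "smooth_map (simplex_space m) N (\<sigma> \<circ> coface j)"
      by (rule smooth_map_compose[OF R S N smooth_map_coface[OF j] \<sigma>])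
    have "pullback (simplex_space m) N (compose (std_simplex m) \<sigma> (coface j)) \<omega> = pullback (simplex_space m) N (\<sigma> \<circ> coface j) \<omega>"
      by (rule pullback_cong[OF R _ _ N, symmetric]) (use sc in \<open>auto simp: topspace_simplex_space compose_def\<close>)
    also have "\<dots> = pullback (simplex_space m) ?S (coface j) ?\<eta>"
      by (rule pullback_pullback[OF R S N smooth_map_coface[OF j] \<sigma> \<omega>, symmetric])
    finally show ?thesis
      unfolding simplex_integral_eq
      by (simp only:) (rule simplex_int_cong, rule pullback_coface[OF j _ edges_tan, symmetric])
  qed
  ultimately show ?thesis unfolding simplex_integral_eq[of "Suc m"] by simp
qed

lemma simplex_integral_add:
  assumes N: "regular_charted N" and \<sigma>: "smooth_map (simplex_space m) N \<sigma>"
    and \<omega>: "\<omega> \<in> forms (int m) N" and \<eta>: "\<eta> \<in> forms (int m) N"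
  shows "simplex_integral m (pullback (simplex_space m) N \<sigma> (\<lambda>c x vs. \<omega> c x vs + \<eta> c x vs)) =
    simplex_integral m (pullback (simplex_space m) N \<sigma> \<omega>) + simplex_integral m (pullback (simplex_space m) N \<sigma> \<eta>)"
proof -
  have c: "continuous_on (std_simplex m) (\<lambda>x. pullback (simplex_space m) N \<sigma> \<xi> (simplex_chart m) x (map edge [1..<Suc m]))"
    if "\<xi> \<in> forms (int m) N" for \<xi>
    using smooth_on_imp_continuous_on[OF pullback_smooth[OF regular_charted_simplex_space N \<sigma> that simplex_chart_atlas, of "map edge [1..<Suc m]"]]
      edges_tan[of m]
    by (simp add: cimg_simplex_chart ctan_simplex_chart del: upt_Suc)
  have "pullback (simplex_space m) N \<sigma> (\<lambda>c x vs. \<omega> c x vs + \<eta> c x vs) (simplex_chart m) x vs =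
    pullback (simplex_space m) N \<sigma> \<omega> (simplex_chart m) x vs + pullback (simplex_space m) N \<sigma> \<eta> (simplex_chart m) x vs" for x vs
    by (simp add: pullback_def Let_def)
  then show ?thesis
    unfolding simplex_integral_eq by (simp only: simplex_int_add[OF c[OF \<omega>] c[OF \<eta>]])
qed

lemma simplex_integral_zero: "simplex_integral m (pullback M N \<sigma> (\<lambda>c x vs. 0)) = 0"
proof -
  have "pullback M N \<sigma> (\<lambda>c x vs. 0) = (\<lambda>c x vs. 0)"
    by (intro ext) (simp add: pullback_def Let_def)
  then show ?thesis by (simp add: simplex_integral_def)
qed

section \<open>Integration of compatible forms as a chain map\<close>

context simplicial_manifold
begin

lemma compatible_formsD:
  assumes "\<omega> \<in> compatible_forms X face k"
  shows "\<omega> n \<in> forms k (prism n)"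
    and "i \<le> Suc n \<Longrightarrow> pullback (prism_face n) (prism (Suc n)) (map_prod (coface i) id) (\<omega> (Suc n)) =
       pullback (prism_face n) (prism n) (map_prod id (face (Suc n) i)) (\<omega> n)"
  using assms by (auto simp: compatible_forms_def)

lemma integration_apply:
  "\<sigma> \<in> smooth_simplices k (prism n) \<Longrightarrow> integration X k \<omega> n \<sigma> =
    simplex_integral (nat k) (pullback (simplex_space (nat k)) (prism n) \<sigma> (\<omega> n))"
  by (simp add: integration_def)

lemma pullback_compose_simplex:
  assumes "regular_charted M" "regular_charted N" "smooth_map M N f" "\<tau> \<in> smooth_simplices k M" "\<omega> \<in> forms l N"
  shows "pullback (simplex_space (nat k)) N (compose (std_simplex (nat k)) f \<tau>) \<omega> =
    pullback (simplex_space (nat k)) M \<tau> (pullback M N f \<omega>)"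
proof -
  have \<tau>: "smooth_map (simplex_space (nat k)) M \<tau>" using assms(4) by (simp add: smooth_simplices_iff)
  note R = regular_charted_simplex_space[of "nat k"]
  have "pullback (simplex_space (nat k)) N (compose (std_simplex (nat k)) f \<tau>) \<omega> = pullback (simplex_space (nat k)) N (f \<circ> \<tau>) \<omega>"
    by (rule pullback_cong[OF R _ smooth_map_compose[OF R assms(1,2) \<tau> assms(3)] assms(2), symmetric])
       (simp add: topspace_simplex_space compose_def)
  then show ?thesis by (simp only: pullback_pullback[OF R assms(1,2) \<tau> assms(3,5)])
qed

text \<open>Both values become integrals over \<open>\<tau>\<close> itself, in the face prism, of
  the two pullbacks that compatibility of \<open>\<omega>\<close> equates.\<close>

lemma integration_compatible:
  assumes "\<omega> \<in> compatible_forms X face k"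
  shows "integration X k \<omega> \<in> compatible_cochains X face complex_group k"
proof (rule compatible_cochainsI)
  fix n i \<tau> assume i: "i \<le> Suc n" and \<tau>: "\<tau> \<in> smooth_simplices k (prism_face n)"
  show "integration X k \<omega> (Suc n) (up k i \<tau>) = integration X k \<omega> n (down k n i \<tau>)"
    unfolding integration_apply[OF up_in[OF i \<tau>]] integration_apply[OF down_in[OF i \<tau>]]
      pullback_compose_simplex[OF regular_prism regular_prism smooth_map_up[OF i] \<tau> compatible_formsD(1)[OF assms]]
      pullback_compose_simplex[OF regular_prism regular_prism smooth_map_down[OF i] \<tau> compatible_formsD(1)[OF assms]]
    by (simp only: compatible_formsD(2)[OF assms i])
qed (auto simp: integration_def)

lemma integration_add:
  assumes "\<omega> \<in> compatible_forms X face k" "\<eta> \<in> compatible_forms X face k"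
    and "(\<lambda>n c x vs. \<omega> n c x vs + \<eta> n c x vs) \<in> compatible_forms X face k"
  shows "integration X k (\<lambda>n c x vs. \<omega> n c x vs + \<eta> n c x vs) =
    integration X k \<omega> \<otimes>\<^bsub>grp (cochains X face complex_group) k\<^esub> integration X k \<eta>"
proof (rule compatible_cochains_eqI[where k = k and R = complex_group and R' = complex_group])
  fix n \<sigma> assume \<sigma>: "\<sigma> \<in> smooth_simplices k (prism n)"
  then have k: "int (nat k) = k" and s: "smooth_map (simplex_space (nat k)) (prism n) \<sigma>" by (auto simp: smooth_simplices_iff)
  show "integration X k (\<lambda>n c x vs. \<omega> n c x vs + \<eta> n c x vs) n \<sigma> =
    (integration X k \<omega> \<otimes>\<^bsub>grp (cochains X face complex_group) k\<^esub> integration X k \<eta>) n \<sigma>"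
    using simplex_integral_add[OF regular_prism s] compatible_formsD(1)[OF assms(1), of n] compatible_formsD(1)[OF assms(2), of n] k
    by (simp add: mult_cochains[OF \<sigma>] integration_apply[OF \<sigma>])
qed (intro integration_compatible mult_compatible comm_group_complex assms)+

lemma integration_dif:
  assumes \<omega>: "\<omega> \<in> compatible_forms X face k" and d\<omega>: "dif (de_Rham X face) k \<omega> \<in> compatible_forms X face (k + 1)"
  shows "integration X (k + 1) (dif (de_Rham X face) k \<omega>) = dif (cochains X face complex_group) k (integration X k \<omega>)"
proof (rule compatible_cochains_eqI[where k = "k + 1" and R = complex_group and R' = complex_group])
  fix n \<sigma> assume \<sigma>: "\<sigma> \<in> smooth_simplices (k + 1) (prism n)"
  have d: "dif (de_Rham X face) k \<omega> n = ext_deriv (prism n) (\<omega> n)" by (simp add: de_Rham_def)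
  have \<omega>n: "\<omega> n \<in> forms k (prism n)" by (rule compatible_formsD(1)[OF \<omega>])
  show "integration X (k + 1) (dif (de_Rham X face) k \<omega>) n \<sigma> = dif (cochains X face complex_group) k (integration X k \<omega>) n \<sigma>"
  proof (cases "0 \<le> k")
    case True
    define m where "m = nat k"
    have k: "k = int m" "nat k = m" "nat (k + 1) = Suc m" "k + 1 = int (Suc m)" using True by (auto simp: m_def)
    have "integration X (k + 1) (dif (de_Rham X face) k \<omega>) n \<sigma> =
      simplex_integral (Suc m) (pullback (simplex_space (Suc m)) (prism n) \<sigma> (ext_deriv (prism n) (\<omega> n)))"
      unfolding integration_apply[OF \<sigma>] d k(3) ..
    also have "\<dots> = (\<Sum>j\<le>Suc m. (-1) ^ j * simplex_integral m (pullback (simplex_space m) (prism n) (compose (std_simplex m) \<sigma> (coface j)) (\<omega> n)))"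
    proof (rule stokes_pullback[OF regular_prism])
      show "smooth_map (simplex_space (Suc m)) (prism n) \<sigma>" using \<sigma> k(3) by (simp add: smooth_simplices_iff)
      show "\<omega> n \<in> forms (int m) (prism n)" using \<omega>n k(1) by simp
      show "ext_deriv (prism n) (\<omega> n) \<in> forms (int (Suc m)) (prism n)"
        using compatible_formsD(1)[OF d\<omega>, of n] unfolding d k(4) .
    qed
    also have "\<dots> = (\<Sum>j\<le>nat (k + 1). (-1) ^ j * integration X k \<omega> n (compose (std_simplex (nat k)) \<sigma> (coface j)))"
      unfolding k(3)
    proof (intro sum.cong refl arg_cong2[where f = "(*)"])
      fix j assume "j \<in> {..Suc m}"
      then have "compose (std_simplex (nat k)) \<sigma> (coface j) \<in> smooth_simplices k (prism n)"
        using k(3) by (intro smooth_simplices_coface[OF regular_prism \<sigma> True]) simp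
      then show "simplex_integral m (pullback (simplex_space m) (prism n) (compose (std_simplex m) \<sigma> (coface j)) (\<omega> n)) =
        integration X k \<omega> n (compose (std_simplex (nat k)) \<sigma> (coface j))"
        by (simp only: integration_apply k(2))
    qed
    also have "\<dots> = dif (cochains X face complex_group) k (integration X k \<omega>) n \<sigma>"
      unfolding dif_cochains by (rule coboundary_complex[OF \<sigma> True, symmetric])
    finally show ?thesis .
  next
    \<comment> \<open>In negative degree the form is zero; for \<open>k = -1\<close> there are
      simplices to check, and both sides vanish on them.\<close>
    case False
    have "\<omega> n c x vs = 0" for c x vs
      using forms_nonzero[OF \<omega>n, of c x vs] False by auto
    then have "\<omega> n = (\<lambda>c x vs. 0)" by (intro ext)
    then have "ext_deriv (prism n) (\<omega> n) = (\<lambda>c x vs. 0)" using ext_deriv_zero[OF regular_prism] by simp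
    then show ?thesis
      unfolding integration_apply[OF \<sigma>] d dif_cochains
      using False coboundary_complex_neg[OF \<sigma>] by (simp only: simplex_integral_zero not_le)
  qed
qed (intro integration_compatible coboundary_compatible assms)+

lemma de_Rham_dif_dif:
  assumes "\<omega> \<in> compatible_forms X face k"
  shows "dif (de_Rham X face) (k + 1) (dif (de_Rham X face) k \<omega>) = (\<lambda>n c x vs. 0)"
  using ext_deriv_ext_deriv[OF regular_prism compatible_formsD(1)[OF assms]] by (simp add: de_Rham_def)

end

section \<open>Characters and multiplicative cohomology of abstract complexes\<close>

lemma cohomology_class_hom:
  assumes G: "comm_group G" and Z: "subgroup Z G" and B: "subgroup B G" "B \<subseteq> Z"
  defines "H \<equiv> G\<lparr>carrier := Z\<rparr> Mod B"
  shows "group H" and "(\<lambda>z. B #>\<^bsub>G\<^esub> z) \<in> hom (G\<lparr>carrier := Z\<rparr>) H"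
    and "carrier H = (\<lambda>z. B #>\<^bsub>G\<^esub> z) ` Z" and "\<one>\<^bsub>H\<^esub> = B"
    and "z \<in> Z \<Longrightarrow> B #>\<^bsub>G\<^esub> z = B \<longleftrightarrow> z \<in> B"
proof -
  interpret G: comm_group G by (rule G)
  have gZ: "group (G\<lparr>carrier := Z\<rparr>)" by (rule subgroup.subgroup_is_group[OF Z G.is_group])
  have cZ: "comm_group (G\<lparr>carrier := Z\<rparr>)"
    using subgroup.mem_carrier[OF Z] by (intro group.group_comm_groupI[OF gZ]) (auto intro: G.m_comm)
  have BZ: "subgroup B (G\<lparr>carrier := Z\<rparr>)"
    by (rule G.subgroup_incl[OF B(1) Z B(2)])
  have N: "B \<lhd> (G\<lparr>carrier := Z\<rparr>)" by (rule comm_group.subgroup_imp_normal[OF cZ BZ])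
  have r: "B #>\<^bsub>G\<lparr>carrier := Z\<rparr>\<^esub> z = B #>\<^bsub>G\<^esub> z" for z by (simp add: r_coset_def)
  show "group H" unfolding H_def by (rule normal.factorgroup_is_group[OF N])
  show "(\<lambda>z. B #>\<^bsub>G\<^esub> z) \<in> hom (G\<lparr>carrier := Z\<rparr>) H"
    using normal.r_coset_hom_Mod[OF N] unfolding H_def r .
  show "carrier H = (\<lambda>z. B #>\<^bsub>G\<^esub> z) ` Z" unfolding H_def carrier_FactGroup r by simp
  show "\<one>\<^bsub>H\<^esub> = B" by (simp add: H_def)
  show "z \<in> Z \<Longrightarrow> B #>\<^bsub>G\<^esub> z = B \<longleftrightarrow> z \<in> B"
    using G.coset_join1[OF _ _ B(1), of z] G.coset_join2[OF _ B(1), of z] subgroup.subset[OF B(1)] subgroup.mem_carrier[OF Z, of z]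
    by auto
qed

text \<open>The inclusion of kernels makes \<open>q\<close> constant on the fibres of
  \<open>p\<close>, so it factors through \<open>p\<close>; an element killed by the factor is the
  image under \<open>p\<close> of an element killed by \<open>q\<close>.\<close>

lemma induced_epimorphism:
  assumes W: "group W" and H: "group H" and K: "group K" and p: "p \<in> epi W H" and q: "q \<in> epi W K"
    and ker: "kernel W H p \<subseteq> kernel W K q"
  obtains \<Xi> where "\<Xi> \<in> epi H K" "\<And>w. w \<in> carrier W \<Longrightarrow> \<Xi> (p w) = q w" "kernel H K \<Xi> = p ` kernel W K q"
proof -
  interpret p: group_hom W H p using assms by (simp add: group_hom_def group_hom_axioms_def epi_def)
  interpret q: group_hom W K q using assms by (simp add: group_hom_def group_hom_axioms_def epi_def)
  have psurj: "p ` carrier W = carrier H" and qsurj: "q ` carrier W = carrier K" using p q by (auto simp: epi_def)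
  have wd: "q v = q w" if "v \<in> carrier W" "w \<in> carrier W" "p v = p w" for v w
  proof -
    have "v \<otimes>\<^bsub>W\<^esub> inv\<^bsub>W\<^esub> w \<in> kernel W H p" using that by (simp add: kernel_def)
    then have "q (v \<otimes>\<^bsub>W\<^esub> inv\<^bsub>W\<^esub> w) = \<one>\<^bsub>K\<^esub>" using ker by (auto simp: kernel_def)
    then have "q v \<otimes>\<^bsub>K\<^esub> inv\<^bsub>K\<^esub> q w = \<one>\<^bsub>K\<^esub>" using that by simp
    then show ?thesis using that by (simp add: q.H.inv_equality q.H.inv_solve_right')
  qed
  define \<Xi> where "\<Xi> h = q (SOME w. w \<in> carrier W \<and> p w = h)" for h
  have \<Xi>: "\<Xi> (p w) = q w" if "w \<in> carrier W" for w
  proof -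
    have "\<exists>v. v \<in> carrier W \<and> p v = p w" using that by blast
    then have "(SOME v. v \<in> carrier W \<and> p v = p w) \<in> carrier W \<and> p (SOME v. v \<in> carrier W \<and> p v = p w) = p w"
      by (rule someI_ex)
    then show ?thesis unfolding \<Xi>_def using wd that by blast
  qed
  have hom: "\<Xi> \<in> hom H K"
  proof (rule homI)
    fix x y assume "x \<in> carrier H" "y \<in> carrier H"
    then obtain v w where vw: "v \<in> carrier W" "x = p v" "w \<in> carrier W" "y = p w" using psurj by blast
    have "\<Xi> (p v \<otimes>\<^bsub>H\<^esub> p w) = \<Xi> (p (v \<otimes>\<^bsub>W\<^esub> w))" using vw by simp
    also have "\<dots> = q v \<otimes>\<^bsub>K\<^esub> q w" using vw by (subst \<Xi>) auto
    finally show "\<Xi> (x \<otimes>\<^bsub>H\<^esub> y) = \<Xi> x \<otimes>\<^bsub>K\<^esub> \<Xi> y" using vw by (simp add: \<Xi>)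
  next
    fix x assume "x \<in> carrier H"
    then obtain v where "v \<in> carrier W" "x = p v" using psurj by blast
    then show "\<Xi> x \<in> carrier K" by (simp add: \<Xi>)
  qed
  have "\<Xi> ` carrier H = carrier K"
    unfolding psurj[symmetric] qsurj[symmetric] image_image by (rule image_cong[OF refl]) (rule \<Xi>)
  with hom have "\<Xi> \<in> epi H K" by (simp add: epi_def)
  moreover have "kernel H K \<Xi> = p ` kernel W K q"
    unfolding kernel_def psurj[symmetric] using \<Xi> by auto
  ultimately show ?thesis using that \<Xi> by blast
qed

text \<open>A sign in multiplicative notation: the factor \<open>(-1)^(n+1)\<close> of the cone is
  \<open>sgn_if (odd n)\<close>.\<close>

definition sgn_if :: "bool \<Rightarrow> ('g, 'm) monoid_scheme \<Rightarrow> 'g \<Rightarrow> 'g"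
  where "sgn_if b G x = (if b then x else inv\<^bsub>G\<^esub> x)"

context comm_group
begin

lemma sgn_if_closed [simp]: "x \<in> carrier G \<Longrightarrow> sgn_if b G x \<in> carrier G"
  by (simp add: sgn_if_def)

lemma sgn_if_one [simp]: "sgn_if b G \<one> = \<one>"
  by (simp add: sgn_if_def)

lemma sgn_if_mult: "x \<in> carrier G \<Longrightarrow> y \<in> carrier G \<Longrightarrow> sgn_if b G (x \<otimes> y) = sgn_if b G x \<otimes> sgn_if b G y"
  by (simp add: sgn_if_def inv_mult)

lemma sgn_if_sgn_if [simp]: "x \<in> carrier G \<Longrightarrow> sgn_if b G (sgn_if b G x) = x"
  by (simp add: sgn_if_def)

lemma sgn_if_not: "x \<in> carrier G \<Longrightarrow> sgn_if (\<not> b) G x = inv (sgn_if b G x)"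
  by (simp add: sgn_if_def)

lemma sgn_if_inv: "x \<in> carrier G \<Longrightarrow> sgn_if b G (inv x) = inv (sgn_if b G x)"
  by (simp add: sgn_if_def)

lemma sgn_if_in: "subgroup H G \<Longrightarrow> x \<in> H \<Longrightarrow> sgn_if b G x \<in> H"
  by (simp add: sgn_if_def subgroup.m_inv_closed)

end

lemma hom_sgn_if:
  assumes "group G" "group H" "h \<in> hom G H" "x \<in> carrier G"
  shows "h (sgn_if b G x) = sgn_if b H (h x)"
proof -
  interpret group_hom G H h using assms by (simp add: group_hom_def group_hom_axioms_def)
  show ?thesis using assms(4) by (simp add: sgn_if_def)
qed

text \<open>Retains of the geometry a short exact sequence of complexes from \<open>L\<close>
  through \<open>C\<close> to \<open>Q\<close> and a chain map \<open>I\<close> from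
  \<open>A\<close> to \<open>C\<close>. The assumption \<open>\<rho>_surj\<close> stands for the
  lifting of cochains and \<open>dI\<close> for Stokes' theorem; what follows is algebra.\<close>

locale character_complexes =
  fixes A :: "'f cplx" and L C :: "'c cplx" and Q :: "'q cplx"
    and I :: "int \<Rightarrow> 'f \<Rightarrow> 'c" and \<rho> :: "int \<Rightarrow> 'c \<Rightarrow> 'q"
  assumes comm_A: "comm_group (grp A j)" and comm_C: "comm_group (grp C j)" and comm_Q: "comm_group (grp Q j)"
    and dA: "dif A j \<in> hom (grp A j) (grp A (j + 1))" and dC: "dif C j \<in> hom (grp C j) (grp C (j + 1))"
    and ddA: "x \<in> carrier (grp A j) \<Longrightarrow> dif A (j + 1) (dif A j x) = \<one>\<^bsub>grp A (j + 1 + 1)\<^esub>"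
    and ddC: "y \<in> carrier (grp C j) \<Longrightarrow> dif C (j + 1) (dif C j y) = \<one>\<^bsub>grp C (j + 1 + 1)\<^esub>"
    and L_grp: "grp L j = (grp C j)\<lparr>carrier := carrier (grp L j)\<rparr>"
    and L_subset: "carrier (grp L j) \<subseteq> carrier (grp C j)"
    and dL: "y \<in> carrier (grp L j) \<Longrightarrow> dif L j y = dif C j y"
    and \<rho>: "\<rho> j \<in> hom (grp C j) (grp Q j)"
    and \<rho>_surj: "q \<in> carrier (grp Q j) \<Longrightarrow> \<exists>y\<in>carrier (grp C j). \<rho> j y = q"
    and \<rho>_kernel: "y \<in> carrier (grp C j) \<Longrightarrow> \<rho> j y = \<one>\<^bsub>grp Q j\<^esub> \<longleftrightarrow> y \<in> carrier (grp L j)"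
    and dQ: "y \<in> carrier (grp C j) \<Longrightarrow> dif Q j (\<rho> j y) = \<rho> (j + 1) (dif C j y)"
    and I: "I j \<in> hom (grp A j) (grp C j)"
    and dI: "x \<in> carrier (grp A j) \<Longrightarrow> I (j + 1) (dif A j x) = dif C j (I j x)"
begin

sublocale A: comm_group "grp A j" for j by (rule comm_A)
sublocale C: comm_group "grp C j" for j by (rule comm_C)
sublocale Q: comm_group "grp Q j" for j by (rule comm_Q)
sublocale dA: group_hom "grp A j" "grp A (j + 1)" "dif A j" for j
  by (unfold_locales) (rule dA)
sublocale dC: group_hom "grp C j" "grp C (j + 1)" "dif C j" for j
  by (unfold_locales) (rule dC)
sublocale \<rho>: group_hom "grp C j" "grp Q j" "\<rho> j" for j
  by (unfold_locales) (rule \<rho>)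
sublocale I: group_hom "grp A j" "grp C j" "I j" for j
  by (unfold_locales) (rule I)

lemma L_subgroup: "subgroup (carrier (grp L j)) (grp C j)"
proof -
  have "carrier (grp L j) = kernel (grp C j) (grp Q j) (\<rho> j)"
    using \<rho>_kernel L_subset by (auto simp: kernel_def)
  then show ?thesis using \<rho>.subgroup_kernel by simp
qed

text \<open>Additivity descends from \<open>C\<close> along the surjection
  \<open>\<rho>\<close>.\<close>

lemma dQ_hom: "dif Q j \<in> hom (grp Q j) (grp Q (j + 1))"
proof (rule homI)
  fix x y assume "x \<in> carrier (grp Q j)" "y \<in> carrier (grp Q j)"
  then obtain u v where uv: "u \<in> carrier (grp C j)" "\<rho> j u = x" "v \<in> carrier (grp C j)" "\<rho> j v = y"
    using \<rho>_surj by metis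
  have "dif Q j (\<rho> j u \<otimes>\<^bsub>grp Q j\<^esub> \<rho> j v) = dif Q j (\<rho> j (u \<otimes>\<^bsub>grp C j\<^esub> v))" using uv by simp
  also have "\<dots> = \<rho> (j + 1) (dif C j (u \<otimes>\<^bsub>grp C j\<^esub> v))" by (rule dQ) (use uv in simp)
  also have "\<dots> = \<rho> (j + 1) (dif C j u) \<otimes>\<^bsub>grp Q (j + 1)\<^esub> \<rho> (j + 1) (dif C j v)" using uv by simp
  also have "\<dots> = dif Q j (\<rho> j u) \<otimes>\<^bsub>grp Q (j + 1)\<^esub> dif Q j (\<rho> j v)" using uv(1,3) by (simp add: dQ)
  finally show "dif Q j (x \<otimes>\<^bsub>grp Q j\<^esub> y) = dif Q j x \<otimes>\<^bsub>grp Q (j + 1)\<^esub> dif Q j y" using uv by simp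
next
  fix x assume "x \<in> carrier (grp Q j)"
  then obtain u where "u \<in> carrier (grp C j)" "\<rho> j u = x" using \<rho>_surj by metis
  then show "dif Q j x \<in> carrier (grp Q (j + 1))" using dQ by auto
qed

sublocale dQ: group_hom "grp Q j" "grp Q (j + 1)" "dif Q j" for j
  by (unfold_locales) (rule dQ_hom)

text \<open>\<open>L\<close> is the kernel of \<open>\<rho>\<close>, which commutes with the
  differentials.\<close>

lemma dC_L: "y \<in> carrier (grp L j) \<Longrightarrow> dif C j y \<in> carrier (grp L (j + 1))"
proof -
  assume y: "y \<in> carrier (grp L j)"
  then have yC: "y \<in> carrier (grp C j)" using L_subset by blast
  have "\<rho> (j + 1) (dif C j y) = \<one>\<^bsub>grp Q (j + 1)\<^esub>"
    using dQ[OF yC] \<rho>_kernel[OF yC] y dQ.hom_one by simp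
  then show ?thesis using \<rho>_kernel[of "dif C j y" "j + 1"] yC by simp
qed

end

text \<open>Consecutive degrees get their own names: \<open>k - 1 + 1\<close> and \<open>k\<close>
  index the same group but do not match syntactically, so the facts about differentials are restated
  after rewriting with \<open>degs\<close>.\<close>

locale character_degree = character_complexes A L C Q I \<rho>
  for A :: "'f cplx" and L C :: "'c cplx" and Q :: "'q cplx"
    and I :: "int \<Rightarrow> 'f \<Rightarrow> 'c" and \<rho> :: "int \<Rightarrow> 'c \<Rightarrow> 'q" +
  fixes k j i :: int
  assumes kj: "j = k - 1" and ji: "i = j - 1"
begin

lemma degs: "j + 1 = k" "i + 1 = j" "k - 1 = j" "j - 1 = i"
  using kj ji by auto

declare degs(1,2) [simp]

abbreviation (input) E1 where "E1 \<equiv> cone (\<lambda>k \<omega>. \<rho> k (I k \<omega>)) (cplx_trunc k A) Q"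
abbreviation (input) E2 where "E2 \<equiv> cone (\<lambda>k (c, \<omega>). let C = grp C k in c \<otimes>\<^bsub>C\<^esub> inv\<^bsub>C\<^esub> (I k \<omega>)) (cplx_sum L A) C"

abbreviation (input) s where "s \<equiv> sgn_if (odd k) (grp C k)"
abbreviation (input) t where "t \<equiv> sgn_if (odd j) (grp C j)"

lemmas dCj [simp] = dC.hom_closed[of _ j, unfolded degs] dC.hom_closed[of _ i, unfolded degs]
lemmas dAj [simp] = dA.hom_closed[of _ j, unfolded degs]
lemmas dQi [simp] = dQ.hom_closed[of _ i, unfolded degs] dQ.hom_closed[of _ j, unfolded degs]
lemmas dCj_mult = dC.hom_mult[of _ j, unfolded degs] dC.hom_mult[of _ i, unfolded degs]
lemmas dC_one = dC.hom_one[of j, unfolded degs] dC.hom_one[of i, unfolded degs]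
lemmas dC_inv = dC.hom_inv[of _ j, unfolded degs] dC.hom_inv[of _ i, unfolded degs]
lemmas dA_one = dA.hom_one[of j, unfolded degs]
lemmas ddCi = ddC[of _ i, unfolded degs]
lemmas ddAj = ddA[of _ j, unfolded degs]
lemmas dIj = dI[of _ j, unfolded degs]
lemmas dQj = dQ[of _ j, unfolded degs] dQ[of _ i, unfolded degs]
lemmas LC = subsetD[OF L_subset]

lemma parity: "odd j \<longleftrightarrow> \<not> odd k"
  using kj by simp

text \<open>Neighbouring degrees carry opposite signs; therefore the mixed terms cancel when the
  differential of the cone is applied twice.\<close>

lemma d_t: "x \<in> carrier (grp C j) \<Longrightarrow> dif C j (t x) = inv\<^bsub>grp C k\<^esub> s (dif C j x)"
  using hom_sgn_if[OF C.is_group C.is_group dC[of j], of x "odd j", unfolded degs] C.sgn_if_not[of "dif C j x" k "odd k"]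
  by (simp add: parity)

lemma d_s: "x \<in> carrier (grp C j) \<Longrightarrow> dif C j (sgn_if (odd k) (grp C j) x) = s (dif C j x)"
  using hom_sgn_if[OF C.is_group C.is_group dC[of j], of x "odd k", unfolded degs] .

lemma grp_E1: "grp E1 k = grp A k \<times>\<times> grp Q j"
  by (simp add: cone_def cplx_trunc_def degs)

lemma cocycles_E1: "cocycles E1 k = {(a, b). a \<in> carrier (grp A k) \<and> b \<in> carrier (grp Q j) \<and> dif A k a = \<one>\<^bsub>grp A (k + 1)\<^esub> \<and>
    sgn_if (odd k) (grp Q k) (\<rho> k (I k a)) \<otimes>\<^bsub>grp Q k\<^esub> dif Q j b = \<one>\<^bsub>grp Q k\<^esub>}"
  unfolding cocycles_def kernel_def
  by (auto simp: cone_def cplx_trunc_def sgn_if_def degs)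

text \<open>The truncation leaves only the trivial form in degree \<open>j\<close>, so all
  coboundaries come from \<open>Q\<close>.\<close>

lemma coboundaries_E1: "coboundaries E1 k = {(\<one>\<^bsub>grp A k\<^esub>, dif Q i b) |b. b \<in> carrier (grp Q i)}"
proof -
  have "dif E1 j (\<one>\<^bsub>grp A j\<^esub>, b) = (\<one>\<^bsub>grp A k\<^esub>, dif Q i b)" if "b \<in> carrier (grp Q i)" for b
    using that by (simp add: cone_def cplx_trunc_def degs dA_one)
  moreover have "carrier (grp E1 j) = {\<one>\<^bsub>grp A j\<^esub>} \<times> carrier (grp Q i)"
  proof -
    have "\<not> k \<le> j" using kj by simp
    then show ?thesis by (simp add: cone_def cplx_trunc_def degs(4))
  qed
  ultimately show ?thesis unfolding coboundaries_def degs(3) by (auto simp: image_iff)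
qed

lemma grp_E2: "grp E2 k = (grp L k \<times>\<times> grp A k) \<times>\<times> grp C j"
  by (simp add: cone_def cplx_sum_def degs)

lemma one_L: "\<one>\<^bsub>grp L l\<^esub> = \<one>\<^bsub>grp C l\<^esub>" and mult_L: "x \<otimes>\<^bsub>grp L l\<^esub> y = x \<otimes>\<^bsub>grp C l\<^esub> y"
  by (subst L_grp, simp)+

lemma cocycles_E2: "cocycles E2 k = {((c, a), b). c \<in> carrier (grp L k) \<and> a \<in> carrier (grp A k) \<and> b \<in> carrier (grp C j) \<and>
    dif C k c = \<one>\<^bsub>grp C (k + 1)\<^esub> \<and> dif A k a = \<one>\<^bsub>grp A (k + 1)\<^esub> \<and>
    s (c \<otimes>\<^bsub>grp C k\<^esub> inv\<^bsub>grp C k\<^esub> I k a) \<otimes>\<^bsub>grp C k\<^esub> dif C j b = \<one>\<^bsub>grp C k\<^esub>}"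
  unfolding cocycles_def kernel_def
  by (auto simp: cone_def cplx_sum_def sgn_if_def degs one_L dL Let_def)

text \<open>In contrast to \<open>coboundaries_E1\<close>, forms of degree \<open>j\<close>
  contribute here; this contrast is the source of the kernel.\<close>

lemma coboundaries_E2: "coboundaries E2 k = {((dif C j l, dif A j a), t (l \<otimes>\<^bsub>grp C j\<^esub> inv\<^bsub>grp C j\<^esub> I j a) \<otimes>\<^bsub>grp C j\<^esub> dif C i b) |l a b.
    l \<in> carrier (grp L j) \<and> a \<in> carrier (grp A j) \<and> b \<in> carrier (grp C i)}"
proof -
  have d: "dif E2 j ((l, a), b) = ((dif C j l, dif A j a), t (l \<otimes>\<^bsub>grp C j\<^esub> inv\<^bsub>grp C j\<^esub> I j a) \<otimes>\<^bsub>grp C j\<^esub> dif C i b)"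
    if "l \<in> carrier (grp L j)" for l a b
    using that by (simp add: cone_def cplx_sum_def sgn_if_def degs dL Let_def)
  have carr: "carrier (grp E2 j) = (carrier (grp L j) \<times> carrier (grp A j)) \<times> carrier (grp C i)"
    by (simp add: cone_def cplx_sum_def degs)
  show ?thesis
    unfolding coboundaries_def degs(3) carr
  proof (intro equalityI subsetI)
    fix x assume "x \<in> dif E2 j ` ((carrier (grp L j) \<times> carrier (grp A j)) \<times> carrier (grp C i))"
    then obtain l a b where "l \<in> carrier (grp L j)" "a \<in> carrier (grp A j)" "b \<in> carrier (grp C i)" "x = dif E2 j ((l, a), b)"
      by (elim imageE SigmaE) simp
    with d show "x \<in> {((dif C j l, dif A j a), t (l \<otimes>\<^bsub>grp C j\<^esub> inv\<^bsub>grp C j\<^esub> I j a) \<otimes>\<^bsub>grp C j\<^esub> dif C i b) |l a b.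
      l \<in> carrier (grp L j) \<and> a \<in> carrier (grp A j) \<and> b \<in> carrier (grp C i)}" by blast
  next
    fix x assume "x \<in> {((dif C j l, dif A j a), t (l \<otimes>\<^bsub>grp C j\<^esub> inv\<^bsub>grp C j\<^esub> I j a) \<otimes>\<^bsub>grp C j\<^esub> dif C i b) |l a b.
      l \<in> carrier (grp L j) \<and> a \<in> carrier (grp A j) \<and> b \<in> carrier (grp C i)}"
    then obtain l a b where lab: "l \<in> carrier (grp L j)" "a \<in> carrier (grp A j)" "b \<in> carrier (grp C i)"
      "x = ((dif C j l, dif A j a), t (l \<otimes>\<^bsub>grp C j\<^esub> inv\<^bsub>grp C j\<^esub> I j a) \<otimes>\<^bsub>grp C j\<^esub> dif C i b)" by blast
    show "x \<in> dif E2 j ` ((carrier (grp L j) \<times> carrier (grp A j)) \<times> carrier (grp C i))"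
      by (rule image_eqI[of _ _ "((l, a), b)"]) (use lab d in simp_all)
  qed
qed

lemma comm_E1: "comm_group (grp E1 k)"
  unfolding grp_E1 by (rule group.group_comm_groupI[OF DirProd_group[OF A.is_group Q.is_group]]) (auto simp: A.m_comm Q.m_comm)

lemma group_L: "group (grp L l)"
  using subgroup.subgroup_is_group[OF L_subgroup C.is_group] L_grp by metis

lemma comm_E2: "comm_group (grp E2 k)"
  unfolding grp_E2
  by (rule group.group_comm_groupI[OF DirProd_group[OF DirProd_group[OF group_L A.is_group] C.is_group]])
     (auto simp: A.m_comm C.m_comm LC mult_L)

lemma subgroup_homI:
  assumes "group G" "group H" "h \<in> hom G H" shows "subgroup (h ` carrier G) H"
  using group_hom.img_is_subgroup[of G H h] assms by (simp add: group_hom_def group_hom_axioms_def)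

text \<open>Pairs \<open>(\<omega>, c)\<close> with a cochain lifting the second component of a character; both cohomology
  groups are quotients of this group.\<close>

definition lifts :: "('f \<times> 'c) set" where
  "lifts = {(a, c). a \<in> carrier (grp A k) \<and> c \<in> carrier (grp C j) \<and> dif A k a = \<one>\<^bsub>grp A (k + 1)\<^esub> \<and>
     s (I k a) \<otimes>\<^bsub>grp C k\<^esub> dif C j c \<in> carrier (grp L k)}"

definition lift_group :: "('f \<times> 'c) monoid" where
  "lift_group = (grp A k \<times>\<times> grp C j)\<lparr>carrier := lifts\<rparr>"

lemma subgroup_lifts: "subgroup lifts (grp A k \<times>\<times> grp C j)"
proof -
  let ?P = "grp A k \<times>\<times> grp C j"
  have P: "group ?P" by (rule DirProd_group[OF A.is_group C.is_group])
  show ?thesis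
  proof (rule group.subgroupI[OF P])
    show "lifts \<subseteq> carrier ?P" by (auto simp: lifts_def)
    have "(\<one>\<^bsub>grp A k\<^esub>, \<one>\<^bsub>grp C j\<^esub>) \<in> lifts"
      using subgroup.one_closed[OF L_subgroup] by (simp add: lifts_def dC_one)
    then show "lifts \<noteq> {}" by blast
    fix x assume "x \<in> lifts"
    then obtain a c where x: "x = (a, c)" "a \<in> carrier (grp A k)" "c \<in> carrier (grp C j)" "dif A k a = \<one>\<^bsub>grp A (k + 1)\<^esub>"
       "s (I k a) \<otimes>\<^bsub>grp C k\<^esub> dif C j c \<in> carrier (grp L k)"
      by (auto simp: lifts_def)
    have "inv\<^bsub>grp C k\<^esub> (s (I k a) \<otimes>\<^bsub>grp C k\<^esub> dif C j c) \<in> carrier (grp L k)"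
      by (rule subgroup.m_inv_closed[OF L_subgroup x(5)])
    then have "s (I k (inv\<^bsub>grp A k\<^esub> a)) \<otimes>\<^bsub>grp C k\<^esub> dif C j (inv\<^bsub>grp C j\<^esub> c) \<in> carrier (grp L k)"
      using x by (simp add: C.inv_mult C.sgn_if_inv dC_inv)
    then show "inv\<^bsub>?P\<^esub> x \<in> lifts"
      using x by (simp add: lifts_def inv_DirProd[OF A.is_group C.is_group])
    fix y assume "y \<in> lifts"
    then obtain b e where y: "y = (b, e)" "b \<in> carrier (grp A k)" "e \<in> carrier (grp C j)" "dif A k b = \<one>\<^bsub>grp A (k + 1)\<^esub>"
       "s (I k b) \<otimes>\<^bsub>grp C k\<^esub> dif C j e \<in> carrier (grp L k)"
      by (auto simp: lifts_def)
    have "(s (I k a) \<otimes>\<^bsub>grp C k\<^esub> dif C j c) \<otimes>\<^bsub>grp C k\<^esub> (s (I k b) \<otimes>\<^bsub>grp C k\<^esub> dif C j e) \<in> carrier (grp L k)"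
      by (rule subgroup.m_closed[OF L_subgroup x(5) y(5)])
    also have "(s (I k a) \<otimes>\<^bsub>grp C k\<^esub> dif C j c) \<otimes>\<^bsub>grp C k\<^esub> (s (I k b) \<otimes>\<^bsub>grp C k\<^esub> dif C j e) =
      s (I k (a \<otimes>\<^bsub>grp A k\<^esub> b)) \<otimes>\<^bsub>grp C k\<^esub> dif C j (c \<otimes>\<^bsub>grp C j\<^esub> e)"
      using x y by (simp add: C.sgn_if_mult dCj_mult C.m_ac)
    finally show "x \<otimes>\<^bsub>?P\<^esub> y \<in> lifts" using x y by (simp add: lifts_def)
  qed
qed

lemma group_lift_group: "group lift_group"
  unfolding lift_group_def by (rule subgroup.subgroup_is_group[OF subgroup_lifts DirProd_group[OF A.is_group C.is_group]])

definition to_char :: "'f \<times> 'c \<Rightarrow> 'f \<times> 'q" where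
  "to_char w = (fst w, \<rho> j (snd w))"

text \<open>With last component \<open>- c\<close>, the cocycle condition for
  \<open>((l, a), - c)\<close> reads \<open>s (l - I a) = d c\<close> in additive notation. As
  \<open>s\<close> is an involution it can be solved for \<open>l\<close>, which gives the first
  entry.\<close>

definition to_mult :: "'f \<times> 'c \<Rightarrow> ('c \<times> 'f) \<times> 'c" where
  "to_mult w = ((I k (fst w) \<otimes>\<^bsub>grp C k\<^esub> s (dif C j (snd w)), fst w), inv\<^bsub>grp C j\<^esub> snd w)"

lemma subgroup_coboundaries_E1: "subgroup (coboundaries E1 k) (grp E1 k)"
proof -
  have "(\<lambda>b. (\<one>\<^bsub>grp A k\<^esub>, dif Q i b)) \<in> hom (grp Q i) (grp E1 k)"
    unfolding grp_E1 by (rule homI) (use dQ.hom_mult[of _ i, unfolded degs] in auto)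
  from subgroup_homI[OF Q.is_group comm_group.axioms(2)[OF comm_E1] this] show ?thesis
    unfolding coboundaries_E1 by (simp add: setcompr_eq_image)
qed

lemma subgroup_cocycles_E1: "subgroup (cocycles E1 k) (grp E1 k)"
proof -
  interpret G: comm_group "grp E1 k" by (rule comm_E1)
  let ?f = "\<lambda>x. (dif A k (fst x), sgn_if (odd k) (grp Q k) (\<rho> k (I k (fst x))) \<otimes>\<^bsub>grp Q k\<^esub> dif Q j (snd x))"
  have "?f \<in> hom (grp E1 k) (grp A (k + 1) \<times>\<times> grp Q k)"
    unfolding grp_E1
    by (rule homI) (auto simp: Q.sgn_if_mult dQ.hom_mult[of _ j, unfolded degs] Q.m_ac)
  then have "group_hom (grp E1 k) (grp A (k + 1) \<times>\<times> grp Q k) ?f"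
    using G.is_group DirProd_group[OF A.is_group Q.is_group] by (simp add: group_hom_def group_hom_axioms_def)
  then have "subgroup (kernel (grp E1 k) (grp A (k + 1) \<times>\<times> grp Q k) ?f) (grp E1 k)"
    by (rule group_hom.subgroup_kernel)
  moreover have "kernel (grp E1 k) (grp A (k + 1) \<times>\<times> grp Q k) ?f = cocycles E1 k"
    unfolding cocycles_E1 kernel_def grp_E1 by auto
  ultimately show ?thesis by simp
qed

text \<open>The square of the differential of \<open>Q\<close> is computed on a lift to
  \<open>C\<close>, where it vanishes by \<open>ddC\<close>.\<close>

lemma coboundaries_E1_subset: "coboundaries E1 k \<subseteq> cocycles E1 k"
proof
  fix x assume "x \<in> coboundaries E1 k"
  then obtain b where b: "b \<in> carrier (grp Q i)" "x = (\<one>\<^bsub>grp A k\<^esub>, dif Q i b)" unfolding coboundaries_E1 by blast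
  obtain y where y: "y \<in> carrier (grp C i)" "\<rho> i y = b" using \<rho>_surj[OF b(1)] by blast
  have "dif Q j (dif Q i b) = \<one>\<^bsub>grp Q k\<^esub>"
    using y dQj(2)[OF y(1)] dQj(1)[of "dif C i y"] ddCi[OF y(1)] by auto
  then show "x \<in> cocycles E1 k" unfolding cocycles_E1 using b by simp
qed

lemma subgroup_coboundaries_E2: "subgroup (coboundaries E2 k) (grp E2 k)"
proof -
  let ?P = "(grp L j \<times>\<times> grp A j) \<times>\<times> grp C i"
  let ?f = "\<lambda>x. ((dif C j (fst (fst x)), dif A j (snd (fst x))),
     t (fst (fst x) \<otimes>\<^bsub>grp C j\<^esub> inv\<^bsub>grp C j\<^esub> I j (snd (fst x))) \<otimes>\<^bsub>grp C j\<^esub> dif C i (snd x))"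
  have "?f \<in> hom ?P (grp E2 k)"
    unfolding grp_E2
    by (rule homI)
       (use LC dC_L[of _ j, unfolded degs] in
         \<open>auto simp: mult_L C.sgn_if_mult dCj_mult dA.hom_mult[of _ j, unfolded degs] C.inv_mult C.m_ac\<close>)
  from subgroup_homI[OF DirProd_group[OF DirProd_group[OF group_L A.is_group] C.is_group] comm_group.axioms(2)[OF comm_E2] this]
  have "subgroup (?f ` carrier ?P) (grp E2 k)" .
  moreover have "?f ` carrier ?P = coboundaries E2 k"
    unfolding coboundaries_E2 by force
  ultimately show ?thesis by simp
qed

lemma subgroup_cocycles_E2: "subgroup (cocycles E2 k) (grp E2 k)"
proof -
  interpret G: comm_group "grp E2 k" by (rule comm_E2)
  let ?H = "(grp C (k + 1) \<times>\<times> grp A (k + 1)) \<times>\<times> grp C k"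
  let ?f = "\<lambda>x. ((dif C k (fst (fst x)), dif A k (snd (fst x))),
     s (fst (fst x) \<otimes>\<^bsub>grp C k\<^esub> inv\<^bsub>grp C k\<^esub> I k (snd (fst x))) \<otimes>\<^bsub>grp C k\<^esub> dif C j (snd x))"
  have "?f \<in> hom (grp E2 k) ?H"
    unfolding grp_E2
    by (rule homI) (use LC in \<open>auto simp: mult_L C.sgn_if_mult dCj_mult C.inv_mult C.m_ac\<close>)
  then have "group_hom (grp E2 k) ?H ?f"
    using G.is_group DirProd_group[OF DirProd_group[OF C.is_group A.is_group] C.is_group] by (simp add: group_hom_def group_hom_axioms_def)
  then have "subgroup (kernel (grp E2 k) ?H ?f) (grp E2 k)"
    by (rule group_hom.subgroup_kernel)
  moreover have "kernel (grp E2 k) ?H ?f = cocycles E2 k"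
    unfolding cocycles_E2 kernel_def grp_E2 by auto
  ultimately show ?thesis by simp
qed

text \<open>By \<open>d_t\<close> the differential of the \<open>t\<close>-term is inverse to the
  \<open>s\<close>-term of the cone, once \<open>dI\<close> has matched the contributions of the
  form.\<close>

lemma coboundaries_E2_subset: "coboundaries E2 k \<subseteq> cocycles E2 k"
proof
  fix x assume "x \<in> coboundaries E2 k"
  then obtain l a b where x: "l \<in> carrier (grp L j)" "a \<in> carrier (grp A j)" "b \<in> carrier (grp C i)"
    "x = ((dif C j l, dif A j a), t (l \<otimes>\<^bsub>grp C j\<^esub> inv\<^bsub>grp C j\<^esub> I j a) \<otimes>\<^bsub>grp C j\<^esub> dif C i b)"
    unfolding coboundaries_E2 by blast
  let ?y = "l \<otimes>\<^bsub>grp C j\<^esub> inv\<^bsub>grp C j\<^esub> I j a"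
  have y: "?y \<in> carrier (grp C j)" using x LC by simp
  have "dif C j (t ?y \<otimes>\<^bsub>grp C j\<^esub> dif C i b) = inv\<^bsub>grp C k\<^esub> s (dif C j ?y)"
    using x y ddCi[OF x(3)] by (simp add: dCj_mult d_t)
  moreover have "dif C j ?y = dif C j l \<otimes>\<^bsub>grp C k\<^esub> inv\<^bsub>grp C k\<^esub> I k (dif A j a)"
    using x LC by (simp add: dCj_mult dC_inv dIj)
  moreover have "dif C k (dif C j l) = \<one>\<^bsub>grp C (k + 1)\<^esub>" using ddC[OF LC[OF x(1)]] unfolding degs .
  ultimately show "x \<in> cocycles E2 k"
    unfolding cocycles_E2 using x y dC_L[OF x(1), unfolded degs] ddAj[OF x(2)] LC[OF x(1)] by simp
qed

lemmas H1 = cohomology_class_hom[OF comm_E1 subgroup_cocycles_E1 subgroup_coboundaries_E1 coboundaries_E1_subset, folded cohomology_def]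
lemmas H2 = cohomology_class_hom[OF comm_E2 subgroup_cocycles_E2 subgroup_coboundaries_E2 coboundaries_E2_subset, folded cohomology_def]

lemma to_char_in: "w \<in> lifts \<Longrightarrow> to_char w \<in> cocycles E1 k"
proof -
  assume "w \<in> lifts"
  then obtain a c where w: "w = (a, c)" "a \<in> carrier (grp A k)" "c \<in> carrier (grp C j)" "dif A k a = \<one>\<^bsub>grp A (k + 1)\<^esub>"
       "s (I k a) \<otimes>\<^bsub>grp C k\<^esub> dif C j c \<in> carrier (grp L k)"
    by (auto simp: lifts_def)
  have "\<rho> k (s (I k a) \<otimes>\<^bsub>grp C k\<^esub> dif C j c) = \<one>\<^bsub>grp Q k\<^esub>"
    using w \<rho>_kernel[of "s (I k a) \<otimes>\<^bsub>grp C k\<^esub> dif C j c" k] by simp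
  then show ?thesis
    using w by (simp add: to_char_def cocycles_E1 hom_sgn_if[OF C.is_group Q.is_group \<rho>] dQj)
qed

lemma to_char_hom: "to_char \<in> hom lift_group ((grp E1 k)\<lparr>carrier := cocycles E1 k\<rparr>)"
  using to_char_in by (intro homI) (auto simp: lift_group_def to_char_def grp_E1 lifts_def)

lemma to_char_surj: "to_char ` lifts = cocycles E1 k"
proof (intro equalityI subsetI)
  fix x assume "x \<in> cocycles E1 k"
  then obtain a b where x: "x = (a, b)" "a \<in> carrier (grp A k)" "b \<in> carrier (grp Q j)" "dif A k a = \<one>\<^bsub>grp A (k + 1)\<^esub>"
    "sgn_if (odd k) (grp Q k) (\<rho> k (I k a)) \<otimes>\<^bsub>grp Q k\<^esub> dif Q j b = \<one>\<^bsub>grp Q k\<^esub>"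
    unfolding cocycles_E1 by blast
  \<comment> \<open>Here the cochain of a character is lifted to complex values.\<close>
  obtain c where c: "c \<in> carrier (grp C j)" "\<rho> j c = b" using \<rho>_surj[OF x(3)] by blast
  have "\<rho> k (s (I k a) \<otimes>\<^bsub>grp C k\<^esub> dif C j c) = \<one>\<^bsub>grp Q k\<^esub>"
    using x c by (simp add: hom_sgn_if[OF C.is_group Q.is_group \<rho>] flip: dQj)
  then have "(a, c) \<in> lifts"
    using x c \<rho>_kernel[of "s (I k a) \<otimes>\<^bsub>grp C k\<^esub> dif C j c" k] by (simp add: lifts_def)
  moreover have "x = to_char (a, c)" using x c by (simp add: to_char_def)
  ultimately show "x \<in> to_char ` lifts" by blast
qed (use to_char_in in auto)

lemma to_mult_in: "w \<in> lifts \<Longrightarrow> to_mult w \<in> cocycles E2 k"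
proof -
  assume "w \<in> lifts"
  then obtain a c where w: "w = (a, c)" "a \<in> carrier (grp A k)" "c \<in> carrier (grp C j)" "dif A k a = \<one>\<^bsub>grp A (k + 1)\<^esub>"
       "s (I k a) \<otimes>\<^bsub>grp C k\<^esub> dif C j c \<in> carrier (grp L k)"
    by (auto simp: lifts_def)
  let ?l = "I k a \<otimes>\<^bsub>grp C k\<^esub> s (dif C j c)"
  \<comment> \<open>Applying the involution \<open>s\<close> to the \<open>L\<close>-valued element
    in the definition of \<open>lifts\<close> gives the first entry of
    \<open>to_mult\<close>.\<close>
  have "s (s (I k a) \<otimes>\<^bsub>grp C k\<^esub> dif C j c) \<in> carrier (grp L k)"
    by (rule C.sgn_if_in[OF L_subgroup w(5)])
  then have l: "?l \<in> carrier (grp L k)" using w by (simp add: C.sgn_if_mult)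
  have "dif C k (I k a) = \<one>\<^bsub>grp C (k + 1)\<^esub>" using dI[OF w(2)] w(4) by simp
  moreover have "dif C k (s (dif C j c)) = \<one>\<^bsub>grp C (k + 1)\<^esub>"
    using w ddC[of c j] hom_sgn_if[OF C.is_group C.is_group dC[of k], of "dif C j c" "odd k"] by (simp add: degs)
  ultimately have dl: "dif C k ?l = \<one>\<^bsub>grp C (k + 1)\<^esub>" using w by simp
  have "?l \<otimes>\<^bsub>grp C k\<^esub> inv\<^bsub>grp C k\<^esub> I k a = s (dif C j c)"
    using w by (simp add: C.m_comm[of "I k a"] C.m_assoc)
  then have "s (?l \<otimes>\<^bsub>grp C k\<^esub> inv\<^bsub>grp C k\<^esub> I k a) \<otimes>\<^bsub>grp C k\<^esub> dif C j (inv\<^bsub>grp C j\<^esub> c) = \<one>\<^bsub>grp C k\<^esub>"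
    using w by (simp add: dC_inv)
  then show ?thesis using w l dl by (simp add: to_mult_def cocycles_E2)
qed

lemma to_mult_hom: "to_mult \<in> hom lift_group ((grp E2 k)\<lparr>carrier := cocycles E2 k\<rparr>)"
proof (rule homI)
  fix x y assume "x \<in> carrier lift_group" "y \<in> carrier lift_group"
  then show "to_mult (x \<otimes>\<^bsub>lift_group\<^esub> y) = to_mult x \<otimes>\<^bsub>(grp E2 k)\<lparr>carrier := cocycles E2 k\<rparr>\<^esub> to_mult y"
    by (auto simp: lift_group_def lifts_def to_mult_def grp_E2 mult_L dCj_mult C.sgn_if_mult C.inv_mult C.m_ac)
qed (use to_mult_in in \<open>auto simp: lift_group_def\<close>)

text \<open>A multiplicative cocycle already contains a lift, namely its form and the inverse of its
  last cochain; the cocycle condition recovers the \<open>L\<close>-valued entry from them.\<close>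

lemma to_mult_surj: "to_mult ` lifts = cocycles E2 k"
proof (intro equalityI subsetI)
  fix x assume "x \<in> cocycles E2 k"
  then obtain c a b where x: "x = ((c, a), b)" "c \<in> carrier (grp L k)" "a \<in> carrier (grp A k)" "b \<in> carrier (grp C j)"
    "dif A k a = \<one>\<^bsub>grp A (k + 1)\<^esub>" "s (c \<otimes>\<^bsub>grp C k\<^esub> inv\<^bsub>grp C k\<^esub> I k a) \<otimes>\<^bsub>grp C k\<^esub> dif C j b = \<one>\<^bsub>grp C k\<^esub>"
    unfolding cocycles_E2 by blast
  let ?y = "c \<otimes>\<^bsub>grp C k\<^esub> inv\<^bsub>grp C k\<^esub> I k a"
  have c: "c \<in> carrier (grp C k)" using x(2) by (rule LC)
  have y: "?y \<in> carrier (grp C k)" using c x by simp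
  have db: "dif C j (inv\<^bsub>grp C j\<^esub> b) = s ?y"
    using C.inv_equality[OF x(6)] x y by (simp add: dC_inv)
  have "s (I k a) \<otimes>\<^bsub>grp C k\<^esub> s ?y = s c"
    using c x y by (simp add: C.m_comm[of c] C.m_assoc[symmetric] flip: C.sgn_if_mult)
  then have "(a, inv\<^bsub>grp C j\<^esub> b) \<in> lifts"
    using x db C.sgn_if_in[OF L_subgroup x(2)] by (simp add: lifts_def)
  moreover have "I k a \<otimes>\<^bsub>grp C k\<^esub> ?y = c"
    using c x by (simp add: C.m_comm[of c] C.m_assoc[symmetric])
  then have "x = to_mult (a, inv\<^bsub>grp C j\<^esub> b)" using x y db by (simp add: to_mult_def)
  ultimately show "x \<in> to_mult ` lifts" by blast
qed (use to_mult_in in auto)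

section \<open>The two quotient maps and their kernels\<close>

abbreviation (input) p where "p \<equiv> \<lambda>w. coboundaries E1 k #>\<^bsub>grp E1 k\<^esub> to_char w"
abbreviation (input) q where "q \<equiv> \<lambda>w. coboundaries E2 k #>\<^bsub>grp E2 k\<^esub> to_mult w"

lemma p_epi: "p \<in> epi lift_group (cohomology E1 k)"
  using hom_compose[OF to_char_hom H1(2)] to_char_surj H1(3)
  by (simp add: epi_def comp_def lift_group_def image_image[symmetric])

lemma q_epi: "q \<in> epi lift_group (cohomology E2 k)"
  using hom_compose[OF to_mult_hom H2(2)] to_mult_surj H2(3)
  by (simp add: epi_def comp_def lift_group_def image_image[symmetric])

lemma kernel_p: "kernel lift_group (cohomology E1 k) p = {w \<in> lifts. to_char w \<in> coboundaries E1 k}"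
proof -
  have "p w = \<one>\<^bsub>cohomology E1 k\<^esub> \<longleftrightarrow> to_char w \<in> coboundaries E1 k" if "w \<in> lifts" for w
    unfolding H1(4) by (rule H1(5)[OF to_char_in[OF that]])
  then show ?thesis unfolding kernel_def by (auto simp: lift_group_def)
qed

lemma kernel_q: "kernel lift_group (cohomology E2 k) q = {w \<in> lifts. to_mult w \<in> coboundaries E2 k}"
proof -
  have "q w = \<one>\<^bsub>cohomology E2 k\<^esub> \<longleftrightarrow> to_mult w \<in> coboundaries E2 k" if "w \<in> lifts" for w
    unfolding H2(4) by (rule H2(5)[OF to_mult_in[OF that]])
  then show ?thesis unfolding kernel_def by (auto simp: lift_group_def)
qed

text \<open>Lifting the primitive from \<open>Q\<close> to \<open>C\<close> leaves a discrepancy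
  that reduces to zero and hence lies in \<open>L\<close>.\<close>

lemma \<rho>_exact:
  assumes "c \<in> carrier (grp C j)"
  shows "(\<exists>b\<in>carrier (grp Q i). \<rho> j c = dif Q i b) \<longleftrightarrow> (\<exists>l\<in>carrier (grp L j). \<exists>b\<in>carrier (grp C i). c = l \<otimes>\<^bsub>grp C j\<^esub> dif C i b)"
proof
  assume "\<exists>b\<in>carrier (grp Q i). \<rho> j c = dif Q i b"
  then obtain b' where b': "b' \<in> carrier (grp Q i)" "\<rho> j c = dif Q i b'" by blast
  obtain b where b: "b \<in> carrier (grp C i)" "\<rho> i b = b'" using \<rho>_surj[OF b'(1)] by blast
  let ?l = "c \<otimes>\<^bsub>grp C j\<^esub> inv\<^bsub>grp C j\<^esub> dif C i b"
  have "\<rho> j ?l = \<one>\<^bsub>grp Q j\<^esub>" using assms b b' dQj(2)[OF b(1)] by simp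
  then have "?l \<in> carrier (grp L j)" using assms b \<rho>_kernel[of ?l j] by simp
  moreover have "c = ?l \<otimes>\<^bsub>grp C j\<^esub> dif C i b" using assms b by (simp add: C.m_assoc)
  ultimately show "\<exists>l\<in>carrier (grp L j). \<exists>b\<in>carrier (grp C i). c = l \<otimes>\<^bsub>grp C j\<^esub> dif C i b" using b(1) by blast
next
  assume "\<exists>l\<in>carrier (grp L j). \<exists>b\<in>carrier (grp C i). c = l \<otimes>\<^bsub>grp C j\<^esub> dif C i b"
  then obtain l b where "l \<in> carrier (grp L j)" "b \<in> carrier (grp C i)" "c = l \<otimes>\<^bsub>grp C j\<^esub> dif C i b" by blast
  then show "\<exists>b\<in>carrier (grp Q i). \<rho> j c = dif Q i b"
    using \<rho>_kernel[of l j] LC[of l j] dQj(2)[of b] by (intro bexI[of _ "\<rho> i b"]) auto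
qed

lemma to_char_coboundary_iff:
  assumes "(a, c) \<in> lifts"
  shows "to_char (a, c) \<in> coboundaries E1 k \<longleftrightarrow> a = \<one>\<^bsub>grp A k\<^esub> \<and>
    (\<exists>l\<in>carrier (grp L j). \<exists>b\<in>carrier (grp C i). c = l \<otimes>\<^bsub>grp C j\<^esub> dif C i b)"
  using assms \<rho>_exact[of c] by (auto simp: to_char_def coboundaries_E1 lifts_def)

lemma inv_t: "x \<in> carrier (grp C j) \<Longrightarrow> inv\<^bsub>grp C j\<^esub> t x = sgn_if (odd k) (grp C j) x"
  using C.sgn_if_not[of x j "odd j"] by (simp add: parity)

text \<open>A pair representing a trivial character has zero form and a cochain that is the sum of
  some \<open>l\<close> in \<open>L\<close> and a coboundary \<open>d b\<close>. The same
  \<open>l\<close> and \<open>b\<close>, up to signs, bound its image in the multiplicative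
  cone.\<close>

lemma kernel_p_subset: "kernel lift_group (cohomology E1 k) p \<subseteq> kernel lift_group (cohomology E2 k) q"
  unfolding kernel_p kernel_q
proof clarify
  fix a c assume w: "(a, c) \<in> lifts" and "to_char (a, c) \<in> coboundaries E1 k"
  then obtain l b where lb: "a = \<one>\<^bsub>grp A k\<^esub>" "l \<in> carrier (grp L j)" "b \<in> carrier (grp C i)" "c = l \<otimes>\<^bsub>grp C j\<^esub> dif C i b"
    using to_char_coboundary_iff[OF w] by blast
  \<comment> \<open>This sign is opposite to \<open>t\<close>, so \<open>t ?l\<close> is the inverse
    of \<open>l\<close>, as the last component of \<open>to_mult (a, c)\<close> requires.\<close>
  let ?l = "sgn_if (odd k) (grp C j) l"
  have l: "l \<in> carrier (grp C j)" "?l \<in> carrier (grp L j)" using lb(2) LC C.sgn_if_in[OF L_subgroup] by auto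
  have tl: "t ?l = inv\<^bsub>grp C j\<^esub> l"
    using l inv_t[of "t l"] inv_t[OF l(1)] C.sgn_if_inv[of "t l" j "odd j"] by simp
  have "to_mult (a, c) = ((dif C j ?l, dif A j \<one>\<^bsub>grp A j\<^esub>), t (?l \<otimes>\<^bsub>grp C j\<^esub> inv\<^bsub>grp C j\<^esub> I j \<one>\<^bsub>grp A j\<^esub>) \<otimes>\<^bsub>grp C j\<^esub> dif C i (inv\<^bsub>grp C i\<^esub> b))"
    using lb l tl ddCi[OF lb(3)] by (simp add: to_mult_def dA_one dCj_mult d_s C.inv_mult dC_inv)
  then show "to_mult (a, c) \<in> coboundaries E2 k"
    unfolding coboundaries_E2 using l(2) lb(3) by blast
qed

text \<open>The sign \<open>t\<close> makes the differential of \<open>t (I j a)\<close> inverse to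
  \<open>s (I k (dif A j a))\<close>. So the \<open>L\<close>-valued element attached to the pair is
  trivial, and \<open>to_mult\<close> sends the pair to the coboundary of the form \<open>a\<close>
  in the multiplicative cone.\<close>

definition from_form :: "'f \<Rightarrow> 'f \<times> 'c" where
  "from_form a = (dif A j a, t (I j a))"

lemma from_form_in:
  assumes a: "a \<in> carrier (grp A j)"
  shows "from_form a \<in> lifts"
  using a dIj[OF a] ddAj[OF a] subgroup.one_closed[OF L_subgroup] by (simp add: from_form_def lifts_def d_t)

lemma from_form_hom: "from_form \<in> hom (grp A j) lift_group"
  using from_form_in
  by (intro homI) (auto simp: lift_group_def from_form_def dA.hom_mult[of _ j, unfolded degs] C.sgn_if_mult)

lemma from_form_kernel:
  assumes a: "a \<in> carrier (grp A j)"
  shows "to_mult (from_form a) \<in> coboundaries E2 k"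
proof -
  have "to_mult (from_form a) = ((dif C j \<one>\<^bsub>grp C j\<^esub>, dif A j a), t (\<one>\<^bsub>grp C j\<^esub> \<otimes>\<^bsub>grp C j\<^esub> inv\<^bsub>grp C j\<^esub> I j a) \<otimes>\<^bsub>grp C j\<^esub> dif C i \<one>\<^bsub>grp C i\<^esub>)"
    using a dIj[OF a] by (simp add: to_mult_def from_form_def dC_one d_t C.sgn_if_inv)
  then show ?thesis
    unfolding coboundaries_E2 using a subgroup.one_closed[OF L_subgroup] C.one_closed by blast
qed

text \<open>A lift with vanishing multiplicative class differs from some \<open>from_form a\<close>
  by a pair with zero form whose cochain lies in \<open>L\<close> up to a coboundary, and such a
  pair is a trivial character.\<close>

lemma kernel_q_from_form: "p ` kernel lift_group (cohomology E2 k) q = (\<lambda>a. p (from_form a)) ` carrier (grp A j)"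
proof (intro equalityI subsetI)
  fix x assume "x \<in> (\<lambda>a. p (from_form a)) ` carrier (grp A j)"
  then show "x \<in> p ` kernel lift_group (cohomology E2 k) q"
    unfolding kernel_q using from_form_in from_form_kernel by blast
next
  interpret p: group_hom lift_group "cohomology E1 k" p
    using p_epi group_lift_group H1(1) by (simp add: group_hom_def group_hom_axioms_def epi_def)
  fix x assume "x \<in> p ` kernel lift_group (cohomology E2 k) q"
  then obtain w where "w \<in> lifts" "to_mult w \<in> coboundaries E2 k" and x: "x = p w"
    unfolding kernel_q by blast
  then obtain \<omega> c where w: "w = (\<omega>, c)" "(\<omega>, c) \<in> lifts" "to_mult (\<omega>, c) \<in> coboundaries E2 k" by (cases w) auto
  then obtain l a b where lab: "l \<in> carrier (grp L j)" "a \<in> carrier (grp A j)" "b \<in> carrier (grp C i)"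
      "\<omega> = dif A j a" "inv\<^bsub>grp C j\<^esub> c = t (l \<otimes>\<^bsub>grp C j\<^esub> inv\<^bsub>grp C j\<^esub> I j a) \<otimes>\<^bsub>grp C j\<^esub> dif C i b"
    unfolding coboundaries_E2 to_mult_def by auto
  have c: "c \<in> carrier (grp C j)" using w(2) by (simp add: lifts_def)
  have l: "l \<in> carrier (grp C j)" using lab(1) by (rule LC)
  let ?l = "inv\<^bsub>grp C j\<^esub> t l" and ?b = "inv\<^bsub>grp C i\<^esub> b"
  have l': "?l \<in> carrier (grp L j)"
    using subgroup.m_inv_closed[OF L_subgroup C.sgn_if_in[OF L_subgroup lab(1)]] .
  have "c = inv\<^bsub>grp C j\<^esub> (t (l \<otimes>\<^bsub>grp C j\<^esub> inv\<^bsub>grp C j\<^esub> I j a) \<otimes>\<^bsub>grp C j\<^esub> dif C i b)"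
    using lab(5) c by (metis C.inv_inv)
  also have "\<dots> = t (I j a) \<otimes>\<^bsub>grp C j\<^esub> (?l \<otimes>\<^bsub>grp C j\<^esub> dif C i ?b)"
    using lab l by (simp add: C.sgn_if_mult C.sgn_if_inv C.inv_mult dC_inv C.m_ac)
  finally have ceq: "c = t (I j a) \<otimes>\<^bsub>grp C j\<^esub> (?l \<otimes>\<^bsub>grp C j\<^esub> dif C i ?b)" .
  let ?v = "(\<one>\<^bsub>grp A k\<^esub>, ?l \<otimes>\<^bsub>grp C j\<^esub> dif C i ?b)"
  have v: "?v \<in> lifts"
    using lab l dC_L[OF l', unfolded degs] LC[OF dC_L[OF l', unfolded degs]] ddCi[of ?b] by (simp add: lifts_def dCj_mult)
  then have "to_char ?v \<in> coboundaries E1 k"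
    using to_char_coboundary_iff[OF v] l' lab(3) by blast
  then have "p ?v = \<one>\<^bsub>cohomology E1 k\<^esub>"
    using kernel_p v by (auto simp: kernel_def)
  moreover have "w = from_form a \<otimes>\<^bsub>lift_group\<^esub> ?v"
    using w(1) lab ceq by (simp add: from_form_def lift_group_def)
  moreover have "from_form a \<in> carrier lift_group" "?v \<in> carrier lift_group"
    using from_form_in[OF lab(2)] v by (simp_all add: lift_group_def)
  ultimately have "p w = p (from_form a) \<otimes>\<^bsub>cohomology E1 k\<^esub> \<one>\<^bsub>cohomology E1 k\<^esub>"
    using p.hom_mult[of "from_form a" ?v] by simp
  also have "\<dots> = p (from_form a)"
    by (rule p.H.r_one) (rule p.hom_closed[OF \<open>from_form a \<in> carrier lift_group\<close>])
  finally have "p w = p (from_form a)" .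
  then show "x \<in> (\<lambda>a. p (from_form a)) ` carrier (grp A j)" using x lab(2) by blast
qed

text \<open>Unfolds classes into cochains, the shape in which the kernel is computed. The map of
  classes is well defined because coboundaries of \<open>L\<close> are coboundaries of
  \<open>C\<close>, and \<open>l\<close> is a cocycle automatically since \<open>I j a\<close> is
  one.\<close>

lemma integral_classes_iff:
  "{a \<in> cocycles A j. coh_class C j (I j a) \<in> coh_map (\<lambda>c. c) C j ` carrier (cohomology L j)} =
   {a \<in> carrier (grp A j). dif A j a = \<one>\<^bsub>grp A k\<^esub> \<and> (\<exists>l\<in>carrier (grp L j). \<exists>b\<in>carrier (grp C i). I j a = l \<otimes>\<^bsub>grp C j\<^esub> dif C i b)}"
proof -
  let ?BC = "coboundaries C j" and ?BL = "coboundaries L j"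
  have BC: "?BC = dif C i ` carrier (grp C i)" by (simp add: coboundaries_def degs)
  have BL: "?BL = dif C i ` carrier (grp L i)" by (simp add: coboundaries_def degs dL cong: image_cong)
  have sBC: "subgroup ?BC (grp C j)"
    unfolding BC using subgroup_homI[OF C.is_group C.is_group dC[of i, unfolded degs]] .
  have BLC: "?BL \<subseteq> ?BC" unfolding BL BC using LC by auto
  have ZL: "z \<in> cocycles L j \<longleftrightarrow> z \<in> carrier (grp L j) \<and> dif C j z = \<one>\<^bsub>grp C k\<^esub>" for z
    by (auto simp: cocycles_def kernel_def dL one_L degs)
  have cm: "coh_map (\<lambda>c. c) C j (?BL #>\<^bsub>grp L j\<^esub> z) = ?BC #>\<^bsub>grp C j\<^esub> z" if z: "z \<in> cocycles L j" for z
  proof -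
    have zC: "z \<in> carrier (grp C j)" using z LC by (simp add: ZL)
    have "?BC #>\<^bsub>grp C j\<^esub> y = ?BC #>\<^bsub>grp C j\<^esub> z" if "y \<in> ?BL #>\<^bsub>grp L j\<^esub> z" for y
    proof -
      have "y \<in> ?BC #>\<^bsub>grp C j\<^esub> z" using that BLC by (auto simp: r_coset_def mult_L)
      then show ?thesis using C.repr_independence[OF _ zC sBC] by metis
    qed
    moreover have "z \<in> ?BL #>\<^bsub>grp L j\<^esub> z"
    proof -
      have "\<one>\<^bsub>grp C j\<^esub> \<in> ?BL"
        unfolding BL using subgroup.one_closed[OF L_subgroup, of i] dC_one(2) by (metis imageI)
      then show ?thesis using zC by (force simp: r_coset_def mult_L)
    qed
    ultimately have "(\<lambda>y. coh_class C j y) ` (?BL #>\<^bsub>grp L j\<^esub> z) = {?BC #>\<^bsub>grp C j\<^esub> z}"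
      unfolding coh_class_def by blast
    then show ?thesis by (simp add: coh_map_def)
  qed
  have carr: "carrier (cohomology L j) = (\<lambda>z. ?BL #>\<^bsub>grp L j\<^esub> z) ` cocycles L j"
    unfolding cohomology_def carrier_FactGroup by (simp add: r_coset_def)
  have im: "coh_map (\<lambda>c. c) C j ` carrier (cohomology L j) = (\<lambda>z. ?BC #>\<^bsub>grp C j\<^esub> z) ` cocycles L j"
    unfolding carr image_image by (rule image_cong[OF refl]) (rule cm)
  show ?thesis
  proof (intro equalityI subsetI)
    fix a assume "a \<in> {a \<in> cocycles A j. coh_class C j (I j a) \<in> coh_map (\<lambda>c. c) C j ` carrier (cohomology L j)}"
    then have a: "a \<in> carrier (grp A j)" "dif A j a = \<one>\<^bsub>grp A k\<^esub>"
      and "?BC #>\<^bsub>grp C j\<^esub> I j a \<in> (\<lambda>z. ?BC #>\<^bsub>grp C j\<^esub> z) ` cocycles L j"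
      unfolding im[symmetric] by (auto simp: cocycles_def kernel_def degs coh_class_def)
    then obtain z where z: "z \<in> cocycles L j" "?BC #>\<^bsub>grp C j\<^esub> I j a = ?BC #>\<^bsub>grp C j\<^esub> z" by blast
    have "I j a \<in> ?BC #>\<^bsub>grp C j\<^esub> z"
      unfolding z(2)[symmetric] by (rule C.rcos_self[OF _ sBC]) (use a in simp)
    then obtain b where b: "b \<in> carrier (grp C i)" "I j a = dif C i b \<otimes>\<^bsub>grp C j\<^esub> z"
      by (auto simp: r_coset_def BC)
    have zL: "z \<in> carrier (grp L j)" using z(1) by (simp add: ZL)
    have "I j a = z \<otimes>\<^bsub>grp C j\<^esub> dif C i b" using b LC[OF zL] by (simp add: C.m_comm)
    then show "a \<in> {a \<in> carrier (grp A j). dif A j a = \<one>\<^bsub>grp A k\<^esub> \<and> (\<exists>l\<in>carrier (grp L j). \<exists>b\<in>carrier (grp C i). I j a = l \<otimes>\<^bsub>grp C j\<^esub> dif C i b)}"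
      using a zL b(1) by blast
  next
    fix a assume "a \<in> {a \<in> carrier (grp A j). dif A j a = \<one>\<^bsub>grp A k\<^esub> \<and> (\<exists>l\<in>carrier (grp L j). \<exists>b\<in>carrier (grp C i). I j a = l \<otimes>\<^bsub>grp C j\<^esub> dif C i b)}"
    then obtain l b where a: "a \<in> carrier (grp A j)" "dif A j a = \<one>\<^bsub>grp A k\<^esub>"
      and lb: "l \<in> carrier (grp L j)" "b \<in> carrier (grp C i)" "I j a = l \<otimes>\<^bsub>grp C j\<^esub> dif C i b" by blast
    have l: "l \<in> carrier (grp C j)" using lb(1) by (rule LC)
    have "dif C j (I j a) = \<one>\<^bsub>grp C k\<^esub>" using dIj[OF a(1)] a(2) by simp
    then have "dif C j l = \<one>\<^bsub>grp C k\<^esub>" using lb l ddCi[OF lb(2)] by (simp add: dCj_mult)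
    then have zl: "l \<in> cocycles L j" using lb(1) by (simp add: ZL)
    have "I j a \<in> ?BC #>\<^bsub>grp C j\<^esub> l"
      using lb l by (auto simp: r_coset_def BC C.m_comm)
    then have "?BC #>\<^bsub>grp C j\<^esub> I j a = ?BC #>\<^bsub>grp C j\<^esub> l"
      using C.repr_independence[OF _ l sBC] by metis
    then have "coh_class C j (I j a) \<in> coh_map (\<lambda>c. c) C j ` carrier (cohomology L j)"
      unfolding im coh_class_def using zl by blast
    then show "a \<in> {a \<in> cocycles A j. coh_class C j (I j a) \<in> coh_map (\<lambda>c. c) C j ` carrier (cohomology L j)}"
      using a by (simp add: cocycles_def kernel_def degs)
  qed
qed

lemma kernel_from_form:
  "kernel (grp A j) (cohomology E1 k) (\<lambda>a. p (from_form a)) =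
    {a \<in> cocycles A j. coh_class C j (I j a) \<in> coh_map (\<lambda>c. c) C j ` carrier (cohomology L j)}"
proof -
  have "p (from_form a) = \<one>\<^bsub>cohomology E1 k\<^esub> \<longleftrightarrow>
    dif A j a = \<one>\<^bsub>grp A k\<^esub> \<and> (\<exists>l\<in>carrier (grp L j). \<exists>b\<in>carrier (grp C i). I j a = l \<otimes>\<^bsub>grp C j\<^esub> dif C i b)"
    if a: "a \<in> carrier (grp A j)" for a
  proof -
    have "p (from_form a) = \<one>\<^bsub>cohomology E1 k\<^esub> \<longleftrightarrow> to_char (from_form a) \<in> coboundaries E1 k"
      using H1(4) H1(5)[OF to_char_in[OF from_form_in[OF a]]] by simp
    also have "\<dots> \<longleftrightarrow> dif A j a = \<one>\<^bsub>grp A k\<^esub> \<and> (\<exists>l\<in>carrier (grp L j). \<exists>b\<in>carrier (grp C i). t (I j a) = l \<otimes>\<^bsub>grp C j\<^esub> dif C i b)"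
      using to_char_coboundary_iff[of "dif A j a" "t (I j a)"] from_form_in[OF a] by (simp add: from_form_def)
    also have "(\<exists>l\<in>carrier (grp L j). \<exists>b\<in>carrier (grp C i). t (I j a) = l \<otimes>\<^bsub>grp C j\<^esub> dif C i b) \<longleftrightarrow>
      (\<exists>l\<in>carrier (grp L j). \<exists>b\<in>carrier (grp C i). I j a = l \<otimes>\<^bsub>grp C j\<^esub> dif C i b)"
    proof -
      \<comment> \<open>The sign \<open>t\<close> preserves \<open>L\<close> and commutes with the
        differential; being its own inverse, it can be removed by the same argument that inserts
        it.\<close>
      have step: "\<exists>l\<in>carrier (grp L j). \<exists>b\<in>carrier (grp C i). t x = l \<otimes>\<^bsub>grp C j\<^esub> dif C i b"
        if "l \<in> carrier (grp L j)" "b \<in> carrier (grp C i)" "x = l \<otimes>\<^bsub>grp C j\<^esub> dif C i b" for x l b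
      proof (intro bexI)
        show "t x = t l \<otimes>\<^bsub>grp C j\<^esub> dif C i (sgn_if (odd j) (grp C i) b)"
          using that LC[OF that(1)] hom_sgn_if[OF C.is_group C.is_group dC[of i], of b "odd j", unfolded degs]
          by (simp add: C.sgn_if_mult)
        show "t l \<in> carrier (grp L j)" by (rule C.sgn_if_in[OF L_subgroup that(1)])
      qed (use that in simp)
      show ?thesis
      proof
        assume "\<exists>l\<in>carrier (grp L j). \<exists>b\<in>carrier (grp C i). t (I j a) = l \<otimes>\<^bsub>grp C j\<^esub> dif C i b"
        then obtain l b where "l \<in> carrier (grp L j)" "b \<in> carrier (grp C i)" "t (I j a) = l \<otimes>\<^bsub>grp C j\<^esub> dif C i b" by blast
        from step[OF this] show "\<exists>l\<in>carrier (grp L j). \<exists>b\<in>carrier (grp C i). I j a = l \<otimes>\<^bsub>grp C j\<^esub> dif C i b"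
          using a by simp
      next
        assume "\<exists>l\<in>carrier (grp L j). \<exists>b\<in>carrier (grp C i). I j a = l \<otimes>\<^bsub>grp C j\<^esub> dif C i b"
        then show "\<exists>l\<in>carrier (grp L j). \<exists>b\<in>carrier (grp C i). t (I j a) = l \<otimes>\<^bsub>grp C j\<^esub> dif C i b"
          using step by blast
      qed
    qed
    finally show ?thesis .
  qed
  then show ?thesis unfolding integral_classes_iff kernel_def by blast
qed

text \<open>The kernel of \<open>\<Xi>\<close> is the image of the homomorphism
  \<open>a \<mapsto> p (from_form a)\<close> on forms of degree \<open>j\<close>, so the first
  isomorphism theorem presents it as these forms modulo the closed ones with integral class.\<close>

theorem characters_epimorphism:
  "\<exists>\<Xi> \<in> epi (cohomology E1 k) (cohomology E2 k).
    (cohomology E1 k)\<lparr>carrier := kernel (cohomology E1 k) (cohomology E2 k) \<Xi>\<rparr>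
    \<cong> grp A j Mod {a \<in> cocycles A j. coh_class C j (I j a) \<in> coh_map (\<lambda>c. c) C j ` carrier (cohomology L j)}"
proof -
  obtain \<Xi> where \<Xi>: "\<Xi> \<in> epi (cohomology E1 k) (cohomology E2 k)"
    "kernel (cohomology E1 k) (cohomology E2 k) \<Xi> = p ` kernel lift_group (cohomology E2 k) q"
    by (rule induced_epimorphism[OF group_lift_group H1(1) H2(1) p_epi q_epi kernel_p_subset], rule that)
  let ?\<psi> = "\<lambda>a. p (from_form a)"
  let ?K = "(cohomology E1 k)\<lparr>carrier := kernel (cohomology E1 k) (cohomology E2 k) \<Xi>\<rparr>"
  have carr: "kernel (cohomology E1 k) (cohomology E2 k) \<Xi> = ?\<psi> ` carrier (grp A j)"
    unfolding \<Xi>(2) by (rule kernel_q_from_form)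
  have "p \<in> hom lift_group (cohomology E1 k)" using p_epi by (simp add: epi_def)
  from hom_compose[OF from_form_hom this] have hom: "?\<psi> \<in> hom (grp A j) (cohomology E1 k)"
    by (simp only: comp_def)
  have gK: "group ?K"
    unfolding carr by (rule subgroup.subgroup_is_group[OF subgroup_homI[OF A.is_group H1(1) hom] H1(1)])
  have homK: "?\<psi> \<in> hom (grp A j) ?K"
    using hom unfolding carr hom_def by auto
  have "group_hom (grp A j) ?K ?\<psi>"
    using homK gK A.is_group by (simp add: group_hom_def group_hom_axioms_def)
  then have "grp A j Mod kernel (grp A j) ?K ?\<psi> \<cong> ?K"
    by (rule group_hom.FactGroup_iso) (simp add: carr)
  moreover have "kernel (grp A j) ?K ?\<psi> = kernel (grp A j) (cohomology E1 k) ?\<psi>"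
    by (simp add: kernel_def)
  ultimately have iso: "grp A j Mod {a \<in> cocycles A j. coh_class C j (I j a) \<in> coh_map (\<lambda>c. c) C j ` carrier (cohomology L j)} \<cong> ?K"
    unfolding kernel_from_form[symmetric] by simp
  have "group (grp A j Mod kernel (grp A j) ?K ?\<psi>)"
    by (rule normal.factorgroup_is_group[OF group_hom.normal_kernel[OF \<open>group_hom (grp A j) ?K ?\<psi>\<close>]])
  then have "group (grp A j Mod {a \<in> cocycles A j. coh_class C j (I j a) \<in> coh_map (\<lambda>c. c) C j ` carrier (cohomology L j)})"
    unfolding kernel_from_form[symmetric] by (simp add: kernel_def)
  from group.iso_sym[OF this iso] show ?thesis using \<Xi>(1) by blast
qed

end

section \<open>The filtered de Rham complex\<close>

lemma ext_deriv_add: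
  assumes M: "regular_charted M" and \<omega>: "\<omega> \<in> forms k M" and \<eta>: "\<eta> \<in> forms k M"
  shows "ext_deriv M (\<lambda>c x vs. \<omega> c x vs + \<eta> c x vs) = (\<lambda>c x vs. ext_deriv M \<omega> c x vs + ext_deriv M \<eta> c x vs)"
proof (intro ext)
  fix c x vs
  show "ext_deriv M (\<lambda>c x vs. \<omega> c x vs + \<eta> c x vs) c x vs = ext_deriv M \<omega> c x vs + ext_deriv M \<eta> c x vs"
  proof (cases "c \<in> atlas M \<and> x \<in> cimg c \<and> set vs \<subseteq> ctan c")
    case True
    then have c: "c \<in> atlas M" "x \<in> cimg c" "set vs \<subseteq> ctan c" by auto
    have "frechet_derivative (\<lambda>y. \<omega> c y (del_nth i vs) + \<eta> c y (del_nth i vs)) (at x within cimg c) (vs ! i) =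
      frechet_derivative (\<lambda>y. \<omega> c y (del_nth i vs)) (at x within cimg c) (vs ! i) +
      frechet_derivative (\<lambda>y. \<eta> c y (del_nth i vs)) (at x within cimg c) (vs ! i)" if "i < length vs" for i
    proof -
      have d: "set (del_nth i vs) \<subseteq> ctan c" using set_del_nth c(3) by (metis dual_order.trans)
      have v: "vs ! i \<in> ctan c" using c(3) that nth_mem by blast
      show ?thesis
        by (rule frechet_derivative_tangential[OF regular_chart_tangential[OF M c(1)] c(2) v])
           (intro has_derivative_add smooth_on_has_derivative forms_smooth[OF \<omega> c(1) d] forms_smooth[OF \<eta> c(1) d] c(2))
    qed
    then show ?thesis by (simp add: ext_deriv_eq[OF c] sum.distrib[symmetric] distrib_left)
  qed (auto simp: ext_deriv_def)
qed

section \<open>The groups of filtered forms and the geometric input of the diagram\<close>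

context simplicial_manifold
begin

context
  fixes F :: "int \<Rightarrow> int \<Rightarrow> 'a form_seq set"
  assumes F: "filtration X face F"
begin

lemma filtrationD:
  shows filtration_compatible: "\<omega> \<in> F r k \<Longrightarrow> \<omega> \<in> compatible_forms X face k"
    and filtration_zero: "(\<lambda>n c x vs. 0) \<in> F r k"
    and filtration_add: "\<omega> \<in> F r k \<Longrightarrow> \<eta> \<in> F r k \<Longrightarrow> (\<lambda>n c x vs. \<omega> n c x vs + \<eta> n c x vs) \<in> F r k"
    and filtration_scale: "\<omega> \<in> F r k \<Longrightarrow> (\<lambda>n c x vs. a * \<omega> n c x vs) \<in> F r k"
    and filtration_dif: "\<omega> \<in> F r k \<Longrightarrow> dif (de_Rham X face) k \<omega> \<in> F r (k + 1)"
  using F unfolding filtration_def by blast+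

lemma filtered_simps:
  "carrier (grp (filtered_de_Rham X face F r) k) = F r k"
  "\<omega> \<otimes>\<^bsub>grp (filtered_de_Rham X face F r) k\<^esub> \<eta> = (\<lambda>n c x vs. \<omega> n c x vs + \<eta> n c x vs)"
  "\<one>\<^bsub>grp (filtered_de_Rham X face F r) k\<^esub> = (\<lambda>n c x vs. 0)"
  "dif (filtered_de_Rham X face F r) k = dif (de_Rham X face) k"
  by (simp_all add: filtered_de_Rham_def de_Rham_def)

lemma comm_group_filtered: "comm_group (grp (filtered_de_Rham X face F r) k)"
proof (rule comm_groupI; unfold filtered_simps)
  fix \<omega> assume "\<omega> \<in> F r k"
  \<comment> \<open>Filtrations are closed under complex scalars, hence under negatives.\<close>
  then show "\<exists>\<eta>\<in>F r k. (\<lambda>n c x vs. \<eta> n c x vs + \<omega> n c x vs) = (\<lambda>n c x vs. 0)"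
    by (intro bexI[of _ "\<lambda>n c x vs. -1 * \<omega> n c x vs"] filtration_scale) auto
next
  fix \<omega> \<eta> \<theta> assume "\<omega> \<in> F r k" "\<eta> \<in> F r k" "\<theta> \<in> F r k"
  show "(\<lambda>n c x vs. (\<omega> n c x vs + \<eta> n c x vs) + \<theta> n c x vs) = (\<lambda>n c x vs. \<omega> n c x vs + (\<eta> n c x vs + \<theta> n c x vs))"
    by (simp only: add.assoc)
next
  fix \<omega> \<eta> assume "\<omega> \<in> F r k" "\<eta> \<in> F r k"
  show "(\<lambda>n c x vs. \<omega> n c x vs + \<eta> n c x vs) = (\<lambda>n c x vs. \<eta> n c x vs + \<omega> n c x vs)"
    by (simp only: add.commute)
qed (auto intro: filtration_zero filtration_add)

lemma dif_filtered_hom: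
  "dif (filtered_de_Rham X face F r) k \<in> hom (grp (filtered_de_Rham X face F r) k) (grp (filtered_de_Rham X face F r) (k + 1))"
proof (rule homI; unfold filtered_simps)
  fix \<omega> \<eta> assume \<omega>: "\<omega> \<in> F r k" and \<eta>: "\<eta> \<in> F r k"
  have "ext_deriv (prism n) (\<lambda>c x vs. \<omega> n c x vs + \<eta> n c x vs) =
    (\<lambda>c x vs. ext_deriv (prism n) (\<omega> n) c x vs + ext_deriv (prism n) (\<eta> n) c x vs)" for n
    by (rule ext_deriv_add[OF regular_prism]) (use compatible_formsD(1) filtration_compatible \<omega> \<eta> in blast)+
  then show "dif (de_Rham X face) k (\<lambda>n c x vs. \<omega> n c x vs + \<eta> n c x vs) =
    (\<lambda>n c x vs. dif (de_Rham X face) k \<omega> n c x vs + dif (de_Rham X face) k \<eta> n c x vs)"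
    by (simp add: de_Rham_def)
qed (rule filtration_dif)

text \<open>The point where geometry enters the diagram. Closure of the filtration under
  \<open>dif\<close> also guarantees here that the differential of a form is again a compatible
  form, as \<open>integration_dif\<close> requires.\<close>

lemma character_complexes:
  assumes \<Lambda>: "subgroup \<Lambda> complex_group"
  shows "character_complexes (filtered_de_Rham X face F r) (cochains X face (complex_group\<lparr>carrier := \<Lambda>\<rparr>))
    (cochains X face complex_group) (cochains X face (complex_group Mod \<Lambda>)) (integration X) (reduce_mod X \<Lambda>)"
proof (rule character_complexes.intro)
  fix k
  show "integration X k \<in> hom (grp (filtered_de_Rham X face F r) k) (grp (cochains X face complex_group) k)"
  proof (rule homI; unfold filtered_simps carrier_cochains)
    fix \<omega> \<eta> assume "\<omega> \<in> F r k" "\<eta> \<in> F r k"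
    then show "integration X k (\<lambda>n c x vs. \<omega> n c x vs + \<eta> n c x vs) =
      integration X k \<omega> \<otimes>\<^bsub>grp (cochains X face complex_group) k\<^esub> integration X k \<eta>"
      by (intro integration_add filtration_compatible[OF filtration_add] filtration_compatible)
  qed (intro integration_compatible filtration_compatible)
next
  fix k \<omega> assume "\<omega> \<in> carrier (grp (filtered_de_Rham X face F r) k)"
  then have \<omega>: "\<omega> \<in> F r k" by (simp only: filtered_simps)
  show "dif (filtered_de_Rham X face F r) (k + 1) (dif (filtered_de_Rham X face F r) k \<omega>) =
    \<one>\<^bsub>grp (filtered_de_Rham X face F r) (k + 1 + 1)\<^esub>"
    unfolding filtered_simps by (rule de_Rham_dif_dif[OF filtration_compatible[OF \<omega>]])
  show "integration X (k + 1) (dif (filtered_de_Rham X face F r) k \<omega>) =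
    dif (cochains X face complex_group) k (integration X k \<omega>)"
    unfolding filtered_simps
    by (rule integration_dif[OF filtration_compatible[OF \<omega>] filtration_compatible[OF filtration_dif[OF \<omega>]]])
next
  fix k c assume c: "c \<in> carrier (grp (cochains X face (complex_group Mod \<Lambda>)) k)"
  show "\<exists>b\<in>carrier (grp (cochains X face complex_group) k). reduce_mod X \<Lambda> k b = c"
    using c unfolding carrier_cochains by (rule reduce_mod_surj[OF \<Lambda>])
next
  fix k c assume "c \<in> carrier (grp (cochains X face complex_group) k)"
  then have c: "c \<in> compatible_cochains X face complex_group k" by (simp only: carrier_cochains)
  show "dif (cochains X face complex_group) (k + 1) (dif (cochains X face complex_group) k c) =
    \<one>\<^bsub>grp (cochains X face complex_group) (k + 1 + 1)\<^esub>"
    by (rule dif_dif_cochains[OF c])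
  show "(reduce_mod X \<Lambda> k c = \<one>\<^bsub>grp (cochains X face (complex_group Mod \<Lambda>)) k\<^esub>) =
    (c \<in> carrier (grp (cochains X face (complex_group\<lparr>carrier := \<Lambda>\<rparr>)) k))"
    unfolding carrier_cochains by (rule reduce_mod_kernel[OF \<Lambda> c])
  show "dif (cochains X face (complex_group Mod \<Lambda>)) k (reduce_mod X \<Lambda> k c) =
    reduce_mod X \<Lambda> (k + 1) (dif (cochains X face complex_group) k c)"
    by (rule reduce_mod_dif[OF \<Lambda> c])
next
  fix k c assume "c \<in> carrier (grp (cochains X face (complex_group\<lparr>carrier := \<Lambda>\<rparr>)) k)"
  then show "dif (cochains X face (complex_group\<lparr>carrier := \<Lambda>\<rparr>)) k c = dif (cochains X face complex_group) k c"
    unfolding carrier_cochains by (rule dif_Lambda_cochains[OF \<Lambda>])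
next
  fix k
  show "carrier (grp (cochains X face (complex_group\<lparr>carrier := \<Lambda>\<rparr>)) k) \<subseteq> carrier (grp (cochains X face complex_group) k)"
    unfolding carrier_cochains by (auto simp: Lambda_cochains_iff[OF \<Lambda>])
qed (rule comm_group_filtered comm_group_cochains[OF comm_group_complex] comm_group_cochains[OF comm_group_Mod[OF \<Lambda>]]
    dif_filtered_hom dif_cochains_hom grp_Lambda_cochains[OF \<Lambda>] reduce_mod_hom[OF \<Lambda>])+

end

end

theorem theorem2p4:
  fixes X :: "nat \<Rightarrow> ('a, coords) charted"
    and face degen :: "nat \<Rightarrow> nat \<Rightarrow> 'a \<Rightarrow> 'a"
    and \<Lambda> :: "complex set"
    and F :: "int \<Rightarrow> int \<Rightarrow> 'a form_seq set"
    and r n :: int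
  assumes "simplicial_manifold X face degen"
    and "subgroup \<Lambda> complex_group"
    and "filtration X face F"
  shows "\<exists>\<Xi> \<in> epi (diff_characters X face \<Lambda> F r (2 * r - n - 1)) (mult_cohomology X face \<Lambda> F r n).
    (diff_characters X face \<Lambda> F r (2 * r - n - 1))
      \<lparr>carrier := kernel (diff_characters X face \<Lambda> F r (2 * r - n - 1))
                    (mult_cohomology X face \<Lambda> F r n) \<Xi>\<rparr>
    \<cong> (grp (filtered_de_Rham X face F r) (2 * r - n - 1))
        Mod integral_closed_forms X face \<Lambda> F r (2 * r - n - 1)"
proof -
  interpret simplicial_manifold X face degen by (rule assms(1))
  let ?k = "2 * r - n"
  interpret character_complexes "filtered_de_Rham X face F r" "cochains X face (complex_group\<lparr>carrier := \<Lambda>\<rparr>)"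
    "cochains X face complex_group" "cochains X face (complex_group Mod \<Lambda>)" "integration X" "reduce_mod X \<Lambda>"
    by (rule character_complexes[OF assms(3,2)])
  interpret character_degree "filtered_de_Rham X face F r" "cochains X face (complex_group\<lparr>carrier := \<Lambda>\<rparr>)"
    "cochains X face complex_group" "cochains X face (complex_group Mod \<Lambda>)" "integration X" "reduce_mod X \<Lambda>"
    ?k "?k - 1" "?k - 1 - 1"
    by unfold_locales simp_all
  \<comment> \<open>\<open>diff_characters\<close> truncates and takes cohomology in the degree one
    above its index; here that degree is \<open>?k\<close>.\<close>
  have k: "?k - 1 + 1 = ?k" by simp
  show ?thesis
    unfolding diff_characters_def mult_cohomology_def integral_closed_forms_def k
    by (rule characters_epimorphism)
qed

end
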